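(* Let $k$ be a commutative ring and $(A,C,\psi)$ a right-right entwining structure over $k$, and assume that $C$ is finitely generated and projective as a $k$-module, with finite dual basis $\{d_i,d_i^*\mid i=1,\dots,m\}$. Let $F:\mathcal{M}(\psi)_A^C\to\mathcal{M}_A$ be the functor forgetting the $C$-coaction, and $G=\bullet\otimes C$ its right adjoint. Then the following statements are equivalent: 1) $(F,G)$ is a Frobenius pair. 2) There exist $z=\sum_l a_l\otimes c_l\in W_1$ and $\theta\in V_1$ such that the maps $\phi:C^*\otimes A\to A\otimes C$ and $\overline{\phi}:A\otimes C\to C^*\otimes A$ given by $$\phi(c^*\otimes a)=\sum_l a_la_\psi\otimes\langle c^*,c_{l(2)}\rangle c_{l(1)}^{\psi},\qquad \overline{\phi}(a\otimes c)=\sum_i d_i^*\otimes a_\psi\theta(d_i^\psi\otimes c)$$ are inverses of each other. 3) $C^*\otimes A$ and $A\otimes C$ are isomorphic as objects in ${}_A\mathcal{M}(\psi)_A^C$.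
   Context: All tensor products are over the commutative ring $k$ and summation symbols are often omitted. $\Delta(c)=c_{(1)}\otimes c_{(2)}$ is the comultiplication, $\varepsilon_C$ the counit of $C$, and $\rho^r(m)=m_{[0]}\otimes m_{[1]}$ a right coaction. $C^*=\mathrm{Hom}_k(C,k)$ with convolution product $\langle f*g,c\rangle=\langle f,c_{(1)}\rangle\langle g,c_{(2)}\rangle$. Entwining structure: $A$ is a $k$-algebra, $C$ a (flat) $k$-coalgebra, and $\psi:C\otimes A\to A\otimes C$ a $k$-linear map, written $\psi(c\otimes a)=a_\psi\otimes c^\psi$ (with $\Psi,\Psi'$ for further copies of $\psi$; in $a_{\psi\Psi}$ or $c^{\psi\Psi}$ the copy $\psi$ is applied first), such that for all $a,b\in A$, $c\in C$: $(ab)_\psi\otimes c^\psi=a_\psi b_\Psi\otimes c^{\psi\Psi}$; $\ \varepsilon_C(c^\psi)a_\psi=\varepsilon_C(c)a$; $\ a_\psi\otimes\Delta(c^\psi)=a_{\psi\Psi}\otimes c_{(1)}^{\Psi}\otimes c_{(2)}^{\psi}$; $\ 1_\psi\otimes c^\psi=1\otimes c$. $\mathcal{M}_A$ is the category of right $A$-modules. $\mathcal{M}(\psi)_A^C$ is the category of entwined modules: $k$-modules $M$ with a right $A$-action and right $C$-coaction with $\rho^r(ma)=m_{[0]}a_\psi\otimes m_{[1]}^\psi$; morphisms are $A$-linear $C$-colinear maps. For $M\in\mathcal{M}_A$, $G(M)=M\otimes C$ has $\rho^r(m\otimes c)=m\otimes c_{(1)}\otimes c_{(2)}$ and $(m\otimes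 c)a=ma_\psi\otimes c^\psi$. ${}_A\mathcal{M}(\psi)_A^C$ is the category of entwined modules with an additional left $A$-action that is right $A$-linear and right $C$-colinear; its morphisms are left and right $A$-linear, right $C$-colinear maps. $A\otimes C\in{}_A\mathcal{M}(\psi)_A^C$ via $\rho^r(a\otimes c)=a\otimes c_{(1)}\otimes c_{(2)}$, $b(a\otimes c)b'=bab'_\psi\otimes c^\psi$. When $C$ is finitely generated projective, $C^*\otimes A\in{}_A\mathcal{M}(\psi)_A^C$ via $b(c^*\otimes a)b'=\sum_i\langle c^*,d_i^\psi\rangle d_i^*\otimes b_\psi ab'$ and $\rho^r(c^*\otimes a)=\sum_i d_i^* * c^*\otimes a_\psi\otimes d_i^\psi$. A pair of functors $(F,G)$ with $G$ right adjoint to $F$ is a Frobenius pair if $G$ is also a left adjoint of $F$. $V_1$ is the $k$-module of $k$-linear maps $\theta:C\otimes C\to A$ such that for all $c,d\in C$, $a\in A$: $\theta(c\otimes d)a=a_{\psi\Psi}\theta(c^\Psi\otimes d^\psi)$ and $\theta(c\otimes d_{(1)})\otimes d_{(2)}=\theta(c_{(2)}\otimes d)_\psi\otimes c_{(1)}^\psi$. $W_1$ is the $k$-module of elements $z=\sum_l a_l\otimes c_l\in A\otimes C$ such that $\sum_l aa_l\otimes c_l=\sum_l a_la_\psi\otimes c_l^\psi$ for all $a\in A$. *)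

theory Defs
  imports "HOL-Algebra.Module"
begin

section \<open>Linear maps and tensor products over a commutative ring\<close>

definition linear_map ::
  "('k, 'r) ring_scheme \<Rightarrow> ('k, 'm, 'x) module_scheme \<Rightarrow> ('k, 'n, 'y) module_scheme
    \<Rightarrow> ('m \<Rightarrow> 'n) \<Rightarrow> bool" where
  "linear_map k M N f \<longleftrightarrow>
     f \<in> carrier M \<rightarrow> carrier N \<and>
     (\<forall>x\<in>carrier M. \<forall>y\<in>carrier M. f (x \<oplus>\<^bsub>M\<^esub> y) = f x \<oplus>\<^bsub>N\<^esub> f y) \<and>
     (\<forall>r\<in>carrier k. \<forall>x\<in>carrier M. f (r \<odot>\<^bsub>M\<^esub> x) = r \<odot>\<^bsub>N\<^esub> f x)"

definition self_module :: "('k, 'r) ring_scheme \<Rightarrow> ('k, 'k) module" where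
  "self_module k = \<lparr>carrier = carrier k, mult = mult k, one = one k, zero = zero k, add = add k,
     smult = mult k\<rparr>"

text \<open>
  A list of pairs \<open>[(m1, n1), \<dots>, (ml, nl)]\<close> stands for the formal sum of the \<open>mi \<otimes> ni\<close>.
  The tensor product is the free commutative monoid of formal sums modulo the congruence
  generated by the relations below. Thanks to \<open>zero\<close> the quotient is a group,
  \<open>(-m) \<otimes> n\<close> being inverse to \<open>m \<otimes> n\<close>.
\<close>

inductive tens_eq ::
  "('k, 'r) ring_scheme \<Rightarrow> ('k, 'm, 'x) module_scheme \<Rightarrow> ('k, 'n, 'y) module_scheme
    \<Rightarrow> ('m \<times> 'n) list \<Rightarrow> ('m \<times> 'n) list \<Rightarrow> bool"
  for k M N where
  refl: "xs \<in> lists (carrier M \<times> carrier N) \<Longrightarrow> tens_eq k M N xs xs"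
| sym: "tens_eq k M N xs ys \<Longrightarrow> tens_eq k M N ys xs"
| trans: "tens_eq k M N xs ys \<Longrightarrow> tens_eq k M N ys zs \<Longrightarrow> tens_eq k M N xs zs"
| append: "tens_eq k M N xs xs' \<Longrightarrow> tens_eq k M N ys ys' \<Longrightarrow> tens_eq k M N (xs @ ys) (xs' @ ys')"
| commute: "xs \<in> lists (carrier M \<times> carrier N) \<Longrightarrow> ys \<in> lists (carrier M \<times> carrier N)
    \<Longrightarrow> tens_eq k M N (xs @ ys) (ys @ xs)"
| add_left: "m \<in> carrier M \<Longrightarrow> m' \<in> carrier M \<Longrightarrow> n \<in> carrier N
    \<Longrightarrow> tens_eq k M N [(m \<oplus>\<^bsub>M\<^esub> m', n)] [(m, n), (m', n)]"
| add_right: "m \<in> carrier M \<Longrightarrow> n \<in> carrier N \<Longrightarrow> n' \<in> carrier N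
    \<Longrightarrow> tens_eq k M N [(m, n \<oplus>\<^bsub>N\<^esub> n')] [(m, n), (m, n')]"
| balanced: "r \<in> carrier k \<Longrightarrow> m \<in> carrier M \<Longrightarrow> n \<in> carrier N
    \<Longrightarrow> tens_eq k M N [(r \<odot>\<^bsub>M\<^esub> m, n)] [(m, r \<odot>\<^bsub>N\<^esub> n)]"
| zero: "n \<in> carrier N \<Longrightarrow> tens_eq k M N [(\<zero>\<^bsub>M\<^esub>, n)] []"

definition tens_class ::
  "('k, 'r) ring_scheme \<Rightarrow> ('k, 'm, 'x) module_scheme \<Rightarrow> ('k, 'n, 'y) module_scheme
    \<Rightarrow> ('m \<times> 'n) list \<Rightarrow> ('m \<times> 'n) list set" where
  "tens_class k M N xs = {ys. tens_eq k M N xs ys}"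

definition tensor ::
  "('k, 'r) ring_scheme \<Rightarrow> ('k, 'm, 'x) module_scheme \<Rightarrow> ('k, 'n, 'y) module_scheme
    \<Rightarrow> ('k, ('m \<times> 'n) list set) module" where
  "tensor k M N =
     \<lparr>carrier = tens_class k M N ` lists (carrier M \<times> carrier N),
      mult = undefined, one = undefined,
      zero = tens_class k M N [],
      add = (\<lambda>s t. \<Union>xs\<in>s. \<Union>ys\<in>t. tens_class k M N (xs @ ys)),
      smult = (\<lambda>r s. \<Union>xs\<in>s. tens_class k M N (map (\<lambda>(m, n). (r \<odot>\<^bsub>M\<^esub> m, n)) xs))\<rparr>"

definition tens ::
  "('k, 'r) ring_scheme \<Rightarrow> ('k, 'm, 'x) module_scheme \<Rightarrow> ('k, 'n, 'y) module_scheme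
    \<Rightarrow> 'm \<Rightarrow> 'n \<Rightarrow> ('m \<times> 'n) list set" where
  "tens k M N m n = tens_class k M N [(m, n)]"

definition list_sum :: "('p, 'x) ring_scheme \<Rightarrow> ('m \<Rightarrow> 'n \<Rightarrow> 'p) \<Rightarrow> ('m \<times> 'n) list \<Rightarrow> 'p" where
  "list_sum P f xs = foldr (\<lambda>(m, n) s. f m n \<oplus>\<^bsub>P\<^esub> s) xs \<zero>\<^bsub>P\<^esub>"

text \<open>
  \<open>tens_sum P t f\<close> is the value at \<open>t\<close> of the linear map into \<open>P\<close> induced by the bilinear map \<open>f\<close>:
  the sum of the \<open>f mi ni\<close> for any representation of \<open>t\<close> as a sum of \<open>mi \<otimes> ni\<close>.
  It renders Sweedler notation: with \<open>t = \<Delta>(c)\<close>, \<open>tens_sum P t (\<lambda>c1 c2. f c1 c2)\<close> is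
  \<open>f c\<^sub>(\<^sub>1\<^sub>) c\<^sub>(\<^sub>2\<^sub>)\<close> with the summation sign omitted, and with \<open>t = \<psi>(c \<otimes> a)\<close>,
  \<open>tens_sum P t (\<lambda>a' c'. f a' c')\<close> is \<open>f a\<^sub>\<psi> c\<^sup>\<psi>\<close>.
\<close>

definition tens_sum ::
  "('p, 'x) ring_scheme \<Rightarrow> ('m \<times> 'n) list set \<Rightarrow> ('m \<Rightarrow> 'n \<Rightarrow> 'p) \<Rightarrow> 'p" where
  "tens_sum P t f = (THE y. list_sum P f ` t = {y})"


section \<open>Algebras, coalgebras and entwining structures\<close>

text \<open>
  \<open>algebra\<close> of HOL-Algebra requires the multiplication to be commutative, which is not wanted here.
\<close>

locale k_algebra =
  fixes k :: "('k, 'r) ring_scheme" and A :: "('k, 'a, 'x) module_scheme"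
  assumes cring: "cring k"
    and module: "module k A"
    and ring: "ring A"
    and smult_mult_left: "\<lbrakk>r \<in> carrier k; a \<in> carrier A; b \<in> carrier A\<rbrakk>
      \<Longrightarrow> (r \<odot>\<^bsub>A\<^esub> a) \<otimes>\<^bsub>A\<^esub> b = r \<odot>\<^bsub>A\<^esub> (a \<otimes>\<^bsub>A\<^esub> b)"
    and smult_mult_right: "\<lbrakk>r \<in> carrier k; a \<in> carrier A; b \<in> carrier A\<rbrakk>
      \<Longrightarrow> a \<otimes>\<^bsub>A\<^esub> (r \<odot>\<^bsub>A\<^esub> b) = r \<odot>\<^bsub>A\<^esub> (a \<otimes>\<^bsub>A\<^esub> b)"

text \<open>In the following the fields \<open>mult\<close> and \<open>one\<close> of a record describing a mere module are junk.\<close>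

record ('k, 'c) coalgebra = "('k, 'c) module" +
  comult :: "'c \<Rightarrow> ('c \<times> 'c) list set"
  counit :: "'c \<Rightarrow> 'k"

locale k_coalgebra =
  fixes k :: "('k, 'r) ring_scheme" and C :: "('k, 'c, 'x) coalgebra_scheme"
  assumes cring: "cring k"
    and module: "module k C"
    and comult_linear: "linear_map k C (tensor k C C) (comult C)"
    and counit_linear: "linear_map k C (self_module k) (counit C)"
    and coassoc: "c \<in> carrier C \<Longrightarrow>
      tens_sum (tensor k (tensor k C C) C) (comult C c)
        (\<lambda>c1 c2. tens k (tensor k C C) C (comult C c1) c2) =
      tens_sum (tensor k (tensor k C C) C) (comult C c)
        (\<lambda>c1 c2. tens_sum (tensor k (tensor k C C) C) (comult C c2)
          (\<lambda>c2' c3. tens k (tensor k C C) C (tens k C C c1 c2') c3))"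
    and counit_left: "c \<in> carrier C \<Longrightarrow>
      tens_sum C (comult C c) (\<lambda>c1 c2. counit C c1 \<odot>\<^bsub>C\<^esub> c2) = c"
    and counit_right: "c \<in> carrier C \<Longrightarrow>
      tens_sum C (comult C c) (\<lambda>c1 c2. counit C c2 \<odot>\<^bsub>C\<^esub> c1) = c"

text \<open>
  The dual \<open>C\<^sup>*\<close> with the convolution product. Its elements are functions on \<open>carrier C\<close>, hence
  extensional.
\<close>

definition dual :: "('k, 'r) ring_scheme \<Rightarrow> ('k, 'c, 'x) coalgebra_scheme \<Rightarrow> ('k, 'c \<Rightarrow> 'k) module" where
  "dual k C =
     \<lparr>carrier = {f \<in> extensional (carrier C). linear_map k C (self_module k) f},
      mult = (\<lambda>f g. \<lambda>c\<in>carrier C. tens_sum k (comult C c) (\<lambda>c1 c2. f c1 \<otimes>\<^bsub>k\<^esub> g c2)),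
      one = (\<lambda>c\<in>carrier C. counit C c),
      zero = (\<lambda>c\<in>carrier C. \<zero>\<^bsub>k\<^esub>),
      add = (\<lambda>f g. \<lambda>c\<in>carrier C. f c \<oplus>\<^bsub>k\<^esub> g c),
      smult = (\<lambda>r f. \<lambda>c\<in>carrier C. r \<otimes>\<^bsub>k\<^esub> f c)\<rparr>"

text \<open>
  A finite dual basis \<open>{d i, d' i | i = 1, \<dots>, m}\<close> exhibits \<open>C\<close> as a direct summand of \<open>k\<^sup>m\<close>,
  i.e. as a finitely generated projective (in particular flat) \<open>k\<close>-module.
\<close>

definition finite_dual_basis ::
  "('k, 'r) ring_scheme \<Rightarrow> ('k, 'c, 'x) coalgebra_scheme \<Rightarrow> nat \<Rightarrow> (nat \<Rightarrow> 'c) \<Rightarrow> (nat \<Rightarrow> 'c \<Rightarrow> 'k)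
    \<Rightarrow> bool" where
  "finite_dual_basis k C m d d' \<longleftrightarrow>
     (\<forall>i\<in>{1..m}. d i \<in> carrier C \<and> d' i \<in> carrier (dual k C)) \<and>
     (\<forall>c\<in>carrier C. c = (\<Oplus>\<^bsub>C\<^esub>i\<in>{1..m}. d' i c \<odot>\<^bsub>C\<^esub> d i))"

type_synonym ('a, 'c) entwining = "('c \<times> 'a) list set \<Rightarrow> ('a \<times> 'c) list set"

locale entwining_structure = k_algebra k A + C: k_coalgebra k C
  for k :: "('k, 'r) ring_scheme"
    and A :: "('k, 'a, 'x) module_scheme"
    and C :: "('k, 'c, 'y) coalgebra_scheme" +
  fixes \<psi> :: "('a, 'c) entwining"
  assumes psi_linear: "linear_map k (tensor k C A) (tensor k A C) \<psi>"
    and psi_mult: "\<lbrakk>a \<in> carrier A; b \<in> carrier A; c \<in> carrier C\<rbrakk> \<Longrightarrow>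
      \<psi> (tens k C A c (a \<otimes>\<^bsub>A\<^esub> b)) =
      tens_sum (tensor k A C) (\<psi> (tens k C A c a))
        (\<lambda>a' c'. tens_sum (tensor k A C) (\<psi> (tens k C A c' b))
          (\<lambda>b' c''. tens k A C (a' \<otimes>\<^bsub>A\<^esub> b') c''))"
    and psi_counit: "\<lbrakk>a \<in> carrier A; c \<in> carrier C\<rbrakk> \<Longrightarrow>
      tens_sum A (\<psi> (tens k C A c a)) (\<lambda>a' c'. counit C c' \<odot>\<^bsub>A\<^esub> a') = counit C c \<odot>\<^bsub>A\<^esub> a"
    and psi_comult: "\<lbrakk>a \<in> carrier A; c \<in> carrier C\<rbrakk> \<Longrightarrow>
      tens_sum (tensor k (tensor k A C) C) (\<psi> (tens k C A c a))
        (\<lambda>a' c'. tens_sum (tensor k (tensor k A C) C) (comult C c')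
          (\<lambda>c1 c2. tens k (tensor k A C) C (tens k A C a' c1) c2)) =
      tens_sum (tensor k (tensor k A C) C) (comult C c)
        (\<lambda>c1 c2. tens_sum (tensor k (tensor k A C) C) (\<psi> (tens k C A c2 a))
          (\<lambda>a' c2'. tens_sum (tensor k (tensor k A C) C) (\<psi> (tens k C A c1 a'))
            (\<lambda>a'' c1'. tens k (tensor k A C) C (tens k A C a'' c1') c2')))"
    and psi_one: "c \<in> carrier C \<Longrightarrow> \<psi> (tens k C A c \<one>\<^bsub>A\<^esub>) = tens k A C \<one>\<^bsub>A\<^esub> c"


section \<open>Modules and entwined modules\<close>

record ('k, 'm, 'a) rmod = "('k, 'm) module" +
  ract :: "'m \<Rightarrow> 'a \<Rightarrow> 'm"

record ('k, 'm, 'a, 'c) emod = "('k, 'm, 'a) rmod" +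
  coact :: "'m \<Rightarrow> ('m \<times> 'c) list set"

record ('k, 'm, 'a, 'c) bemod = "('k, 'm, 'a, 'c) emod" +
  lact :: "'a \<Rightarrow> 'm \<Rightarrow> 'm"

locale right_module =
  fixes k :: "('k, 'r) ring_scheme" and A :: "('k, 'a, 'x) module_scheme"
    and M :: "('k, 'm, 'a, 'z) rmod_scheme"
  assumes module: "module k M"
    and ract_closed: "\<lbrakk>m \<in> carrier M; a \<in> carrier A\<rbrakk> \<Longrightarrow> ract M m a \<in> carrier M"
    and ract_add_left: "\<lbrakk>m \<in> carrier M; n \<in> carrier M; a \<in> carrier A\<rbrakk>
      \<Longrightarrow> ract M (m \<oplus>\<^bsub>M\<^esub> n) a = ract M m a \<oplus>\<^bsub>M\<^esub> ract M n a"
    and ract_add_right: "\<lbrakk>m \<in> carrier M; a \<in> carrier A; b \<in> carrier A\<rbrakk>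
      \<Longrightarrow> ract M m (a \<oplus>\<^bsub>A\<^esub> b) = ract M m a \<oplus>\<^bsub>M\<^esub> ract M m b"
    and ract_smult_left: "\<lbrakk>r \<in> carrier k; m \<in> carrier M; a \<in> carrier A\<rbrakk>
      \<Longrightarrow> ract M (r \<odot>\<^bsub>M\<^esub> m) a = r \<odot>\<^bsub>M\<^esub> ract M m a"
    and ract_smult_right: "\<lbrakk>r \<in> carrier k; m \<in> carrier M; a \<in> carrier A\<rbrakk>
      \<Longrightarrow> ract M m (r \<odot>\<^bsub>A\<^esub> a) = r \<odot>\<^bsub>M\<^esub> ract M m a"
    and ract_mult: "\<lbrakk>m \<in> carrier M; a \<in> carrier A; b \<in> carrier A\<rbrakk>
      \<Longrightarrow> ract M m (a \<otimes>\<^bsub>A\<^esub> b) = ract M (ract M m a) b"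
    and ract_one: "m \<in> carrier M \<Longrightarrow> ract M m \<one>\<^bsub>A\<^esub> = m"

locale entwined_module = right_module k A M
  for k :: "('k, 'r) ring_scheme"
    and A :: "('k, 'a, 'x) module_scheme"
    and C :: "('k, 'c, 'y) coalgebra_scheme"
    and \<psi> :: "('a, 'c) entwining"
    and M :: "('k, 'm, 'a, 'c, 'z) emod_scheme" +
  assumes coact_linear: "linear_map k M (tensor k M C) (coact M)"
    and coact_coassoc: "m \<in> carrier M \<Longrightarrow>
      tens_sum (tensor k (tensor k M C) C) (coact M m)
        (\<lambda>m0 m1. tens k (tensor k M C) C (coact M m0) m1) =
      tens_sum (tensor k (tensor k M C) C) (coact M m)
        (\<lambda>m0 m1. tens_sum (tensor k (tensor k M C) C) (comult C m1)
          (\<lambda>c1 c2. tens k (tensor k M C) C (tens k M C m0 c1) c2))"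
    and coact_counit: "m \<in> carrier M \<Longrightarrow>
      tens_sum M (coact M m) (\<lambda>m0 m1. counit C m1 \<odot>\<^bsub>M\<^esub> m0) = m"
    and coact_ract: "\<lbrakk>m \<in> carrier M; a \<in> carrier A\<rbrakk> \<Longrightarrow>
      coact M (ract M m a) =
      tens_sum (tensor k M C) (coact M m)
        (\<lambda>m0 m1. tens_sum (tensor k M C) (\<psi> (tens k C A m1 a))
          (\<lambda>a' c'. tens k M C (ract M m0 a') c'))"

text \<open>The objects of \<open>\<^sub>A\<M>(\<psi>)\<^sub>A\<^sup>C\<close>.\<close>

locale bi_entwined_module = entwined_module k A C \<psi> M
  for k :: "('k, 'r) ring_scheme"
    and A :: "('k, 'a, 'x) module_scheme"
    and C :: "('k, 'c, 'y) coalgebra_scheme"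
    and \<psi> :: "('a, 'c) entwining"
    and M :: "('k, 'm, 'a, 'c, 'z) bemod_scheme" +
  assumes lact_closed: "\<lbrakk>a \<in> carrier A; m \<in> carrier M\<rbrakk> \<Longrightarrow> lact M a m \<in> carrier M"
    and lact_add_right: "\<lbrakk>a \<in> carrier A; m \<in> carrier M; n \<in> carrier M\<rbrakk>
      \<Longrightarrow> lact M a (m \<oplus>\<^bsub>M\<^esub> n) = lact M a m \<oplus>\<^bsub>M\<^esub> lact M a n"
    and lact_add_left: "\<lbrakk>a \<in> carrier A; b \<in> carrier A; m \<in> carrier M\<rbrakk>
      \<Longrightarrow> lact M (a \<oplus>\<^bsub>A\<^esub> b) m = lact M a m \<oplus>\<^bsub>M\<^esub> lact M b m"
    and lact_smult_right: "\<lbrakk>r \<in> carrier k; a \<in> carrier A; m \<in> carrier M\<rbrakk>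
      \<Longrightarrow> lact M a (r \<odot>\<^bsub>M\<^esub> m) = r \<odot>\<^bsub>M\<^esub> lact M a m"
    and lact_smult_left: "\<lbrakk>r \<in> carrier k; a \<in> carrier A; m \<in> carrier M\<rbrakk>
      \<Longrightarrow> lact M (r \<odot>\<^bsub>A\<^esub> a) m = r \<odot>\<^bsub>M\<^esub> lact M a m"
    and lact_mult: "\<lbrakk>a \<in> carrier A; b \<in> carrier A; m \<in> carrier M\<rbrakk>
      \<Longrightarrow> lact M (a \<otimes>\<^bsub>A\<^esub> b) m = lact M a (lact M b m)"
    and lact_one: "m \<in> carrier M \<Longrightarrow> lact M \<one>\<^bsub>A\<^esub> m = m"
    and lact_ract: "\<lbrakk>a \<in> carrier A; m \<in> carrier M; b \<in> carrier A\<rbrakk>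
      \<Longrightarrow> lact M a (ract M m b) = ract M (lact M a m) b"
    and lact_coact: "\<lbrakk>a \<in> carrier A; m \<in> carrier M\<rbrakk> \<Longrightarrow>
      coact M (lact M a m) =
      tens_sum (tensor k M C) (coact M m) (\<lambda>m0 m1. tens k M C (lact M a m0) m1)"

text \<open>Morphisms are extensional functions, so that equality of morphisms is equality in HOL.\<close>

definition rmod_hom ::
  "('k, 'r) ring_scheme \<Rightarrow> ('k, 'a, 'x) module_scheme
    \<Rightarrow> ('k, 'm, 'a, 'z) rmod_scheme \<Rightarrow> ('k, 'n, 'a, 'w) rmod_scheme \<Rightarrow> ('m \<Rightarrow> 'n) set" where
  "rmod_hom k A M N =
     {f \<in> extensional (carrier M). linear_map k M N f \<and>
       (\<forall>m\<in>carrier M. \<forall>a\<in>carrier A. f (ract M m a) = ract N (f m) a)}"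

definition emod_hom ::
  "('k, 'r) ring_scheme \<Rightarrow> ('k, 'a, 'x) module_scheme \<Rightarrow> ('k, 'c, 'y) coalgebra_scheme
    \<Rightarrow> ('k, 'm, 'a, 'c, 'z) emod_scheme \<Rightarrow> ('k, 'n, 'a, 'c, 'w) emod_scheme \<Rightarrow> ('m \<Rightarrow> 'n) set" where
  "emod_hom k A C M N =
     {f \<in> rmod_hom k A M N. \<forall>m\<in>carrier M.
       coact N (f m) = tens_sum (tensor k N C) (coact M m) (\<lambda>m0 m1. tens k N C (f m0) m1)}"

definition bemod_hom ::
  "('k, 'r) ring_scheme \<Rightarrow> ('k, 'a, 'x) module_scheme \<Rightarrow> ('k, 'c, 'y) coalgebra_scheme
    \<Rightarrow> ('k, 'm, 'a, 'c, 'z) bemod_scheme \<Rightarrow> ('k, 'n, 'a, 'c, 'w) bemod_scheme \<Rightarrow> ('m \<Rightarrow> 'n) set" where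
  "bemod_hom k A C M N =
     {f \<in> emod_hom k A C M N. \<forall>a\<in>carrier A. \<forall>m\<in>carrier M. f (lact M a m) = lact N a (f m)}"

text \<open>Being isomorphic objects of \<open>\<^sub>A\<M>(\<psi>)\<^sub>A\<^sup>C\<close>; the underlying HOL types may differ.\<close>

definition bemod_isomorphic ::
  "('k, 'r) ring_scheme \<Rightarrow> ('k, 'a, 'x) module_scheme \<Rightarrow> ('k, 'c, 'y) coalgebra_scheme
    \<Rightarrow> ('a, 'c) entwining
    \<Rightarrow> ('k, 'm, 'a, 'c, 'z) bemod_scheme \<Rightarrow> ('k, 'n, 'a, 'c, 'w) bemod_scheme \<Rightarrow> bool" where
  "bemod_isomorphic k A C \<psi> M N \<longleftrightarrow>
     bi_entwined_module k A C \<psi> M \<and> bi_entwined_module k A C \<psi> N \<and>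
     (\<exists>f\<in>bemod_hom k A C M N. \<exists>g\<in>bemod_hom k A C N M.
       compose (carrier M) g f = (\<lambda>x\<in>carrier M. x) \<and>
       compose (carrier N) f g = (\<lambda>y\<in>carrier N. y))"

text \<open>The entwined module \<open>M \<otimes> C\<close> of a right \<open>A\<close>-module \<open>M\<close>.\<close>

definition cofree ::
  "('k, 'r) ring_scheme \<Rightarrow> ('k, 'a, 'x) module_scheme \<Rightarrow> ('k, 'c, 'y) coalgebra_scheme
    \<Rightarrow> ('a, 'c) entwining \<Rightarrow> ('k, 'm, 'a, 'z) rmod_scheme
    \<Rightarrow> ('k, ('m \<times> 'c) list set, 'a, 'c) emod" where
  "cofree k A C \<psi> M = (let T = tensor k M C in
     \<lparr>carrier = carrier T, mult = mult T, one = one T, zero = zero T, add = add T, smult = smult T,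
      ract = (\<lambda>t a. tens_sum T t (\<lambda>m c. tens_sum T (\<psi> (tens k C A c a))
        (\<lambda>a' c'. tens k M C (ract M m a') c'))),
      coact = (\<lambda>t. tens_sum (tensor k T C) t (\<lambda>m c. tens_sum (tensor k T C) (comult C c)
        (\<lambda>c1 c2. tens k T C (tens k M C m c1) c2)))\<rparr>)"

definition A_tensor_C ::
  "('k, 'r) ring_scheme \<Rightarrow> ('k, 'a, 'x) module_scheme \<Rightarrow> ('k, 'c, 'y) coalgebra_scheme
    \<Rightarrow> ('a, 'c) entwining \<Rightarrow> ('k, ('a \<times> 'c) list set, 'a, 'c) bemod" where
  "A_tensor_C k A C \<psi> = (let T = tensor k A C in
     \<lparr>carrier = carrier T, mult = mult T, one = one T, zero = zero T, add = add T, smult = smult T,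
      ract = (\<lambda>t b'. tens_sum T t (\<lambda>a c. tens_sum T (\<psi> (tens k C A c b'))
        (\<lambda>b'' c'. tens k A C (a \<otimes>\<^bsub>A\<^esub> b'') c'))),
      coact = (\<lambda>t. tens_sum (tensor k T C) t (\<lambda>a c. tens_sum (tensor k T C) (comult C c)
        (\<lambda>c1 c2. tens k T C (tens k A C a c1) c2))),
      lact = (\<lambda>b t. tens_sum T t (\<lambda>a c. tens k A C (b \<otimes>\<^bsub>A\<^esub> a) c))\<rparr>)"

text \<open>
  The left and right actions on \<open>C\<^sup>* \<otimes> A\<close> are the cases \<open>b' = 1\<close> and \<open>b = 1\<close> of
  \<open>b(c\<^sup>* \<otimes> a)b' = \<Sum>\<^sub>i \<langle>c\<^sup>*, d\<^sub>i\<^sup>\<psi>\<rangle> d\<^sub>i\<^sup>* \<otimes> b\<^sub>\<psi> a b'\<close>;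
  for \<open>b = 1\<close> the sum is \<open>\<Sum>\<^sub>i \<langle>c\<^sup>*, d\<^sub>i\<rangle> d\<^sub>i\<^sup>* \<otimes> a b' = c\<^sup>* \<otimes> a b'\<close>.
\<close>

definition dual_tensor_A ::
  "('k, 'r) ring_scheme \<Rightarrow> ('k, 'a, 'x) module_scheme \<Rightarrow> ('k, 'c, 'y) coalgebra_scheme
    \<Rightarrow> ('a, 'c) entwining \<Rightarrow> nat \<Rightarrow> (nat \<Rightarrow> 'c) \<Rightarrow> (nat \<Rightarrow> 'c \<Rightarrow> 'k)
    \<Rightarrow> ('k, (('c \<Rightarrow> 'k) \<times> 'a) list set, 'a, 'c) bemod" where
  "dual_tensor_A k A C \<psi> m d d' = (let D = dual k C; T = tensor k D A in
     \<lparr>carrier = carrier T, mult = mult T, one = one T, zero = zero T, add = add T, smult = smult T,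
      ract = (\<lambda>t b'. tens_sum T t (\<lambda>f a. tens k D A f (a \<otimes>\<^bsub>A\<^esub> b'))),
      coact = (\<lambda>t. tens_sum (tensor k T C) t (\<lambda>f a.
        \<Oplus>\<^bsub>tensor k T C\<^esub>i\<in>{1..m}. tens_sum (tensor k T C) (\<psi> (tens k C A (d i) a))
          (\<lambda>a' c'. tens k T C (tens k D A (d' i \<otimes>\<^bsub>D\<^esub> f) a') c'))),
      lact = (\<lambda>b t. tens_sum T t (\<lambda>f a.
        \<Oplus>\<^bsub>T\<^esub>i\<in>{1..m}. tens_sum T (\<psi> (tens k C A (d i) b))
          (\<lambda>b' c'. tens k D A (f c' \<odot>\<^bsub>D\<^esub> d' i) (b' \<otimes>\<^bsub>A\<^esub> a))))\<rparr>)"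


section \<open>The modules \<open>V\<^sub>1\<close>, \<open>W\<^sub>1\<close> and the maps they induce\<close>

definition V1 ::
  "('k, 'r) ring_scheme \<Rightarrow> ('k, 'a, 'x) module_scheme \<Rightarrow> ('k, 'c, 'y) coalgebra_scheme
    \<Rightarrow> ('a, 'c) entwining \<Rightarrow> (('c \<times> 'c) list set \<Rightarrow> 'a) set" where
  "V1 k A C \<psi> = {\<theta>. linear_map k (tensor k C C) A \<theta> \<and>
     (\<forall>c\<in>carrier C. \<forall>d\<in>carrier C. \<forall>a\<in>carrier A.
        \<theta> (tens k C C c d) \<otimes>\<^bsub>A\<^esub> a =
        tens_sum A (\<psi> (tens k C A d a)) (\<lambda>a' d'. tens_sum A (\<psi> (tens k C A c a'))
          (\<lambda>a'' c'. a'' \<otimes>\<^bsub>A\<^esub> \<theta> (tens k C C c' d')))) \<and>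
     (\<forall>c\<in>carrier C. \<forall>d\<in>carrier C.
        tens_sum (tensor k A C) (comult C d) (\<lambda>d1 d2. tens k A C (\<theta> (tens k C C c d1)) d2) =
        tens_sum (tensor k A C) (comult C c) (\<lambda>c1 c2. \<psi> (tens k C A c1 (\<theta> (tens k C C c2 d)))))}"

definition W1 ::
  "('k, 'r) ring_scheme \<Rightarrow> ('k, 'a, 'x) module_scheme \<Rightarrow> ('k, 'c, 'y) coalgebra_scheme
    \<Rightarrow> ('a, 'c) entwining \<Rightarrow> ('a \<times> 'c) list set set" where
  "W1 k A C \<psi> = {z \<in> carrier (tensor k A C). \<forall>a\<in>carrier A.
     tens_sum (tensor k A C) z (\<lambda>al cl. tens k A C (a \<otimes>\<^bsub>A\<^esub> al) cl) =
     tens_sum (tensor k A C) z (\<lambda>al cl. tens_sum (tensor k A C) (\<psi> (tens k C A cl a))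
       (\<lambda>a' cl'. tens k A C (al \<otimes>\<^bsub>A\<^esub> a') cl'))}"

definition phi ::
  "('k, 'r) ring_scheme \<Rightarrow> ('k, 'a, 'x) module_scheme \<Rightarrow> ('k, 'c, 'y) coalgebra_scheme
    \<Rightarrow> ('a, 'c) entwining \<Rightarrow> ('a \<times> 'c) list set
    \<Rightarrow> (('c \<Rightarrow> 'k) \<times> 'a) list set \<Rightarrow> ('a \<times> 'c) list set" where
  "phi k A C \<psi> z t = tens_sum (tensor k A C) t (\<lambda>f a.
     tens_sum (tensor k A C) z (\<lambda>al cl.
       tens_sum (tensor k A C) (comult C cl) (\<lambda>cl1 cl2.
         tens_sum (tensor k A C) (\<psi> (tens k C A cl1 a)) (\<lambda>a' cl1'.
           tens k A C (al \<otimes>\<^bsub>A\<^esub> a') (f cl2 \<odot>\<^bsub>C\<^esub> cl1')))))"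

definition phi_bar ::
  "('k, 'r) ring_scheme \<Rightarrow> ('k, 'a, 'x) module_scheme \<Rightarrow> ('k, 'c, 'y) coalgebra_scheme
    \<Rightarrow> ('a, 'c) entwining \<Rightarrow> nat \<Rightarrow> (nat \<Rightarrow> 'c) \<Rightarrow> (nat \<Rightarrow> 'c \<Rightarrow> 'k)
    \<Rightarrow> (('c \<times> 'c) list set \<Rightarrow> 'a)
    \<Rightarrow> ('a \<times> 'c) list set \<Rightarrow> (('c \<Rightarrow> 'k) \<times> 'a) list set" where
  "phi_bar k A C \<psi> m d d' \<theta> t = (let T = tensor k (dual k C) A in
     tens_sum T t (\<lambda>a c. \<Oplus>\<^bsub>T\<^esub>i\<in>{1..m}. tens_sum T (\<psi> (tens k C A (d i) a))
       (\<lambda>a' di'. tens k (dual k C) A (d' i) (a' \<otimes>\<^bsub>A\<^esub> \<theta> (tens k C C di' c)))))"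


section \<open>Categories, adjoint functors and Frobenius pairs\<close>

text \<open>
  In a category \<open>\<C>\<close>, \<open>Cmp \<C> X Y Z g f\<close> is the composite of \<open>f : X \<rightarrow> Y\<close> and \<open>g : Y \<rightarrow> Z\<close>.
\<close>

record ('o, 'f) cat =
  Ob :: "'o set"
  Ar :: "'o \<Rightarrow> 'o \<Rightarrow> 'f set"
  Idt :: "'o \<Rightarrow> 'f"
  Cmp :: "'o \<Rightarrow> 'o \<Rightarrow> 'o \<Rightarrow> 'f \<Rightarrow> 'f \<Rightarrow> 'f"

locale is_category =
  fixes \<C> :: "('o, 'f) cat"
  assumes id_closed: "X \<in> Ob \<C> \<Longrightarrow> Idt \<C> X \<in> Ar \<C> X X"
    and comp_closed: "\<lbrakk>X \<in> Ob \<C>; Y \<in> Ob \<C>; Z \<in> Ob \<C>; f \<in> Ar \<C> X Y; g \<in> Ar \<C> Y Z\<rbrakk>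
      \<Longrightarrow> Cmp \<C> X Y Z g f \<in> Ar \<C> X Z"
    and id_left: "\<lbrakk>X \<in> Ob \<C>; Y \<in> Ob \<C>; f \<in> Ar \<C> X Y\<rbrakk> \<Longrightarrow> Cmp \<C> X Y Y (Idt \<C> Y) f = f"
    and id_right: "\<lbrakk>X \<in> Ob \<C>; Y \<in> Ob \<C>; f \<in> Ar \<C> X Y\<rbrakk> \<Longrightarrow> Cmp \<C> X X Y f (Idt \<C> X) = f"
    and comp_assoc: "\<lbrakk>W \<in> Ob \<C>; X \<in> Ob \<C>; Y \<in> Ob \<C>; Z \<in> Ob \<C>;
      f \<in> Ar \<C> W X; g \<in> Ar \<C> X Y; h \<in> Ar \<C> Y Z\<rbrakk>
      \<Longrightarrow> Cmp \<C> W X Z (Cmp \<C> X Y Z h g) f = Cmp \<C> W Y Z h (Cmp \<C> W X Y g f)"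

record ('o, 'f, 'p, 'g) func =
  fob :: "'o \<Rightarrow> 'p"
  far :: "'o \<Rightarrow> 'o \<Rightarrow> 'f \<Rightarrow> 'g"

locale is_functor = C: is_category \<C> + D: is_category \<D>
  for \<C> :: "('o, 'f) cat" and \<D> :: "('p, 'g) cat" and F :: "('o, 'f, 'p, 'g) func" +
  assumes fob_closed: "X \<in> Ob \<C> \<Longrightarrow> fob F X \<in> Ob \<D>"
    and far_closed: "\<lbrakk>X \<in> Ob \<C>; Y \<in> Ob \<C>; f \<in> Ar \<C> X Y\<rbrakk> \<Longrightarrow> far F X Y f \<in> Ar \<D> (fob F X) (fob F Y)"
    and far_id: "X \<in> Ob \<C> \<Longrightarrow> far F X X (Idt \<C> X) = Idt \<D> (fob F X)"
    and far_comp: "\<lbrakk>X \<in> Ob \<C>; Y \<in> Ob \<C>; Z \<in> Ob \<C>; f \<in> Ar \<C> X Y; g \<in> Ar \<C> Y Z\<rbrakk>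
      \<Longrightarrow> far F X Z (Cmp \<C> X Y Z g f) = Cmp \<D> (fob F X) (fob F Y) (fob F Z) (far F Y Z g) (far F X Y f)"

text \<open>\<open>F : \<C> \<rightarrow> \<D>\<close> is left adjoint to \<open>G : \<D> \<rightarrow> \<C>\<close>.\<close>

definition left_adjoint ::
  "('o, 'f) cat \<Rightarrow> ('p, 'g) cat \<Rightarrow> ('o, 'f, 'p, 'g) func \<Rightarrow> ('p, 'g, 'o, 'f) func \<Rightarrow> bool" where
  "left_adjoint \<C> \<D> F G \<longleftrightarrow> is_functor \<C> \<D> F \<and> is_functor \<D> \<C> G \<and>
     (\<exists>\<Phi> :: 'o \<Rightarrow> 'p \<Rightarrow> 'g \<Rightarrow> 'f.
       (\<forall>X\<in>Ob \<C>. \<forall>Y\<in>Ob \<D>. bij_betw (\<Phi> X Y) (Ar \<D> (fob F X) Y) (Ar \<C> X (fob G Y))) \<and>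
       (\<forall>X\<in>Ob \<C>. \<forall>X'\<in>Ob \<C>. \<forall>Y\<in>Ob \<D>. \<forall>f\<in>Ar \<C> X' X. \<forall>h\<in>Ar \<D> (fob F X) Y.
          \<Phi> X' Y (Cmp \<D> (fob F X') (fob F X) Y h (far F X' X f)) =
          Cmp \<C> X' X (fob G Y) (\<Phi> X Y h) f) \<and>
       (\<forall>X\<in>Ob \<C>. \<forall>Y\<in>Ob \<D>. \<forall>Y'\<in>Ob \<D>. \<forall>g\<in>Ar \<D> Y Y'. \<forall>h\<in>Ar \<D> (fob F X) Y.
          \<Phi> X Y' (Cmp \<D> (fob F X) Y Y' g h) =
          Cmp \<C> X (fob G Y) (fob G Y') (far G Y Y' g) (\<Phi> X Y h)))"

definition Frobenius_pair ::
  "('o, 'f) cat \<Rightarrow> ('p, 'g) cat \<Rightarrow> ('o, 'f, 'p, 'g) func \<Rightarrow> ('p, 'g, 'o, 'f) func \<Rightarrow> bool" where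
  "Frobenius_pair \<C> \<D> F G \<longleftrightarrow> left_adjoint \<C> \<D> F G \<and> left_adjoint \<D> \<C> G F"

text \<open>
  The categories \<open>\<M>\<^sub>A\<close> and \<open>\<M>(\<psi>)\<^sub>A\<^sup>C\<close> consist of the modules whose carrier is a subset of an
  arbitrary type \<open>'u\<close>, which plays the role of the universe.
\<close>

definition rmod_cat ::
  "('k, 'r) ring_scheme \<Rightarrow> ('k, 'a, 'x) module_scheme \<Rightarrow> (('k, 'u, 'a) rmod, 'u \<Rightarrow> 'u) cat" where
  "rmod_cat k A =
     \<lparr>Ob = {M. right_module k A M},
      Ar = rmod_hom k A,
      Idt = (\<lambda>M. \<lambda>x\<in>carrier M. x),
      Cmp = (\<lambda>L M N g f. compose (carrier L) g f)\<rparr>"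

definition emod_cat ::
  "('k, 'r) ring_scheme \<Rightarrow> ('k, 'a, 'x) module_scheme \<Rightarrow> ('k, 'c, 'y) coalgebra_scheme
    \<Rightarrow> ('a, 'c) entwining \<Rightarrow> (('k, 'u, 'a, 'c) emod, 'u \<Rightarrow> 'u) cat" where
  "emod_cat k A C \<psi> =
     \<lparr>Ob = {M. entwined_module k A C \<psi> M},
      Ar = emod_hom k A C,
      Idt = (\<lambda>M. \<lambda>x\<in>carrier M. x),
      Cmp = (\<lambda>L M N g f. compose (carrier L) g f)\<rparr>"

definition forget_functor ::
  "(('k, 'u, 'a, 'c) emod, 'u \<Rightarrow> 'u, ('k, 'u, 'a) rmod, 'u \<Rightarrow> 'u) func" where
  "forget_functor = \<lparr>fob = rmod.truncate, far = (\<lambda>M N f. f)\<rparr>"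

text \<open>
  The functor \<open>\<bullet> \<otimes> C\<close> has to stay inside the universe \<open>'u\<close>, whereas the elements of \<open>M \<otimes> C\<close>, for
  \<open>M\<close> in \<open>'u\<close>, are sets of lists. Given an injective coding \<open>\<iota>\<close> of lists of pairs by elements of
  \<open>'u\<close>, a tensor is coded by the code of a chosen representative, and the structure of
  \<open>M \<otimes> C\<close> is transported along this bijection.
\<close>

definition tens_code :: "(('u \<times> 'c) list \<Rightarrow> 'u) \<Rightarrow> ('u \<times> 'c) list set \<Rightarrow> 'u" where
  "tens_code \<iota> t = \<iota> (SOME xs. xs \<in> t)"

definition transport ::
  "('k, 'r) ring_scheme \<Rightarrow> ('k, 'c, 'y) coalgebra_scheme
    \<Rightarrow> ('m \<Rightarrow> 'u) \<Rightarrow> ('k, 'm, 'a, 'c) emod \<Rightarrow> ('k, 'u, 'a, 'c) emod" where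
  "transport k C e X = (let e' = inv_into (carrier X) e;
     N = \<lparr>carrier = e ` carrier X, mult = undefined, one = undefined,
       zero = e \<zero>\<^bsub>X\<^esub>, add = (\<lambda>u v. e (e' u \<oplus>\<^bsub>X\<^esub> e' v)), smult = (\<lambda>r u. e (r \<odot>\<^bsub>X\<^esub> e' u))\<rparr> in
     \<lparr>carrier = carrier N, mult = mult N, one = one N, zero = zero N, add = add N, smult = smult N,
      ract = (\<lambda>u a. e (ract X (e' u) a)),
      coact = (\<lambda>u. tens_sum (tensor k N C) (coact X (e' u)) (\<lambda>x c. tens k N C (e x) c))\<rparr>)"

definition tensor_C_functor ::
  "('k, 'r) ring_scheme \<Rightarrow> ('k, 'a, 'x) module_scheme \<Rightarrow> ('k, 'c, 'y) coalgebra_scheme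
    \<Rightarrow> ('a, 'c) entwining \<Rightarrow> (('u \<times> 'c) list \<Rightarrow> 'u)
    \<Rightarrow> (('k, 'u, 'a) rmod, 'u \<Rightarrow> 'u, ('k, 'u, 'a, 'c) emod, 'u \<Rightarrow> 'u) func" where
  "tensor_C_functor k A C \<psi> \<iota> =
     \<lparr>fob = (\<lambda>M. transport k C (tens_code \<iota>) (cofree k A C \<psi> M)),
      far = (\<lambda>M N f. \<lambda>u\<in>tens_code \<iota> ` carrier (tensor k M C).
        tens_code \<iota> (tens_sum (tensor k N C) (inv_into (carrier (tensor k M C)) (tens_code \<iota>) u)
          (\<lambda>m c. tens k N C (f m) c)))\<rparr>"

end

theory Submission
  imports Defs
begin

text \<open>
  Since \<open>C\<close> has a finite dual basis \<open>d\<^sub>i, d\<^sub>i\<^sup>*\<close>, the pairing \<open>\<langle>c\<^sup>* \<otimes> a, c\<rangle> = \<langle>c\<^sup>*, c\<rangle> a\<close> identifies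
  \<open>C\<^sup>* \<otimes> A\<close> with the linear maps from \<open>C\<close> to \<open>A\<close>, where the structure of \<open>C\<^sup>* \<otimes> A\<close> reads
  \<open>(h b)(c) = h(c) b\<close>, \<open>(b h)(c) = b\<^sub>\<psi> h(c\<^sup>\<psi>)\<close> and \<open>\<langle>\<rho>(h), c\<rangle> = \<psi>(c\<^sub>(\<^sub>1\<^sub>) \<otimes> h(c\<^sub>(\<^sub>2\<^sub>)))\<close>.
  As an entwined module, \<open>C\<^sup>* \<otimes> A\<close> is free on the generator \<open>\<epsilon> \<otimes> 1\<close>: for \<open>y\<close> in an entwined module \<open>Y\<close>,
  \<open>c\<^sup>* \<otimes> a \<mapsto> \<langle>c\<^sup>*, y\<^sub>[\<^sub>1\<^sub>]\<rangle> y\<^sub>[\<^sub>0\<^sub>] a\<close> is the only morphism taking \<open>\<epsilon> \<otimes> 1\<close> to \<open>y\<close>, and \<open>\<phi>\<close> is this morphism for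
  \<open>z \<in> A \<otimes> C\<close>.

  If \<open>G\<close> is left adjoint to \<open>F\<close>, then \<open>A \<otimes> C = G(A)\<close> also represents the underlying set functor of entwined
  modules, so by Yoneda it is isomorphic to \<open>C\<^sup>* \<otimes> A\<close>, compatibly with the left actions by
  naturality in the endomorphisms of \<open>A\<close>. A bimodule isomorphism is of the form \<open>\<phi>\<close>, with \<open>z\<close> the image of
  \<open>\<epsilon> \<otimes> 1\<close>, and its inverse is the map \<open>phi_bar\<close> of \<open>\<theta>\<close>, where \<open>\<theta>(c \<otimes> d)\<close> is the pairing of \<open>c\<close> with the image of
  \<open>1 \<otimes> d\<close>. Conversely, mutually inverse maps of these forms make \<open>x \<mapsto> x z\<close> and
  \<open>y \<otimes> c \<mapsto> y\<^sub>[\<^sub>0\<^sub>] \<theta>(y\<^sub>[\<^sub>1\<^sub>] \<otimes> c)\<close> the unit and counit of an adjunction between \<open>G\<close> and \<open>F\<close>.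
\<close>

section \<open>Linear maps and tensor products\<close>

text \<open>Two obstacles shape the proof. Elements of a tensor product are classes of lists, and
  \<open>tens_sum\<close> is a definite description that is guaranteed to denote only for bilinear
  summands. Every manipulation of a Sweedler sum therefore comes with linearity obligations, and the
  rules \<open>lin\<close> exist to discharge them. In the same spirit, equations in
  \<open>C\<^sup>* \<otimes> A\<close> and in its tensor products with \<open>C\<close> are tested
  by the pairing. Joint injectivity of the pairings is not by itself stable under tensoring, but the
  formula \<open>\<Sum>\<^sub>i d\<^sub>i\<^sup>* \<otimes> \<langle>t, d\<^sub>i\<rangle> =
  t\<close> is an identity of linear maps and can simply be tensored with \<open>C\<close>.

  The second obstacle is size. The Yoneda argument needs \<open>C\<^sup>* \<otimes> A\<close> as an
  object of a category whose modules live in the type \<open>'u\<close>. The dual basis makes this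
  possible: finitely many values in \<open>A\<close> determine a tensor, and \<open>\<iota>\<close>
  and \<open>j\<close> turn them into one element of \<open>'u\<close>.\<close>

lemma linear_mapI:
  assumes "\<And>x. x \<in> carrier M \<Longrightarrow> f x \<in> carrier N"
    and "\<And>x y. \<lbrakk>x \<in> carrier M; y \<in> carrier M\<rbrakk> \<Longrightarrow> f (x \<oplus>\<^bsub>M\<^esub> y) = f x \<oplus>\<^bsub>N\<^esub> f y"
    and "\<And>r x. \<lbrakk>r \<in> carrier k; x \<in> carrier M\<rbrakk> \<Longrightarrow> f (r \<odot>\<^bsub>M\<^esub> x) = r \<odot>\<^bsub>N\<^esub> f x"
  shows "linear_map k M N f"
  using assms by (auto simp: linear_map_def)

lemma linear_mapD:
  assumes "linear_map k M N f"
  shows linear_map_closed: "\<And>x. x \<in> carrier M \<Longrightarrow> f x \<in> carrier N"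
    and linear_map_add: "\<And>x y. \<lbrakk>x \<in> carrier M; y \<in> carrier M\<rbrakk> \<Longrightarrow> f (x \<oplus>\<^bsub>M\<^esub> y) = f x \<oplus>\<^bsub>N\<^esub> f y"
    and linear_map_smult: "\<And>r x. \<lbrakk>r \<in> carrier k; x \<in> carrier M\<rbrakk> \<Longrightarrow> f (r \<odot>\<^bsub>M\<^esub> x) = r \<odot>\<^bsub>N\<^esub> f x"
  using assms by (auto simp: linear_map_def)

lemma module_cring: "module k M \<Longrightarrow> cring k"
  by (rule module.axioms)

lemma module_group: "module k M \<Longrightarrow> abelian_group M"
  by (rule module.axioms)

lemmas module_zero = abelian_groupE(2)[OF module_group]
  and module_add = abelian_groupE(1)[OF module_group]
  and module_smult = module.smult_closed
  and module_assoc = abelian_groupE(3)[OF module_group]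
  and module_comm = abelian_groupE(4)[OF module_group]
  and module_zero_left = abelian_groupE(5)[OF module_group]
  and module_smult_zero = module.smult_r_null
  and module_one_smult = module.smult_one
  and module_smult_add = module.smult_r_distr
  and module_add_smult = module.smult_l_distr
  and module_smult_smult = module.smult_assoc1

lemmas moduleD = module_cring module_group module_zero module_add module_smult module_assoc
  module_comm module_zero_left module_smult_zero module_one_smult module_smult_add
  module_add_smult module_smult_smult

text \<open>The predicate \<open>module\<close> reads only these four fields of the record, so
  records may differ in their junk fields and in their extensions.\<close>

lemma module_fields_cong:
  assumes "module k M" and "carrier M' = carrier M" and "add M' = add M" and "zero M' = zero M"
    and "smult M' = smult M"
  shows "module k M'"
proof -
  have "abelian_group M'"
    by (rule abelian_groupI)
      (use abelian_groupE[OF module_group[OF assms(1)]] assms(2-) in auto)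
  then show ?thesis
    by (intro moduleI) (use assms in \<open>auto simp: moduleD\<close>)
qed

lemma linear_map_zero:
  assumes "module k M" "module k N" "linear_map k M N f"
  shows "f \<zero>\<^bsub>M\<^esub> = \<zero>\<^bsub>N\<^esub>"
proof -
  interpret M: module k M by fact
  interpret N: module k N by fact
  show ?thesis
    using linear_map_smult[OF assms(3), of "\<zero>\<^bsub>k\<^esub>" "\<zero>\<^bsub>M\<^esub>"] linear_map_closed[OF assms(3)] by simp
qed

definition bilin ::
  "('k, 'r) ring_scheme \<Rightarrow> ('k, 'm, 'x) module_scheme \<Rightarrow> ('k, 'n, 'y) module_scheme
    \<Rightarrow> ('k, 'p, 'z) module_scheme \<Rightarrow> ('m \<Rightarrow> 'n \<Rightarrow> 'p) \<Rightarrow> bool" where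
  "bilin k M N P f \<longleftrightarrow>
     (\<forall>m\<in>carrier M. linear_map k N P (f m)) \<and> (\<forall>n\<in>carrier N. linear_map k M P (\<lambda>m. f m n))"

text \<open>
  Rules for goals of the forms \<open>x \<in> carrier M\<close>, \<open>module k M\<close>, \<open>linear_map k M N (\<lambda>x. \<dots>)\<close> and
  \<open>bilin k M N P (\<lambda>x y. \<dots>)\<close>, applied by \<open>(assumption | rule lin)+\<close>. They recurse over the head
  symbol of the expression; modules that do not occur in the conclusion are determined by a premise
  that is solved before the premises that depend on them.
\<close>

named_theorems lin

lemma bilinI [lin]:
  assumes "\<And>m. m \<in> carrier M \<Longrightarrow> linear_map k N P (\<lambda>n. f m n)"
    and "\<And>n. n \<in> carrier N \<Longrightarrow> linear_map k M P (\<lambda>m. f m n)"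
  shows "bilin k M N P f"
  using assms by (simp add: bilin_def)

lemma bilinD:
  assumes "bilin k M N P f"
  shows bilin_right: "\<And>m. m \<in> carrier M \<Longrightarrow> linear_map k N P (\<lambda>n. f m n)"
    and bilin_left: "\<And>n. n \<in> carrier N \<Longrightarrow> linear_map k M P (\<lambda>m. f m n)"
    and bilin_closed: "\<And>m n. m \<in> carrier M \<Longrightarrow> n \<in> carrier N \<Longrightarrow> f m n \<in> carrier P"
  using assms by (auto simp: bilin_def dest: linear_map_closed)

section \<open>Sums of bilinear functions over representing lists\<close>

lemma list_sum_Nil [simp]: "list_sum P f [] = \<zero>\<^bsub>P\<^esub>"
  by (simp add: list_sum_def)

lemma list_sum_Cons [simp]: "list_sum P f ((m, n) # xs) = f m n \<oplus>\<^bsub>P\<^esub> list_sum P f xs"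
  by (simp add: list_sum_def)

lemma list_sum_closed:
  assumes P: "module k P" and f: "bilin k M N P f" and "xs \<in> lists (carrier M \<times> carrier N)"
  shows "list_sum P f xs \<in> carrier P"
  using assms(3) by (induction xs) (auto simp: bilin_closed[OF f] module_zero[OF P] module_add[OF P])

lemma list_sum_append:
  assumes P: "module k P" and f: "bilin k M N P f"
    and xs: "xs \<in> lists (carrier M \<times> carrier N)" and ys: "ys \<in> lists (carrier M \<times> carrier N)"
  shows "list_sum P f (xs @ ys) = list_sum P f xs \<oplus>\<^bsub>P\<^esub> list_sum P f ys"
  using xs
proof (induction xs)
  case Nil
  then show ?case using list_sum_closed[OF P f ys] by (simp add: module_zero_left[OF P])
next
  case (Cons x xs)
  then show ?case
    using list_sum_closed[OF P f] ys
    by (cases x) (simp add: bilin_closed[OF f] module_assoc[OF P])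
qed

lemma list_sum_cong:
  assumes "\<And>m n. m \<in> carrier M \<Longrightarrow> n \<in> carrier N \<Longrightarrow> f m n = g m n"
    "xs \<in> lists (carrier M \<times> carrier N)"
  shows "list_sum P f xs = list_sum P g xs"
  using assms(2) by (induction xs) (auto simp: assms(1))

lemma tens_eq_lists:
  assumes "module k M" "module k N" "tens_eq k M N xs ys"
  shows "xs \<in> lists (carrier M \<times> carrier N) \<and> ys \<in> lists (carrier M \<times> carrier N)"
  using assms(3)
  by induction (auto simp: moduleD[OF assms(1)] moduleD[OF assms(2)])

text \<open>The generating relations of \<open>tens_eq\<close> are equations that every bilinear
  function satisfies, and order and bracketing do not matter in the abelian group \<open>P\<close>.
  This is the well-definedness behind \<open>tens_sum\<close>.\<close>

lemma list_sum_tens_eq: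
  assumes P: "module k P" and M: "module k M" and N: "module k N" and f: "bilin k M N P f"
    and "tens_eq k M N xs ys"
  shows "list_sum P f xs = list_sum P f ys"
  using assms(5)
proof induction
  case (append xs xs' ys ys')
  then show ?case
    using tens_eq_lists[OF M N]
    by (metis (no_types, lifting) list_sum_append[OF P f])
next
  case (commute xs ys)
  then show ?case
    by (simp add: list_sum_append[OF P f] moduleD[OF P]
        list_sum_closed[OF P f])
next
  case (add_left m m' n)
  then show ?case
    using linear_map_add[OF bilin_left[OF f]]
    by (simp add: bilin_closed[OF f] moduleD[OF P])
next
  case (add_right m n n')
  then show ?case
    using linear_map_add[OF bilin_right[OF f]]
    by (simp add: bilin_closed[OF f] moduleD[OF P])
next
  case (balanced r m n)
  then show ?case
    using linear_map_smult[OF bilin_left[OF f]] linear_map_smult[OF bilin_right[OF f]]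
    by (simp add: bilin_closed[OF f] moduleD[OF P])
next
  case (zero n)
  then show ?case
    using linear_map_zero[OF M P bilin_left[OF f]]
    by (simp add: moduleD[OF P])
qed auto

lemma tens_class_eq:
  assumes "tens_eq k M N xs ys"
  shows "tens_class k M N xs = tens_class k M N ys"
  using assms by (auto simp: tens_class_def intro: tens_eq.sym tens_eq.trans)

lemma tens_class_self:
  "xs \<in> lists (carrier M \<times> carrier N) \<Longrightarrow> xs \<in> tens_class k M N xs"
  by (simp add: tens_class_def tens_eq.refl)

lemma tens_class_closed:
  "xs \<in> lists (carrier M \<times> carrier N) \<Longrightarrow> tens_class k M N xs \<in> carrier (tensor k M N)"
  by (simp add: tensor_def)

lemma tensor_cases:
  assumes "t \<in> carrier (tensor k M N)"
  obtains xs where "xs \<in> lists (carrier M \<times> carrier N)" "t = tens_class k M N xs"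
  using assms by (auto simp: tensor_def)

text \<open>All representatives give the same sum, so the image in the definition of
  \<open>tens_sum\<close> is a singleton and the description picks its element.\<close>

lemma tens_sum_class:
  assumes "module k P" "module k M" "module k N" "bilin k M N P f"
    "xs \<in> lists (carrier M \<times> carrier N)"
  shows "tens_sum P (tens_class k M N xs) f = list_sum P f xs"
proof -
  have "list_sum P f ` tens_class k M N xs = {list_sum P f xs}"
    using list_sum_tens_eq[OF assms(1-4)] tens_class_self[OF assms(5)]
    by (auto simp: tens_class_def)
  then show ?thesis by (simp add: tens_sum_def)
qed

section \<open>The module structure of the tensor product\<close>

lemma zero_tensor: "\<zero>\<^bsub>tensor k M N\<^esub> = tens_class k M N []"
  by (simp add: tensor_def)

text \<open>The operations of \<open>tensor\<close> are unions over all representatives; they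
  collapse to a single class once every choice contributes the same one.\<close>

lemma UN_const:
  assumes "S \<noteq> {}" "\<And>x. x \<in> S \<Longrightarrow> f x = c"
  shows "(\<Union>x\<in>S. f x) = c"
  using assms by auto

lemma add_tens_class:
  assumes "module k M" "module k N"
    "xs \<in> lists (carrier M \<times> carrier N)" "ys \<in> lists (carrier M \<times> carrier N)"
  shows "tens_class k M N xs \<oplus>\<^bsub>tensor k M N\<^esub> tens_class k M N ys = tens_class k M N (xs @ ys)"
proof -
  have "(\<Union>xs'\<in>tens_class k M N xs. \<Union>ys'\<in>tens_class k M N ys. tens_class k M N (xs' @ ys'))
    = tens_class k M N (xs @ ys)"
  proof (intro UN_const)
    fix xs' ys' assume "xs' \<in> tens_class k M N xs" "ys' \<in> tens_class k M N ys"
    then show "tens_class k M N (xs' @ ys') = tens_class k M N (xs @ ys)"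
      by (auto simp: tens_class_def[of _ _ _ xs] tens_class_def[of _ _ _ ys]
          intro!: tens_class_eq tens_eq.append intro: tens_eq.sym)
  qed (use assms tens_class_self in blast)+
  then show ?thesis by (simp add: tensor_def)
qed

lemma map_smult_lists:
  assumes M: "module k M" and "xs \<in> lists (carrier M \<times> carrier N)" and r: "r \<in> carrier k"
  shows "map (\<lambda>(m, n). (r \<odot>\<^bsub>M\<^esub> m, n)) xs \<in> lists (carrier M \<times> carrier N)"
  using assms(2) by (induction xs) (auto simp: module_smult[OF M r])

lemma tens_eq_map_smult:
  assumes M: "module k M" and N: "module k N" and r: "r \<in> carrier k" and "tens_eq k M N xs ys"
  shows "tens_eq k M N (map (\<lambda>(m, n). (r \<odot>\<^bsub>M\<^esub> m, n)) xs) (map (\<lambda>(m, n). (r \<odot>\<^bsub>M\<^esub> m, n)) ys)"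
  using assms(4)
proof induction
  case (refl xs)
  then show ?case by (intro tens_eq.refl map_smult_lists[OF M] r)
next
  case (trans xs ys zs)
  then show ?case by (blast intro: tens_eq.trans)
next
  case (commute xs ys)
  then show ?case unfolding map_append by (intro tens_eq.commute map_smult_lists[OF M] r)
next
  case (add_left m m' n)
  then show ?case
    using r by (simp add: module_smult_add[OF M] module_smult[OF M] tens_eq.add_left)
next
  case (balanced s m n)
  \<comment> \<open>The acting scalar \<open>r\<close> and the scalar \<open>s\<close> that moves
    across the tensor sign have to be exchanged; this is where commutativity of \<open>k\<close> is
    used.\<close>
  then have "r \<odot>\<^bsub>M\<^esub> (s \<odot>\<^bsub>M\<^esub> m) = s \<odot>\<^bsub>M\<^esub> (r \<odot>\<^bsub>M\<^esub> m)"
    using r cring.cring_simprules(14)[OF module_cring[OF M], of r s]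
      module_smult_smult[OF M, of r s m] module_smult_smult[OF M, of s r m]
    by simp
  then show ?case
    using r balanced by (simp add: moduleD[OF M] tens_eq.balanced)
next
  case (zero n)
  then show ?case
    using r by (simp add: moduleD[OF M] tens_eq.zero)
qed (auto simp: moduleD[OF M] r intro: tens_eq.intros)

lemma smult_tens_class:
  assumes M: "module k M" and N: "module k N" and r: "r \<in> carrier k"
    and xs: "xs \<in> lists (carrier M \<times> carrier N)"
  shows "r \<odot>\<^bsub>tensor k M N\<^esub> tens_class k M N xs
    = tens_class k M N (map (\<lambda>(m, n). (r \<odot>\<^bsub>M\<^esub> m, n)) xs)"
proof -
  have "(\<Union>xs\<in>tens_class k M N xs. tens_class k M N (map (\<lambda>(m, n). (r \<odot>\<^bsub>M\<^esub> m, n)) xs))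
    = tens_class k M N (map (\<lambda>(m, n). (r \<odot>\<^bsub>M\<^esub> m, n)) xs)"
    using tens_class_self[OF xs]
    by (intro UN_const)
      (auto simp: tens_class_def[of _ _ _ xs]
        intro!: tens_class_eq tens_eq_map_smult[OF M N r] intro: tens_eq.sym)
  then show ?thesis by (simp add: tensor_def)
qed

lemma tens_class_Cons:
  assumes "module k M" "module k N" "m \<in> carrier M" "n \<in> carrier N"
    "xs \<in> lists (carrier M \<times> carrier N)"
  shows "tens_class k M N ((m, n) # xs) = tens k M N m n \<oplus>\<^bsub>tensor k M N\<^esub> tens_class k M N xs"
  using assms by (simp add: tens_def add_tens_class)

lemma tensor_module [lin]:
  assumes M: "module k M" and N: "module k N"
  shows "module k (tensor k M N)"
proof -
  note cls = tens_class_closed[of _ M N k]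
  note sums = add_tens_class[OF M N] smult_tens_class[OF M N] zero_tensor
  \<comment> \<open>The additive inverse of a class scales all left entries by
    \<open>\<ominus> \<one>\<close>. In the induction the head of the original list has to be moved
    past the scaled tail before it meets its own inverse.\<close>
  have neg: "tens_eq k M N (map (\<lambda>(m, n). ((\<ominus>\<^bsub>k\<^esub> \<one>\<^bsub>k\<^esub>) \<odot>\<^bsub>M\<^esub> m, n)) xs @ xs) []"
    if "xs \<in> lists (carrier M \<times> carrier N)" for xs
    using that
  proof (induction xs)
    case (Cons x xs)
    obtain m n where x: "x = (m, n)" "m \<in> carrier M" "n \<in> carrier N" using Cons by auto
    let ?r = "\<ominus>\<^bsub>k\<^esub> \<one>\<^bsub>k\<^esub>"
    interpret M: module k M by fact
    have r: "?r \<in> carrier k" by simp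
    have 1: "?r \<odot>\<^bsub>M\<^esub> m \<oplus>\<^bsub>M\<^esub> m = \<zero>\<^bsub>M\<^esub>"
      using x M.smult_l_minus[of "\<one>\<^bsub>k\<^esub>" m] by (simp add: M.M.l_neg)
    let ?ys = "map (\<lambda>(m, n). (?r \<odot>\<^bsub>M\<^esub> m, n)) xs"
    have ys: "?ys \<in> lists (carrier M \<times> carrier N)" using Cons r by (intro map_smult_lists[OF M]) auto
    have xs: "xs \<in> lists (carrier M \<times> carrier N)" using Cons by auto
    have 2: "tens_eq k M N [(?r \<odot>\<^bsub>M\<^esub> m, n), (m, n)] []"
      using tens_eq.add_left[of "?r \<odot>\<^bsub>M\<^esub> m" M m n N k] tens_eq.zero[of n N k M] x r
      by (metis 1 M.smult_closed tens_eq.sym tens_eq.trans)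
    have "tens_eq k M N ((?r \<odot>\<^bsub>M\<^esub> m, n) # (?ys @ [(m, n)]) @ xs) ((?r \<odot>\<^bsub>M\<^esub> m, n) # ([(m, n)] @ ?ys) @ xs)"
      using tens_eq.append[OF tens_eq.refl[of "[(?r \<odot>\<^bsub>M\<^esub> m, n)]" M N k]
          tens_eq.append[OF tens_eq.commute[of ?ys M N "[(m, n)]" k] tens_eq.refl[OF xs]]] x ys xs r
      by (simp del: map_append)
    also have "(?r \<odot>\<^bsub>M\<^esub> m, n) # ([(m, n)] @ ?ys) @ xs = [(?r \<odot>\<^bsub>M\<^esub> m, n), (m, n)] @ (?ys @ xs)"
      by simp
    finally have "tens_eq k M N ((?r \<odot>\<^bsub>M\<^esub> m, n) # (?ys @ [(m, n)]) @ xs) ([] @ [])"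
      using tens_eq.append[OF 2 Cons.IH] xs by (blast intro: tens_eq.trans)
    then show ?case by (simp add: x)
  qed (simp add: tens_eq.refl)
  have grp: "abelian_group (tensor k M N)"
  proof (rule abelian_groupI)
    fix s assume "s \<in> carrier (tensor k M N)"
    then obtain xs where s: "xs \<in> lists (carrier M \<times> carrier N)" "s = tens_class k M N xs"
      by (rule tensor_cases)
    let ?ys = "map (\<lambda>(m, n). ((\<ominus>\<^bsub>k\<^esub> \<one>\<^bsub>k\<^esub>) \<odot>\<^bsub>M\<^esub> m, n)) xs"
    have "?ys \<in> lists (carrier M \<times> carrier N)"
      using s cring.cring_simprules[OF module_cring[OF M]] by (intro map_smult_lists[OF M]) auto
    then show "\<exists>t\<in>carrier (tensor k M N). t \<oplus>\<^bsub>tensor k M N\<^esub> s = \<zero>\<^bsub>tensor k M N\<^esub>"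
      using s cls tens_class_eq[OF neg[OF s(1)]] by (intro bexI[of _ "tens_class k M N ?ys"]) (auto simp: sums)
  next
    fix s t assume "s \<in> carrier (tensor k M N)" "t \<in> carrier (tensor k M N)"
    then obtain xs ys where *: "xs \<in> lists (carrier M \<times> carrier N)" "s = tens_class k M N xs"
      "ys \<in> lists (carrier M \<times> carrier N)" "t = tens_class k M N ys"
      by (elim tensor_cases)
    then have **: "xs @ ys \<in> lists (carrier M \<times> carrier N)" by simp
    show "s \<oplus>\<^bsub>tensor k M N\<^esub> t \<in> carrier (tensor k M N)" using * cls[OF **] by (simp add: sums)
    show "s \<oplus>\<^bsub>tensor k M N\<^esub> t = t \<oplus>\<^bsub>tensor k M N\<^esub> s"
      using * tens_eq.commute[of xs M N ys k] by (simp add: sums tens_class_eq)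
    fix u assume "u \<in> carrier (tensor k M N)"
    then obtain zs where "zs \<in> lists (carrier M \<times> carrier N)" "u = tens_class k M N zs"
      by (elim tensor_cases)
    with * show "s \<oplus>\<^bsub>tensor k M N\<^esub> t \<oplus>\<^bsub>tensor k M N\<^esub> u = s \<oplus>\<^bsub>tensor k M N\<^esub> (t \<oplus>\<^bsub>tensor k M N\<^esub> u)"
      using ** by (simp add: sums)
  next
    show "\<zero>\<^bsub>tensor k M N\<^esub> \<in> carrier (tensor k M N)" by (simp add: sums cls)
    fix s assume "s \<in> carrier (tensor k M N)"
    then show "\<zero>\<^bsub>tensor k M N\<^esub> \<oplus>\<^bsub>tensor k M N\<^esub> s = s"
      by (elim tensor_cases) (simp add: sums)
  qed
  have map_closed: "map (\<lambda>(m, n). (r \<odot>\<^bsub>M\<^esub> m, n)) xs \<in> lists (carrier M \<times> carrier N)"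
    if "xs \<in> lists (carrier M \<times> carrier N)" "r \<in> carrier k" for xs r
    using that by (intro map_smult_lists[OF M])
  \<comment> \<open>Scaling by a sum of scalars interleaves the two scaled lists, so each induction
    step needs one \<open>commute\<close> to sort the entries.\<close>
  have map_add: "tens_eq k M N (map (\<lambda>(m, n). ((a \<oplus>\<^bsub>k\<^esub> b) \<odot>\<^bsub>M\<^esub> m, n)) xs)
      (map (\<lambda>(m, n). (a \<odot>\<^bsub>M\<^esub> m, n)) xs @ map (\<lambda>(m, n). (b \<odot>\<^bsub>M\<^esub> m, n)) xs)"
    if "xs \<in> lists (carrier M \<times> carrier N)" and ab: "a \<in> carrier k" "b \<in> carrier k" for a b xs
    using that(1)
  proof (induction xs)
    case (Cons x xs)
    obtain m n where x: "x = (m, n)" "m \<in> carrier M" "n \<in> carrier N" using Cons by auto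
    let ?as = "map (\<lambda>(m, n). (a \<odot>\<^bsub>M\<^esub> m, n)) xs" and ?bs = "map (\<lambda>(m, n). (b \<odot>\<^bsub>M\<^esub> m, n)) xs"
    have c: "?as \<in> lists (carrier M \<times> carrier N)" "?bs \<in> lists (carrier M \<times> carrier N)"
      "[(a \<odot>\<^bsub>M\<^esub> m, n)] \<in> lists (carrier M \<times> carrier N)"
      "[(b \<odot>\<^bsub>M\<^esub> m, n)] \<in> lists (carrier M \<times> carrier N)"
      using Cons ab x map_closed by (auto simp: moduleD[OF M])
    have "tens_eq k M N [((a \<oplus>\<^bsub>k\<^esub> b) \<odot>\<^bsub>M\<^esub> m, n)] [(a \<odot>\<^bsub>M\<^esub> m, n), (b \<odot>\<^bsub>M\<^esub> m, n)]"
      using x ab by (simp add: moduleD[OF M] tens_eq.add_left)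
    from tens_eq.append[OF this Cons.IH]
    have 1: "tens_eq k M N (map (\<lambda>(m, n). ((a \<oplus>\<^bsub>k\<^esub> b) \<odot>\<^bsub>M\<^esub> m, n)) (x # xs))
      ([(a \<odot>\<^bsub>M\<^esub> m, n)] @ ([(b \<odot>\<^bsub>M\<^esub> m, n)] @ ?as) @ ?bs)"
      using x Cons by simp
    have 2: "tens_eq k M N ([(a \<odot>\<^bsub>M\<^esub> m, n)] @ ([(b \<odot>\<^bsub>M\<^esub> m, n)] @ ?as) @ ?bs)
      ([(a \<odot>\<^bsub>M\<^esub> m, n)] @ (?as @ [(b \<odot>\<^bsub>M\<^esub> m, n)]) @ ?bs)"
      by (intro tens_eq.append tens_eq.commute tens_eq.refl c)
    show ?case using tens_eq.trans[OF 1 2] x by simp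
  qed (simp add: tens_eq.refl)
  have map_mult: "map (\<lambda>(m, n). ((a \<otimes>\<^bsub>k\<^esub> b) \<odot>\<^bsub>M\<^esub> m, n)) xs
      = map (\<lambda>(m, n). (a \<odot>\<^bsub>M\<^esub> m, n)) (map (\<lambda>(m, n). (b \<odot>\<^bsub>M\<^esub> m, n)) xs)"
    if "xs \<in> lists (carrier M \<times> carrier N)" "a \<in> carrier k" "b \<in> carrier k" for a b xs
    using that(1) by (induction xs) (use that(2,3) in \<open>auto simp: moduleD[OF M]\<close>)
  have map_one: "map (\<lambda>(m, n). (\<one>\<^bsub>k\<^esub> \<odot>\<^bsub>M\<^esub> m, n)) xs = xs"
    if "xs \<in> lists (carrier M \<times> carrier N)" for xs
    using that by (induction xs) (auto simp: moduleD[OF M])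
  note [simp] = sums cls map_closed
  note [simp del] = map_map map_append in_lists_conv_set
  interpret K: cring k by (rule module_cring[OF M])
  show ?thesis
  proof (intro moduleI module_cring[OF M] grp)
    fix a s assume a: "a \<in> carrier k" and "s \<in> carrier (tensor k M N)"
    then obtain xs where s: "xs \<in> lists (carrier M \<times> carrier N)" "s = tens_class k M N xs"
      by (elim tensor_cases)
    show "a \<odot>\<^bsub>tensor k M N\<^esub> s \<in> carrier (tensor k M N)" using s a by simp
    show "(a \<oplus>\<^bsub>k\<^esub> b) \<odot>\<^bsub>tensor k M N\<^esub> s = a \<odot>\<^bsub>tensor k M N\<^esub> s \<oplus>\<^bsub>tensor k M N\<^esub> b \<odot>\<^bsub>tensor k M N\<^esub> s" if "b \<in> carrier k" for b
      using s a that by (simp add: tens_class_eq[OF map_add])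
    show "(a \<otimes>\<^bsub>k\<^esub> b) \<odot>\<^bsub>tensor k M N\<^esub> s = a \<odot>\<^bsub>tensor k M N\<^esub> (b \<odot>\<^bsub>tensor k M N\<^esub> s)" if "b \<in> carrier k" for b
      using s a that by (simp add: map_mult)
    fix t assume "t \<in> carrier (tensor k M N)"
    then obtain ys where t: "ys \<in> lists (carrier M \<times> carrier N)" "t = tens_class k M N ys"
      by (elim tensor_cases)
    have "xs @ ys \<in> lists (carrier M \<times> carrier N)" using s t by simp
    then show "a \<odot>\<^bsub>tensor k M N\<^esub> (s \<oplus>\<^bsub>tensor k M N\<^esub> t) = a \<odot>\<^bsub>tensor k M N\<^esub> s \<oplus>\<^bsub>tensor k M N\<^esub> a \<odot>\<^bsub>tensor k M N\<^esub> t"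
      using s t a by (simp add: map_append)
  next
    fix s assume "s \<in> carrier (tensor k M N)"
    then show "\<one>\<^bsub>k\<^esub> \<odot>\<^bsub>tensor k M N\<^esub> s = s" by (elim tensor_cases) (simp add: map_one)
  qed
qed

section \<open>Linear maps out of a tensor product\<close>

lemma tensor_induct [consumes 3, case_names zero add]:
  assumes M: "module k M" and N: "module k N" and t: "t \<in> carrier (tensor k M N)"
    and 0: "Q \<zero>\<^bsub>tensor k M N\<^esub>"
    and add: "\<And>m n t. \<lbrakk>m \<in> carrier M; n \<in> carrier N; t \<in> carrier (tensor k M N); Q t\<rbrakk>
      \<Longrightarrow> Q (tens k M N m n \<oplus>\<^bsub>tensor k M N\<^esub> t)"
  shows "Q t"
proof -
  obtain xs where xs: "xs \<in> lists (carrier M \<times> carrier N)" "t = tens_class k M N xs"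
    using t by (rule tensor_cases)
  have "Q (tens_class k M N xs)" using xs(1)
  proof (induction xs)
    case Nil then show ?case using 0 by (simp add: zero_tensor)
  next
    case (Cons x xs)
    then show ?case using add[OF _ _ tens_class_closed]
      by (cases x) (simp add: tens_class_Cons[OF M N])
  qed
  then show ?thesis using xs by simp
qed

lemma tens_closed [lin]:
  assumes "m \<in> carrier M" "n \<in> carrier N"
  shows "tens k M N m n \<in> carrier (tensor k M N)"
  using assms by (simp add: tens_def tens_class_closed)

lemma linear_id [lin]: "linear_map k M M (\<lambda>x. x)"
  by (simp add: linear_map_def)

lemma linear_comp:
  assumes "linear_map k N P h" "linear_map k M N f"
  shows "linear_map k M P (\<lambda>x. h (f x))"
  using assms by (auto simp: linear_map_def Pi_iff)

lemma bilin_tens: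
  assumes M: "module k M" and N: "module k N"
  shows "bilin k M N (tensor k M N) (tens k M N)"
proof -
  note sums = add_tens_class[OF M N] smult_tens_class[OF M N]
  show ?thesis
  proof (intro bilinI linear_mapI)
    fix r m n assume a: "r \<in> carrier k" "m \<in> carrier M" "n \<in> carrier N"
    show "tens k M N (r \<odot>\<^bsub>M\<^esub> m) n = r \<odot>\<^bsub>tensor k M N\<^esub> tens k M N m n"
      using a by (simp add: tens_def sums)
    moreover have "tens k M N (r \<odot>\<^bsub>M\<^esub> m) n = tens k M N m (r \<odot>\<^bsub>N\<^esub> n)"
      using a by (simp add: tens_def tens_class_eq tens_eq.balanced)
    ultimately show "tens k M N m (r \<odot>\<^bsub>N\<^esub> n) = r \<odot>\<^bsub>tensor k M N\<^esub> tens k M N m n"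
      by simp
  qed (simp_all add: tens_closed, simp_all add: tens_def sums tens_class_eq tens_eq.add_left tens_eq.add_right)
qed

lemma linear_tens_left [lin]:
  assumes "module k M" "module k N" "linear_map k X M f" "n \<in> carrier N"
  shows "linear_map k X (tensor k M N) (\<lambda>x. tens k M N (f x) n)"
  using linear_comp[OF bilin_left[OF bilin_tens[OF assms(1,2)] assms(4)] assms(3)] .

lemma linear_tens_right [lin]:
  assumes "module k M" "module k N" "linear_map k X N f" "m \<in> carrier M"
  shows "linear_map k X (tensor k M N) (\<lambda>x. tens k M N m (f x))"
  using linear_comp[OF bilin_right[OF bilin_tens[OF assms(1,2)] assms(4)] assms(3)] .

lemma linear_smult_right [lin]:
  assumes P: "module k P" and f: "linear_map k X P f" and r: "r \<in> carrier k"
  shows "linear_map k X P (\<lambda>x. r \<odot>\<^bsub>P\<^esub> f x)"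
proof -
  interpret P: module k P by fact
  show ?thesis
    using f r P.m_comm
    by (auto simp: linear_map_def Pi_iff P.smult_r_distr P.smult_assoc1[symmetric])
qed

lemma linear_smult_left [lin]:
  assumes P: "module k P" and f: "linear_map k X (self_module k) f" and p: "p \<in> carrier P"
  shows "linear_map k X P (\<lambda>x. f x \<odot>\<^bsub>P\<^esub> p)"
proof -
  interpret P: module k P by fact
  show ?thesis
    using f p
    by (auto simp: linear_map_def Pi_iff self_module_def P.smult_l_distr P.smult_assoc1)
qed

lemma linear_add:
  assumes P: "module k P" and f: "linear_map k X P f" "linear_map k X P g"
  shows "linear_map k X P (\<lambda>x. f x \<oplus>\<^bsub>P\<^esub> g x)"
proof -
  interpret P: module k P by fact
  show ?thesis using f
    by (intro linear_mapI) (simp_all add: linear_mapD P.smult_r_distr P.M.add.m_ac)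
qed

lemma linear_zero:
  assumes P: "module k P"
  shows "linear_map k X P (\<lambda>x. \<zero>\<^bsub>P\<^esub>)"
  by (intro linear_mapI) (simp_all add: moduleD[OF P])

lemma smult_closed' [lin]:
  assumes "module k P" "r \<in> carrier k" "p \<in> carrier P"
  shows "r \<odot>\<^bsub>P\<^esub> p \<in> carrier P"
  using assms by (simp add: moduleD)

lemma tens_sum_closed [lin]:
  assumes "module k M" "module k N" "module k P" "t \<in> carrier (tensor k M N)" "bilin k M N P f"
  shows "tens_sum P t f \<in> carrier P"
  using assms(4)
  by (elim tensor_cases) (simp add: tens_sum_class[OF assms(3,1,2,5)] list_sum_closed[OF assms(3) assms(5)])

lemma tens_sum_tens:
  assumes "module k M" "module k N" "module k P" "bilin k M N P f" "m \<in> carrier M" "n \<in> carrier N"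
  shows "tens_sum P (tens k M N m n) f = f m n"
  using assms(5,6)
  by (simp add: tens_def tens_sum_class[OF assms(3,1,2,4)] bilin_closed[OF assms(4)] moduleD[OF assms(3)])

lemma linear_tens_sum':
  assumes M: "module k M" and N: "module k N" and P: "module k P" and f: "bilin k M N P f"
  shows "linear_map k (tensor k M N) P (\<lambda>t. tens_sum P t f)"
proof (rule linear_mapI)
  note [simp] = tens_sum_class[OF P M N f] add_tens_class[OF M N] smult_tens_class[OF M N]
    moduleD[OF P] bilin_closed[OF f] list_sum_closed[OF P f]
  show "tens_sum P t f \<in> carrier P" if "t \<in> carrier (tensor k M N)" for t
    using that assms by (blast intro: tens_sum_closed)
  show "tens_sum P (s \<oplus>\<^bsub>tensor k M N\<^esub> t) f = tens_sum P s f \<oplus>\<^bsub>P\<^esub> tens_sum P t f"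
    if "s \<in> carrier (tensor k M N)" "t \<in> carrier (tensor k M N)" for s t
    using that by (elim tensor_cases) (simp add: list_sum_append[OF P f])
  show "tens_sum P (r \<odot>\<^bsub>tensor k M N\<^esub> t) f = r \<odot>\<^bsub>P\<^esub> tens_sum P t f"
    if r: "r \<in> carrier k" and "t \<in> carrier (tensor k M N)" for r t
    using that(2)
  proof (elim tensor_cases)
    fix xs assume xs: "xs \<in> lists (carrier M \<times> carrier N)" "t = tens_class k M N xs"
    have "map (\<lambda>(m, n). (r \<odot>\<^bsub>M\<^esub> m, n)) xs \<in> lists (carrier M \<times> carrier N)"
      using xs r by (intro map_smult_lists[OF M])
    moreover have "list_sum P f (map (\<lambda>(m, n). (r \<odot>\<^bsub>M\<^esub> m, n)) xs) = r \<odot>\<^bsub>P\<^esub> list_sum P f xs"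
      using xs(1)
    proof (induction xs)
      case Nil
      then show ?case using r by (simp add: module_smult_zero[OF P])
    next
      case (Cons x xs)
      then show ?case
        using r list_sum_closed[OF P f, of xs]
        by (cases x) (simp add: linear_map_smult[OF bilin_left[OF f]] module_smult_add[OF P] bilin_closed[OF f])
    qed
    ultimately show ?thesis using xs r by simp
  qed
qed

text \<open>Pure tensors generate the tensor product. Most identities below are reduced to pure
  tensors by this rule, at the price of showing both sides linear, which is the task of the rules
  \<open>lin\<close>.\<close>

lemma linear_ext_tensor:
  assumes M: "module k M" and N: "module k N" and P: "module k P"
    and g: "linear_map k (tensor k M N) P g" and h: "linear_map k (tensor k M N) P h"
    and eq: "\<And>m n. \<lbrakk>m \<in> carrier M; n \<in> carrier N\<rbrakk> \<Longrightarrow> g (tens k M N m n) = h (tens k M N m n)"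
    and t: "t \<in> carrier (tensor k M N)"
  shows "g t = h t"
  using M N t
proof (induction rule: tensor_induct)
  case zero
  then show ?case
    using linear_map_zero[OF tensor_module[OF M N] P g] linear_map_zero[OF tensor_module[OF M N] P h] by simp
next
  case (add m n t)
  then show ?case using g h by (simp add: linear_map_add tens_closed eq)
qed

text \<open>Both functions have the same image of \<open>t\<close>, so the two descriptions agree
  even where they would denote nothing. Rewriting under a sum therefore raises no linearity
  obligation.\<close>

lemma tens_sum_cong:
  assumes "module k M" "module k N" "t \<in> carrier (tensor k M N)"
    and "\<And>m n. \<lbrakk>m \<in> carrier M; n \<in> carrier N\<rbrakk> \<Longrightarrow> f m n = g m n"
  shows "tens_sum P t f = tens_sum P t g"
proof -
  have "list_sum P f ` t = list_sum P g ` t"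
  proof (rule image_cong)
    fix xs assume "xs \<in> t"
    then have "xs \<in> lists (carrier M \<times> carrier N)"
      using assms(3) tens_eq_lists[OF assms(1,2)]
      by (elim tensor_cases) (auto simp: tens_class_def simp del: in_lists_conv_set)
    then show "list_sum P f xs = list_sum P g xs"
      by (intro list_sum_cong[of M N] assms(4))
  qed simp
  then show ?thesis by (simp add: tens_sum_def)
qed

lemma linear_tens_sum_outer [lin]:
  assumes "module k M" "module k N" "module k P" "linear_map k X (tensor k M N) T" "bilin k M N P f"
  shows "linear_map k X P (\<lambda>x. tens_sum P (T x) f)"
  using linear_comp[OF linear_tens_sum'[OF assms(1-3,5)] assms(4)] .

text \<open>One fixed list represents \<open>t\<close> for all parameters \<open>x\<close>, and a
  finite sum of linear maps is linear.\<close>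

lemma linear_tens_sum_inner [lin]:
  assumes M: "module k M" and N: "module k N" and P: "module k P" and X: "module k X"
    and t: "t \<in> carrier (tensor k M N)"
    and f: "\<And>m n. \<lbrakk>m \<in> carrier M; n \<in> carrier N\<rbrakk> \<Longrightarrow> linear_map k X P (\<lambda>x. f x m n)"
    and b: "\<And>x. x \<in> carrier X \<Longrightarrow> bilin k M N P (f x)"
  shows "linear_map k X P (\<lambda>x. tens_sum P t (f x))"
proof -
  obtain xs where xs: "xs \<in> lists (carrier M \<times> carrier N)" "t = tens_class k M N xs"
    using t by (rule tensor_cases)
  have "linear_map k X P (\<lambda>x. list_sum P (f x) xs)"
    using xs(1)
    by (induction xs) (auto intro!: linear_zero linear_add P f)
  then have "linear_map k X P (\<lambda>x. tens_sum P t (f x))"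
    unfolding linear_map_def using X
    by (auto simp: xs tens_sum_class[OF P M N b] moduleD Pi_iff)
  then show ?thesis .
qed

text \<open>By uniqueness of linear extensions from pure tensors. Read backwards, it pulls an
  operation out of a Sweedler sum.\<close>

lemma tens_sum_linear:
  assumes M: "module k M" and N: "module k N" and P: "module k P" and Q: "module k Q"
    and h: "linear_map k P Q h" and t: "t \<in> carrier (tensor k M N)" and f: "bilin k M N P f"
  shows "h (tens_sum P t f) = tens_sum Q t (\<lambda>m n. h (f m n))"
proof -
  have b: "bilin k M N Q (\<lambda>m n. h (f m n))"
    by (intro bilinI linear_comp[OF h] bilinD[OF f])
  show ?thesis
    by (rule linear_ext_tensor[OF M N Q linear_comp[OF h linear_tens_sum'[OF M N P f]]
          linear_tens_sum'[OF M N Q b] _ t])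
      (simp add: tens_sum_tens[OF M N P f] tens_sum_tens[OF M N Q b])
qed

lemma tens_sum_tens_sum:
  assumes M: "module k M" and N: "module k N" and X: "module k X" and Y: "module k Y"
    and P: "module k P"
    and t: "t \<in> carrier (tensor k X Y)" and f: "bilin k X Y (tensor k M N) f" and g: "bilin k M N P g"
  shows "tens_sum P (tens_sum (tensor k M N) t f) g = tens_sum P t (\<lambda>a b. tens_sum P (f a b) g)"
  using tens_sum_linear[OF X Y tensor_module[OF M N] P linear_tens_sum'[OF M N P g] t f] .

text \<open>Fubini for Sweedler sums: both sides are linear in \<open>t\<close>, and for a pure
  tensor \<open>t\<close> only the sum over \<open>s\<close> remains.\<close>

lemma tens_sum_swap:
  assumes M: "module k M" and N: "module k N" and X: "module k X" and Y: "module k Y"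
    and P: "module k P"
    and t: "t \<in> carrier (tensor k M N)" and s: "s \<in> carrier (tensor k X Y)"
    and f: "\<And>m n. \<lbrakk>m \<in> carrier M; n \<in> carrier N\<rbrakk> \<Longrightarrow> bilin k X Y P (\<lambda>x y. f m n x y)"
    and g: "\<And>x y. \<lbrakk>x \<in> carrier X; y \<in> carrier Y\<rbrakk> \<Longrightarrow> bilin k M N P (\<lambda>m n. f m n x y)"
  shows "tens_sum P t (\<lambda>m n. tens_sum P s (\<lambda>x y. f m n x y))
    = tens_sum P s (\<lambda>x y. tens_sum P t (\<lambda>m n. f m n x y))"
proof -
  have b1: "bilin k M N P (\<lambda>m n. tens_sum P s (\<lambda>x y. f m n x y))"
    by (intro bilinI linear_tens_sum_inner[OF X Y P _ s] M N f bilin_right[OF g] bilin_left[OF g]; assumption)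
  have b2: "bilin k X Y P (\<lambda>x y. tens_sum P t' (\<lambda>m n. f m n x y))" if "t' \<in> carrier (tensor k M N)" for t'
    by (intro bilinI linear_tens_sum_inner[OF M N P _ that] X Y g bilin_right[OF f] bilin_left[OF f]; assumption)
  show ?thesis
  proof (rule linear_ext_tensor[OF M N P linear_tens_sum'[OF M N P b1] _ _ t])
    show "linear_map k (tensor k M N) P (\<lambda>a. tens_sum P s (\<lambda>x y. tens_sum P a (\<lambda>m n. f m n x y)))"
      by (intro linear_tens_sum_inner[OF X Y P _ s] linear_tens_sum' b2 tensor_module M N P g)
    fix m n assume "m \<in> carrier M" "n \<in> carrier N"
    then show "tens_sum P (tens k M N m n) (\<lambda>m n. tens_sum P s (f m n)) =
      tens_sum P s (\<lambda>x y. tens_sum P (tens k M N m n) (\<lambda>m n. f m n x y))"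
      by (simp add: tens_sum_tens[OF M N P b1] tens_sum_tens[OF M N P g] cong: tens_sum_cong[OF X Y s])
  qed
qed

section \<open>Sweedler notation\<close>

text \<open>
  The fields \<open>mult\<close> and \<open>one\<close> of the records for modules are junk, and records for entwined modules
  extend those for modules; all of this is invisible to tensor products and linear maps.
\<close>

definition same_module :: "('k, 'm, 'x) module_scheme \<Rightarrow> ('k, 'm, 'y) module_scheme \<Rightarrow> bool" where
  "same_module M M' \<longleftrightarrow>
     carrier M = carrier M' \<and> add M = add M' \<and> zero M = zero M' \<and> smult M = smult M'"

lemma tens_eq_same:
  assumes "tens_eq k M N xs ys" "same_module M M'"
  shows "tens_eq k M' N xs ys"
  using assms(1)
proof induction
  case (trans xs ys zs)
  then show ?case by (blast intro: tens_eq.trans)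
qed (use assms(2) in \<open>auto simp: same_module_def intro: tens_eq.intros
    tens_eq.add_left[of _ M', simplified] tens_eq.balanced[of _ _ _ M', simplified]
    tens_eq.zero[of _ _ _ M', simplified]\<close>)

text \<open>Tensor products, sums and linearity depend on a module through its four fields only.
  Rewriting with these equations replaces the record of an entwined module by the underlying tensor
  product.\<close>

lemma same_moduleD:
  assumes "same_module M M'"
  shows same_carrier: "carrier M = carrier M'"
    and same_tensor: "tensor k M N = tensor k M' N"
    and same_tens: "tens k M N = tens k M' N"
    and same_tens_sum: "tens_sum M = tens_sum M'"
    and same_linear_left: "linear_map k M X = linear_map k M' X"
    and same_linear_right: "linear_map k Y M = linear_map k Y M'"
    and same_module_iff: "module k M = module k M'"
proof -
  have s: "same_module M' M" using assms by (simp add: same_module_def)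
  have "tens_eq k M N = tens_eq k M' N"
    by (intro ext) (use tens_eq_same[OF _ assms] tens_eq_same[OF _ s] in blast)
  then have c: "tens_class k M N = tens_class k M' N"
    by (intro ext) (simp add: tens_class_def)
  show "carrier M = carrier M'" using assms by (simp add: same_module_def)
  show "tensor k M N = tensor k M' N" using assms c by (simp add: tensor_def same_module_def)
  show "tens k M N = tens k M' N" using assms c by (intro ext) (simp add: tens_def)
  show "tens_sum M = tens_sum M'"
    using assms by (intro ext) (simp add: tens_sum_def list_sum_def[abs_def] same_module_def)
  show "linear_map k M X = linear_map k M' X" "linear_map k Y M = linear_map k Y M'"
    using assms by (auto simp: linear_map_def same_module_def fun_eq_iff)
  show "module k M = module k M'"
    using assms by (auto simp: same_module_def intro: module_fields_cong)
qed

definition trilin where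
  "trilin k L M N P f \<longleftrightarrow>
     (\<forall>x\<in>carrier L. \<forall>y\<in>carrier M. linear_map k N P (\<lambda>z. f x y z)) \<and>
     (\<forall>x\<in>carrier L. \<forall>z\<in>carrier N. linear_map k M P (\<lambda>y. f x y z)) \<and>
     (\<forall>y\<in>carrier M. \<forall>z\<in>carrier N. linear_map k L P (\<lambda>x. f x y z))"

lemma trilinI [lin]:
  assumes "\<And>x y. \<lbrakk>x \<in> carrier L; y \<in> carrier M\<rbrakk> \<Longrightarrow> linear_map k N P (\<lambda>z. f x y z)"
    and "\<And>x z. \<lbrakk>x \<in> carrier L; z \<in> carrier N\<rbrakk> \<Longrightarrow> linear_map k M P (\<lambda>y. f x y z)"
    and "\<And>y z. \<lbrakk>y \<in> carrier M; z \<in> carrier N\<rbrakk> \<Longrightarrow> linear_map k L P (\<lambda>x. f x y z)"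
  shows "trilin k L M N P f"
  using assms by (simp add: trilin_def)

lemma trilinD:
  assumes "trilin k L M N P f"
  shows trilin_3: "\<And>x y. \<lbrakk>x \<in> carrier L; y \<in> carrier M\<rbrakk> \<Longrightarrow> linear_map k N P (\<lambda>z. f x y z)"
    and trilin_2: "\<And>x z. \<lbrakk>x \<in> carrier L; z \<in> carrier N\<rbrakk> \<Longrightarrow> linear_map k M P (\<lambda>y. f x y z)"
    and trilin_1: "\<And>y z. \<lbrakk>y \<in> carrier M; z \<in> carrier N\<rbrakk> \<Longrightarrow> linear_map k L P (\<lambda>x. f x y z)"
  using assms by (auto simp: trilin_def)

lemma self_module_module [lin]:
  assumes "cring k"
  shows "module k (self_module k)"
proof -
  interpret cring k by fact
  have "abelian_group (self_module k)"
    by (rule abelian_groupI) (auto simp: self_module_def a_ac)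
  then show ?thesis
    by (intro moduleI assms) (auto simp: self_module_def l_distr r_distr m_assoc)
qed

lemma carrier_self_module [simp]: "carrier (self_module k) = carrier k"
  by (simp add: self_module_def)

abbreviation (in entwining_structure) "AC \<equiv> tensor k A C"
abbreviation (in entwining_structure) "Psi c a \<equiv> \<psi> (tens k C A c a)"

section \<open>The coalgebra and entwining axioms for sums of arbitrary multilinear
  functions\<close>

context entwining_structure
begin

sublocale R: ring A by (rule ring)

declare cring [lin] module [lin] C.module [lin]

lemmas [lin] = linear_map_closed[OF C.comult_linear] linear_comp[OF C.comult_linear]
  linear_map_closed[OF psi_linear] linear_comp[OF psi_linear]
  linear_map_closed[OF C.counit_linear, simplified] linear_comp[OF C.counit_linear]

lemma [lin]: "a \<in> carrier A \<Longrightarrow> b \<in> carrier A \<Longrightarrow> a \<otimes>\<^bsub>A\<^esub> b \<in> carrier A" "\<one>\<^bsub>A\<^esub> \<in> carrier A"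
  by simp_all

lemma linear_mult_left [lin]:
  assumes "linear_map k X A f" "a \<in> carrier A"
  shows "linear_map k X A (\<lambda>x. f x \<otimes>\<^bsub>A\<^esub> a)"
  using assms by (auto simp: linear_map_def Pi_iff R.l_distr smult_mult_left)

lemma linear_mult_right [lin]:
  assumes "linear_map k X A f" "a \<in> carrier A"
  shows "linear_map k X A (\<lambda>x. a \<otimes>\<^bsub>A\<^esub> f x)"
  using assms by (auto simp: linear_map_def Pi_iff R.r_distr smult_mult_right)

text \<open>The axiom equates two elements of \<open>(C \<otimes> C) \<otimes> C\<close>; the linear
  map \<open>?h\<close> induced by \<open>f\<close> is applied to both. The remaining axioms are
  turned into rules for sums in the same spirit.\<close>

lemma coassoc_sum:
  assumes P: "module k P" and f: "trilin k C C C P f" and c: "c \<in> carrier C"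
  shows "tens_sum P (comult C c) (\<lambda>c1 c2. tens_sum P (comult C c1) (\<lambda>x y. f x y c2))
    = tens_sum P (comult C c) (\<lambda>c1 c2. tens_sum P (comult C c2) (\<lambda>x y. f c1 x y))"
proof -
  let ?T = "tensor k (tensor k C C) C"
  let ?h = "\<lambda>t. tens_sum P t (\<lambda>u z. tens_sum P u (\<lambda>x y. f x y z))"
  note [lin] = P c trilinD[OF f]
  have h: "linear_map k ?T P ?h" by (assumption | rule lin)+
  have "?h (tens_sum ?T (comult C c) (\<lambda>c1 c2. tens k (tensor k C C) C (comult C c1) c2))
     = tens_sum P (comult C c) (\<lambda>c1 c2. ?h (tens k (tensor k C C) C (comult C c1) c2))"
    by (rule tens_sum_linear[OF _ _ _ _ h]) (assumption | rule lin)+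
  also have "\<dots> = tens_sum P (comult C c) (\<lambda>c1 c2. tens_sum P (comult C c1) (\<lambda>x y. f x y c2))"
    by (rule tens_sum_cong, (assumption | rule lin)+, rule tens_sum_tens, (assumption | rule lin)+)
  finally have 1: "?h (tens_sum ?T (comult C c) (\<lambda>c1 c2. tens k (tensor k C C) C (comult C c1) c2)) = \<dots>" .
  have "?h (tens_sum ?T (comult C c) (\<lambda>c1 c2. tens_sum ?T (comult C c2)
        (\<lambda>c2' c3. tens k (tensor k C C) C (tens k C C c1 c2') c3)))
     = tens_sum P (comult C c) (\<lambda>c1 c2. ?h (tens_sum ?T (comult C c2)
        (\<lambda>c2' c3. tens k (tensor k C C) C (tens k C C c1 c2') c3)))"
    by (rule tens_sum_linear[OF _ _ _ _ h]) (assumption | rule lin)+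
  also have "\<dots> = tens_sum P (comult C c) (\<lambda>c1 c2. tens_sum P (comult C c2) (\<lambda>x y. f c1 x y))"
  proof (rule tens_sum_cong[OF C.module C.module], (assumption | rule lin)+)
    fix c1 c2 assume [lin]: "c1 \<in> carrier C" "c2 \<in> carrier C"
    have "?h (tens_sum ?T (comult C c2) (\<lambda>c2' c3. tens k (tensor k C C) C (tens k C C c1 c2') c3))
      = tens_sum P (comult C c2) (\<lambda>c2' c3. ?h (tens k (tensor k C C) C (tens k C C c1 c2') c3))"
      by (rule tens_sum_linear[OF _ _ _ _ h]) (assumption | rule lin)+
    also have "\<dots> = tens_sum P (comult C c2) (\<lambda>c2' c3. f c1 c2' c3)"
      apply (rule tens_sum_cong[OF C.module C.module], (assumption | rule lin)+)
      apply (subst tens_sum_tens[of k "tensor k C C" C], (assumption | rule lin)+)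
      apply (rule tens_sum_tens, (assumption | rule lin)+)
      done
    finally show "?h (tens_sum ?T (comult C c2) (\<lambda>c2' c3. tens k (tensor k C C) C (tens k C C c1 c2') c3)) = \<dots>" .
  qed
  finally show ?thesis using 1 C.coassoc[OF c] by simp
qed

lemma counit_left_sum:
  assumes P: "module k P" and f: "linear_map k C P f" and c: "c \<in> carrier C"
  shows "tens_sum P (comult C c) (\<lambda>c1 c2. counit C c1 \<odot>\<^bsub>P\<^esub> f c2) = f c"
proof -
  note [lin] = P c linear_map_closed[OF f] linear_comp[OF f]
  have "f (tens_sum C (comult C c) (\<lambda>c1 c2. counit C c1 \<odot>\<^bsub>C\<^esub> c2))
    = tens_sum P (comult C c) (\<lambda>c1 c2. f (counit C c1 \<odot>\<^bsub>C\<^esub> c2))"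
    by (rule tens_sum_linear[OF _ _ _ _ f]) (assumption | rule lin)+
  also have "\<dots> = tens_sum P (comult C c) (\<lambda>c1 c2. counit C c1 \<odot>\<^bsub>P\<^esub> f c2)"
    by (rule tens_sum_cong) (assumption | rule lin linear_map_smult[OF f])+
  finally show ?thesis using C.counit_left[OF c] by simp
qed

lemma counit_right_sum:
  assumes P: "module k P" and f: "linear_map k C P f" and c: "c \<in> carrier C"
  shows "tens_sum P (comult C c) (\<lambda>c1 c2. counit C c2 \<odot>\<^bsub>P\<^esub> f c1) = f c"
proof -
  note [lin] = P c linear_map_closed[OF f] linear_comp[OF f]
  have "f (tens_sum C (comult C c) (\<lambda>c1 c2. counit C c2 \<odot>\<^bsub>C\<^esub> c1))
    = tens_sum P (comult C c) (\<lambda>c1 c2. f (counit C c2 \<odot>\<^bsub>C\<^esub> c1))"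
    by (rule tens_sum_linear[OF _ _ _ _ f]) (assumption | rule lin)+
  also have "\<dots> = tens_sum P (comult C c) (\<lambda>c1 c2. counit C c2 \<odot>\<^bsub>P\<^esub> f c1)"
    by (rule tens_sum_cong) (assumption | rule lin linear_map_smult[OF f])+
  finally show ?thesis using C.counit_right[OF c] by simp
qed

lemma psi_mult_sum:
  assumes P: "module k P" and f: "bilin k A C P f"
    and a: "a \<in> carrier A" and b: "b \<in> carrier A" and c: "c \<in> carrier C"
  shows "tens_sum P (Psi c (a \<otimes>\<^bsub>A\<^esub> b)) f
    = tens_sum P (Psi c a) (\<lambda>a' c'. tens_sum P (Psi c' b) (\<lambda>b' c''. f (a' \<otimes>\<^bsub>A\<^esub> b') c''))"
proof -
  note [lin] = P a b c bilinD[OF f] linear_comp[OF bilin_left[OF f]] linear_comp[OF bilin_right[OF f]]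
  have "tens_sum P (Psi c (a \<otimes>\<^bsub>A\<^esub> b)) f = tens_sum P (Psi c a)
      (\<lambda>a' c'. tens_sum P (tens_sum AC (Psi c' b) (\<lambda>b' c''. tens k A C (a' \<otimes>\<^bsub>A\<^esub> b') c'')) f)"
    unfolding psi_mult[OF a b c]
    by (rule tens_sum_tens_sum) (assumption | rule lin)+
  also have "\<dots> = tens_sum P (Psi c a)
      (\<lambda>a' c'. tens_sum P (Psi c' b) (\<lambda>b' c''. tens_sum P (tens k A C (a' \<otimes>\<^bsub>A\<^esub> b') c'') f))"
    by (rule tens_sum_cong, (assumption | rule lin)+, rule tens_sum_tens_sum, (assumption | rule lin)+)
  also have "\<dots> = tens_sum P (Psi c a) (\<lambda>a' c'. tens_sum P (Psi c' b) (\<lambda>b' c''. f (a' \<otimes>\<^bsub>A\<^esub> b') c''))"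
    by (rule tens_sum_cong, (assumption | rule lin)+, rule tens_sum_cong, (assumption | rule lin)+,
        rule tens_sum_tens, (assumption | rule lin)+)
  finally show ?thesis .
qed

lemma psi_counit_sum:
  assumes P: "module k P" and f: "linear_map k A P f"
    and a: "a \<in> carrier A" and c: "c \<in> carrier C"
  shows "tens_sum P (Psi c a) (\<lambda>a' c'. counit C c' \<odot>\<^bsub>P\<^esub> f a') = counit C c \<odot>\<^bsub>P\<^esub> f a"
proof -
  note [lin] = P a c linear_map_closed[OF f] linear_comp[OF f]
  have "f (tens_sum A (Psi c a) (\<lambda>a' c'. counit C c' \<odot>\<^bsub>A\<^esub> a'))
    = tens_sum P (Psi c a) (\<lambda>a' c'. f (counit C c' \<odot>\<^bsub>A\<^esub> a'))"
    by (rule tens_sum_linear[OF _ _ _ _ f]) (assumption | rule lin)+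
  also have "\<dots> = tens_sum P (Psi c a) (\<lambda>a' c'. counit C c' \<odot>\<^bsub>P\<^esub> f a')"
    by (rule tens_sum_cong) (assumption | rule lin linear_map_smult[OF f])+
  moreover have "f (counit C c \<odot>\<^bsub>A\<^esub> a) = counit C c \<odot>\<^bsub>P\<^esub> f a"
    by (assumption | rule lin linear_map_smult[OF f])+
  ultimately show ?thesis using psi_counit[OF a c] by simp
qed

lemma psi_one_sum:
  assumes P: "module k P" and f: "bilin k A C P f" and c: "c \<in> carrier C"
  shows "tens_sum P (Psi c \<one>\<^bsub>A\<^esub>) f = f \<one>\<^bsub>A\<^esub> c"
  unfolding psi_one[OF c] by (rule tens_sum_tens) (assumption | rule lin P f c)+

lemma psi_comult_sum:
  assumes P: "module k P" and f: "trilin k A C C P f"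
    and a: "a \<in> carrier A" and c: "c \<in> carrier C"
  shows "tens_sum P (Psi c a) (\<lambda>a' c'. tens_sum P (comult C c') (\<lambda>c1 c2. f a' c1 c2))
    = tens_sum P (comult C c) (\<lambda>c1 c2. tens_sum P (Psi c2 a) (\<lambda>a' c2'.
        tens_sum P (Psi c1 a') (\<lambda>a'' c1'. f a'' c1' c2')))"
proof -
  let ?T = "tensor k AC C"
  let ?h = "\<lambda>t. tens_sum P t (\<lambda>u z. tens_sum P u (\<lambda>x y. f x y z))"
  note [lin] = P a c trilinD[OF f]
  have h: "linear_map k ?T P ?h" by (assumption | rule lin)+
  have h_tens: "?h (tens k AC C (tens k A C x y) z) = f x y z"
    if "x \<in> carrier A" "y \<in> carrier C" "z \<in> carrier C" for x y z
    supply [lin] = that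
    apply (subst tens_sum_tens[of k AC C], (assumption | rule lin)+)
    apply (rule tens_sum_tens, (assumption | rule lin)+)
    done
  have "?h (tens_sum ?T (Psi c a) (\<lambda>a' c'. tens_sum ?T (comult C c') (\<lambda>c1 c2. tens k AC C (tens k A C a' c1) c2)))
    = tens_sum P (Psi c a) (\<lambda>a' c'. ?h (tens_sum ?T (comult C c') (\<lambda>c1 c2. tens k AC C (tens k A C a' c1) c2)))"
    by (rule tens_sum_linear[OF _ _ _ _ h]) (assumption | rule lin)+
  also have "\<dots> = tens_sum P (Psi c a) (\<lambda>a' c'. tens_sum P (comult C c') (\<lambda>c1 c2. ?h (tens k AC C (tens k A C a' c1) c2)))"
    by (rule tens_sum_cong, (assumption | rule lin)+, rule tens_sum_linear[OF _ _ _ _ h], (assumption | rule lin)+)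
  also have "\<dots> = tens_sum P (Psi c a) (\<lambda>a' c'. tens_sum P (comult C c') (\<lambda>c1 c2. f a' c1 c2))"
    by (rule tens_sum_cong, (assumption | rule lin)+, rule tens_sum_cong, (assumption | rule lin h_tens)+)
  finally have 1: "?h (tens_sum ?T (Psi c a) (\<lambda>a' c'. tens_sum ?T (comult C c') (\<lambda>c1 c2. tens k AC C (tens k A C a' c1) c2))) = \<dots>" .
  have "?h (tens_sum ?T (comult C c) (\<lambda>c1 c2. tens_sum ?T (Psi c2 a) (\<lambda>a' c2'. tens_sum ?T (Psi c1 a')
        (\<lambda>a'' c1'. tens k AC C (tens k A C a'' c1') c2'))))
    = tens_sum P (comult C c) (\<lambda>c1 c2. ?h (tens_sum ?T (Psi c2 a) (\<lambda>a' c2'. tens_sum ?T (Psi c1 a')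
        (\<lambda>a'' c1'. tens k AC C (tens k A C a'' c1') c2'))))"
    by (rule tens_sum_linear[OF _ _ _ _ h]) (assumption | rule lin)+
  also have "\<dots> = tens_sum P (comult C c) (\<lambda>c1 c2. tens_sum P (Psi c2 a) (\<lambda>a' c2'. ?h (tens_sum ?T (Psi c1 a')
        (\<lambda>a'' c1'. tens k AC C (tens k A C a'' c1') c2'))))"
    by (rule tens_sum_cong, (assumption | rule lin)+, rule tens_sum_linear[OF _ _ _ _ h], (assumption | rule lin)+)
  also have "\<dots> = tens_sum P (comult C c) (\<lambda>c1 c2. tens_sum P (Psi c2 a) (\<lambda>a' c2'. tens_sum P (Psi c1 a')
        (\<lambda>a'' c1'. ?h (tens k AC C (tens k A C a'' c1') c2'))))"
    by (rule tens_sum_cong, (assumption | rule lin)+, rule tens_sum_cong, (assumption | rule lin)+,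
        rule tens_sum_linear[OF _ _ _ _ h], (assumption | rule lin)+)
  also have "\<dots> = tens_sum P (comult C c) (\<lambda>c1 c2. tens_sum P (Psi c2 a) (\<lambda>a' c2'. tens_sum P (Psi c1 a')
        (\<lambda>a'' c1'. f a'' c1' c2')))"
    by (rule tens_sum_cong, (assumption | rule lin)+, rule tens_sum_cong, (assumption | rule lin)+,
        rule tens_sum_cong, (assumption | rule lin h_tens)+)
  finally show ?thesis using 1 psi_comult[OF a c] by simp
qed

end

section \<open>The dual basis\<close>

text \<open>Elements of the dual are extensional, so equality is equality on
  \<open>carrier C\<close>, and linearity does not see the restriction to it. The axioms are then
  those of the base ring, taken pointwise.\<close>

lemma (in cring) dual_module:
  assumes "module R C"
  shows "module R (dual R C)"
proof -
  interpret C: module R C by fact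
  have dualI: "f \<in> carrier (dual R C) \<longleftrightarrow> f \<in> extensional (carrier C) \<and> linear_map R C (self_module R) f" for f
    by (simp add: dual_def)
  have ev: "f c \<in> carrier R" if "f \<in> carrier (dual R C)" "c \<in> carrier C" for f c
    using that linear_map_closed[of R C "self_module R" f c] by (simp add: dualI)
  have lin: "linear_map R C (self_module R) (restrict f (carrier C)) \<longleftrightarrow> linear_map R C (self_module R) f" for f
    by (auto simp: linear_map_def Pi_iff)
  note self = self_module_module[OF is_cring]
  have ops: "f \<oplus>\<^bsub>dual R C\<^esub> g = (\<lambda>c\<in>carrier C. f c \<oplus>\<^bsub>self_module R\<^esub> g c)"
    "r \<odot>\<^bsub>dual R C\<^esub> f = (\<lambda>c\<in>carrier C. r \<odot>\<^bsub>self_module R\<^esub> f c)"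
    "\<zero>\<^bsub>dual R C\<^esub> = (\<lambda>c\<in>carrier C. \<zero>\<^bsub>self_module R\<^esub>)" for f g r
    by (simp_all add: dual_def self_module_def)
  have add: "f \<oplus>\<^bsub>dual R C\<^esub> g \<in> carrier (dual R C)" if "f \<in> carrier (dual R C)" "g \<in> carrier (dual R C)" for f g
    using that linear_add[OF self, of C f g] by (simp add: dualI ops lin)
  have zero: "\<zero>\<^bsub>dual R C\<^esub> \<in> carrier (dual R C)"
    using linear_zero[OF self, of C] by (simp add: dualI ops lin)
  have smult: "r \<odot>\<^bsub>dual R C\<^esub> f \<in> carrier (dual R C)" if "r \<in> carrier R" "f \<in> carrier (dual R C)" for r f
    using that linear_smult_right[OF self, of C f r] by (simp add: dualI ops lin)
  have app: "(f \<oplus>\<^bsub>dual R C\<^esub> g) c = f c \<oplus> g c" "(r \<odot>\<^bsub>dual R C\<^esub> f) c = r \<otimes> f c"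
    "\<zero>\<^bsub>dual R C\<^esub> c = \<zero>" if "c \<in> carrier C" for f g r c
    using that by (simp_all add: dual_def)
  have ext: "f = g" if "f \<in> carrier (dual R C)" "g \<in> carrier (dual R C)" "\<And>c. c \<in> carrier C \<Longrightarrow> f c = g c" for f g
    using that by (auto simp: dualI intro: extensionalityI)
  have "abelian_group (dual R C)"
  proof (rule abelian_groupI)
    fix f assume f: "f \<in> carrier (dual R C)"
    show "\<exists>g\<in>carrier (dual R C). g \<oplus>\<^bsub>dual R C\<^esub> f = \<zero>\<^bsub>dual R C\<^esub>"
      using f smult[of "\<ominus> \<one>" f] ev[OF f] l_minus
      by (intro bexI[of _ "(\<ominus> \<one>) \<odot>\<^bsub>dual R C\<^esub> f"] ext add zero) (auto simp: app l_minus l_neg)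
  qed (auto intro!: ext add zero simp: ev app a_ac)
  then show ?thesis
    by (intro moduleI is_cring smult) (auto intro!: ext add smult simp: ev app l_distr r_distr m_assoc)
qed

locale entwining_dual_basis = entwining_structure k A C \<psi>
  for k :: "('k, 'r) ring_scheme"
    and A :: "('k, 'a, 'x) module_scheme"
    and C :: "('k, 'c, 'y) coalgebra_scheme"
    and \<psi> :: "('a, 'c) entwining" +
  fixes m :: nat and d :: "nat \<Rightarrow> 'c" and d' :: "nat \<Rightarrow> 'c \<Rightarrow> 'k"
  assumes dual_basis: "finite_dual_basis k C m d d'"
begin

abbreviation "D \<equiv> dual k C"
abbreviation "DA \<equiv> tensor k D A"

sublocale K: cring k by (rule cring)

lemma D_module [lin]: "module k D"
  by (rule K.dual_module) (rule C.module)

lemma dual_linear [lin]: "f \<in> carrier D \<Longrightarrow> linear_map k C (self_module k) f"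
  by (simp add: dual_def)

lemma dual_linear' [lin]: "f \<in> carrier D \<Longrightarrow> linear_map k X C g \<Longrightarrow> linear_map k X (self_module k) (\<lambda>x. f (g x))"
  by (rule linear_comp[OF dual_linear])

lemma eval_linear [lin]: "c \<in> carrier C \<Longrightarrow> linear_map k D (self_module k) (\<lambda>f. f c)"
  using linear_map_closed[OF dual_linear, of _ c]
  by (intro linear_mapI) (auto simp: dual_def self_module_def)

lemma eval_closed [lin]: "f \<in> carrier D \<Longrightarrow> c \<in> carrier C \<Longrightarrow> f c \<in> carrier k"
  using linear_map_closed[OF dual_linear, of f c] by simp

lemma dual_ext:
  "\<lbrakk>f \<in> carrier D; g \<in> carrier D; \<And>c. c \<in> carrier C \<Longrightarrow> f c = g c\<rbrakk> \<Longrightarrow> f = g"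
  by (auto simp: dual_def intro: extensionalityI)

lemma dual_smult_apply: "c \<in> carrier C \<Longrightarrow> (r \<odot>\<^bsub>D\<^esub> f) c = r \<otimes>\<^bsub>k\<^esub> f c"
  by (simp add: dual_def)

text \<open>The canonical element \<open>\<Sum>\<^sub>i d\<^sub>i\<^sup>* \<otimes> d\<^sub>i\<close>: sums over the dual basis are instances of \<open>tens_sum\<close>.\<close>

definition coev :: "(('c \<Rightarrow> 'k) \<times> 'c) list set" where
  "coev = tens_class k D C (map (\<lambda>i. (d' i, d i)) [1..<Suc m])"

lemma basis_closed: "i \<in> {1..m} \<Longrightarrow> d i \<in> carrier C" "i \<in> {1..m} \<Longrightarrow> d' i \<in> carrier D"
  using dual_basis by (auto simp: finite_dual_basis_def)

lemma coev_list: "map (\<lambda>i. (d' i, d i)) [1..<Suc m] \<in> lists (carrier D \<times> carrier C)"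
  using basis_closed by (auto simp del: upt_Suc)

lemma coev_closed [lin]: "coev \<in> carrier (tensor k D C)"
  unfolding coev_def by (rule tens_class_closed[OF coev_list])

text \<open>Trades the indexed sums of the given formulas for a sum over \<open>coev\<close>, to
  which the rules for Sweedler sums apply.\<close>

lemma finsum_coev:
  assumes P: "module k P" and f: "bilin k D C P f"
  shows "(\<Oplus>\<^bsub>P\<^esub>i\<in>{1..m}. f (d' i) (d i)) = tens_sum P coev f"
proof -
  interpret P: abelian_group P by (rule module_group[OF P])
  \<comment> \<open>The lower index is generalized because lists and intervals are peeled off at the
    bottom; \<open>l \<ge> 1\<close> keeps the indices inside the dual basis.\<close>
  have "list_sum P f (map (\<lambda>i. (d' i, d i)) [l..<Suc m]) = (\<Oplus>\<^bsub>P\<^esub>i\<in>{l..m}. f (d' i) (d i))"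
    if "l \<ge> 1" for l
    using that
  proof (induction "Suc m - l" arbitrary: l)
    case 0
    then show ?case by simp
  next
    case (Suc n)
    have "{l..m} = insert l {Suc l..m}" using Suc by auto
    moreover have "(\<lambda>i. f (d' i) (d i)) \<in> {l..m} \<rightarrow> carrier P"
      using Suc basis_closed by (auto intro!: bilin_closed[OF f])
    moreover have "[l..<Suc m] = l # [Suc l..<Suc m]"
      using Suc by (subst upt_conv_Cons) auto
    ultimately show ?case
      using Suc(1)[of "Suc l"] Suc(2,3) by (simp del: upt_Suc)
  qed
  from this[of 1] show ?thesis
    unfolding coev_def tens_sum_class[OF P D_module C.module f coev_list] by simp
qed

text \<open>This is how every dual basis below disappears: in a summand that is linear in the basis
  element and weighted by its dual at \<open>c\<close>, the basis element is replaced by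
  \<open>c\<close>.\<close>

lemma coev_sum:
  assumes P: "module k P" and f: "linear_map k C P f" and c: "c \<in> carrier C"
  shows "tens_sum P coev (\<lambda>g x. g c \<odot>\<^bsub>P\<^esub> f x) = f c"
proof -
  note [lin] = P c linear_map_closed[OF f] linear_comp[OF f]
  have "c = (\<Oplus>\<^bsub>C\<^esub>i\<in>{1..m}. d' i c \<odot>\<^bsub>C\<^esub> d i)"
    using dual_basis c by (simp add: finite_dual_basis_def)
  also have "\<dots> = tens_sum C coev (\<lambda>g x. g c \<odot>\<^bsub>C\<^esub> x)"
    by (rule finsum_coev) (assumption | rule lin)+
  finally have "f c = f (tens_sum C coev (\<lambda>g x. g c \<odot>\<^bsub>C\<^esub> x))" by simp
  also have "\<dots> = tens_sum P coev (\<lambda>g x. f (g c \<odot>\<^bsub>C\<^esub> x))"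
    by (rule tens_sum_linear[OF _ _ _ _ f]) (assumption | rule lin)+
  also have "\<dots> = tens_sum P coev (\<lambda>g x. g c \<odot>\<^bsub>P\<^esub> f x)"
    by (rule tens_sum_cong) (assumption | rule lin linear_map_smult[OF f])+
  finally show ?thesis by simp
qed

text \<open>The dual basis property read in the dual: evaluation at \<open>c\<close> turns the claim
  into \<open>coev_sum\<close> for the linear map \<open>f\<close>.\<close>

lemma coev_dual:
  assumes f: "f \<in> carrier D"
  shows "tens_sum D coev (\<lambda>g x. f x \<odot>\<^bsub>D\<^esub> g) = f"
proof (rule dual_ext)
  note [lin] = f
  show "tens_sum D coev (\<lambda>g x. f x \<odot>\<^bsub>D\<^esub> g) \<in> carrier D" by (assumption | rule lin)+
  fix c assume c [lin]: "c \<in> carrier C"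
  have ev: "linear_map k D (self_module k) (\<lambda>g. g c)" by (rule lin)+
  have "tens_sum D coev (\<lambda>g x. f x \<odot>\<^bsub>D\<^esub> g) c = tens_sum (self_module k) coev (\<lambda>g x. (f x \<odot>\<^bsub>D\<^esub> g) c)"
    by (rule tens_sum_linear[OF _ _ _ _ ev]) (assumption | rule lin)+
  also have "\<dots> = tens_sum (self_module k) coev (\<lambda>g x. g c \<odot>\<^bsub>self_module k\<^esub> f x)"
    by (rule tens_sum_cong, (assumption | rule lin)+)
      (simp add: dual_smult_apply self_module_def c f K.m_comm eval_closed)
  also have "\<dots> = f c"
    by (rule coev_sum) (assumption | rule lin)+
  finally show "tens_sum D coev (\<lambda>g x. f x \<odot>\<^bsub>D\<^esub> g) c = f c" .
qed (rule f)

lemma coev_sum_dual: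
  assumes P: "module k P" and h: "linear_map k D P h" and f: "f \<in> carrier D"
  shows "tens_sum P coev (\<lambda>g x. f x \<odot>\<^bsub>P\<^esub> h g) = h f"
proof -
  note [lin] = P f linear_map_closed[OF h] linear_comp[OF h]
  have "h f = h (tens_sum D coev (\<lambda>g x. f x \<odot>\<^bsub>D\<^esub> g))" by (simp add: coev_dual[OF f])
  also have "\<dots> = tens_sum P coev (\<lambda>g x. h (f x \<odot>\<^bsub>D\<^esub> g))"
    by (rule tens_sum_linear[OF _ _ _ _ h]) (assumption | rule lin)+
  also have "\<dots> = tens_sum P coev (\<lambda>g x. f x \<odot>\<^bsub>P\<^esub> h g)"
    by (rule tens_sum_cong) (assumption | rule lin linear_map_smult[OF h])+
  finally show ?thesis by simp
qed

section \<open>The pairing of \<open>C\<close> with \<open>C\<^sup>* \<otimes> A\<close>\<close>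

definition pair :: "'c \<Rightarrow> (('c \<Rightarrow> 'k) \<times> 'a) list set \<Rightarrow> 'a" where
  "pair c t = tens_sum A t (\<lambda>f a. f c \<odot>\<^bsub>A\<^esub> a)"

lemma pair_linear_right [lin]:
  "linear_map k X DA g \<Longrightarrow> c \<in> carrier C \<Longrightarrow> linear_map k X A (\<lambda>x. pair c (g x))"
  unfolding pair_def by (assumption | rule lin)+

lemma pair_linear_left [lin]:
  assumes X: "module k X" and g: "linear_map k X C g" and t: "t \<in> carrier DA"
  shows "linear_map k X A (\<lambda>x. pair (g x) t)"
  unfolding pair_def by (assumption | rule lin X g t linear_map_closed[OF g])+

lemma pair_closed [lin]: "c \<in> carrier C \<Longrightarrow> t \<in> carrier DA \<Longrightarrow> pair c t \<in> carrier A"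
  unfolding pair_def by (assumption | rule lin)+

lemma pair_tens: "\<lbrakk>c \<in> carrier C; f \<in> carrier D; a \<in> carrier A\<rbrakk> \<Longrightarrow> pair c (tens k D A f a) = f c \<odot>\<^bsub>A\<^esub> a"
  unfolding pair_def by (rule tens_sum_tens) (assumption | rule lin)+

text \<open>A tensor is recovered from the values of its pairing on the dual basis; for pure tensors
  this comes from \<open>coev_dual\<close>. Beyond the injectivity in \<open>pair_ext\<close>, the
  formula itself is used later, because it can be tensored with \<open>C\<close>.\<close>

lemma pair_coev:
  assumes t: "t \<in> carrier DA"
  shows "tens_sum DA coev (\<lambda>g x. tens k D A g (pair x t)) = t"
proof (rule linear_ext_tensor[OF D_module module _ _ linear_id _ t])
  show "linear_map k DA DA (\<lambda>t. tens_sum DA coev (\<lambda>g x. tens k D A g (pair x t)))"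
    by (assumption | rule lin)+
  fix f a assume [lin]: "f \<in> carrier D" "a \<in> carrier A"
  have "tens_sum DA coev (\<lambda>g x. tens k D A g (pair x (tens k D A f a)))
    = tens_sum DA coev (\<lambda>g x. f x \<odot>\<^bsub>DA\<^esub> tens k D A g a)"
    apply (rule tens_sum_cong[OF D_module C.module], (assumption | rule lin)+)
    apply (subst pair_tens, (assumption | rule lin)+)
    apply (rule linear_map_smult[OF bilin_right[OF bilin_tens]], (assumption | rule lin)+)
    done
  also have "\<dots> = tens k D A f a"
    by (rule coev_sum_dual) (assumption | rule lin)+
  finally show "tens_sum DA coev (\<lambda>g x. tens k D A g (pair x (tens k D A f a))) = tens k D A f a" .
qed (assumption | rule lin)+

lemma pair_ext:
  assumes "s \<in> carrier DA" "t \<in> carrier DA" "\<And>c. c \<in> carrier C \<Longrightarrow> pair c s = pair c t"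
  shows "s = t"
proof -
  have "s = tens_sum DA coev (\<lambda>g x. tens k D A g (pair x s))" by (simp add: pair_coev assms)
  also have "\<dots> = tens_sum DA coev (\<lambda>g x. tens k D A g (pair x t))"
    by (rule tens_sum_cong, (assumption | rule lin)+) (simp add: assms)
  also have "\<dots> = t" by (simp add: pair_coev assms)
  finally show ?thesis .
qed

end

section \<open>Tensoring a map with a fixed right factor\<close>

definition tmap ::
  "('k, 'r) ring_scheme \<Rightarrow> ('k, 'y, 'b) module_scheme \<Rightarrow> ('k, 'n, 'c) module_scheme
    \<Rightarrow> ('x \<Rightarrow> 'y) \<Rightarrow> ('x \<times> 'n) list set \<Rightarrow> ('y \<times> 'n) list set" where
  "tmap k Y N h t = tens_sum (tensor k Y N) t (\<lambda>x n. tens k Y N (h x) n)"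

lemma tmap_closed [lin]:
  assumes "module k X" "module k Y" "module k N" "t \<in> carrier (tensor k X N)" "linear_map k X Y h"
  shows "tmap k Y N h t \<in> carrier (tensor k Y N)"
  unfolding tmap_def by (assumption | rule lin assms linear_comp[OF assms(5)] linear_map_closed[OF assms(5)])+

lemma tmap_linear [lin]:
  assumes "module k X" "module k Y" "module k N" "linear_map k Z (tensor k X N) T" "linear_map k X Y h"
  shows "linear_map k Z (tensor k Y N) (\<lambda>z. tmap k Y N h (T z))"
  unfolding tmap_def by (assumption | rule lin assms linear_comp[OF assms(5)] linear_map_closed[OF assms(5)])+

lemma tmap_linear_param [lin]:
  assumes "module k X" "module k Y" "module k N" "module k Z" "t \<in> carrier (tensor k X N)"
    and h: "\<And>z. z \<in> carrier Z \<Longrightarrow> linear_map k X Y (h z)"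
    and h': "\<And>x. x \<in> carrier X \<Longrightarrow> linear_map k Z Y (\<lambda>z. h z x)"
  shows "linear_map k Z (tensor k Y N) (\<lambda>z. tmap k Y N (h z) t)"
  unfolding tmap_def
  by (assumption | rule lin assms(1-5) h h' linear_comp[OF h] linear_map_closed[OF h])+

lemma tmap_tens:
  assumes "module k X" "module k Y" "module k N" "linear_map k X Y h" "x \<in> carrier X" "n \<in> carrier N"
  shows "tmap k Y N h (tens k X N x n) = tens k Y N (h x) n"
  unfolding tmap_def
  by (rule tens_sum_tens) (assumption | rule lin assms linear_comp[OF assms(4)] linear_map_closed[OF assms(4)])+

lemma tmap_cong:
  assumes "module k X" "module k N" "t \<in> carrier (tensor k X N)" "\<And>x. x \<in> carrier X \<Longrightarrow> g x = h x"
  shows "tmap k Y N g t = tmap k Y N h t"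
  unfolding tmap_def using assms by (intro tens_sum_cong) auto

lemma tens_sum_tmap:
  assumes X: "module k X" and Y: "module k Y" and N: "module k N" and P: "module k P"
    and t: "t \<in> carrier (tensor k X N)" and h: "linear_map k X Y h" and f: "bilin k Y N P f"
  shows "tens_sum P (tmap k Y N h t) f = tens_sum P t (\<lambda>x n. f (h x) n)"
proof -
  note [lin] = X Y N P t linear_comp[OF h] linear_map_closed[OF h] bilinD[OF f] linear_comp[OF bilin_left[OF f]]
  show ?thesis
    unfolding tmap_def
    apply (subst tens_sum_tens_sum, (assumption | rule lin f)+)
    apply (rule tens_sum_cong[OF X N t], rule tens_sum_tens, (assumption | rule lin)+)
    done
qed

lemma tmap_tmap:
  assumes "module k X" "module k Y" "module k Z" "module k N"
    and "t \<in> carrier (tensor k X N)" and h: "linear_map k X Y h" and g: "linear_map k Y Z g"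
  shows "tmap k Z N g (tmap k Y N h t) = tmap k Z N (\<lambda>x. g (h x)) t"
  unfolding tmap_def[of k Z]
  by (rule tens_sum_tmap) (assumption | rule lin assms linear_comp[OF g] linear_map_closed[OF g])+

lemma tens_sum_id:
  assumes "module k M" "module k N" "t \<in> carrier (tensor k M N)"
  shows "tens_sum (tensor k M N) t (\<lambda>m n. tens k M N m n) = t"
proof (rule linear_ext_tensor[OF _ _ _ _ linear_id _ assms(3)])
  show "tens_sum (tensor k M N) (tens k M N m n) (\<lambda>m n. tens k M N m n) = tens k M N m n"
    if "m \<in> carrier M" "n \<in> carrier N" for m n
    by (rule tens_sum_tens) (assumption | rule lin assms that)+
qed (assumption | rule lin assms)+

lemma tmap_id:
  assumes "module k M" "module k N" "t \<in> carrier (tensor k M N)"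
  shows "tmap k M N (\<lambda>x. x) t = t"
  unfolding tmap_def by (rule tens_sum_id[OF assms])

lemma tmap_tens_sum:
  assumes "module k X" "module k Y" "module k N" "module k M" "module k L"
    and "t \<in> carrier (tensor k M L)" and "linear_map k X Y h" and "bilin k M L (tensor k X N) f"
  shows "tmap k Y N h (tens_sum (tensor k X N) t f) = tens_sum (tensor k Y N) t (\<lambda>a b. tmap k Y N h (f a b))"
  by (rule tens_sum_linear) (assumption | rule lin assms)+

text \<open>\<open>tmap\<close> is linear in the map as well, so a Sweedler sum in the map moves
  outside. This lets the formulas for the pairing be applied inside a coaction.\<close>

lemma tmap_sum_param:
  assumes X: "module k X" and Y: "module k Y" and N: "module k N" and M: "module k M" and L: "module k L"
    and s: "s \<in> carrier (tensor k M L)" and t: "t \<in> carrier (tensor k X N)"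
    and F: "trilin k M L X Y F"
  shows "tmap k Y N (\<lambda>x. tens_sum Y s (\<lambda>a b. F a b x)) t = tens_sum (tensor k Y N) s (\<lambda>a b. tmap k Y N (F a b) t)"
proof -
  note [lin] = X Y N M L s trilinD[OF F]
  show ?thesis
  proof (rule linear_ext_tensor[OF X N _ _ _ _ t])
    fix x n assume [lin]: "x \<in> carrier X" "n \<in> carrier N"
    have "tmap k Y N (\<lambda>x. tens_sum Y s (\<lambda>a b. F a b x)) (tens k X N x n) = tens k Y N (tens_sum Y s (\<lambda>a b. F a b x)) n"
      by (rule tmap_tens) (assumption | rule lin)+
    also have "\<dots> = tens_sum (tensor k Y N) s (\<lambda>a b. tens k Y N (F a b x) n)"
      by (rule tens_sum_linear[of k M L Y "tensor k Y N" "\<lambda>y. tens k Y N y n"]) (assumption | rule lin)+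
    also have "\<dots> = tens_sum (tensor k Y N) s (\<lambda>a b. tmap k Y N (F a b) (tens k X N x n))"
      by (rule tens_sum_cong, (assumption | rule lin)+, rule tmap_tens[symmetric], (assumption | rule lin)+)
    finally show "tmap k Y N (\<lambda>x. tens_sum Y s (\<lambda>a b. F a b x)) (tens k X N x n)
      = tens_sum (tensor k Y N) s (\<lambda>a b. tmap k Y N (F a b) (tens k X N x n))" .
  qed (assumption | rule lin)+
qed

text \<open>The module axioms in the shape of the rules \<open>lin\<close>, to be added locally for
  each module.\<close>

lemma right_module_lin:
  assumes "right_module k A M"
  shows "module k M"
    and "\<And>x a. \<lbrakk>x \<in> carrier M; a \<in> carrier A\<rbrakk> \<Longrightarrow> ract M x a \<in> carrier M"
    and "\<And>X f a. \<lbrakk>linear_map k X M f; a \<in> carrier A\<rbrakk> \<Longrightarrow> linear_map k X M (\<lambda>x. ract M (f x) a)"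
    and "\<And>X f a. \<lbrakk>linear_map k X A f; a \<in> carrier M\<rbrakk> \<Longrightarrow> linear_map k X M (\<lambda>x. ract M a (f x))"
proof -
  interpret right_module k A M by fact
  show "module k M" by (rule module)
  show "\<And>x a. \<lbrakk>x \<in> carrier M; a \<in> carrier A\<rbrakk> \<Longrightarrow> ract M x a \<in> carrier M" by (rule ract_closed)
  show "\<And>X f a. \<lbrakk>linear_map k X M f; a \<in> carrier A\<rbrakk> \<Longrightarrow> linear_map k X M (\<lambda>x. ract M (f x) a)"
    by (auto simp: linear_map_def Pi_iff ract_closed ract_add_left ract_smult_left)
  show "\<And>X f a. \<lbrakk>linear_map k X A f; a \<in> carrier M\<rbrakk> \<Longrightarrow> linear_map k X M (\<lambda>x. ract M a (f x))"
    by (auto simp: linear_map_def Pi_iff ract_closed ract_add_right ract_smult_right)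
qed

lemma right_moduleI:
  assumes "module k M"
    and "\<And>a. a \<in> carrier A \<Longrightarrow> linear_map k M M (\<lambda>x. ract M x a)"
    and "\<And>x. x \<in> carrier M \<Longrightarrow> linear_map k A M (\<lambda>a. ract M x a)"
    and "\<And>m a b. \<lbrakk>m \<in> carrier M; a \<in> carrier A; b \<in> carrier A\<rbrakk>
      \<Longrightarrow> ract M m (a \<otimes>\<^bsub>A\<^esub> b) = ract M (ract M m a) b"
    and "\<And>m. m \<in> carrier M \<Longrightarrow> ract M m \<one>\<^bsub>A\<^esub> = m"
  shows "right_module k A M"
  using assms by (intro right_module.intro) (simp_all add: linear_map_def Pi_iff)

section \<open>The structure maps of \<open>M \<otimes> C\<close>\<close>

context entwining_structure
begin

text \<open>Kept apart from the record \<open>cofree\<close>, as is \<open>cdelta\<close>, because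
  the axioms of an arbitrary entwined module are statements about these two maps as well.\<close>

definition cact :: "('k, 'm, 'a, 'z) rmod_scheme \<Rightarrow> ('m \<times> 'c) list set \<Rightarrow> 'a \<Rightarrow> ('m \<times> 'c) list set" where
  "cact M t a = tens_sum (tensor k M C) t (\<lambda>m c. tens_sum (tensor k M C) (Psi c a)
        (\<lambda>a' c'. tens k M C (ract M m a') c'))"

definition cdelta :: "('k, 'm, 'z) module_scheme \<Rightarrow> ('m \<times> 'c) list set \<Rightarrow> (('m \<times> 'c) list set \<times> 'c) list set" where
  "cdelta M t = tens_sum (tensor k (tensor k M C) C) t (\<lambda>m c. tens_sum (tensor k (tensor k M C) C) (comult C c)
        (\<lambda>c1 c2. tens k (tensor k M C) C (tens k M C m c1) c2))"

lemma cdelta_linear [lin]: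
  "\<lbrakk>module k M; linear_map k X (tensor k M C) f\<rbrakk> \<Longrightarrow> linear_map k X (tensor k (tensor k M C) C) (\<lambda>x. cdelta M (f x))"
  unfolding cdelta_def by (assumption | rule lin)+

lemma cdelta_closed [lin]:
  "\<lbrakk>module k M; t \<in> carrier (tensor k M C)\<rbrakk> \<Longrightarrow> cdelta M t \<in> carrier (tensor k (tensor k M C) C)"
  unfolding cdelta_def by (assumption | rule lin)+

lemma cdelta_tens:
  "\<lbrakk>module k M; x \<in> carrier M; c \<in> carrier C\<rbrakk> \<Longrightarrow> cdelta M (tens k M C x c)
    = tens_sum (tensor k (tensor k M C) C) (comult C c) (\<lambda>c1 c2. tens k (tensor k M C) C (tens k M C x c1) c2)"
  unfolding cdelta_def by (rule tens_sum_tens) (assumption | rule lin)+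

lemma cact_linear [lin]:
  assumes "right_module k A M" "linear_map k X (tensor k M C) f" "a \<in> carrier A"
  shows "linear_map k X (tensor k M C) (\<lambda>x. cact M (f x) a)"
  unfolding cact_def by (assumption | rule lin assms right_module_lin[OF assms(1)])+

lemma cact_linear_right [lin]:
  assumes "right_module k A M" "module k X" "linear_map k X A f" "t \<in> carrier (tensor k M C)"
  shows "linear_map k X (tensor k M C) (\<lambda>x. cact M t (f x))"
  unfolding cact_def by (assumption | rule lin assms right_module_lin[OF assms(1)] linear_map_closed[OF assms(3)])+

lemma cact_closed [lin]:
  assumes "right_module k A M" "t \<in> carrier (tensor k M C)" "a \<in> carrier A"
  shows "cact M t a \<in> carrier (tensor k M C)"
  unfolding cact_def by (assumption | rule lin assms right_module_lin[OF assms(1)])+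

lemma cact_tens:
  assumes "right_module k A M" "x \<in> carrier M" "c \<in> carrier C" "a \<in> carrier A"
  shows "cact M (tens k M C x c) a = tens_sum (tensor k M C) (Psi c a) (\<lambda>a' c'. tens k M C (ract M x a') c')"
  unfolding cact_def by (rule tens_sum_tens) (assumption | rule lin assms right_module_lin[OF assms(1)])+

text \<open>Compatibility of \<open>\<psi>\<close> with products is what makes this action
  associative; \<open>psi_one\<close> gives the unit law.\<close>

lemma cact_mult:
  assumes M: "right_module k A M" and t: "t \<in> carrier (tensor k M C)" and a: "a \<in> carrier A" and b: "b \<in> carrier A"
  shows "cact M t (a \<otimes>\<^bsub>A\<^esub> b) = cact M (cact M t a) b"
proof (rule linear_ext_tensor[OF _ _ _ _ _ _ t])
  note [lin] = M a b right_module_lin[OF M]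
  interpret M: right_module k A M by fact
  fix x c assume [lin]: "x \<in> carrier M" "c \<in> carrier C"
  let ?T = "tensor k M C"
  have "cact M (cact M (tens k M C x c) a) b
    = cact M (tens_sum ?T (Psi c a) (\<lambda>a' c'. tens k M C (ract M x a') c')) b"
    by (subst cact_tens) (assumption | rule lin HOL.refl)+
  also have "\<dots> = tens_sum ?T (Psi c a) (\<lambda>a' c'. cact M (tens k M C (ract M x a') c') b)"
    by (rule tens_sum_linear[where h = "\<lambda>t. cact M t b"]) (assumption | rule lin)+
  also have "\<dots> = tens_sum ?T (Psi c a) (\<lambda>a' c'. tens_sum ?T (Psi c' b) (\<lambda>b' c''. tens k M C (ract M (ract M x a') b') c''))"
    by (rule tens_sum_cong, (assumption | rule lin)+, rule cact_tens, (assumption | rule lin)+)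
  also have "\<dots> = tens_sum ?T (Psi c a) (\<lambda>a' c'. tens_sum ?T (Psi c' b) (\<lambda>b' c''. tens k M C (ract M x (a' \<otimes>\<^bsub>A\<^esub> b')) c''))"
    by (rule tens_sum_cong, (assumption | rule lin)+, rule tens_sum_cong, (assumption | rule lin)+,
        subst M.ract_mult, (assumption | rule lin HOL.refl)+)
  also have "\<dots> = tens_sum ?T (Psi c (a \<otimes>\<^bsub>A\<^esub> b)) (\<lambda>a' c'. tens k M C (ract M x a') c')"
    by (rule psi_mult_sum[symmetric]) (assumption | rule lin)+
  also have "\<dots> = cact M (tens k M C x c) (a \<otimes>\<^bsub>A\<^esub> b)"
    by (rule cact_tens[symmetric]) (assumption | rule lin)+
  finally show "cact M (tens k M C x c) (a \<otimes>\<^bsub>A\<^esub> b) = cact M (cact M (tens k M C x c) a) b" ..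
qed (assumption | rule lin right_module_lin[OF M] M a b)+

lemma cact_one:
  assumes M: "right_module k A M" and t: "t \<in> carrier (tensor k M C)"
  shows "cact M t \<one>\<^bsub>A\<^esub> = t"
proof (rule linear_ext_tensor[OF _ _ _ _ linear_id _ t])
  note [lin] = M right_module_lin[OF M]
  interpret M: right_module k A M by fact
  fix x c assume x [lin]: "x \<in> carrier M" and c [lin]: "c \<in> carrier C"
  have "cact M (tens k M C x c) \<one>\<^bsub>A\<^esub> = tens_sum (tensor k M C) (Psi c \<one>\<^bsub>A\<^esub>) (\<lambda>a' c'. tens k M C (ract M x a') c')"
    by (rule cact_tens) (assumption | rule lin)+
  also have "\<dots> = tens k M C (ract M x \<one>\<^bsub>A\<^esub>) c"
    by (rule psi_one_sum) (assumption | rule lin)+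
  finally show "cact M (tens k M C x c) \<one>\<^bsub>A\<^esub> = tens k M C x c" using M.ract_one[OF x] by simp
qed (assumption | rule lin right_module_lin[OF M] M)+

lemma cdelta_natural:
  assumes M: "module k M" and N: "module k N" and h: "linear_map k M N h" and t: "t \<in> carrier (tensor k M C)"
  shows "cdelta N (tmap k N C h t) = tmap k (tensor k N C) C (tmap k N C h) (cdelta M t)"
proof (rule linear_ext_tensor[OF _ _ _ _ _ _ t])
  note [lin] = M N h linear_map_closed[OF h] linear_comp[OF h]
  let ?T = "tensor k (tensor k N C) C"
  fix x c assume [lin]: "x \<in> carrier M" "c \<in> carrier C"
  have "cdelta N (tmap k N C h (tens k M C x c)) = cdelta N (tens k N C (h x) c)"
    by (subst tmap_tens) (assumption | rule lin HOL.refl)+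
  also have "\<dots> = tens_sum ?T (comult C c) (\<lambda>c1 c2. tens k (tensor k N C) C (tens k N C (h x) c1) c2)"
    by (rule cdelta_tens) (assumption | rule lin)+
  also have "\<dots> = tens_sum ?T (comult C c) (\<lambda>c1 c2. tmap k (tensor k N C) C (tmap k N C h)
      (tens k (tensor k M C) C (tens k M C x c1) c2))"
    apply (rule tens_sum_cong[OF C.module C.module], (assumption | rule lin)+)
    apply (subst tmap_tens[of k "tensor k M C"], (assumption | rule lin)+)
    apply (subst tmap_tens, (assumption | rule lin HOL.refl)+)
    done
  also have "\<dots> = tmap k (tensor k N C) C (tmap k N C h)
      (tens_sum (tensor k (tensor k M C) C) (comult C c) (\<lambda>c1 c2. tens k (tensor k M C) C (tens k M C x c1) c2))"
    by (rule tmap_tens_sum[symmetric]) (assumption | rule lin)+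
  also have "\<dots> = tmap k (tensor k N C) C (tmap k N C h) (cdelta M (tens k M C x c))"
    by (subst cdelta_tens) (assumption | rule lin HOL.refl)+
  finally show "cdelta N (tmap k N C h (tens k M C x c))
    = tmap k (tensor k N C) C (tmap k N C h) (cdelta M (tens k M C x c))" .
qed (assumption | rule lin M N h)+

text \<open>An important instance of \<open>h\<close> is \<open>ract X x\<close>, from the regular
  module to \<open>X\<close>: it carries facts about \<open>A \<otimes> C\<close> over to
  \<open>X \<otimes> C\<close>.\<close>

lemma cact_natural:
  assumes M: "right_module k A M" and N: "right_module k A N" and h: "linear_map k M N h"
    and hA: "\<And>x a. \<lbrakk>x \<in> carrier M; a \<in> carrier A\<rbrakk> \<Longrightarrow> h (ract M x a) = ract N (h x) a"
    and t: "t \<in> carrier (tensor k M C)" and a: "a \<in> carrier A"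
  shows "tmap k N C h (cact M t a) = cact N (tmap k N C h t) a"
proof (rule linear_ext_tensor[OF _ _ _ _ _ _ t])
  note [lin] = M N a right_module_lin[OF M] right_module_lin[OF N] h linear_map_closed[OF h] linear_comp[OF h]
  let ?T = "tensor k N C"
  fix x c assume [lin]: "x \<in> carrier M" "c \<in> carrier C"
  have "tmap k N C h (cact M (tens k M C x c) a)
    = tmap k N C h (tens_sum (tensor k M C) (Psi c a) (\<lambda>a' c'. tens k M C (ract M x a') c'))"
    by (subst cact_tens) (assumption | rule lin HOL.refl)+
  also have "\<dots> = tens_sum ?T (Psi c a) (\<lambda>a' c'. tmap k N C h (tens k M C (ract M x a') c'))"
    by (rule tmap_tens_sum) (assumption | rule lin)+
  also have "\<dots> = tens_sum ?T (Psi c a) (\<lambda>a' c'. tens k N C (ract N (h x) a') c')"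
    apply (rule tens_sum_cong[of k A C], (assumption | rule lin)+)
    apply (subst tmap_tens, (assumption | rule lin)+)
    apply (subst hA, (assumption | rule lin HOL.refl)+)
    done
  also have "\<dots> = cact N (tens k N C (h x) c) a"
    by (rule cact_tens[symmetric]) (assumption | rule lin)+
  also have "\<dots> = cact N (tmap k N C h (tens k M C x c)) a"
    by (subst tmap_tens) (assumption | rule lin HOL.refl)+
  finally show "tmap k N C h (cact M (tens k M C x c) a) = cact N (tmap k N C h (tens k M C x c)) a" .
qed (assumption | rule lin right_module_lin[OF M] right_module_lin[OF N] M N h a)+

end

section \<open>Cofree entwined modules\<close>

lemma same_tmap: "same_module M M' \<Longrightarrow> tmap k M N = tmap k M' N"
  by (intro ext) (simp add: tmap_def same_moduleD)

lemma right_module_cong: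
  assumes "same_module M M'" "ract M = ract M'"
  shows "right_module k A M = right_module k A M'"
  using same_module_iff[OF assms(1), of k] assms
  by (simp add: right_module_def same_module_def)

context entwining_structure
begin

text \<open>The coaction of an entwined module is a morphism to the cofree entwined module over it.\<close>

lemma entwined_module_iff:
  "entwined_module k A C \<psi> M \<longleftrightarrow> right_module k A M \<and> linear_map k M (tensor k M C) (coact M) \<and>
     (\<forall>m\<in>carrier M. tmap k (tensor k M C) C (coact M) (coact M m) = cdelta M (coact M m)) \<and>
     (\<forall>m\<in>carrier M. tens_sum M (coact M m) (\<lambda>m0 m1. counit C m1 \<odot>\<^bsub>M\<^esub> m0) = m) \<and>
     (\<forall>m\<in>carrier M. \<forall>a\<in>carrier A. coact M (ract M m a) = cact M (coact M m) a)"
  unfolding entwined_module_def entwined_module_axioms_def tmap_def cdelta_def cact_def by blast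

lemma same_cdelta: "same_module M M' \<Longrightarrow> cdelta M = cdelta M'"
  by (intro ext) (simp add: cdelta_def same_moduleD)

lemma same_cact: "same_module M M' \<Longrightarrow> ract M = ract M' \<Longrightarrow> cact M = cact M'"
  by (intro ext) (simp add: cact_def same_moduleD)

lemma entwined_module_cong:
  assumes s: "same_module M M'" and r: "ract M = ract M'" and c: "coact M = coact M'"
  shows "entwined_module k A C \<psi> M = entwined_module k A C \<psi> M'"
  unfolding entwined_module_iff right_module_cong[OF s r] same_moduleD[OF s] same_cdelta[OF s] same_tmap[OF s] same_cact[OF s r] c r
  using s by (simp add: same_module_def)

lemma cofree_simps:
  "same_module (cofree k A C \<psi> M) (tensor k M C)"
  "carrier (cofree k A C \<psi> M) = carrier (tensor k M C)"
  "ract (cofree k A C \<psi> M) = cact M"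
  "coact (cofree k A C \<psi> M) = cdelta M"
  by (auto simp: same_module_def cofree_def Let_def cact_def[abs_def] cdelta_def[abs_def])

lemma cofree_right_module:
  assumes "right_module k A M"
  shows "right_module k A (cofree k A C \<psi> M)"
proof (rule right_moduleI)
  note [lin] = assms right_module_lin[OF assms]
  note simps = cofree_simps same_moduleD[OF cofree_simps(1)]
  show "module k (cofree k A C \<psi> M)" unfolding simps by (assumption | rule lin)+
  show "linear_map k (cofree k A C \<psi> M) (cofree k A C \<psi> M) (\<lambda>x. ract (cofree k A C \<psi> M) x a)"
    if [lin]: "a \<in> carrier A" for a unfolding simps by (assumption | rule lin)+
  show "linear_map k A (cofree k A C \<psi> M) (ract (cofree k A C \<psi> M) x)"
    if "x \<in> carrier (cofree k A C \<psi> M)" for x using that unfolding simps by - (assumption | rule lin)+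
qed (simp_all add: cofree_simps cact_mult[OF assms] cact_one[OF assms])

lemma cdelta_coassoc:
  assumes M: "module k M" and t: "t \<in> carrier (tensor k M C)"
  shows "tmap k (tensor k (tensor k M C) C) C (cdelta M) (cdelta M t) = cdelta (tensor k M C) (cdelta M t)"
proof (rule linear_ext_tensor[OF _ _ _ _ _ _ t])
  note [lin] = M
  let ?T = "tensor k M C"
  let ?TT = "tensor k ?T C"
  let ?TTT = "tensor k ?TT C"
  fix x c assume [lin]: "x \<in> carrier M" "c \<in> carrier C"
  have "tmap k ?TT C (cdelta M) (cdelta M (tens k M C x c))
    = tmap k ?TT C (cdelta M) (tens_sum ?TT (comult C c) (\<lambda>c1 c2. tens k ?T C (tens k M C x c1) c2))"
    by (subst cdelta_tens) (assumption | rule lin HOL.refl)+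
  also have "\<dots> = tens_sum ?TTT (comult C c) (\<lambda>c1 c2. tmap k ?TT C (cdelta M) (tens k ?T C (tens k M C x c1) c2))"
    by (rule tmap_tens_sum) (assumption | rule lin)+
  also have "\<dots> = tens_sum ?TTT (comult C c) (\<lambda>c1 c2. tens_sum ?TTT (comult C c1)
      (\<lambda>y z. tens k ?TT C (tens k ?T C (tens k M C x y) z) c2))"
    apply (rule tens_sum_cong[OF C.module C.module], (assumption | rule lin)+)
    apply (subst tmap_tens[of k ?T], (assumption | rule lin)+)
    apply (subst cdelta_tens, (assumption | rule lin)+)
    apply (rule tens_sum_linear[where h = "\<lambda>u. tens k ?TT C u n" for n], (assumption | rule lin)+)
    done
  also have "\<dots> = tens_sum ?TTT (comult C c) (\<lambda>c1 c2. tens_sum ?TTT (comult C c2)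
      (\<lambda>y z. tens k ?TT C (tens k ?T C (tens k M C x c1) y) z))"
    by (rule coassoc_sum[where f = "\<lambda>c1 c2 c3. tens k ?TT C (tens k ?T C (tens k M C x c1) c2) c3"])
      (assumption | rule lin)+
  also have "\<dots> = tens_sum ?TTT (comult C c) (\<lambda>c1 c2. cdelta ?T (tens k ?T C (tens k M C x c1) c2))"
    by (rule tens_sum_cong, (assumption | rule lin)+, rule cdelta_tens[symmetric], (assumption | rule lin)+)
  also have "\<dots> = cdelta ?T (tens_sum ?TT (comult C c) (\<lambda>c1 c2. tens k ?T C (tens k M C x c1) c2))"
    by (rule tens_sum_linear[where h = "cdelta ?T", symmetric]) (assumption | rule lin)+
  also have "\<dots> = cdelta ?T (cdelta M (tens k M C x c))"
    by (subst cdelta_tens[OF M]) (assumption | rule lin HOL.refl)+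
  finally show "tmap k ?TT C (cdelta M) (cdelta M (tens k M C x c)) = cdelta ?T (cdelta M (tens k M C x c))" .
qed (assumption | rule lin M)+

lemma cdelta_counit:
  assumes M: "module k M" and t: "t \<in> carrier (tensor k M C)"
  shows "tens_sum (tensor k M C) (cdelta M t) (\<lambda>t0 c. counit C c \<odot>\<^bsub>tensor k M C\<^esub> t0) = t"
proof (rule linear_ext_tensor[OF _ _ _ _ linear_id _ t])
  note [lin] = M
  let ?T = "tensor k M C"
  let ?h = "\<lambda>u. tens_sum ?T u (\<lambda>t0 c. counit C c \<odot>\<^bsub>?T\<^esub> t0)"
  show h: "linear_map k (tensor k M C) ?T (\<lambda>t. ?h (cdelta M t))" by (assumption | rule lin)+
  fix x c assume [lin]: "x \<in> carrier M" "c \<in> carrier C"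
  have "?h (cdelta M (tens k M C x c))
    = ?h (tens_sum (tensor k ?T C) (comult C c) (\<lambda>c1 c2. tens k ?T C (tens k M C x c1) c2))"
    by (subst cdelta_tens) (assumption | rule lin HOL.refl)+
  also have "\<dots> = tens_sum ?T (comult C c) (\<lambda>c1 c2. ?h (tens k ?T C (tens k M C x c1) c2))"
    by (rule tens_sum_linear[where h = ?h]) (assumption | rule lin)+
  also have "\<dots> = tens_sum ?T (comult C c) (\<lambda>c1 c2. counit C c2 \<odot>\<^bsub>?T\<^esub> tens k M C x c1)"
    by (rule tens_sum_cong, (assumption | rule lin)+, rule tens_sum_tens, (assumption | rule lin)+)
  also have "\<dots> = tens k M C x c"
    by (rule counit_right_sum) (assumption | rule lin)+
  finally show "?h (cdelta M (tens k M C x c)) = tens k M C x c" .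
qed (assumption | rule lin M)+

text \<open>This is where \<open>psi_comult\<close> enters. The action on the right is the one on
  \<open>(M \<otimes> C) \<otimes> C\<close>, with \<open>M \<otimes> C\<close> itself carrying the
  twisted action; expanding it twice produces the nested \<open>\<psi>\<close> of that
  axiom.\<close>

lemma cdelta_cact:
  assumes M: "right_module k A M" and t: "t \<in> carrier (tensor k M C)" and a: "a \<in> carrier A"
  shows "cdelta M (cact M t a) = cact (cofree k A C \<psi> M) (cdelta M t) a"
proof (rule linear_ext_tensor[OF _ _ _ _ _ _ t])
  note N = cofree_right_module[OF M]
  let ?T = "tensor k M C"
  let ?TT = "tensor k ?T C"
  note [lin] = M right_module_lin[OF M] a
  note simps = cofree_simps(3) same_moduleD[OF cofree_simps(1)]
  show lin_cact: "linear_map k ?T ?TT (\<lambda>t. cact (cofree k A C \<psi> M) (cdelta M t) a)"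
    by (rule cact_linear[OF N, unfolded simps]) (assumption | rule lin)+
  have cact': "linear_map k ?TT ?TT (\<lambda>t. cact (cofree k A C \<psi> M) t a)"
    by (rule cact_linear[OF N, unfolded simps]) (assumption | rule lin)+
  fix x c assume [lin]: "x \<in> carrier M" "c \<in> carrier C"
  have "cdelta M (cact M (tens k M C x c) a) = cdelta M (tens_sum ?T (Psi c a) (\<lambda>a' c'. tens k M C (ract M x a') c'))"
    by (subst cact_tens) (assumption | rule lin HOL.refl)+
  also have "\<dots> = tens_sum ?TT (Psi c a) (\<lambda>a' c'. cdelta M (tens k M C (ract M x a') c'))"
    by (rule tens_sum_linear[where h = "cdelta M"]) (assumption | rule lin)+
  also have "\<dots> = tens_sum ?TT (Psi c a) (\<lambda>a' c'. tens_sum ?TT (comult C c') (\<lambda>c1 c2. tens k ?T C (tens k M C (ract M x a') c1) c2))"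
    by (rule tens_sum_cong, (assumption | rule lin)+, rule cdelta_tens, (assumption | rule lin)+)
  also have "\<dots> = tens_sum ?TT (comult C c) (\<lambda>c1 c2. tens_sum ?TT (Psi c2 a) (\<lambda>a' c2'.
        tens_sum ?TT (Psi c1 a') (\<lambda>a'' c1'. tens k ?T C (tens k M C (ract M x a'') c1') c2')))"
    by (rule psi_comult_sum[where f = "\<lambda>a c1 c2. tens k ?T C (tens k M C (ract M x a) c1) c2"]) (assumption | rule lin)+
  also have "\<dots> = tens_sum ?TT (comult C c) (\<lambda>c1 c2. tens_sum ?TT (Psi c2 a) (\<lambda>a' c2'.
        tens k ?T C (cact M (tens k M C x c1) a') c2'))"
    apply (rule tens_sum_cong[OF C.module C.module], (assumption | rule lin)+)
    apply (rule tens_sum_cong[OF module C.module], (assumption | rule lin)+)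
    apply (subst cact_tens, (assumption | rule lin)+)
    apply (rule tens_sum_linear[where h = "\<lambda>u. tens k ?T C u n" for n, symmetric], (assumption | rule lin)+)
    done
  also have "\<dots> = tens_sum ?TT (comult C c) (\<lambda>c1 c2. cact (cofree k A C \<psi> M) (tens k ?T C (tens k M C x c1) c2) a)"
    by (rule tens_sum_cong, (assumption | rule lin)+,
        rule cact_tens[OF N, unfolded simps, symmetric], (assumption | rule lin)+)
  also have "\<dots> = cact (cofree k A C \<psi> M) (tens_sum ?TT (comult C c) (\<lambda>c1 c2. tens k ?T C (tens k M C x c1) c2)) a"
    by (rule tens_sum_linear[where h = "\<lambda>t. cact (cofree k A C \<psi> M) t a", symmetric, OF _ _ _ _ cact']) (assumption | rule lin)+
  also have "\<dots> = cact (cofree k A C \<psi> M) (cdelta M (tens k M C x c)) a"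
    by (subst cdelta_tens) (assumption | rule lin HOL.refl)+
  finally show "cdelta M (cact M (tens k M C x c) a) = cact (cofree k A C \<psi> M) (cdelta M (tens k M C x c)) a" .
qed (assumption | rule lin M right_module_lin[OF M] a)+

lemma cofree_entwined:
  assumes "right_module k A M"
  shows "entwined_module k A C \<psi> (cofree k A C \<psi> M)"
proof -
  note M = right_module_lin(1)[OF assms]
  note s = cofree_simps(1)[of M]
  show ?thesis
    unfolding entwined_module_iff cofree_simps same_moduleD[OF s] same_cdelta[OF s] same_tmap[OF s]
    using cofree_right_module[OF assms] cdelta_coassoc[OF M] cdelta_counit[OF M] cdelta_cact[OF assms] s
    by (auto simp: same_module_def intro: lin M)
qed

text \<open>\<open>A\<close> has no field \<open>ract\<close>; as a module over itself it becomes a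
  record from which \<open>cofree\<close> builds \<open>A \<otimes> C\<close>.\<close>

definition regular :: "('k, 'a, 'a) rmod" where
  "regular = \<lparr>carrier = carrier A, mult = undefined, one = undefined, zero = \<zero>\<^bsub>A\<^esub>, add = add A,
     smult = smult A, ract = mult A\<rparr>"

lemma regular_simps: "same_module regular A" "ract regular = mult A"
  by (auto simp: regular_def same_module_def)

lemma regular_right_module: "right_module k A regular"
proof (rule right_moduleI)
  note simps = regular_simps same_moduleD[OF regular_simps(1)]
  show "module k regular" unfolding simps by (rule module)
  show "linear_map k regular regular (\<lambda>x. ract regular x a)" if [lin]: "a \<in> carrier A" for a
    unfolding simps by (assumption | rule lin)+
  show "linear_map k A regular (ract regular x)" if "x \<in> carrier regular" for x
    using that unfolding simps by - (assumption | rule lin)+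
qed (use regular_simps in \<open>auto simp: same_module_def R.m_assoc\<close>)

section \<open>\<open>A \<otimes> C\<close> as an entwined module with a left action\<close>

lemma AC_simps:
  "same_module (A_tensor_C k A C \<psi>) AC"
  "carrier (A_tensor_C k A C \<psi>) = carrier AC"
  "ract (A_tensor_C k A C \<psi>) = cact regular"
  "coact (A_tensor_C k A C \<psi>) = cdelta A"
  "lact (A_tensor_C k A C \<psi>) b = tmap k A C (\<lambda>a. b \<otimes>\<^bsub>A\<^esub> a)"
  by (auto simp: same_moduleD[OF regular_simps(1)] same_module_def A_tensor_C_def Let_def cact_def[abs_def] cdelta_def[abs_def]
      tmap_def[abs_def] regular_simps)

lemma A_tensor_C_entwined: "entwined_module k A C \<psi> (A_tensor_C k A C \<psi>)"
proof -
  have "same_module (A_tensor_C k A C \<psi>) (cofree k A C \<psi> regular)"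
    using AC_simps(1) cofree_simps(1)[of regular] same_tensor[OF regular_simps(1), of k C]
    by (simp add: same_module_def)
  from entwined_module_cong[OF this] show ?thesis
    using cofree_entwined[OF regular_right_module]
    by (simp add: AC_simps cofree_simps same_cdelta[OF regular_simps(1)])
qed

text \<open>Left multiplication by \<open>a\<close> is right linear on \<open>A\<close>, so
  naturality of \<open>cact\<close> and \<open>cdelta\<close> gives the compatibility of the left
  action with the right action and the coaction.\<close>

lemma A_tensor_C_bi_entwined: "bi_entwined_module k A C \<psi> (A_tensor_C k A C \<psi>)"
proof -
  let ?N = "A_tensor_C k A C \<psi>"
  note s = AC_simps(1)
  note sm = same_moduleD[OF s]
  have sf: "add ?N = add AC" "zero ?N = zero AC" "smult ?N = smult AC" using s by (auto simp: same_module_def)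
  have l2: "linear_map k AC AC (tmap k A C (\<lambda>x. a \<otimes>\<^bsub>A\<^esub> x))" if [lin]: "a \<in> carrier A" for a
    by (assumption | rule lin)+
  have l1: "linear_map k A AC (\<lambda>a. tmap k A C (\<lambda>x. a \<otimes>\<^bsub>A\<^esub> x) t)" if [lin]: "t \<in> carrier AC" for t
    by (assumption | rule lin)+
  show ?thesis
  proof (rule bi_entwined_module.intro[OF A_tensor_C_entwined], unfold_locales, unfold AC_simps sf sm)
    fix a assume a [lin]: "a \<in> carrier A"
    fix t assume t [lin]: "t \<in> carrier AC"
    show "tmap k A C (\<lambda>x. a \<otimes>\<^bsub>A\<^esub> x) t \<in> carrier AC" by (assumption | rule lin)+
    show "tmap k A C (\<lambda>x. a \<otimes>\<^bsub>A\<^esub> x) (t \<oplus>\<^bsub>AC\<^esub> u)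
      = tmap k A C (\<lambda>x. a \<otimes>\<^bsub>A\<^esub> x) t \<oplus>\<^bsub>AC\<^esub> tmap k A C (\<lambda>x. a \<otimes>\<^bsub>A\<^esub> x) u" if "u \<in> carrier AC" for u
      using that by (intro linear_map_add[OF l2] a t)
    show "tmap k A C ((\<otimes>\<^bsub>A\<^esub>) (a \<oplus>\<^bsub>A\<^esub> b)) t
      = tmap k A C (\<lambda>x. a \<otimes>\<^bsub>A\<^esub> x) t \<oplus>\<^bsub>AC\<^esub> tmap k A C (\<lambda>x. b \<otimes>\<^bsub>A\<^esub> x) t" if "b \<in> carrier A" for b
      using that by (intro linear_map_add[OF l1] a t)
    show "tmap k A C ((\<otimes>\<^bsub>A\<^esub>) a) (r \<odot>\<^bsub>AC\<^esub> t) = r \<odot>\<^bsub>AC\<^esub> tmap k A C ((\<otimes>\<^bsub>A\<^esub>) a) t" if "r \<in> carrier k" for r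
      using that by (intro linear_map_smult[OF l2] a t)
    show "tmap k A C ((\<otimes>\<^bsub>A\<^esub>) (r \<odot>\<^bsub>A\<^esub> a)) t = r \<odot>\<^bsub>AC\<^esub> tmap k A C ((\<otimes>\<^bsub>A\<^esub>) a) t" if "r \<in> carrier k" for r
      using that by (intro linear_map_smult[OF l1] a t)
    show "tmap k A C ((\<otimes>\<^bsub>A\<^esub>) (a \<otimes>\<^bsub>A\<^esub> b)) t = tmap k A C ((\<otimes>\<^bsub>A\<^esub>) a) (tmap k A C ((\<otimes>\<^bsub>A\<^esub>) b) t)"
      if b [lin]: "b \<in> carrier A" for b
      apply (subst tmap_tmap[of k A A A], (assumption | rule lin)+)
      apply (rule tmap_cong[OF module C.module t], simp add: R.m_assoc a b)
      done
    show "tmap k A C ((\<otimes>\<^bsub>A\<^esub>) a) (cact regular t b) = cact regular (tmap k A C ((\<otimes>\<^bsub>A\<^esub>) a) t) b"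
      if b [lin]: "b \<in> carrier A" for b
    proof -
      have "linear_map k A A ((\<otimes>\<^bsub>A\<^esub>) a)" by (assumption | rule lin)+
      from cact_natural[OF regular_right_module regular_right_module, unfolded same_moduleD[OF regular_simps(1)] regular_simps same_tmap[OF regular_simps(1)], OF this _ t b]
      show ?thesis using a by (simp add: R.m_assoc)
    qed
    show "cdelta A (tmap k A C ((\<otimes>\<^bsub>A\<^esub>) a) t) =
       tens_sum (tensor k AC C) (cdelta A t) (\<lambda>m0 m1. tens k AC C (tmap k A C ((\<otimes>\<^bsub>A\<^esub>) a) m0) m1)"
      unfolding tmap_def[of k AC, symmetric]
      by (rule cdelta_natural) (assumption | rule lin)+
  next
    fix t assume t: "t \<in> carrier AC"
    show "tmap k A C ((\<otimes>\<^bsub>A\<^esub>) \<one>\<^bsub>A\<^esub>) t = t"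
      using tmap_cong[OF module C.module t, of "(\<otimes>\<^bsub>A\<^esub>) \<one>\<^bsub>A\<^esub>" "\<lambda>x. x" A] tmap_id[OF module C.module t] by simp
  qed
qed

end

section \<open>The entwined module \<open>C\<^sup>* \<otimes> A\<close>\<close>

context entwining_dual_basis
begin

abbreviation "DAC \<equiv> tensor k DA C"
abbreviation "N \<equiv> dual_tensor_A k A C \<psi> m d d'"

text \<open>Writes the product of \<open>k\<close> as the scalar action on
  \<open>self_module k\<close>, so that the linearity rules for modules apply to the
  convolution.\<close>

lemma conv_apply: "c \<in> carrier C \<Longrightarrow> (f \<otimes>\<^bsub>D\<^esub> g) c
    = tens_sum (self_module k) (comult C c) (\<lambda>c1 c2. f c1 \<odot>\<^bsub>self_module k\<^esub> g c2)"
  by (simp add: dual_def tens_sum_def list_sum_def[abs_def] self_module_def)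

lemma dualI: "\<lbrakk>linear_map k C (self_module k) f; f \<in> extensional (carrier C)\<rbrakk> \<Longrightarrow> f \<in> carrier D"
  by (simp add: dual_def)

lemma linear_map_cong:
  assumes "module k M" "linear_map k M P f" "\<And>x. x \<in> carrier M \<Longrightarrow> f x = g x"
  shows "linear_map k M P g"
  using assms by (auto simp: linear_map_def Pi_iff moduleD)

lemma eval_closed' [lin]: "f \<in> carrier D \<Longrightarrow> c \<in> carrier C \<Longrightarrow> f c \<in> carrier (self_module k)"
  using eval_closed by simp

lemma conv_closed [lin]:
  assumes [lin]: "f \<in> carrier D" "g \<in> carrier D"
  shows "f \<otimes>\<^bsub>D\<^esub> g \<in> carrier D"
proof (rule dualI)
  have "linear_map k C (self_module k) (\<lambda>c. tens_sum (self_module k) (comult C c) (\<lambda>c1 c2. f c1 \<odot>\<^bsub>self_module k\<^esub> g c2))"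
    by (assumption | rule lin)+
  then show "linear_map k C (self_module k) (f \<otimes>\<^bsub>D\<^esub> g)"
    by (rule linear_map_cong[OF C.module]) (simp add: conv_apply)
qed (simp add: dual_def)

text \<open>Equality in the dual is pointwise, so linearity of a map into it can be checked after
  every evaluation.\<close>

lemma dual_linearI:
  assumes X: "module k X" and "\<And>x. x \<in> carrier X \<Longrightarrow> F x \<in> carrier D"
    and "\<And>c. c \<in> carrier C \<Longrightarrow> linear_map k X (self_module k) (\<lambda>x. F x c)"
  shows "linear_map k X D F"
proof (rule linear_mapI)
  note D = moduleD[OF D_module]
  fix x y assume "x \<in> carrier X" "y \<in> carrier X"
  then show "F (x \<oplus>\<^bsub>X\<^esub> y) = F x \<oplus>\<^bsub>D\<^esub> F y"
    using linear_map_add[OF assms(3)] assms(2)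
    by (intro dual_ext) (simp_all add: moduleD[OF X] D, simp add: dual_def self_module_def)
next
  fix r x assume "r \<in> carrier k" "x \<in> carrier X"
  then show "F (r \<odot>\<^bsub>X\<^esub> x) = r \<odot>\<^bsub>D\<^esub> F x"
    using linear_map_smult[OF assms(3)] assms(2)
    by (intro dual_ext) (simp_all add: moduleD[OF X] moduleD[OF D_module], simp add: dual_def self_module_def)
qed (rule assms(2))

lemma conv_linear_left [lin]:
  assumes X: "module k X" and F: "linear_map k X D F" and [lin]: "g \<in> carrier D"
  shows "linear_map k X D (\<lambda>x. F x \<otimes>\<^bsub>D\<^esub> g)"
proof (rule dual_linearI[OF X])
  note [lin] = X linear_map_closed[OF F] linear_comp[OF eval_linear F]
  show "F x \<otimes>\<^bsub>D\<^esub> g \<in> carrier D" if "x \<in> carrier X" for x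
    using that by - (assumption | rule lin)+
  fix c assume [lin]: "c \<in> carrier C"
  have "linear_map k X (self_module k) (\<lambda>x. tens_sum (self_module k) (comult C c) (\<lambda>c1 c2. F x c1 \<odot>\<^bsub>self_module k\<^esub> g c2))"
    by (assumption | rule lin dual_linear[OF linear_map_closed[OF F]])+
  then show "linear_map k X (self_module k) (\<lambda>x. (F x \<otimes>\<^bsub>D\<^esub> g) c)"
    by (rule linear_map_cong[OF X]) (simp add: conv_apply \<open>c \<in> carrier C\<close>)
qed

lemma conv_linear_right [lin]:
  assumes X: "module k X" and F: "linear_map k X D F" and [lin]: "g \<in> carrier D"
  shows "linear_map k X D (\<lambda>x. g \<otimes>\<^bsub>D\<^esub> F x)"
proof (rule dual_linearI[OF X])
  note [lin] = X linear_map_closed[OF F] linear_comp[OF eval_linear F]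
  show "g \<otimes>\<^bsub>D\<^esub> F x \<in> carrier D" if "x \<in> carrier X" for x
    using that by - (assumption | rule lin)+
  fix c assume [lin]: "c \<in> carrier C"
  have "linear_map k X (self_module k) (\<lambda>x. tens_sum (self_module k) (comult C c) (\<lambda>c1 c2. g c1 \<odot>\<^bsub>self_module k\<^esub> F x c2))"
    by (assumption | rule lin dual_linear[OF linear_map_closed[OF F]])+
  then show "linear_map k X (self_module k) (\<lambda>x. (g \<otimes>\<^bsub>D\<^esub> F x) c)"
    by (rule linear_map_cong[OF X]) (simp add: conv_apply \<open>c \<in> carrier C\<close>)
qed

section \<open>The structure maps of \<open>C\<^sup>* \<otimes> A\<close> and their effect on the
  pairing\<close>

definition dract where "dract t b = tens_sum DA t (\<lambda>f a. tens k D A f (a \<otimes>\<^bsub>A\<^esub> b))"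

text \<open>The sums over the dual basis in the record are here sums over \<open>coev\<close>, and
  likewise in \<open>dcoact\<close>; \<open>DA_simps\<close> shows the agreement on the
  carrier.\<close>

definition dlact where
  "dlact b t = tens_sum DA t (\<lambda>f a. tens_sum DA coev (\<lambda>g x. tens_sum DA (Psi x b)
     (\<lambda>b' c'. tens k D A (f c' \<odot>\<^bsub>D\<^esub> g) (b' \<otimes>\<^bsub>A\<^esub> a))))"

definition dcoact where
  "dcoact t = tens_sum DAC t (\<lambda>f a. tens_sum DAC coev (\<lambda>g x. tens_sum DAC (Psi x a)
     (\<lambda>a' c'. tens k DA C (tens k D A (g \<otimes>\<^bsub>D\<^esub> f) a') c')))"

lemma dract_linear [lin]: "\<lbrakk>linear_map k X DA f; b \<in> carrier A\<rbrakk> \<Longrightarrow> linear_map k X DA (\<lambda>x. dract (f x) b)"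
  unfolding dract_def by (assumption | rule lin)+

lemma dract_linear_right [lin]:
  assumes "module k X" "linear_map k X A f" "t \<in> carrier DA"
  shows "linear_map k X DA (\<lambda>x. dract t (f x))"
  unfolding dract_def by (assumption | rule lin assms linear_map_closed[OF assms(2)])+

lemma dract_closed [lin]: "\<lbrakk>t \<in> carrier DA; b \<in> carrier A\<rbrakk> \<Longrightarrow> dract t b \<in> carrier DA"
  unfolding dract_def by (assumption | rule lin)+

lemma dlact_linear [lin]: "\<lbrakk>linear_map k X DA f; b \<in> carrier A\<rbrakk> \<Longrightarrow> linear_map k X DA (\<lambda>x. dlact b (f x))"
  unfolding dlact_def by (assumption | rule lin)+

lemma dlact_linear_left [lin]:
  assumes "module k X" "linear_map k X A f" "t \<in> carrier DA"
  shows "linear_map k X DA (\<lambda>x. dlact (f x) t)"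
  unfolding dlact_def by (assumption | rule lin assms linear_map_closed[OF assms(2)])+

lemma dlact_closed [lin]: "\<lbrakk>t \<in> carrier DA; b \<in> carrier A\<rbrakk> \<Longrightarrow> dlact b t \<in> carrier DA"
  unfolding dlact_def by (assumption | rule lin)+

lemma dcoact_linear [lin]: "linear_map k X DA f \<Longrightarrow> linear_map k X DAC (\<lambda>x. dcoact (f x))"
  unfolding dcoact_def by (assumption | rule lin)+

lemma dcoact_closed [lin]: "t \<in> carrier DA \<Longrightarrow> dcoact t \<in> carrier DAC"
  unfolding dcoact_def by (assumption | rule lin)+

lemma DA_simps:
  "same_module N DA" "carrier N = carrier DA" "ract N = dract"
  "t \<in> carrier DA \<Longrightarrow> coact N t = dcoact t"
  "\<lbrakk>b \<in> carrier A; t \<in> carrier DA\<rbrakk> \<Longrightarrow> lact N b t = dlact b t"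
proof -
  show "same_module N DA" "carrier N = carrier DA" "ract N = dract"
    by (auto simp: dual_tensor_A_def same_module_def Let_def dract_def[abs_def])
  assume t: "t \<in> carrier DA"
  have "coact N t = tens_sum DAC t (\<lambda>f a. \<Oplus>\<^bsub>DAC\<^esub>i\<in>{1..m}. tens_sum DAC (Psi (d i) a)
     (\<lambda>a' c'. tens k DA C (tens k D A (d' i \<otimes>\<^bsub>D\<^esub> f) a') c'))"
    by (simp add: dual_tensor_A_def Let_def)
  also have "\<dots> = dcoact t"
    unfolding dcoact_def
    apply (rule tens_sum_cong[OF D_module module t])
    apply (rule finsum_coev[where f = "\<lambda>g x. tens_sum DAC (Psi x a)
     (\<lambda>a' c'. tens k DA C (tens k D A (g \<otimes>\<^bsub>D\<^esub> f) a') c')" for f a])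
    apply (assumption | rule lin)+
    done
  finally show "coact N t = dcoact t" .
  assume b: "b \<in> carrier A"
  have "lact N b t = tens_sum DA t (\<lambda>f a. \<Oplus>\<^bsub>DA\<^esub>i\<in>{1..m}. tens_sum DA (Psi (d i) b)
     (\<lambda>b' c'. tens k D A (f c' \<odot>\<^bsub>D\<^esub> d' i) (b' \<otimes>\<^bsub>A\<^esub> a)))"
    by (simp add: dual_tensor_A_def Let_def)
  also have "\<dots> = dlact b t"
    unfolding dlact_def
    apply (rule tens_sum_cong[OF D_module module t])
    apply (rule finsum_coev[where f = "\<lambda>g x. tens_sum DA (Psi x b)
     (\<lambda>b' c'. tens k D A (f c' \<odot>\<^bsub>D\<^esub> g) (b' \<otimes>\<^bsub>A\<^esub> a))" for f a])
    apply (assumption | rule lin b)+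
    done
  finally show "lact N b t = dlact b t" .
qed

lemma pair_dract:
  assumes t: "t \<in> carrier DA" and b: "b \<in> carrier A" and c: "c \<in> carrier C"
  shows "pair c (dract t b) = pair c t \<otimes>\<^bsub>A\<^esub> b"
proof (rule linear_ext_tensor[OF _ _ _ _ _ _ t])
  note [lin] = b c
  fix f a assume [lin]: "f \<in> carrier D" "a \<in> carrier A"
  have "pair c (dract (tens k D A f a) b) = pair c (tens k D A f (a \<otimes>\<^bsub>A\<^esub> b))"
    unfolding dract_def by (subst tens_sum_tens) (assumption | rule lin HOL.refl)+
  also have "\<dots> = f c \<odot>\<^bsub>A\<^esub> (a \<otimes>\<^bsub>A\<^esub> b)"
    by (rule pair_tens) (assumption | rule lin)+
  also have "\<dots> = (f c \<odot>\<^bsub>A\<^esub> a) \<otimes>\<^bsub>A\<^esub> b"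
    by (rule smult_mult_left[symmetric]) (assumption | rule lin)+
  also have "\<dots> = pair c (tens k D A f a) \<otimes>\<^bsub>A\<^esub> b"
    by (subst pair_tens) (assumption | rule lin HOL.refl)+
  finally show "pair c (dract (tens k D A f a) b) = pair c (tens k D A f a) \<otimes>\<^bsub>A\<^esub> b" .
qed (assumption | rule lin b c)+

text \<open>The factor \<open>d\<^sub>i\<^sup>*\<close> pairs with \<open>c\<close> while
  \<open>d\<^sub>i\<close> is an argument of \<open>\<psi>\<close>, so \<open>coev_sum\<close> puts
  \<open>c\<close> in its place.\<close>

lemma pair_dlact:
  assumes t: "t \<in> carrier DA" and b: "b \<in> carrier A" and c: "c \<in> carrier C"
  shows "pair c (dlact b t) = tens_sum A (Psi c b) (\<lambda>b' c'. b' \<otimes>\<^bsub>A\<^esub> pair c' t)"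
proof (rule linear_ext_tensor[OF _ _ _ _ _ _ t])
  note [lin] = b c
  fix f a assume [lin]: "f \<in> carrier D" "a \<in> carrier A"
  let ?F = "\<lambda>x. tens_sum A (Psi x b) (\<lambda>b' c'. b' \<otimes>\<^bsub>A\<^esub> pair c' (tens k D A f a))"
  have "pair c (dlact b (tens k D A f a)) = pair c (tens_sum DA coev (\<lambda>g x. tens_sum DA (Psi x b)
     (\<lambda>b' c'. tens k D A (f c' \<odot>\<^bsub>D\<^esub> g) (b' \<otimes>\<^bsub>A\<^esub> a))))"
    unfolding dlact_def by (subst tens_sum_tens) (assumption | rule lin HOL.refl)+
  also have "\<dots> = tens_sum A coev (\<lambda>g x. pair c (tens_sum DA (Psi x b)
     (\<lambda>b' c'. tens k D A (f c' \<odot>\<^bsub>D\<^esub> g) (b' \<otimes>\<^bsub>A\<^esub> a))))"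
    by (rule tens_sum_linear[where h = "pair c"]) (assumption | rule lin)+
  also have "\<dots> = tens_sum A coev (\<lambda>g x. g c \<odot>\<^bsub>A\<^esub> ?F x)"
  proof (rule tens_sum_cong[OF D_module C.module], (assumption | rule lin)+)
    fix g x assume [lin]: "g \<in> carrier D" "x \<in> carrier C"
    have "pair c (tens_sum DA (Psi x b) (\<lambda>b' c'. tens k D A (f c' \<odot>\<^bsub>D\<^esub> g) (b' \<otimes>\<^bsub>A\<^esub> a)))
      = tens_sum A (Psi x b) (\<lambda>b' c'. pair c (tens k D A (f c' \<odot>\<^bsub>D\<^esub> g) (b' \<otimes>\<^bsub>A\<^esub> a)))"
      by (rule tens_sum_linear[where h = "pair c"]) (assumption | rule lin)+
    also have "\<dots> = tens_sum A (Psi x b) (\<lambda>b' c'. g c \<odot>\<^bsub>A\<^esub> (b' \<otimes>\<^bsub>A\<^esub> pair c' (tens k D A f a)))"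
    proof (rule tens_sum_cong[OF module C.module], (assumption | rule lin)+)
      fix b' c' assume [lin]: "b' \<in> carrier A" "c' \<in> carrier C"
      have "pair c (tens k D A (f c' \<odot>\<^bsub>D\<^esub> g) (b' \<otimes>\<^bsub>A\<^esub> a)) = (f c' \<odot>\<^bsub>D\<^esub> g) c \<odot>\<^bsub>A\<^esub> (b' \<otimes>\<^bsub>A\<^esub> a)"
        by (rule pair_tens) (assumption | rule lin)+
      also have "\<dots> = (g c \<otimes>\<^bsub>k\<^esub> f c') \<odot>\<^bsub>A\<^esub> (b' \<otimes>\<^bsub>A\<^esub> a)"
        using eval_closed[OF \<open>f \<in> _\<close> \<open>c' \<in> _\<close>] eval_closed[OF \<open>g \<in> _\<close> c] by (simp add: dual_smult_apply c K.m_comm)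
      also have "\<dots> = g c \<odot>\<^bsub>A\<^esub> (f c' \<odot>\<^bsub>A\<^esub> (b' \<otimes>\<^bsub>A\<^esub> a))"
        by (rule module_smult_smult) (assumption | rule lin)+
      also have "f c' \<odot>\<^bsub>A\<^esub> (b' \<otimes>\<^bsub>A\<^esub> a) = b' \<otimes>\<^bsub>A\<^esub> (f c' \<odot>\<^bsub>A\<^esub> a)"
        by (rule smult_mult_right[symmetric]) (assumption | rule lin)+
      also have "f c' \<odot>\<^bsub>A\<^esub> a = pair c' (tens k D A f a)"
        by (rule pair_tens[symmetric]) (assumption | rule lin)+
      finally show "pair c (tens k D A (f c' \<odot>\<^bsub>D\<^esub> g) (b' \<otimes>\<^bsub>A\<^esub> a)) = g c \<odot>\<^bsub>A\<^esub> (b' \<otimes>\<^bsub>A\<^esub> pair c' (tens k D A f a))" .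
    qed
    also have "\<dots> = g c \<odot>\<^bsub>A\<^esub> ?F x"
      by (rule tens_sum_linear[where h = "\<lambda>u. g c \<odot>\<^bsub>A\<^esub> u", symmetric]) (assumption | rule lin)+
    finally show "pair c (tens_sum DA (Psi x b) (\<lambda>b' c'. tens k D A (f c' \<odot>\<^bsub>D\<^esub> g) (b' \<otimes>\<^bsub>A\<^esub> a))) = g c \<odot>\<^bsub>A\<^esub> ?F x" .
  qed
  also have "\<dots> = ?F c"
    by (rule coev_sum) (assumption | rule lin)+
  finally show "pair c (dlact b (tens k D A f a)) = ?F c" .
qed (assumption | rule lin b c)+

text \<open>The convolution \<open>d\<^sub>i\<^sup>* * f\<close> splits \<open>c\<close>: the part
  \<open>c1\<close> meets \<open>d\<^sub>i\<^sup>*\<close> and replaces \<open>d\<^sub>i\<close>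
  inside \<open>\<psi>\<close>, the part \<open>c2\<close> is paired with the tensor.\<close>

lemma pair_dcoact:
  assumes t: "t \<in> carrier DA" and c: "c \<in> carrier C"
  shows "tmap k A C (pair c) (dcoact t) = tens_sum AC (comult C c) (\<lambda>c1 c2. Psi c1 (pair c2 t))"
proof (rule linear_ext_tensor[OF _ _ _ _ _ _ t])
  note [lin] = c
  fix f a assume f [lin]: "f \<in> carrier D" and a [lin]: "a \<in> carrier A"
  let ?p = "tmap k A C (pair c)"
  have "?p (dcoact (tens k D A f a)) = ?p (tens_sum DAC coev (\<lambda>g x. tens_sum DAC (Psi x a)
     (\<lambda>a' c'. tens k DA C (tens k D A (g \<otimes>\<^bsub>D\<^esub> f) a') c')))"
    unfolding dcoact_def by (subst tens_sum_tens) (assumption | rule lin HOL.refl)+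
  also have "\<dots> = tens_sum AC coev (\<lambda>g x. ?p (tens_sum DAC (Psi x a)
     (\<lambda>a' c'. tens k DA C (tens k D A (g \<otimes>\<^bsub>D\<^esub> f) a') c')))"
    by (rule tens_sum_linear[where h = ?p]) (assumption | rule lin)+
  also have "\<dots> = tens_sum AC coev (\<lambda>g x. tens_sum AC (comult C c) (\<lambda>c1 c2. g c1 \<odot>\<^bsub>AC\<^esub> (f c2 \<odot>\<^bsub>AC\<^esub> Psi x a)))"
  proof (rule tens_sum_cong[OF D_module C.module], (assumption | rule lin)+)
    fix g x assume g [lin]: "g \<in> carrier D" and [lin]: "x \<in> carrier C"
    have "?p (tens_sum DAC (Psi x a) (\<lambda>a' c'. tens k DA C (tens k D A (g \<otimes>\<^bsub>D\<^esub> f) a') c'))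
      = tens_sum AC (Psi x a) (\<lambda>a' c'. ?p (tens k DA C (tens k D A (g \<otimes>\<^bsub>D\<^esub> f) a') c'))"
      by (rule tens_sum_linear[where h = ?p]) (assumption | rule lin)+
    also have "\<dots> = tens_sum AC (Psi x a) (\<lambda>a' c'. (g \<otimes>\<^bsub>D\<^esub> f) c \<odot>\<^bsub>AC\<^esub> tens k A C a' c')"
      apply (rule tens_sum_cong[OF module C.module], (assumption | rule lin)+)
      apply (subst tmap_tens, (assumption | rule lin)+)
      apply (subst pair_tens, (assumption | rule lin)+)
      apply (rule linear_map_smult[OF bilin_left[OF bilin_tens]], (assumption | rule lin)+)
      done
    also have "\<dots> = (g \<otimes>\<^bsub>D\<^esub> f) c \<odot>\<^bsub>AC\<^esub> tens_sum AC (Psi x a) (\<lambda>a' c'. tens k A C a' c')"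
      by (rule tens_sum_linear[where h = "\<lambda>u. (g \<otimes>\<^bsub>D\<^esub> f) c \<odot>\<^bsub>AC\<^esub> u", symmetric]) (assumption | rule lin)+
    also have "tens_sum AC (Psi x a) (\<lambda>a' c'. tens k A C a' c') = Psi x a"
      by (rule tens_sum_id) (assumption | rule lin)+
    also have "(g \<otimes>\<^bsub>D\<^esub> f) c \<odot>\<^bsub>AC\<^esub> Psi x a
      = tens_sum AC (comult C c) (\<lambda>c1 c2. (g c1 \<odot>\<^bsub>self_module k\<^esub> f c2) \<odot>\<^bsub>AC\<^esub> Psi x a)"
      unfolding conv_apply[OF c]
      by (rule tens_sum_linear[where h = "\<lambda>u. u \<odot>\<^bsub>AC\<^esub> Psi x a"]) (assumption | rule lin)+
    also have "\<dots> = tens_sum AC (comult C c) (\<lambda>c1 c2. g c1 \<odot>\<^bsub>AC\<^esub> (f c2 \<odot>\<^bsub>AC\<^esub> Psi x a))"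
    proof (rule tens_sum_cong[OF C.module C.module], (assumption | rule lin)+)
      fix c1 c2 assume [lin]: "c1 \<in> carrier C" "c2 \<in> carrier C"
      have "(g c1 \<otimes>\<^bsub>k\<^esub> f c2) \<odot>\<^bsub>AC\<^esub> Psi x a = g c1 \<odot>\<^bsub>AC\<^esub> (f c2 \<odot>\<^bsub>AC\<^esub> Psi x a)"
        by (rule module_smult_smult) (assumption | rule lin)+
      then show "(g c1 \<odot>\<^bsub>self_module k\<^esub> f c2) \<odot>\<^bsub>AC\<^esub> Psi x a = g c1 \<odot>\<^bsub>AC\<^esub> (f c2 \<odot>\<^bsub>AC\<^esub> Psi x a)"
        by (simp add: self_module_def)
    qed
    finally show "?p (tens_sum DAC (Psi x a) (\<lambda>a' c'. tens k DA C (tens k D A (g \<otimes>\<^bsub>D\<^esub> f) a') c')) = \<dots>" .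
  qed
  \<comment> \<open>The sum over the comultiplication of \<open>c\<close> goes outside, so that
    \<open>c1\<close> is fixed when the dual basis is summed.\<close>
  also have "\<dots> = tens_sum AC (comult C c) (\<lambda>c1 c2. tens_sum AC coev (\<lambda>g x. g c1 \<odot>\<^bsub>AC\<^esub> (f c2 \<odot>\<^bsub>AC\<^esub> Psi x a)))"
    by (rule tens_sum_swap) (assumption | rule lin)+
  also have "\<dots> = tens_sum AC (comult C c) (\<lambda>c1 c2. f c2 \<odot>\<^bsub>AC\<^esub> Psi c1 a)"
    by (rule tens_sum_cong, (assumption | rule lin)+, rule coev_sum, (assumption | rule lin)+)
  also have "\<dots> = tens_sum AC (comult C c) (\<lambda>c1 c2. Psi c1 (pair c2 (tens k D A f a)))"
    apply (rule tens_sum_cong[OF C.module C.module], (assumption | rule lin)+)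
    apply (subst pair_tens, (assumption | rule lin)+)
    apply (rule linear_map_smult[symmetric, of _ A AC "\<lambda>a. Psi c1 a" for c1], (assumption | rule lin)+)
    done
  finally show "?p (dcoact (tens k D A f a)) = tens_sum AC (comult C c) (\<lambda>c1 c2. Psi c1 (pair c2 (tens k D A f a)))" .
qed (assumption | rule lin c)+

end

context entwining_structure
begin

lemma cact_Psi:
  assumes "a \<in> carrier A" "b \<in> carrier A" "c \<in> carrier C"
  shows "cact regular (Psi c a) b = Psi c (a \<otimes>\<^bsub>A\<^esub> b)"
  unfolding psi_mult[OF assms] cact_def same_moduleD[OF regular_simps(1)] regular_simps ..

text \<open>\<open>psi_comult\<close> with the inner sum absorbed into one application of
  \<open>\<psi>\<close>; in this form it matches the result of applying \<open>pair_dcoact\<close>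
  twice.\<close>

lemma cdelta_Psi:
  assumes a: "a \<in> carrier A" and c: "c \<in> carrier C"
  shows "cdelta A (Psi c a)
    = tens_sum (tensor k AC C) (comult C c) (\<lambda>c1 c2. tmap k AC C (Psi c1) (Psi c2 a))"
proof -
  let ?T = "tensor k AC C"
  note [lin] = a c
  have "cdelta A (Psi c a) = tens_sum ?T (comult C c) (\<lambda>c1 c2. tens_sum ?T (Psi c2 a)
      (\<lambda>a' c2'. tens_sum ?T (Psi c1 a') (\<lambda>a'' c1'. tens k AC C (tens k A C a'' c1') c2')))"
    unfolding cdelta_def psi_comult[OF a c] ..
  also have "\<dots> = tens_sum ?T (comult C c) (\<lambda>c1 c2. tens_sum ?T (Psi c2 a) (\<lambda>a' c2'. tens k AC C (Psi c1 a') c2'))"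
  proof (rule tens_sum_cong[OF C.module C.module], (assumption | rule lin)+,
      rule tens_sum_cong[OF module C.module], (assumption | rule lin)+)
    fix c1 c2 a' c2' assume [lin]: "c1 \<in> carrier C" "c2 \<in> carrier C" "a' \<in> carrier A" "c2' \<in> carrier C"
    have "tens_sum ?T (Psi c1 a') (\<lambda>a'' c1'. tens k AC C (tens k A C a'' c1') c2')
      = tens k AC C (tens_sum AC (Psi c1 a') (\<lambda>a'' c1'. tens k A C a'' c1')) c2'"
      by (rule tens_sum_linear[where h = "\<lambda>u. tens k AC C u c2'", symmetric]) (assumption | rule lin)+
    also have "tens_sum AC (Psi c1 a') (\<lambda>a'' c1'. tens k A C a'' c1') = Psi c1 a'"
      by (rule tens_sum_id) (assumption | rule lin)+
    finally show "tens_sum ?T (Psi c1 a') (\<lambda>a'' c1'. tens k AC C (tens k A C a'' c1') c2') = tens k AC C (Psi c1 a') c2'" .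
  qed
  finally show ?thesis unfolding tmap_def .
qed

end

section \<open>Separation by the pairing, and the axioms for
  \<open>C\<^sup>* \<otimes> A\<close>\<close>

context entwining_dual_basis
begin

text \<open>A formula that reconstructs \<open>X\<close> from maps into \<open>Y\<close> is an
  identity between linear maps, so it can be tensored with \<open>M\<close>; mere joint injectivity
  of the maps \<open>p c\<close> would not pass to \<open>X \<otimes> M\<close> in general. Two
  applications in succession lead to \<open>pair_CC_ext\<close>.\<close>

lemma separating_tensor:
  assumes X: "module k X" and Y: "module k Y" and M: "module k M"
    and p: "\<And>c. c \<in> carrier C \<Longrightarrow> linear_map k X Y (p c)"
    and p': "\<And>x. x \<in> carrier X \<Longrightarrow> linear_map k C Y (\<lambda>c. p c x)"
    and R: "\<And>g. g \<in> carrier D \<Longrightarrow> linear_map k Y X (R g)"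
    and R': "\<And>y. y \<in> carrier Y \<Longrightarrow> linear_map k D X (\<lambda>g. R g y)"
    and recon: "\<And>x. x \<in> carrier X \<Longrightarrow> tens_sum X coev (\<lambda>g c. R g (p c x)) = x"
    and s: "s \<in> carrier (tensor k X M)"
  shows "tens_sum (tensor k X M) coev (\<lambda>g c. tmap k X M (R g) (tmap k Y M (p c) s)) = s"
proof -
  note [lin] = X Y M s p p' R' linear_map_closed[OF p] linear_map_closed[OF R] R linear_comp[OF R p] linear_comp[OF R p']
  have "tens_sum (tensor k X M) coev (\<lambda>g c. tmap k X M (R g) (tmap k Y M (p c) s))
    = tens_sum (tensor k X M) coev (\<lambda>g c. tmap k X M (\<lambda>x. R g (p c x)) s)"
    by (rule tens_sum_cong[OF D_module C.module], (assumption | rule lin)+, rule tmap_tmap, (assumption | rule lin)+)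
  also have "\<dots> = tmap k X M (\<lambda>x. tens_sum X coev (\<lambda>g c. R g (p c x))) s"
    by (rule tmap_sum_param[symmetric]) (assumption | rule lin)+
  also have "\<dots> = tmap k X M (\<lambda>x. x) s"
    using s by (intro tmap_cong[OF X M]) (auto simp: recon)
  also have "\<dots> = s" by (rule tmap_id[OF X M s])
  finally show ?thesis .
qed

lemma separating_ext:
  assumes X: "module k X"
    and recon: "\<And>x. x \<in> carrier X \<Longrightarrow> tens_sum X coev (\<lambda>g c. R g (p c x)) = x"
    and "x \<in> carrier X" "y \<in> carrier X" and eq: "\<And>c. c \<in> carrier C \<Longrightarrow> p c x = p c y"
  shows "x = y"
proof -
  have "tens_sum X coev (\<lambda>g c. R g (p c x)) = tens_sum X coev (\<lambda>g c. R g (p c y))"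
    by (rule tens_sum_cong[OF D_module C.module coev_closed]) (simp add: eq)
  then show ?thesis using assms by simp
qed

lemma pair_C_recon:
  assumes "s \<in> carrier DAC"
  shows "tens_sum DAC coev (\<lambda>g c. tmap k DA C (tens k D A g) (tmap k A C (pair c) s)) = s"
  by (rule separating_tensor[OF _ _ _ _ _ _ _ pair_coev]) (assumption | rule lin assms)+

lemma pair_C_ext:
  assumes "s \<in> carrier DAC" "t \<in> carrier DAC"
    and "\<And>c. c \<in> carrier C \<Longrightarrow> tmap k A C (pair c) s = tmap k A C (pair c) t"
  shows "s = t"
  by (rule separating_ext[OF _ pair_C_recon assms]) (assumption | rule lin)+

lemma pair_CC_ext:
  assumes "s \<in> carrier (tensor k DAC C)" "t \<in> carrier (tensor k DAC C)"
    and "\<And>c. c \<in> carrier C \<Longrightarrow> tmap k AC C (tmap k A C (pair c)) s = tmap k AC C (tmap k A C (pair c)) t"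
  shows "s = t"
proof (rule separating_ext[OF _ _ assms])
  show "tens_sum (tensor k DAC C) coev (\<lambda>g c. tmap k DAC C (tmap k DA C (tens k D A g))
     (tmap k AC C (tmap k A C (pair c)) x)) = x"
    if "x \<in> carrier (tensor k DAC C)" for x
    by (rule separating_tensor[OF _ _ _ _ _ _ _ pair_C_recon that]) (assumption | rule lin)+
qed (assumption | rule lin)+

lemma N_right_module: "right_module k A N"
proof (rule right_moduleI)
  note simps = DA_simps(2,3) same_moduleD[OF DA_simps(1)]
  show "module k N" unfolding simps by (rule lin)+
  show "linear_map k N N (\<lambda>x. ract N x a)" if "a \<in> carrier A" for a
    using that unfolding simps by - (assumption | rule lin)+
  show "linear_map k A N (ract N x)" if "x \<in> carrier N" for x
    using that unfolding simps by - (assumption | rule lin)+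
  fix t assume "t \<in> carrier N"
  then have t: "t \<in> carrier DA" by (simp add: DA_simps)
  show "ract N t (a \<otimes>\<^bsub>A\<^esub> b) = ract N (ract N t a) b" if "a \<in> carrier A" "b \<in> carrier A" for a b
    unfolding DA_simps using that t
    by (intro pair_ext) (simp_all add: pair_dract dract_closed pair_closed R.m_assoc)
  show "ract N t \<one>\<^bsub>A\<^esub> = t"
    unfolding DA_simps using t
    by (intro pair_ext) (simp_all add: pair_dract dract_closed pair_closed)
qed

text \<open>Paired with \<open>c\<close>, both sides become a sum over the twofold comultiplication
  of \<open>c\<close>, with \<open>\<psi>\<close> applied to the first two parts and the pairing to
  the last: on one side through \<open>cdelta_Psi\<close>, on the other through two uses of
  \<open>pair_dcoact\<close>. Coassociativity of \<open>C\<close> matches them.\<close>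

lemma dcoact_coassoc:
  assumes t: "t \<in> carrier DA"
  shows "tmap k DAC C dcoact (dcoact t) = cdelta DA (dcoact t)"
proof (rule pair_CC_ext)
  note [lin] = t
  show "tmap k DAC C dcoact (dcoact t) \<in> carrier (tensor k DAC C)" "cdelta DA (dcoact t) \<in> carrier (tensor k DAC C)"
    by (assumption | rule lin)+
  fix c assume c [lin]: "c \<in> carrier C"
  let ?T = "tensor k AC C"
  let ?p = "\<lambda>c. tmap k A C (pair c)"
  have "tmap k AC C (?p c) (cdelta DA (dcoact t)) = cdelta A (?p c (dcoact t))"
    by (rule cdelta_natural[symmetric]) (assumption | rule lin)+
  also have "\<dots> = cdelta A (tens_sum AC (comult C c) (\<lambda>c1 c2. Psi c1 (pair c2 t)))"
    by (simp add: pair_dcoact t c)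
  also have "\<dots> = tens_sum ?T (comult C c) (\<lambda>c1 c2. cdelta A (Psi c1 (pair c2 t)))"
    by (rule tens_sum_linear[where h = "cdelta A"]) (assumption | rule lin)+
  also have "\<dots> = tens_sum ?T (comult C c) (\<lambda>c1 c2. tens_sum ?T (comult C c1)
      (\<lambda>x1 x2. tmap k AC C (Psi x1) (Psi x2 (pair c2 t))))"
    by (rule tens_sum_cong[OF C.module C.module], (assumption | rule lin)+, rule cdelta_Psi, (assumption | rule lin)+)
  also have "\<dots> = tens_sum ?T (comult C c) (\<lambda>c1 c2. tens_sum ?T (comult C c2)
      (\<lambda>x y. tmap k AC C (Psi c1) (Psi x (pair y t))))"
    by (rule coassoc_sum[where f = "\<lambda>c1 c2 c3. tmap k AC C (Psi c1) (Psi c2 (pair c3 t))"]) (assumption | rule lin)+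
  also have "\<dots> = tens_sum ?T (comult C c) (\<lambda>c1 c2. tmap k AC C (Psi c1) (?p c2 (dcoact t)))"
    apply (rule tens_sum_cong[OF C.module C.module], (assumption | rule lin)+)
    apply (subst pair_dcoact, (assumption | rule lin)+)
    apply (rule tens_sum_linear[where h = "tmap k AC C (Psi c)" for c, symmetric], (assumption | rule lin)+)
    done
  also have "\<dots> = tens_sum ?T (comult C c) (\<lambda>c1 c2. tmap k AC C (\<lambda>u. Psi c1 (pair c2 u)) (dcoact t))"
    by (rule tens_sum_cong[OF C.module C.module], (assumption | rule lin)+, rule tmap_tmap, (assumption | rule lin)+)
  also have "\<dots> = tmap k AC C (\<lambda>u. tens_sum AC (comult C c) (\<lambda>c1 c2. Psi c1 (pair c2 u))) (dcoact t)"
    by (rule tmap_sum_param[symmetric]) (assumption | rule lin)+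
  also have "\<dots> = tmap k AC C (\<lambda>u. ?p c (dcoact u)) (dcoact t)"
    by (rule tmap_cong[of k DA]) (auto simp: pair_dcoact c intro: lin t)
  also have "\<dots> = tmap k AC C (?p c) (tmap k DAC C dcoact (dcoact t))"
    by (rule tmap_tmap[symmetric]) (assumption | rule lin)+
  finally show "tmap k AC C (?p c) (tmap k DAC C dcoact (dcoact t)) = tmap k AC C (?p c) (cdelta DA (dcoact t))" ..
qed

text \<open>After pairing, the counit falls on the output of \<open>\<psi>\<close>, where
  \<open>psi_counit\<close> removes the twist and the left counit law of \<open>C\<close>
  finishes.\<close>

lemma dcoact_counit:
  assumes t: "t \<in> carrier DA"
  shows "tens_sum DA (dcoact t) (\<lambda>t0 c. counit C c \<odot>\<^bsub>DA\<^esub> t0) = t"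
proof (rule pair_ext)
  note [lin] = t
  show "tens_sum DA (dcoact t) (\<lambda>t0 c. counit C c \<odot>\<^bsub>DA\<^esub> t0) \<in> carrier DA" by (assumption | rule lin)+
  fix c assume c [lin]: "c \<in> carrier C"
  let ?h = "\<lambda>u. tens_sum A u (\<lambda>a e. counit C e \<odot>\<^bsub>A\<^esub> a)"
  have "pair c (tens_sum DA (dcoact t) (\<lambda>t0 e. counit C e \<odot>\<^bsub>DA\<^esub> t0))
    = tens_sum A (dcoact t) (\<lambda>t0 e. pair c (counit C e \<odot>\<^bsub>DA\<^esub> t0))"
    by (rule tens_sum_linear[where h = "pair c"]) (assumption | rule lin)+
  also have "\<dots> = tens_sum A (dcoact t) (\<lambda>t0 e. counit C e \<odot>\<^bsub>A\<^esub> pair c t0)"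
    by (rule tens_sum_cong[OF _ C.module], (assumption | rule lin)+, rule linear_map_smult[of k DA], (assumption | rule lin)+)
  also have "\<dots> = ?h (tmap k A C (pair c) (dcoact t))"
    by (rule tens_sum_tmap[symmetric]) (assumption | rule lin)+
  also have "\<dots> = ?h (tens_sum AC (comult C c) (\<lambda>c1 c2. Psi c1 (pair c2 t)))"
    by (simp add: pair_dcoact t c)
  also have "\<dots> = tens_sum A (comult C c) (\<lambda>c1 c2. ?h (Psi c1 (pair c2 t)))"
    by (rule tens_sum_linear[where h = ?h]) (assumption | rule lin)+
  also have "\<dots> = tens_sum A (comult C c) (\<lambda>c1 c2. counit C c1 \<odot>\<^bsub>A\<^esub> pair c2 t)"
    by (rule tens_sum_cong[OF C.module C.module], (assumption | rule lin)+, rule psi_counit_sum, (assumption | rule lin)+)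
  also have "\<dots> = pair c t"
    by (rule counit_left_sum) (assumption | rule lin)+
  finally show "pair c (tens_sum DA (dcoact t) (\<lambda>t0 e. counit C e \<odot>\<^bsub>DA\<^esub> t0)) = pair c t" .
qed (rule t)

text \<open>An instance of \<open>cact_natural\<close>: \<open>pair c\<close> is right linear by
  \<open>pair_dract\<close>.\<close>

lemma pair_C_cact:
  assumes "s \<in> carrier DAC" "c \<in> carrier C" "a \<in> carrier A"
  shows "tmap k A C (pair c) (cact N s a) = cact regular (tmap k A C (pair c) s) a"
proof -
  have "linear_map k DA A (pair c)" using assms by - (assumption | rule lin)+
  from cact_natural[OF N_right_module regular_right_module, unfolded same_moduleD[OF regular_simps(1)]
      same_moduleD[OF DA_simps(1)] DA_simps(3) regular_simps same_tmap[OF regular_simps(1)], OF this _ assms(1,3)]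
  show ?thesis using assms by (simp add: pair_dract)
qed

lemma cact_N_closed [lin]: "\<lbrakk>s \<in> carrier DAC; a \<in> carrier A\<rbrakk> \<Longrightarrow> cact N s a \<in> carrier DAC"
  using cact_closed[OF N_right_module, unfolded same_moduleD[OF DA_simps(1)]] .

lemma cact_regular_linear [lin]:
  "\<lbrakk>linear_map k X AC f; a \<in> carrier A\<rbrakk> \<Longrightarrow> linear_map k X AC (\<lambda>x. cact regular (f x) a)"
  using cact_linear[OF regular_right_module, unfolded same_moduleD[OF regular_simps(1)]] .

lemma dcoact_dract:
  assumes t: "t \<in> carrier DA" and a: "a \<in> carrier A"
  shows "dcoact (dract t a) = cact N (dcoact t) a"
proof (rule pair_C_ext)
  note [lin] = t a
  show "dcoact (dract t a) \<in> carrier DAC" "cact N (dcoact t) a \<in> carrier DAC"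
    by (assumption | rule lin)+
  fix c assume c [lin]: "c \<in> carrier C"
  let ?p = "tmap k A C (pair c)"
  have "?p (cact N (dcoact t) a) = cact regular (?p (dcoact t)) a"
    by (rule pair_C_cact) (assumption | rule lin)+
  also have "\<dots> = cact regular (tens_sum AC (comult C c) (\<lambda>c1 c2. Psi c1 (pair c2 t))) a"
    by (simp add: pair_dcoact t c)
  also have "\<dots> = tens_sum AC (comult C c) (\<lambda>c1 c2. cact regular (Psi c1 (pair c2 t)) a)"
    by (rule tens_sum_linear[where h = "\<lambda>u. cact regular u a"]) (assumption | rule lin)+
  also have "\<dots> = tens_sum AC (comult C c) (\<lambda>c1 c2. Psi c1 (pair c2 (dract t a)))"
    by (rule tens_sum_cong[OF C.module C.module], (assumption | rule lin)+)
      (simp add: cact_Psi pair_dract t a pair_closed)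
  also have "\<dots> = ?p (dcoact (dract t a))"
    by (rule pair_dcoact[symmetric]) (assumption | rule lin)+
  finally show "?p (dcoact (dract t a)) = ?p (cact N (dcoact t) a)" ..
qed

lemma N_entwined: "entwined_module k A C \<psi> N"
proof -
  note s = DA_simps(1)
  note sm = same_moduleD[OF s]
  have sf: "smult N = smult DA" using s by (simp add: same_module_def)
  have c: "linear_map k DA DAC (coact N)"
    by (rule linear_map_cong[of DA DAC dcoact]) (simp_all add: DA_simps(4) lin)
  show ?thesis
    unfolding entwined_module_iff sm same_cdelta[OF s] same_tmap[OF s] sf
    using N_right_module c dcoact_coassoc dcoact_counit dcoact_dract
    by (auto simp: DA_simps dcoact_closed dract_closed tmap_cong[OF _ C.module dcoact_closed DA_simps(4)] tensor_module D_module module)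
qed

text \<open>Under the pairing, \<open>b\<close> is passed through \<open>c2\<close> by
  \<open>pair_dlact\<close> and then through \<open>c1\<close> by \<open>psi_mult\<close>;
  \<open>psi_comult\<close> read backwards replaces this by a single passage through
  \<open>c\<close> followed by the comultiplication.\<close>

lemma dlact_dcoact:
  assumes t: "t \<in> carrier DA" and b: "b \<in> carrier A"
  shows "dcoact (dlact b t) = tmap k DA C (dlact b) (dcoact t)"
proof (rule pair_C_ext)
  note [lin] = t b
  show "dcoact (dlact b t) \<in> carrier DAC" "tmap k DA C (dlact b) (dcoact t) \<in> carrier DAC"
    by (assumption | rule lin)+
  fix c assume c [lin]: "c \<in> carrier C"
  let ?p = "\<lambda>c. tmap k A C (pair c)"
  let ?l = "\<lambda>b. tmap k A C (\<lambda>a. b \<otimes>\<^bsub>A\<^esub> a)"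
  have "?p c (dcoact (dlact b t)) = tens_sum AC (comult C c) (\<lambda>c1 c2. Psi c1 (pair c2 (dlact b t)))"
    by (rule pair_dcoact) (assumption | rule lin)+
  also have "\<dots> = tens_sum AC (comult C c) (\<lambda>c1 c2. tens_sum AC (Psi c2 b) (\<lambda>b' c2'. tens_sum AC (Psi c1 b')
      (\<lambda>b'' c1'. ?l b'' (Psi c1' (pair c2' t)))))"
  proof (rule tens_sum_cong[OF C.module C.module], (assumption | rule lin)+)
    fix c1 c2 assume [lin]: "c1 \<in> carrier C" "c2 \<in> carrier C"
    have "Psi c1 (pair c2 (dlact b t)) = Psi c1 (tens_sum A (Psi c2 b) (\<lambda>b' c'. b' \<otimes>\<^bsub>A\<^esub> pair c' t))"
      by (subst pair_dlact) (assumption | rule lin HOL.refl)+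
    also have "\<dots> = tens_sum AC (Psi c2 b) (\<lambda>b' c'. Psi c1 (b' \<otimes>\<^bsub>A\<^esub> pair c' t))"
      by (rule tens_sum_linear[where h = "Psi c1"]) (assumption | rule lin)+
    also have "\<dots> = tens_sum AC (Psi c2 b) (\<lambda>b' c2'. tens_sum AC (Psi c1 b')
      (\<lambda>b'' c1'. ?l b'' (Psi c1' (pair c2' t))))"
      unfolding tmap_def
      by (rule tens_sum_cong[OF module C.module], (assumption | rule lin)+, rule psi_mult, (assumption | rule lin)+)
    finally show "Psi c1 (pair c2 (dlact b t)) = \<dots>" .
  qed
  also have "\<dots> = tens_sum AC (Psi c b) (\<lambda>b' c'. tens_sum AC (comult C c') (\<lambda>c1 c2. ?l b' (Psi c1 (pair c2 t))))"
    by (rule psi_comult_sum[symmetric, where f = "\<lambda>b c1 c2. ?l b (Psi c1 (pair c2 t))"]) (assumption | rule lin)+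
  also have "\<dots> = tens_sum AC (Psi c b) (\<lambda>b' c'. ?l b' (?p c' (dcoact t)))"
    apply (rule tens_sum_cong[OF module C.module], (assumption | rule lin)+)
    apply (subst pair_dcoact, (assumption | rule lin)+)
    apply (rule tens_sum_linear[where h = "?l b" for b, symmetric], (assumption | rule lin)+)
    done
  also have "\<dots> = tens_sum AC (Psi c b) (\<lambda>b' c'. tmap k A C (\<lambda>u. b' \<otimes>\<^bsub>A\<^esub> pair c' u) (dcoact t))"
    by (rule tens_sum_cong[OF module C.module], (assumption | rule lin)+, rule tmap_tmap, (assumption | rule lin)+)
  also have "\<dots> = tmap k A C (\<lambda>u. tens_sum A (Psi c b) (\<lambda>b' c'. b' \<otimes>\<^bsub>A\<^esub> pair c' u)) (dcoact t)"
    by (rule tmap_sum_param[symmetric]) (assumption | rule lin)+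
  also have "\<dots> = tmap k A C (\<lambda>u. pair c (dlact b u)) (dcoact t)"
    by (rule tmap_cong[of k DA]) (auto simp: pair_dlact c b intro: lin t)
  also have "\<dots> = ?p c (tmap k DA C (dlact b) (dcoact t))"
    by (rule tmap_tmap[symmetric]) (assumption | rule lin)+
  finally show "?p c (dcoact (dlact b t)) = ?p c (tmap k DA C (dlact b) (dcoact t))" .
qed

lemma dlact_mult:
  assumes t: "t \<in> carrier DA" and a: "a \<in> carrier A" and b: "b \<in> carrier A"
  shows "dlact (a \<otimes>\<^bsub>A\<^esub> b) t = dlact a (dlact b t)"
proof (rule pair_ext)
  note [lin] = t a b
  show "dlact (a \<otimes>\<^bsub>A\<^esub> b) t \<in> carrier DA" "dlact a (dlact b t) \<in> carrier DA" by (assumption | rule lin)+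
  fix c assume c [lin]: "c \<in> carrier C"
  have "pair c (dlact (a \<otimes>\<^bsub>A\<^esub> b) t) = tens_sum A (Psi c (a \<otimes>\<^bsub>A\<^esub> b)) (\<lambda>x c'. x \<otimes>\<^bsub>A\<^esub> pair c' t)"
    by (rule pair_dlact) (assumption | rule lin)+
  also have "\<dots> = tens_sum A (Psi c a) (\<lambda>a' c'. tens_sum A (Psi c' b) (\<lambda>b' c''. a' \<otimes>\<^bsub>A\<^esub> b' \<otimes>\<^bsub>A\<^esub> pair c'' t))"
    by (rule psi_mult_sum) (assumption | rule lin)+
  also have "\<dots> = tens_sum A (Psi c a) (\<lambda>a' c'. tens_sum A (Psi c' b) (\<lambda>b' c''. a' \<otimes>\<^bsub>A\<^esub> (b' \<otimes>\<^bsub>A\<^esub> pair c'' t)))"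
    by (rule tens_sum_cong[OF module C.module], (assumption | rule lin)+,
        rule tens_sum_cong[OF module C.module], (assumption | rule lin R.m_assoc)+)
  also have "\<dots> = tens_sum A (Psi c a) (\<lambda>a' c'. a' \<otimes>\<^bsub>A\<^esub> pair c' (dlact b t))"
    apply (rule tens_sum_cong[OF module C.module], (assumption | rule lin)+)
    apply (subst pair_dlact, (assumption | rule lin)+)
    apply (rule tens_sum_linear[where h = "\<lambda>u. a \<otimes>\<^bsub>A\<^esub> u" for a, symmetric], (assumption | rule lin)+)
    done
  also have "\<dots> = pair c (dlact a (dlact b t))"
    by (rule pair_dlact[symmetric]) (assumption | rule lin)+
  finally show "pair c (dlact (a \<otimes>\<^bsub>A\<^esub> b) t) = pair c (dlact a (dlact b t))" .
qed

lemma dlact_one: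
  assumes t: "t \<in> carrier DA"
  shows "dlact \<one>\<^bsub>A\<^esub> t = t"
proof (rule pair_ext)
  note [lin] = t
  show "dlact \<one>\<^bsub>A\<^esub> t \<in> carrier DA" by (assumption | rule lin)+
  fix c assume c [lin]: "c \<in> carrier C"
  have "pair c (dlact \<one>\<^bsub>A\<^esub> t) = tens_sum A (Psi c \<one>\<^bsub>A\<^esub>) (\<lambda>x c'. x \<otimes>\<^bsub>A\<^esub> pair c' t)"
    by (rule pair_dlact) (assumption | rule lin)+
  also have "\<dots> = \<one>\<^bsub>A\<^esub> \<otimes>\<^bsub>A\<^esub> pair c t"
    by (rule psi_one_sum) (assumption | rule lin)+
  finally show "pair c (dlact \<one>\<^bsub>A\<^esub> t) = pair c t" using pair_closed[OF c t] by simp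
qed (rule t)

lemma dlact_dract:
  assumes t: "t \<in> carrier DA" and a: "a \<in> carrier A" and b: "b \<in> carrier A"
  shows "dlact a (dract t b) = dract (dlact a t) b"
proof (rule pair_ext)
  note [lin] = t a b
  show "dlact a (dract t b) \<in> carrier DA" "dract (dlact a t) b \<in> carrier DA" by (assumption | rule lin)+
  fix c assume c [lin]: "c \<in> carrier C"
  have "pair c (dlact a (dract t b)) = tens_sum A (Psi c a) (\<lambda>x c'. x \<otimes>\<^bsub>A\<^esub> pair c' (dract t b))"
    by (rule pair_dlact) (assumption | rule lin)+
  also have "\<dots> = tens_sum A (Psi c a) (\<lambda>x c'. (x \<otimes>\<^bsub>A\<^esub> pair c' t) \<otimes>\<^bsub>A\<^esub> b)"
    by (rule tens_sum_cong[OF module C.module], (assumption | rule lin)+)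
      (simp add: pair_dract t b pair_closed R.m_assoc)
  also have "\<dots> = tens_sum A (Psi c a) (\<lambda>x c'. x \<otimes>\<^bsub>A\<^esub> pair c' t) \<otimes>\<^bsub>A\<^esub> b"
    by (rule tens_sum_linear[where h = "\<lambda>u. u \<otimes>\<^bsub>A\<^esub> b", symmetric]) (assumption | rule lin)+
  also have "\<dots> = pair c (dlact a t) \<otimes>\<^bsub>A\<^esub> b"
    by (subst pair_dlact) (assumption | rule lin HOL.refl)+
  also have "\<dots> = pair c (dract (dlact a t) b)"
    by (rule pair_dract[symmetric]) (assumption | rule lin)+
  finally show "pair c (dlact a (dract t b)) = pair c (dract (dlact a t) b)" .
qed

lemma N_bi_entwined: "bi_entwined_module k A C \<psi> N"
proof -
  have sf: "add N = add DA" "zero N = zero DA" "smult N = smult DA"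
    using DA_simps(1) by (auto simp: same_module_def)
  note sm = same_moduleD[OF DA_simps(1)]
  have l2: "linear_map k DA DA (dlact a)" if "a \<in> carrier A" for a
    using that by - (assumption | rule lin)+
  have l1: "linear_map k A DA (\<lambda>a. dlact a t)" if "t \<in> carrier DA" for t
    using that by - (assumption | rule lin)+
  note [simp] = linear_mapD[OF l2] linear_mapD(2,3)[OF l1] DA_simps sf dlact_mult dlact_one dlact_dract
    dract_closed dlact_dcoact moduleD[OF tensor_module[OF D_module module]] moduleD(1,2,3,4,5)[OF module]
  show ?thesis
  proof (rule bi_entwined_module.intro[OF N_entwined], unfold_locales)
    fix a t assume "a \<in> carrier A" "t \<in> carrier N"
    then show "coact N (lact N a t) = tens_sum (tensor k N C) (coact N t) (\<lambda>m0 m1. tens k N C (lact N a m0) m1)"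
      using tens_sum_cong[OF tensor_module[OF D_module module] C.module dcoact_closed[of t],
          of "\<lambda>x n. tens k DA C (lact N a x) n" "\<lambda>x n. tens k DA C (dlact a x) n" DAC]
      by (simp add: sm tmap_def)
  qed simp_all
qed

end

section \<open>Morphisms of entwined modules and their inverses\<close>

context entwining_structure
begin

lemma emod_hom_iff:
  "f \<in> emod_hom k A C M N \<longleftrightarrow> f \<in> extensional (carrier M) \<and> linear_map k M N f \<and>
     (\<forall>m\<in>carrier M. \<forall>a\<in>carrier A. f (ract M m a) = ract N (f m) a) \<and>
     (\<forall>m\<in>carrier M. coact N (f m) = tmap k N C f (coact M m))"
  by (auto simp: emod_hom_def rmod_hom_def tmap_def)

lemma bemod_hom_iff:
  "f \<in> bemod_hom k A C M N \<longleftrightarrow> f \<in> emod_hom k A C M N \<and>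
     (\<forall>a\<in>carrier A. \<forall>m\<in>carrier M. f (lact M a m) = lact N a (f m))"
  by (auto simp: bemod_hom_def)

lemma entwined_moduleD:
  assumes "entwined_module k A C \<psi> M"
  shows entwined_right: "right_module k A M"
    and coact_linear: "linear_map k M (tensor k M C) (coact M)"
    and coact_coassoc: "\<And>m. m \<in> carrier M \<Longrightarrow> tmap k (tensor k M C) C (coact M) (coact M m) = cdelta M (coact M m)"
    and coact_counit: "\<And>m. m \<in> carrier M \<Longrightarrow> tens_sum M (coact M m) (\<lambda>m0 m1. counit C m1 \<odot>\<^bsub>M\<^esub> m0) = m"
    and coact_ract: "\<And>m a. \<lbrakk>m \<in> carrier M; a \<in> carrier A\<rbrakk> \<Longrightarrow> coact M (ract M m a) = cact M (coact M m) a"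
  using assms unfolding entwined_module_iff by auto

text \<open>Colinearity of \<open>g\<close> follows by applying \<open>g \<otimes> C\<close> to that
  of \<open>f\<close>. Thus an isomorphism has to be checked for compatibility in one direction
  only.\<close>

lemma emod_hom_inverse:
  assumes M: "entwined_module k A C \<psi> M" and N: "entwined_module k A C \<psi> N"
    and f: "f \<in> emod_hom k A C M N"
    and g: "\<And>y. y \<in> carrier N \<Longrightarrow> g y \<in> carrier M"
    and fg: "\<And>y. y \<in> carrier N \<Longrightarrow> f (g y) = y" and gf: "\<And>x. x \<in> carrier M \<Longrightarrow> g (f x) = x"
  shows "restrict g (carrier N) \<in> emod_hom k A C N M"
proof -
  interpret M: right_module k A M by (rule entwined_right[OF M])
  interpret N: right_module k A N by (rule entwined_right[OF N])
  have fl: "linear_map k M N f" and fr: "\<And>m a. m \<in> carrier M \<Longrightarrow> a \<in> carrier A \<Longrightarrow> f (ract M m a) = ract N (f m) a"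
    and fc: "\<And>m. m \<in> carrier M \<Longrightarrow> coact N (f m) = tmap k N C f (coact M m)"
    using f by (auto simp: emod_hom_iff)
  have eq: "g y = x" if "x \<in> carrier M" "f x = y" for x y using that gf by auto
  note [simp] = moduleD(4,5)[OF M.module] moduleD(4,5)[OF N.module] g fg linear_mapD[OF fl] N.ract_closed M.ract_closed
  have gl: "linear_map k N M (restrict g (carrier N))"
    by (intro linear_mapI) (auto intro!: eq)
  have gc: "coact M (g y) = tmap k M C (restrict g (carrier N)) (coact N y)" if y: "y \<in> carrier N" for y
  proof -
    have c: "coact M (g y) \<in> carrier (tensor k M C)" using linear_map_closed[OF coact_linear[OF M]] y by simp
    have "tmap k M C (restrict g (carrier N)) (coact N y) = tmap k M C (restrict g (carrier N)) (tmap k N C f (coact M (g y)))"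
      using fc[of "g y"] y by simp
    also have "\<dots> = tmap k M C (\<lambda>x. restrict g (carrier N) (f x)) (coact M (g y))"
      by (rule tmap_tmap) (rule M.module N.module C.module c fl gl)+
    also have "\<dots> = tmap k M C (\<lambda>x. x) (coact M (g y))"
      by (rule tmap_cong[OF M.module C.module c]) (simp add: gf)
    also have "\<dots> = coact M (g y)" by (rule tmap_id[OF M.module C.module c])
    finally show ?thesis ..
  qed
  show ?thesis unfolding emod_hom_iff
    by (auto simp: gl gc fr intro!: eq)
qed

lemma bemod_hom_inverse:
  assumes M: "bi_entwined_module k A C \<psi> M" and N: "bi_entwined_module k A C \<psi> N"
    and f: "f \<in> bemod_hom k A C M N"
    and g: "\<And>y. y \<in> carrier N \<Longrightarrow> g y \<in> carrier M"
    and fg: "\<And>y. y \<in> carrier N \<Longrightarrow> f (g y) = y" and gf: "\<And>x. x \<in> carrier M \<Longrightarrow> g (f x) = x"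
  shows "restrict g (carrier N) \<in> bemod_hom k A C N M"
proof -
  interpret M: bi_entwined_module k A C \<psi> M by fact
  interpret N: bi_entwined_module k A C \<psi> N by fact
  have f': "f \<in> emod_hom k A C M N"
    and fa: "\<And>m a. m \<in> carrier M \<Longrightarrow> a \<in> carrier A \<Longrightarrow> f (lact M a m) = lact N a (f m)"
    using f by (auto simp: bemod_hom_iff)
  have "g (lact N a y) = lact M a (g y)" if "a \<in> carrier A" "y \<in> carrier N" for a y
    using gf[of "lact M a (g y)"] that by (simp add: fa fg g M.lact_closed)
  then show ?thesis
    using emod_hom_inverse[OF M.entwined_module_axioms N.entwined_module_axioms f' g fg gf]
    by (simp add: bemod_hom_iff N.lact_closed)
qed

end

section \<open>The universal property of the generator of
  \<open>C\<^sup>* \<otimes> A\<close>\<close>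

context entwining_dual_basis
begin

definition unit_DA where "unit_DA = tens k D A \<one>\<^bsub>D\<^esub> \<one>\<^bsub>A\<^esub>"

lemma one_D [lin]: "\<one>\<^bsub>D\<^esub> \<in> carrier D"
proof (rule dualI)
  show "linear_map k C (self_module k) \<one>\<^bsub>D\<^esub>"
    by (rule linear_map_cong[OF C.module C.counit_linear]) (simp add: dual_def)
qed (simp add: dual_def)

lemma unit_DA_closed [lin]: "unit_DA \<in> carrier DA"
  unfolding unit_DA_def by (assumption | rule lin)+

lemma pair_unit: "c \<in> carrier C \<Longrightarrow> pair c unit_DA = counit C c \<odot>\<^bsub>A\<^esub> \<one>\<^bsub>A\<^esub>"
  unfolding unit_DA_def by (subst pair_tens, (assumption | rule lin)+) (simp add: dual_def)

text \<open>By \<open>psi_counit\<close> the generator commutes with \<open>A\<close>. A bimodule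
  map into \<open>A \<otimes> C\<close> therefore sends it into \<open>W1\<close>, and conversely an
  image in \<open>W1\<close> is what makes the induced map left linear.\<close>

lemma dlact_unit:
  assumes b: "b \<in> carrier A"
  shows "dlact b unit_DA = dract unit_DA b"
proof (rule pair_ext)
  note [lin] = b
  show "dlact b unit_DA \<in> carrier DA" "dract unit_DA b \<in> carrier DA" by (assumption | rule lin)+
  fix c assume c [lin]: "c \<in> carrier C"
  have e: "counit C x \<in> carrier k" if "x \<in> carrier C" for x using that by - (rule lin)
  have "pair c (dlact b unit_DA) = tens_sum A (Psi c b) (\<lambda>b' c'. b' \<otimes>\<^bsub>A\<^esub> pair c' unit_DA)"
    by (rule pair_dlact) (assumption | rule lin)+
  also have "\<dots> = tens_sum A (Psi c b) (\<lambda>b' c'. counit C c' \<odot>\<^bsub>A\<^esub> b')"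
    by (rule tens_sum_cong[OF module C.module], (assumption | rule lin)+)
      (simp add: pair_unit smult_mult_right e)
  also have "\<dots> = counit C c \<odot>\<^bsub>A\<^esub> b" by (rule psi_counit[OF b c])
  also have "\<dots> = pair c (dract unit_DA b)"
    by (simp add: pair_dract b c pair_unit smult_mult_left e unit_DA_closed)
  finally show "pair c (dlact b unit_DA) = pair c (dract unit_DA b)" .
qed

text \<open>The coaction of the generator is the canonical element with \<open>1\<close> inserted.
  Hence a colinear map is determined on every \<open>d\<^sub>i\<^sup>* \<otimes> 1\<close> by its
  value at the generator.\<close>

lemma dcoact_unit: "dcoact unit_DA = tens_sum DAC coev (\<lambda>g x. tens k DA C (tens k D A g \<one>\<^bsub>A\<^esub>) x)"
proof (rule pair_C_ext)
  show "dcoact unit_DA \<in> carrier DAC"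
    "tens_sum DAC coev (\<lambda>g x. tens k DA C (tens k D A g \<one>\<^bsub>A\<^esub>) x) \<in> carrier DAC"
    by (assumption | rule lin)+
  fix c assume c [lin]: "c \<in> carrier C"
  let ?p = "tmap k A C (pair c)"
  have "?p (tens_sum DAC coev (\<lambda>g x. tens k DA C (tens k D A g \<one>\<^bsub>A\<^esub>) x))
    = tens_sum AC coev (\<lambda>g x. ?p (tens k DA C (tens k D A g \<one>\<^bsub>A\<^esub>) x))"
    by (rule tens_sum_linear[where h = ?p]) (assumption | rule lin)+
  also have "\<dots> = tens_sum AC coev (\<lambda>g x. g c \<odot>\<^bsub>AC\<^esub> tens k A C \<one>\<^bsub>A\<^esub> x)"
    apply (rule tens_sum_cong[OF D_module C.module], (assumption | rule lin)+)
    apply (subst tmap_tens, (assumption | rule lin)+)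
    apply (subst pair_tens, (assumption | rule lin)+)
    apply (rule linear_map_smult[OF bilin_left[OF bilin_tens]], (assumption | rule lin)+)
    done
  also have "\<dots> = tens k A C \<one>\<^bsub>A\<^esub> c"
    by (rule coev_sum) (assumption | rule lin)+
  also have "\<dots> = Psi c \<one>\<^bsub>A\<^esub>" by (rule psi_one[OF c, symmetric])
  also have "\<dots> = tens_sum AC (comult C c) (\<lambda>c1 c2. counit C c2 \<odot>\<^bsub>AC\<^esub> Psi c1 \<one>\<^bsub>A\<^esub>)"
    by (rule counit_right_sum[symmetric]) (assumption | rule lin)+
  also have "\<dots> = tens_sum AC (comult C c) (\<lambda>c1 c2. Psi c1 (pair c2 unit_DA))"
    apply (rule tens_sum_cong[OF C.module C.module], (assumption | rule lin)+)
    apply (subst pair_unit, (assumption | rule lin)+)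
    apply (rule linear_map_smult[symmetric, of _ A AC "\<lambda>a. Psi c1 a" for c1], (assumption | rule lin)+)
    done
  also have "\<dots> = ?p (dcoact unit_DA)"
    by (rule pair_dcoact[symmetric]) (assumption | rule lin)+
  finally show "?p (dcoact unit_DA) = ?p (tens_sum DAC coev (\<lambda>g x. tens k DA C (tens k D A g \<one>\<^bsub>A\<^esub>) x))" ..
qed

text \<open>The usual left action of the dual algebra on a right comodule.\<close>

definition dact where "dact Y f y = tens_sum Y (coact Y y) (\<lambda>y0 y1. f y1 \<odot>\<^bsub>Y\<^esub> y0)"

definition univ where "univ Y y t = tens_sum Y t (\<lambda>f a. ract Y (dact Y f y) a)"

context
  fixes Y :: "('k, 'q, 'a, 'c, 'z) emod_scheme"
  assumes Y: "entwined_module k A C \<psi> Y"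
begin

lemmas Y_lin = right_module_lin[OF entwined_right[OF Y]] linear_map_closed[OF coact_linear[OF Y]]
  linear_comp[OF coact_linear[OF Y]]

lemma dact_linear_left [lin]:
  assumes "module k X" "linear_map k X D g" "y \<in> carrier Y"
  shows "linear_map k X Y (\<lambda>x. dact Y (g x) y)"
proof -
  have [lin]: "linear_map k X (self_module k) (\<lambda>x. g x c)" if "c \<in> carrier C" for c
    by (rule linear_comp[OF eval_linear[OF that] assms(2)])
  show ?thesis
    unfolding dact_def by (assumption | rule lin Y_lin assms linear_map_closed[OF assms(2)])+
qed

lemma dact_closed [lin]: "f \<in> carrier D \<Longrightarrow> y \<in> carrier Y \<Longrightarrow> dact Y f y \<in> carrier Y"
  unfolding dact_def by (assumption | rule lin Y_lin)+

lemma univ_linear [lin]: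
  "y \<in> carrier Y \<Longrightarrow> linear_map k X DA g \<Longrightarrow> linear_map k X Y (\<lambda>x. univ Y y (g x))"
  unfolding univ_def by (assumption | rule lin Y_lin)+

lemma univ_tens:
  "\<lbrakk>y \<in> carrier Y; f \<in> carrier D; a \<in> carrier A\<rbrakk> \<Longrightarrow> univ Y y (tens k D A f a) = ract Y (dact Y f y) a"
  unfolding univ_def by (rule tens_sum_tens) (assumption | rule lin Y_lin)+

lemma univ_unit:
  assumes y: "y \<in> carrier Y"
  shows "univ Y y unit_DA = y"
proof -
  note [lin] = Y_lin y
  have "dact Y \<one>\<^bsub>D\<^esub> y = tens_sum Y (coact Y y) (\<lambda>y0 y1. counit C y1 \<odot>\<^bsub>Y\<^esub> y0)"
    unfolding dact_def by (rule tens_sum_cong[OF _ C.module], (assumption | rule lin)+) (simp add: dual_def)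
  also have "\<dots> = y" by (rule coact_counit[OF Y y])
  finally have "dact Y \<one>\<^bsub>D\<^esub> y = y" .
  moreover have "univ Y y unit_DA = ract Y (dact Y \<one>\<^bsub>D\<^esub> y) \<one>\<^bsub>A\<^esub>"
    unfolding unit_DA_def by (rule univ_tens) (assumption | rule lin)+
  ultimately show ?thesis
    by (simp add: right_module.ract_one[OF entwined_right[OF Y]] y)
qed

text \<open>Apply \<open>h\<close> to the first factor of \<open>dcoact_unit\<close> and
  \<open>f\<close> to the last: the sum collapses to \<open>h (f \<otimes> 1)\<close>, while by
  colinearity it is the action of \<open>f\<close> on the image of the generator. Right linearity
  extends this to \<open>f \<otimes> a\<close>.\<close>

lemma univ_unique:
  assumes h: "linear_map k DA Y h" and hr: "\<And>t a. \<lbrakk>t \<in> carrier DA; a \<in> carrier A\<rbrakk> \<Longrightarrow> h (dract t a) = ract Y (h t) a"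
    and hc: "\<And>t. t \<in> carrier DA \<Longrightarrow> coact Y (h t) = tmap k Y C h (dcoact t)"
    and t: "t \<in> carrier DA"
  shows "h t = univ Y (h unit_DA) t"
proof (rule linear_ext_tensor[OF _ _ _ _ _ _ t])
  note [lin] = Y_lin h linear_map_closed[OF h] linear_comp[OF h]
  fix f a assume f [lin]: "f \<in> carrier D" and [lin]: "a \<in> carrier A"
  let ?e = "\<lambda>u. tens_sum Y u (\<lambda>y0 y1. f y1 \<odot>\<^bsub>Y\<^esub> y0)"
  have "dact Y f (h unit_DA) = ?e (tmap k Y C h (dcoact unit_DA))"
    unfolding dact_def hc[OF unit_DA_closed] ..
  also have "\<dots> = tens_sum Y (dcoact unit_DA) (\<lambda>x c. f c \<odot>\<^bsub>Y\<^esub> h x)"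
    by (rule tens_sum_tmap) (assumption | rule lin)+
  also have "\<dots> = tens_sum Y coev (\<lambda>g x. tens_sum Y (tens k DA C (tens k D A g \<one>\<^bsub>A\<^esub>) x) (\<lambda>x c. f c \<odot>\<^bsub>Y\<^esub> h x))"
    unfolding dcoact_unit by (rule tens_sum_tens_sum) (assumption | rule lin)+
  also have "\<dots> = tens_sum Y coev (\<lambda>g x. f x \<odot>\<^bsub>Y\<^esub> h (tens k D A g \<one>\<^bsub>A\<^esub>))"
    by (rule tens_sum_cong[OF D_module C.module], (assumption | rule lin)+, rule tens_sum_tens, (assumption | rule lin)+)
  also have "\<dots> = h (tens k D A f \<one>\<^bsub>A\<^esub>)"
    by (rule coev_sum_dual) (assumption | rule lin)+
  finally have 1: "dact Y f (h unit_DA) = h (tens k D A f \<one>\<^bsub>A\<^esub>)" .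
  have "dract (tens k D A f \<one>\<^bsub>A\<^esub>) a = tens k D A f (\<one>\<^bsub>A\<^esub> \<otimes>\<^bsub>A\<^esub> a)"
    unfolding dract_def by (rule tens_sum_tens) (assumption | rule lin)+
  then have "tens k D A f a = dract (tens k D A f \<one>\<^bsub>A\<^esub>) a"
    using \<open>a \<in> carrier A\<close> by simp
  then have "h (tens k D A f a) = ract Y (dact Y f (h unit_DA)) a"
    unfolding 1 by (simp only:) (rule hr, (assumption | rule lin)+)
  also have "\<dots> = univ Y (h unit_DA) (tens k D A f a)"
    by (rule univ_tens[symmetric]) (assumption | rule lin)+
  finally show "h (tens k D A f a) = univ Y (h unit_DA) (tens k D A f a)" .
qed (assumption | rule lin Y_lin h linear_map_closed[OF h])+

lemma univ_ract:
  assumes y: "y \<in> carrier Y" and t: "t \<in> carrier DA" and b: "b \<in> carrier A"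
  shows "univ Y y (dract t b) = ract Y (univ Y y t) b"
proof (rule linear_ext_tensor[OF _ _ _ _ _ _ t])
  note [lin] = Y_lin y b
  fix f a assume f [lin]: "f \<in> carrier D" and a [lin]: "a \<in> carrier A"
  have 1: "dract (tens k D A f a) b = tens k D A f (a \<otimes>\<^bsub>A\<^esub> b)"
    unfolding dract_def by (rule tens_sum_tens) (assumption | rule lin)+
  show "univ Y y (dract (tens k D A f a) b) = ract Y (univ Y y (tens k D A f a)) b"
    unfolding 1 using f a b y by (simp add: univ_tens right_module.ract_mult[OF entwined_right[OF Y]] dact_closed)
qed (assumption | rule lin Y_lin b y)+

text \<open>At \<open>f \<otimes> 1\<close> both sides are the sum of \<open>y0 \<otimes> c1\<close>
  with coefficient \<open>f c2\<close>, where \<open>c1\<close> and \<open>c2\<close> split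
  \<open>y1\<close>: on the left by coassociativity of \<open>Y\<close>, on the right by the
  convolution and the dual basis. The factor \<open>a\<close> is added by
  \<open>coact_ract\<close>.\<close>

lemma univ_coact:
  assumes y: "y \<in> carrier Y" and t: "t \<in> carrier DA"
  shows "coact Y (univ Y y t) = tmap k Y C (univ Y y) (dcoact t)"
proof (rule linear_ext_tensor[OF _ _ _ _ _ _ t])
  note [lin] = Y_lin y entwined_right[OF Y]
  let ?YC = "tensor k Y C"
  fix f a assume f [lin]: "f \<in> carrier D" and a [lin]: "a \<in> carrier A"
  let ?e = "\<lambda>s. tens_sum ?YC s (\<lambda>u e. f e \<odot>\<^bsub>?YC\<^esub> u)"
  have "coact Y (dact Y f y) = tens_sum ?YC (coact Y y) (\<lambda>y0 y1. coact Y (f y1 \<odot>\<^bsub>Y\<^esub> y0))"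
    unfolding dact_def by (rule tens_sum_linear[OF _ _ _ _ coact_linear[OF Y]]) (assumption | rule lin)+
  also have "\<dots> = tens_sum ?YC (coact Y y) (\<lambda>y0 y1. f y1 \<odot>\<^bsub>?YC\<^esub> coact Y y0)"
    by (rule tens_sum_cong[OF _ C.module], (assumption | rule lin)+, rule linear_map_smult[OF coact_linear[OF Y]], (assumption | rule lin)+)
  also have "\<dots> = ?e (tmap k ?YC C (coact Y) (coact Y y))"
    by (rule tens_sum_tmap[symmetric]) (assumption | rule lin coact_linear[OF Y])+
  also have "\<dots> = ?e (cdelta Y (coact Y y))" by (simp add: coact_coassoc[OF Y y])
  also have "\<dots> = tens_sum ?YC (coact Y y) (\<lambda>y0 y1. ?e (tens_sum (tensor k ?YC C) (comult C y1)
      (\<lambda>c1 c2. tens k ?YC C (tens k Y C y0 c1) c2)))"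
    unfolding cdelta_def by (rule tens_sum_linear[where h = ?e]) (assumption | rule lin)+
  also have "\<dots> = tens_sum ?YC (coact Y y) (\<lambda>y0 y1. tens_sum ?YC (comult C y1) (\<lambda>c1 c2. f c2 \<odot>\<^bsub>?YC\<^esub> tens k Y C y0 c1))"
  proof (rule tens_sum_cong[OF _ C.module], (assumption | rule lin)+)
    fix y0 y1 assume [lin]: "y0 \<in> carrier Y" "y1 \<in> carrier C"
    have "?e (tens_sum (tensor k ?YC C) (comult C y1) (\<lambda>c1 c2. tens k ?YC C (tens k Y C y0 c1) c2))
      = tens_sum ?YC (comult C y1) (\<lambda>c1 c2. ?e (tens k ?YC C (tens k Y C y0 c1) c2))"
      by (rule tens_sum_linear[where h = ?e]) (assumption | rule lin)+
    also have "\<dots> = tens_sum ?YC (comult C y1) (\<lambda>c1 c2. f c2 \<odot>\<^bsub>?YC\<^esub> tens k Y C y0 c1)"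
      by (rule tens_sum_cong[OF C.module C.module], (assumption | rule lin)+, rule tens_sum_tens, (assumption | rule lin)+)
    finally show "?e (tens_sum (tensor k ?YC C) (comult C y1) (\<lambda>c1 c2. tens k ?YC C (tens k Y C y0 c1) c2)) = \<dots>" .
  qed
  finally have 1: "coact Y (dact Y f y) = \<dots>" .

  have 2: "dcoact (tens k D A f a) = tens_sum DAC coev (\<lambda>g x. tens_sum DAC (Psi x a)
     (\<lambda>a' c'. tens k DA C (tens k D A (g \<otimes>\<^bsub>D\<^esub> f) a') c'))"
    unfolding dcoact_def by (rule tens_sum_tens) (assumption | rule lin)+
  have "tmap k Y C (univ Y y) (dcoact (tens k D A f a))
    = tens_sum ?YC coev (\<lambda>g x. tmap k Y C (univ Y y) (tens_sum DAC (Psi x a)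
     (\<lambda>a' c'. tens k DA C (tens k D A (g \<otimes>\<^bsub>D\<^esub> f) a') c')))"
    unfolding 2 by (rule tmap_tens_sum) (assumption | rule lin)+
  also have "\<dots> = tens_sum ?YC coev (\<lambda>g x. tens_sum ?YC (Psi x a) (\<lambda>a' c'. tens k Y C (ract Y (dact Y (g \<otimes>\<^bsub>D\<^esub> f) y) a') c'))"
  proof (rule tens_sum_cong[OF D_module C.module], (assumption | rule lin)+)
    fix g x assume [lin]: "g \<in> carrier D" "x \<in> carrier C"
    have "tmap k Y C (univ Y y) (tens_sum DAC (Psi x a) (\<lambda>a' c'. tens k DA C (tens k D A (g \<otimes>\<^bsub>D\<^esub> f) a') c'))
      = tens_sum ?YC (Psi x a) (\<lambda>a' c'. tmap k Y C (univ Y y) (tens k DA C (tens k D A (g \<otimes>\<^bsub>D\<^esub> f) a') c'))"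
      by (rule tmap_tens_sum) (assumption | rule lin)+
    also have "\<dots> = tens_sum ?YC (Psi x a) (\<lambda>a' c'. tens k Y C (ract Y (dact Y (g \<otimes>\<^bsub>D\<^esub> f) y) a') c')"
      apply (rule tens_sum_cong[OF module C.module], (assumption | rule lin)+)
      apply (subst tmap_tens, (assumption | rule lin)+)
      apply (subst univ_tens, (assumption | rule lin HOL.refl)+)
      done
    finally show "tmap k Y C (univ Y y) (tens_sum DAC (Psi x a) (\<lambda>a' c'. tens k DA C (tens k D A (g \<otimes>\<^bsub>D\<^esub> f) a') c')) = \<dots>" .
  qed
  also have "\<dots> = tens_sum ?YC coev (\<lambda>g x. cact Y (tens k Y C (dact Y (g \<otimes>\<^bsub>D\<^esub> f) y) x) a)"
    by (rule tens_sum_cong[OF D_module C.module], (assumption | rule lin)+, rule cact_tens[symmetric], (assumption | rule lin)+)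
  \<comment> \<open>The action of \<open>a\<close> is pulled out of the sum; what is left inside no
    longer mentions \<open>a\<close>.\<close>
  also have "\<dots> = cact Y (tens_sum ?YC coev (\<lambda>g x. tens k Y C (dact Y (g \<otimes>\<^bsub>D\<^esub> f) y) x)) a"
    by (rule tens_sum_linear[where h = "\<lambda>u. cact Y u a", symmetric]) (assumption | rule lin)+
  also have "tens_sum ?YC coev (\<lambda>g x. tens k Y C (dact Y (g \<otimes>\<^bsub>D\<^esub> f) y) x)
    = tens_sum ?YC coev (\<lambda>g x. tens_sum ?YC (coact Y y) (\<lambda>y0 y1. (g \<otimes>\<^bsub>D\<^esub> f) y1 \<odot>\<^bsub>?YC\<^esub> tens k Y C y0 x))"
  proof (rule tens_sum_cong[OF D_module C.module], (assumption | rule lin)+)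
    fix g x assume [lin]: "g \<in> carrier D" "x \<in> carrier C"
    have "tens k Y C (dact Y (g \<otimes>\<^bsub>D\<^esub> f) y) x
      = tens_sum ?YC (coact Y y) (\<lambda>y0 y1. tens k Y C ((g \<otimes>\<^bsub>D\<^esub> f) y1 \<odot>\<^bsub>Y\<^esub> y0) x)"
      unfolding dact_def by (rule tens_sum_linear[where h = "\<lambda>u. tens k Y C u x"]) (assumption | rule lin)+
    also have "\<dots> = tens_sum ?YC (coact Y y) (\<lambda>y0 y1. (g \<otimes>\<^bsub>D\<^esub> f) y1 \<odot>\<^bsub>?YC\<^esub> tens k Y C y0 x)"
      by (rule tens_sum_cong[OF _ C.module], (assumption | rule lin)+,
          rule linear_map_smult[OF bilin_left[OF bilin_tens]], (assumption | rule lin)+)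
    finally show "tens k Y C (dact Y (g \<otimes>\<^bsub>D\<^esub> f) y) x = \<dots>" .
  qed
  \<comment> \<open>As in \<open>pair_dcoact\<close>, the order of summation is changed so that the
    dual basis is contracted for fixed \<open>y0\<close> and \<open>y1\<close>.\<close>
  also have "\<dots> = tens_sum ?YC (coact Y y) (\<lambda>y0 y1. tens_sum ?YC coev (\<lambda>g x. (g \<otimes>\<^bsub>D\<^esub> f) y1 \<odot>\<^bsub>?YC\<^esub> tens k Y C y0 x))"
    by (rule tens_sum_swap) (assumption | rule lin linear_comp[OF eval_linear])+
  also have "\<dots> = tens_sum ?YC (coact Y y) (\<lambda>y0 y1. tens_sum ?YC (comult C y1) (\<lambda>c1 c2. f c2 \<odot>\<^bsub>?YC\<^esub> tens k Y C y0 c1))"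
  proof (rule tens_sum_cong[OF _ C.module], (assumption | rule lin)+)
    fix y0 y1 assume [lin]: "y0 \<in> carrier Y" and y1 [lin]: "y1 \<in> carrier C"
    have "tens_sum ?YC coev (\<lambda>g x. (g \<otimes>\<^bsub>D\<^esub> f) y1 \<odot>\<^bsub>?YC\<^esub> tens k Y C y0 x)
      = tens_sum ?YC coev (\<lambda>g x. tens_sum ?YC (comult C y1) (\<lambda>c1 c2. g c1 \<odot>\<^bsub>?YC\<^esub> (f c2 \<odot>\<^bsub>?YC\<^esub> tens k Y C y0 x)))"
    proof (rule tens_sum_cong[OF D_module C.module], (assumption | rule lin)+)
      fix g x assume [lin]: "g \<in> carrier D" "x \<in> carrier C"
      have "(g \<otimes>\<^bsub>D\<^esub> f) y1 \<odot>\<^bsub>?YC\<^esub> tens k Y C y0 x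
        = tens_sum ?YC (comult C y1) (\<lambda>c1 c2. (g c1 \<odot>\<^bsub>self_module k\<^esub> f c2) \<odot>\<^bsub>?YC\<^esub> tens k Y C y0 x)"
        unfolding conv_apply[OF y1]
        by (rule tens_sum_linear[where h = "\<lambda>u. u \<odot>\<^bsub>?YC\<^esub> tens k Y C y0 x"]) (assumption | rule lin)+
      also have "\<dots> = tens_sum ?YC (comult C y1) (\<lambda>c1 c2. g c1 \<odot>\<^bsub>?YC\<^esub> (f c2 \<odot>\<^bsub>?YC\<^esub> tens k Y C y0 x))"
      proof (rule tens_sum_cong[OF C.module C.module], (assumption | rule lin)+)
        fix c1 c2 assume [lin]: "c1 \<in> carrier C" "c2 \<in> carrier C"
        have "(g c1 \<otimes>\<^bsub>k\<^esub> f c2) \<odot>\<^bsub>?YC\<^esub> tens k Y C y0 x = g c1 \<odot>\<^bsub>?YC\<^esub> (f c2 \<odot>\<^bsub>?YC\<^esub> tens k Y C y0 x)"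
          by (rule module_smult_smult) (assumption | rule lin)+
        then show "(g c1 \<odot>\<^bsub>self_module k\<^esub> f c2) \<odot>\<^bsub>?YC\<^esub> tens k Y C y0 x = g c1 \<odot>\<^bsub>?YC\<^esub> (f c2 \<odot>\<^bsub>?YC\<^esub> tens k Y C y0 x)"
          by (simp add: self_module_def)
      qed
      finally show "(g \<otimes>\<^bsub>D\<^esub> f) y1 \<odot>\<^bsub>?YC\<^esub> tens k Y C y0 x = \<dots>" .
    qed
    also have "\<dots> = tens_sum ?YC (comult C y1) (\<lambda>c1 c2. tens_sum ?YC coev (\<lambda>g x. g c1 \<odot>\<^bsub>?YC\<^esub> (f c2 \<odot>\<^bsub>?YC\<^esub> tens k Y C y0 x)))"
      by (rule tens_sum_swap) (assumption | rule lin)+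
    also have "\<dots> = tens_sum ?YC (comult C y1) (\<lambda>c1 c2. f c2 \<odot>\<^bsub>?YC\<^esub> tens k Y C y0 c1)"
      by (rule tens_sum_cong[OF C.module C.module], (assumption | rule lin)+, rule coev_sum, (assumption | rule lin)+)
    finally show "tens_sum ?YC coev (\<lambda>g x. (g \<otimes>\<^bsub>D\<^esub> f) y1 \<odot>\<^bsub>?YC\<^esub> tens k Y C y0 x) = \<dots>" .
  qed
  also have "\<dots> = coact Y (dact Y f y)" by (rule 1[symmetric])
  also have "cact Y (coact Y (dact Y f y)) a = coact Y (ract Y (dact Y f y) a)"
    by (rule coact_ract[OF Y, symmetric]) (assumption | rule lin)+
  also have "\<dots> = coact Y (univ Y y (tens k D A f a))"
    by (subst univ_tens) (assumption | rule lin HOL.refl)+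
  finally show "coact Y (univ Y y (tens k D A f a)) = tmap k Y C (univ Y y) (dcoact (tens k D A f a))" ..
qed (assumption | rule lin Y_lin y)+

end

end

section \<open>Isomorphisms between \<open>C\<^sup>* \<otimes> A\<close> and \<open>A \<otimes> C\<close>\<close>

context entwining_dual_basis
begin

abbreviation "NA \<equiv> A_tensor_C k A C \<psi>"

lemma univ_NA_linear:
  assumes z: "z \<in> carrier AC"
  shows "linear_map k DA AC (univ NA z)"
  by (rule univ_linear[OF A_tensor_C_entwined, unfolded same_moduleD[OF AC_simps(1)]]) (rule z lin)+

text \<open>Unfolding the coaction of \<open>A \<otimes> C\<close> at \<open>z\<close> gives the
  action of the functional on \<open>z\<close>, which contributes the split \<open>cl\<close>; the
  right action of \<open>a\<close> then supplies the \<open>\<psi>\<close>.\<close>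

lemma phi_univ:
  assumes z: "z \<in> carrier AC" and t: "t \<in> carrier DA"
  shows "phi k A C \<psi> z t = univ NA z t"
proof -
  have sf: "smult NA = smult AC" "ract NA = cact regular" "coact NA = cdelta A"
    using AC_simps(1) by (simp_all add: AC_simps same_module_def)
  note [lin] = z t
  note s = sf same_moduleD[OF AC_simps(1)]
  show ?thesis
    unfolding phi_def univ_def s
  proof (rule tens_sum_cong[OF D_module module t])
    fix f a assume [lin]: "f \<in> carrier D" "a \<in> carrier A"
    let ?e = "\<lambda>u. tens_sum AC u (\<lambda>y e. f e \<odot>\<^bsub>AC\<^esub> y)"
    have "dact NA f z = ?e (cdelta A z)" unfolding dact_def s ..
    also have "\<dots> = tens_sum AC z (\<lambda>al cl. ?e (tens_sum (tensor k AC C) (comult C cl) (\<lambda>c1 c2. tens k AC C (tens k A C al c1) c2)))"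
      unfolding cdelta_def by (rule tens_sum_linear[where h = ?e]) (assumption | rule lin)+
    also have "\<dots> = tens_sum AC z (\<lambda>al cl. tens_sum AC (comult C cl) (\<lambda>c1 c2. ?e (tens k AC C (tens k A C al c1) c2)))"
      by (rule tens_sum_cong[OF module C.module], (assumption | rule lin)+, rule tens_sum_linear[where h = ?e], (assumption | rule lin)+)
    also have "\<dots> = tens_sum AC z (\<lambda>al cl. tens_sum AC (comult C cl) (\<lambda>c1 c2. f c2 \<odot>\<^bsub>AC\<^esub> tens k A C al c1))"
      by (rule tens_sum_cong[OF module C.module], (assumption | rule lin)+, rule tens_sum_cong[OF C.module C.module], (assumption | rule lin)+,
          rule tens_sum_tens, (assumption | rule lin)+)
    finally have 1: "dact NA f z = \<dots>" .
    have "cact regular (dact NA f z) a = tens_sum AC z (\<lambda>al cl. cact regular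
        (tens_sum AC (comult C cl) (\<lambda>c1 c2. f c2 \<odot>\<^bsub>AC\<^esub> tens k A C al c1)) a)"
      unfolding 1 by (rule tens_sum_linear[where h = "\<lambda>u. cact regular u a"]) (assumption | rule lin)+
    also have "\<dots> = tens_sum AC z (\<lambda>al cl. tens_sum AC (comult C cl) (\<lambda>c1 c2. cact regular (f c2 \<odot>\<^bsub>AC\<^esub> tens k A C al c1) a))"
      by (rule tens_sum_cong[OF module C.module], (assumption | rule lin)+,
          rule tens_sum_linear[where h = "\<lambda>u. cact regular u a"], (assumption | rule lin)+)
    also have "\<dots> = tens_sum AC z (\<lambda>al cl. tens_sum AC (comult C cl) (\<lambda>cl1 cl2.
         tens_sum AC (Psi cl1 a) (\<lambda>a' cl1'. tens k A C (al \<otimes>\<^bsub>A\<^esub> a') (f cl2 \<odot>\<^bsub>C\<^esub> cl1'))))"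
    proof (rule tens_sum_cong[OF module C.module], (assumption | rule lin)+, rule tens_sum_cong[OF C.module C.module], (assumption | rule lin)+)
      fix al cl c1 c2 assume [lin]: "al \<in> carrier A" "cl \<in> carrier C" "c1 \<in> carrier C" "c2 \<in> carrier C"
      have "cact regular (f c2 \<odot>\<^bsub>AC\<^esub> tens k A C al c1) a = f c2 \<odot>\<^bsub>AC\<^esub> cact regular (tens k A C al c1) a"
        by (rule linear_map_smult[of k AC AC "\<lambda>u. cact regular u a"]) (assumption | rule lin)+
      also have "cact regular (tens k A C al c1) a = tens_sum AC (Psi c1 a) (\<lambda>a' c'. tens k A C (al \<otimes>\<^bsub>A\<^esub> a') c')"
        by (rule cact_tens[OF regular_right_module, unfolded same_moduleD[OF regular_simps(1)] regular_simps])
          (assumption | rule lin)+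
      also have "f c2 \<odot>\<^bsub>AC\<^esub> \<dots> = tens_sum AC (Psi c1 a) (\<lambda>a' c'. f c2 \<odot>\<^bsub>AC\<^esub> tens k A C (al \<otimes>\<^bsub>A\<^esub> a') c')"
        by (rule tens_sum_linear[where h = "\<lambda>u. f c2 \<odot>\<^bsub>AC\<^esub> u"]) (assumption | rule lin)+
      also have "\<dots> = tens_sum AC (Psi c1 a) (\<lambda>a' cl1'. tens k A C (al \<otimes>\<^bsub>A\<^esub> a') (f c2 \<odot>\<^bsub>C\<^esub> cl1'))"
        by (rule tens_sum_cong[OF module C.module], (assumption | rule lin)+,
            rule linear_map_smult[OF bilin_right[OF bilin_tens], symmetric], (assumption | rule lin)+)
      finally show "cact regular (f c2 \<odot>\<^bsub>AC\<^esub> tens k A C al c1) a = \<dots>" .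
    qed
    finally show "tens_sum AC z (\<lambda>al cl. tens_sum AC (comult C cl) (\<lambda>cl1 cl2.
         tens_sum AC (Psi cl1 a) (\<lambda>a' cl1'. tens k A C (al \<otimes>\<^bsub>A\<^esub> a') (f cl2 \<odot>\<^bsub>C\<^esub> cl1'))))
      = cact regular (dact NA f z) a" ..
  qed
qed

definition phib where
  "phib \<theta> t = tens_sum DA t (\<lambda>a c. tens_sum DA coev (\<lambda>g x. tens_sum DA (Psi x a)
       (\<lambda>a' x'. tens k D A g (a' \<otimes>\<^bsub>A\<^esub> \<theta> (tens k C C x' c)))))"

context
  fixes \<theta> assumes \<theta>: "linear_map k (tensor k C C) A \<theta>"
begin

lemmas theta_lin = linear_map_closed[OF \<theta>] linear_comp[OF \<theta>]

lemma phib_linear [lin]: "linear_map k X AC f \<Longrightarrow> linear_map k X DA (\<lambda>x. phib \<theta> (f x))"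
  unfolding phib_def by (assumption | rule lin theta_lin)+

lemma phib_closed [lin]: "t \<in> carrier AC \<Longrightarrow> phib \<theta> t \<in> carrier DA"
  unfolding phib_def by (assumption | rule lin theta_lin)+

lemma phi_bar_phib:
  assumes t: "t \<in> carrier AC"
  shows "phi_bar k A C \<psi> m d d' \<theta> t = phib \<theta> t"
  unfolding phi_bar_def Let_def phib_def
  apply (rule tens_sum_cong[OF module C.module t])
  apply (rule finsum_coev[where f = "\<lambda>g x. tens_sum DA (Psi x a)
       (\<lambda>a' x'. tens k D A g (a' \<otimes>\<^bsub>A\<^esub> \<theta> (tens k C C x' c)))" for a c])
  apply (assumption | rule lin theta_lin)+
  done

text \<open>The dual basis collapses as in \<open>pair_dlact\<close>: under the pairing, the image
  of \<open>a \<otimes> c\<close> is the left multiple by \<open>a\<close> of the map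
  \<open>\<theta>(- \<otimes> c)\<close>.\<close>

lemma pair_phib:
  assumes [lin]: "a \<in> carrier A" "c \<in> carrier C" "y \<in> carrier C"
  shows "pair y (phib \<theta> (tens k A C a c)) = tens_sum A (Psi y a) (\<lambda>a' y'. a' \<otimes>\<^bsub>A\<^esub> \<theta> (tens k C C y' c))"
proof -
  note [lin] = theta_lin
  let ?F = "\<lambda>x. tens_sum A (Psi x a) (\<lambda>a' x'. a' \<otimes>\<^bsub>A\<^esub> \<theta> (tens k C C x' c))"
  have "pair y (phib \<theta> (tens k A C a c)) = pair y (tens_sum DA coev (\<lambda>g x. tens_sum DA (Psi x a)
       (\<lambda>a' x'. tens k D A g (a' \<otimes>\<^bsub>A\<^esub> \<theta> (tens k C C x' c)))))"
    unfolding phib_def by (subst tens_sum_tens) (assumption | rule lin HOL.refl)+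
  also have "\<dots> = tens_sum A coev (\<lambda>g x. pair y (tens_sum DA (Psi x a)
       (\<lambda>a' x'. tens k D A g (a' \<otimes>\<^bsub>A\<^esub> \<theta> (tens k C C x' c)))))"
    by (rule tens_sum_linear[where h = "pair y"]) (assumption | rule lin)+
  also have "\<dots> = tens_sum A coev (\<lambda>g x. g y \<odot>\<^bsub>A\<^esub> ?F x)"
  proof (rule tens_sum_cong[OF D_module C.module], (assumption | rule lin)+)
    fix g x assume [lin]: "g \<in> carrier D" "x \<in> carrier C"
    have "pair y (tens_sum DA (Psi x a) (\<lambda>a' x'. tens k D A g (a' \<otimes>\<^bsub>A\<^esub> \<theta> (tens k C C x' c))))
      = tens_sum A (Psi x a) (\<lambda>a' x'. pair y (tens k D A g (a' \<otimes>\<^bsub>A\<^esub> \<theta> (tens k C C x' c))))"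
      by (rule tens_sum_linear[where h = "pair y"]) (assumption | rule lin)+
    also have "\<dots> = tens_sum A (Psi x a) (\<lambda>a' x'. g y \<odot>\<^bsub>A\<^esub> (a' \<otimes>\<^bsub>A\<^esub> \<theta> (tens k C C x' c)))"
      by (rule tens_sum_cong[OF module C.module], (assumption | rule lin)+, rule pair_tens, (assumption | rule lin)+)
    also have "\<dots> = g y \<odot>\<^bsub>A\<^esub> ?F x"
      by (rule tens_sum_linear[where h = "\<lambda>u. g y \<odot>\<^bsub>A\<^esub> u", symmetric]) (assumption | rule lin)+
    finally show "pair y (tens_sum DA (Psi x a) (\<lambda>a' x'. tens k D A g (a' \<otimes>\<^bsub>A\<^esub> \<theta> (tens k C C x' c)))) = \<dots>" .
  qed
  also have "\<dots> = ?F y" by (rule coev_sum) (assumption | rule lin)+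
  finally show ?thesis .
qed

end

lemma V1D:
  assumes "\<theta> \<in> V1 k A C \<psi>"
  shows V1_linear: "linear_map k (tensor k C C) A \<theta>"
    and V1_mult: "\<And>c e a. \<lbrakk>c \<in> carrier C; e \<in> carrier C; a \<in> carrier A\<rbrakk> \<Longrightarrow> \<theta> (tens k C C c e) \<otimes>\<^bsub>A\<^esub> a =
        tens_sum A (Psi e a) (\<lambda>a' e'. tens_sum A (Psi c a') (\<lambda>a'' c'. a'' \<otimes>\<^bsub>A\<^esub> \<theta> (tens k C C c' e')))"
    and V1_comult: "\<And>c e. \<lbrakk>c \<in> carrier C; e \<in> carrier C\<rbrakk> \<Longrightarrow>
        tens_sum AC (comult C e) (\<lambda>e1 e2. tens k A C (\<theta> (tens k C C c e1)) e2) =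
        tens_sum AC (comult C c) (\<lambda>c1 c2. Psi c1 (\<theta> (tens k C C c2 e)))"
  using assms by (auto simp: V1_def)

text \<open>\<open>W1\<close> consists of the elements on which the left and the right action of
  \<open>A\<close> on \<open>A \<otimes> C\<close> agree.\<close>

lemma W1_iff:
  "z \<in> W1 k A C \<psi> \<longleftrightarrow> z \<in> carrier AC \<and> (\<forall>a\<in>carrier A. tmap k A C (\<lambda>x. a \<otimes>\<^bsub>A\<^esub> x) z = cact regular z a)"
  by (simp add: W1_def tmap_def cact_def same_moduleD[OF regular_simps(1)] regular_simps)

lemma hom_N_NA:
  assumes f: "f \<in> emod_hom k A C N NA"
  shows "linear_map k DA AC f"
    and "\<And>t a. \<lbrakk>t \<in> carrier DA; a \<in> carrier A\<rbrakk> \<Longrightarrow> f (dract t a) = cact regular (f t) a"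
    and "\<And>t. t \<in> carrier DA \<Longrightarrow> cdelta A (f t) = tmap k AC C f (dcoact t)"
  using f unfolding emod_hom_iff same_moduleD[OF AC_simps(1)] same_moduleD[OF DA_simps(1)] same_tmap[OF AC_simps(1)]
  by (auto simp: AC_simps DA_simps)

lemma hom_NA_N:
  assumes f: "f \<in> emod_hom k A C NA N"
  shows "linear_map k AC DA f"
    and "\<And>t a. \<lbrakk>t \<in> carrier AC; a \<in> carrier A\<rbrakk> \<Longrightarrow> f (cact regular t a) = dract (f t) a"
    and "\<And>t. t \<in> carrier AC \<Longrightarrow> dcoact (f t) = tmap k DA C f (cdelta A t)"
  using f unfolding emod_hom_iff same_moduleD[OF AC_simps(1)] same_moduleD[OF DA_simps(1)] same_tmap[OF DA_simps(1)]
  by (auto simp: AC_simps DA_simps linear_map_closed)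

lemma hom_N_NA_univ:
  assumes f: "f \<in> emod_hom k A C N NA" and t: "t \<in> carrier DA"
  shows "f t = univ NA (f unit_DA) t"
  by (rule univ_unique[OF A_tensor_C_entwined])
    (auto simp: same_moduleD[OF AC_simps(1)] same_tmap[OF AC_simps(1)] AC_simps hom_N_NA[OF f] t)

section \<open>From a bimodule isomorphism to \<open>z\<close> and \<open>\<theta>\<close>\<close>

definition theta where "theta g t = tens_sum A t (\<lambda>c e. pair c (g (tens k A C \<one>\<^bsub>A\<^esub> e)))"

context
  fixes g assumes g: "linear_map k AC DA g"
begin

lemmas g_lin = g linear_map_closed[OF g] linear_comp[OF g]

lemma theta_linear: "linear_map k (tensor k C C) A (theta g)"
  unfolding theta_def by (assumption | rule lin g_lin)+

lemma theta_tens: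
  "\<lbrakk>c \<in> carrier C; e \<in> carrier C\<rbrakk> \<Longrightarrow> theta g (tens k C C c e) = pair c (g (tens k A C \<one>\<^bsub>A\<^esub> e))"
  unfolding theta_def by (rule tens_sum_tens) (assumption | rule lin g_lin)+

text \<open>Left linearity reduces \<open>a \<otimes> c\<close> to \<open>1 \<otimes> c\<close>, and
  \<open>pair_dlact\<close> computes the effect of \<open>a\<close>; the outcome is the formula of
  \<open>pair_phib\<close>.\<close>

lemma pair_hom:
  assumes gl: "\<And>t a. \<lbrakk>t \<in> carrier AC; a \<in> carrier A\<rbrakk> \<Longrightarrow> g (tmap k A C (\<lambda>x. a \<otimes>\<^bsub>A\<^esub> x) t) = dlact a (g t)"
    and [lin]: "a \<in> carrier A" "c \<in> carrier C" "y \<in> carrier C"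
  shows "pair y (g (tens k A C a c)) = tens_sum A (Psi y a) (\<lambda>a' y'. a' \<otimes>\<^bsub>A\<^esub> theta g (tens k C C y' c))"
proof -
  note [lin] = g_lin
  have "tens k A C a c = tens k A C (a \<otimes>\<^bsub>A\<^esub> \<one>\<^bsub>A\<^esub>) c" using assms by simp
  also have "\<dots> = tmap k A C (\<lambda>x. a \<otimes>\<^bsub>A\<^esub> x) (tens k A C \<one>\<^bsub>A\<^esub> c)"
    by (rule tmap_tens[symmetric]) (assumption | rule lin)+
  finally have "g (tens k A C a c) = dlact a (g (tens k A C \<one>\<^bsub>A\<^esub> c))"
    using gl[of "tens k A C \<one>\<^bsub>A\<^esub> c" a] assms by (simp add: tens_closed)
  then have "pair y (g (tens k A C a c)) = pair y (dlact a (g (tens k A C \<one>\<^bsub>A\<^esub> c)))" by simp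
  also have "\<dots> = tens_sum A (Psi y a) (\<lambda>a' y'. a' \<otimes>\<^bsub>A\<^esub> pair y' (g (tens k A C \<one>\<^bsub>A\<^esub> c)))"
    by (rule pair_dlact) (assumption | rule lin)+
  also have "\<dots> = tens_sum A (Psi y a) (\<lambda>a' y'. a' \<otimes>\<^bsub>A\<^esub> theta g (tens k C C y' c))"
    by (rule tens_sum_cong[OF module C.module], (assumption | rule lin)+) (simp add: theta_tens assms)
  finally show ?thesis .
qed

lemma hom_phib:
  assumes gl: "\<And>t a. \<lbrakk>t \<in> carrier AC; a \<in> carrier A\<rbrakk> \<Longrightarrow> g (tmap k A C (\<lambda>x. a \<otimes>\<^bsub>A\<^esub> x) t) = dlact a (g t)"
    and t: "t \<in> carrier AC"
  shows "g t = phib (theta g) t"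
proof (rule linear_ext_tensor[OF _ _ _ _ _ _ t])
  fix a c assume ac: "a \<in> carrier A" "c \<in> carrier C"
  show "g (tens k A C a c) = phib (theta g) (tens k A C a c)"
    using ac by (intro pair_ext)
      (simp_all add: pair_hom[OF gl] pair_phib[OF theta_linear] linear_map_closed[OF g] phib_closed[OF theta_linear] tens_closed)
qed (assumption | rule lin g theta_linear)+

text \<open>The conditions of \<open>V1\<close> are right linearity and colinearity of
  \<open>g\<close> at \<open>1 \<otimes> e\<close>, paired with \<open>c\<close>. In the first,
  \<open>(1 \<otimes> e) a\<close> brings one \<open>\<psi>\<close>, and the left linearity used in
  \<open>pair_hom\<close> brings the other.\<close>

lemma theta_V1:
  assumes gl: "\<And>t a. \<lbrakk>t \<in> carrier AC; a \<in> carrier A\<rbrakk> \<Longrightarrow> g (tmap k A C (\<lambda>x. a \<otimes>\<^bsub>A\<^esub> x) t) = dlact a (g t)"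
    and gr: "\<And>t a. \<lbrakk>t \<in> carrier AC; a \<in> carrier A\<rbrakk> \<Longrightarrow> g (cact regular t a) = dract (g t) a"
    and gc: "\<And>t. t \<in> carrier AC \<Longrightarrow> dcoact (g t) = tmap k DA C g (cdelta A t)"
  shows "theta g \<in> V1 k A C \<psi>"
  unfolding V1_def
proof (intro CollectI conjI ballI theta_linear)
  note [lin] = g_lin theta_linear linear_map_closed[OF theta_linear] linear_comp[OF theta_linear]
  fix c e assume c [lin]: "c \<in> carrier C" and e [lin]: "e \<in> carrier C"
  {
    fix a assume a [lin]: "a \<in> carrier A"
    have "theta g (tens k C C c e) \<otimes>\<^bsub>A\<^esub> a = pair c (g (tens k A C \<one>\<^bsub>A\<^esub> e)) \<otimes>\<^bsub>A\<^esub> a"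
      by (simp add: theta_tens c e)
    also have "\<dots> = pair c (dract (g (tens k A C \<one>\<^bsub>A\<^esub> e)) a)"
      by (rule pair_dract[symmetric]) (assumption | rule lin)+
    also have "\<dots> = pair c (g (cact regular (tens k A C \<one>\<^bsub>A\<^esub> e) a))"
      by (subst gr) (assumption | rule lin HOL.refl)+
    also have "cact regular (tens k A C \<one>\<^bsub>A\<^esub> e) a = tens_sum AC (Psi e a) (\<lambda>a' e'. tens k A C (\<one>\<^bsub>A\<^esub> \<otimes>\<^bsub>A\<^esub> a') e')"
      by (rule cact_tens[OF regular_right_module, unfolded same_moduleD[OF regular_simps(1)] regular_simps])
          (assumption | rule lin)+
    also have "\<dots> = tens_sum AC (Psi e a) (\<lambda>a' e'. tens k A C a' e')"
      by (rule tens_sum_cong[OF module C.module], (assumption | rule lin)+) simp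
    also have "pair c (g \<dots>) = tens_sum A (Psi e a) (\<lambda>a' e'. pair c (g (tens k A C a' e')))"
      by (rule tens_sum_linear[where h = "\<lambda>u. pair c (g u)"]) (assumption | rule lin)+
    also have "\<dots> = tens_sum A (Psi e a) (\<lambda>a' e'. tens_sum A (Psi c a') (\<lambda>a'' c'. a'' \<otimes>\<^bsub>A\<^esub> theta g (tens k C C c' e')))"
      by (rule tens_sum_cong[OF module C.module], (assumption | rule lin)+, rule pair_hom[OF gl], (assumption | rule lin)+)
    finally show "theta g (tens k C C c e) \<otimes>\<^bsub>A\<^esub> a = \<dots>" .
  }
  have "tens_sum AC (comult C e) (\<lambda>e1 e2. tens k A C (theta g (tens k C C c e1)) e2)
    = tens_sum AC (comult C e) (\<lambda>e1 e2. tens k A C (pair c (g (tens k A C \<one>\<^bsub>A\<^esub> e1))) e2)"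
    by (rule tens_sum_cong[OF C.module C.module], (assumption | rule lin)+) (simp add: theta_tens c)
  also have "\<dots> = tens_sum AC (comult C e) (\<lambda>e1 e2. tmap k A C (\<lambda>u. pair c (g u)) (tens k AC C (tens k A C \<one>\<^bsub>A\<^esub> e1) e2))"
    by (rule tens_sum_cong[OF C.module C.module], (assumption | rule lin)+, rule tmap_tens[symmetric], (assumption | rule lin)+)
  also have "\<dots> = tmap k A C (\<lambda>u. pair c (g u)) (tens_sum (tensor k AC C) (comult C e) (\<lambda>e1 e2. tens k AC C (tens k A C \<one>\<^bsub>A\<^esub> e1) e2))"
    by (rule tmap_tens_sum[symmetric]) (assumption | rule lin)+
  also have "\<dots> = tmap k A C (\<lambda>u. pair c (g u)) (cdelta A (tens k A C \<one>\<^bsub>A\<^esub> e))"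
    by (subst cdelta_tens) (assumption | rule lin HOL.refl)+
  also have "\<dots> = tmap k A C (pair c) (tmap k DA C g (cdelta A (tens k A C \<one>\<^bsub>A\<^esub> e)))"
    by (rule tmap_tmap[symmetric]) (assumption | rule lin)+
  also have "\<dots> = tmap k A C (pair c) (dcoact (g (tens k A C \<one>\<^bsub>A\<^esub> e)))"
    by (subst gc) (assumption | rule lin HOL.refl)+
  also have "\<dots> = tens_sum AC (comult C c) (\<lambda>c1 c2. Psi c1 (pair c2 (g (tens k A C \<one>\<^bsub>A\<^esub> e))))"
    by (rule pair_dcoact) (assumption | rule lin)+
  also have "\<dots> = tens_sum AC (comult C c) (\<lambda>c1 c2. Psi c1 (theta g (tens k C C c2 e)))"
    by (rule tens_sum_cong[OF C.module C.module], (assumption | rule lin)+) (simp add: theta_tens e)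
  finally show "tens_sum AC (comult C e) (\<lambda>e1 e2. tens k A C (theta g (tens k C C c e1)) e2)
    = tens_sum AC (comult C c) (\<lambda>c1 c2. Psi c1 (theta g (tens k C C c2 e)))" .
qed

end

lemma inverse_if_iso:
  assumes "bemod_isomorphic k A C \<psi> N NA"
  shows "\<exists>z\<in>W1 k A C \<psi>. \<exists>\<theta>\<in>V1 k A C \<psi>.
        (\<forall>x\<in>carrier DA. phi_bar k A C \<psi> m d d' \<theta> (phi k A C \<psi> z x) = x) \<and>
        (\<forall>y\<in>carrier AC. phi k A C \<psi> z (phi_bar k A C \<psi> m d d' \<theta> y) = y)"
proof -
  obtain f g where f: "f \<in> bemod_hom k A C N NA" and g: "g \<in> bemod_hom k A C NA N"
    and gf: "compose (carrier N) g f = (\<lambda>x\<in>carrier N. x)"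
    and fg: "compose (carrier NA) f g = (\<lambda>y\<in>carrier NA. y)"
    using assms by (auto simp: bemod_isomorphic_def)
  have f': "f \<in> emod_hom k A C N NA" and g': "g \<in> emod_hom k A C NA N"
    using f g by (auto simp: bemod_hom_iff)
  note F = hom_N_NA[OF f'] and G = hom_NA_N[OF g']
  have fl: "f (dlact a t) = tmap k A C (\<lambda>x. a \<otimes>\<^bsub>A\<^esub> x) (f t)" if "a \<in> carrier A" "t \<in> carrier DA" for a t
    using f that by (auto simp: bemod_hom_iff AC_simps DA_simps)
  have gl: "g (tmap k A C (\<lambda>x. a \<otimes>\<^bsub>A\<^esub> x) t) = dlact a (g t)" if "t \<in> carrier AC" "a \<in> carrier A" for a t
    using g that linear_map_closed[OF G(1)] by (auto simp: bemod_hom_iff AC_simps DA_simps)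
  let ?z = "f unit_DA"
  have z: "?z \<in> carrier AC" by (rule linear_map_closed[OF F(1) unit_DA_closed])
  \<comment> \<open>The generator commutes with \<open>A\<close> by \<open>dlact_unit\<close>, and
    \<open>f\<close> respects both actions.\<close>
  have "?z \<in> W1 k A C \<psi>"
    unfolding W1_iff using z by (simp add: fl[symmetric] F(2)[symmetric] unit_DA_closed dlact_unit)
  moreover have "theta g \<in> V1 k A C \<psi>"
    by (rule theta_V1[OF G(1)]) (auto simp: gl G)
  moreover have "phi_bar k A C \<psi> m d d' (theta g) t = g t" if "t \<in> carrier AC" for t
    using that hom_phib[OF G(1) gl that] by (simp add: phi_bar_phib theta_linear[OF G(1)])
  moreover have "phi k A C \<psi> ?z t = f t" if "t \<in> carrier DA" for t
    using that hom_N_NA_univ[OF f' that] by (simp add: phi_univ z)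
  moreover have "g (f x) = x" if "x \<in> carrier DA" for x
    using fun_cong[OF gf, of x] that by (simp add: compose_def DA_simps)
  moreover have "f (g x) = x" if "x \<in> carrier AC" for x
    using fun_cong[OF fg, of x] that by (simp add: compose_def AC_simps)
  ultimately show ?thesis
    using linear_map_closed[OF F(1)] linear_map_closed[OF G(1)]
    by (intro bexI[of _ ?z] bexI[of _ "theta g"]) auto
qed

end

section \<open>The adjunction between the forgetful functor and \<open>\<bullet> \<otimes> C\<close>\<close>

lemma linear_map_restrict:
  assumes "module k M" "linear_map k M P f"
  shows "linear_map k M P (restrict f (carrier M))"
  using assms by (auto simp: linear_map_def Pi_iff moduleD)

lemma rmod_hom_iff:
  "f \<in> rmod_hom k A M N \<longleftrightarrow> f \<in> extensional (carrier M) \<and> linear_map k M N f \<and>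
     (\<forall>m\<in>carrier M. \<forall>a\<in>carrier A. f (ract M m a) = ract N (f m) a)"
  by (auto simp: rmod_hom_def)

lemma rmod_hom_id: "right_module k A M \<Longrightarrow> (\<lambda>x\<in>carrier M. x) \<in> rmod_hom k A M M"
  using right_module_lin[of k A M] by (simp add: rmod_hom_iff linear_map_restrict linear_id)

lemma rmod_hom_comp:
  assumes "right_module k A L" "f \<in> rmod_hom k A L M" "g \<in> rmod_hom k A M N"
  shows "compose (carrier L) g f \<in> rmod_hom k A L N"
  using assms right_module_lin[OF assms(1)]
  by (auto simp: rmod_hom_iff compose_def linear_map_closed intro!: linear_map_restrict intro: linear_comp)

section \<open>The categories and the forgetful functor\<close>

context entwining_structure
begin

lemma emod_hom_rmod: "f \<in> emod_hom k A C M N \<longleftrightarrow> f \<in> rmod_hom k A M N \<and>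
     (\<forall>m\<in>carrier M. coact N (f m) = tmap k N C f (coact M m))"
  by (auto simp: emod_hom_iff rmod_hom_iff)

text \<open>Morphisms are extensional. This rule lets them be given by arbitrary linear functions,
  since restricting to the carrier does not alter \<open>tmap\<close> on the coaction.\<close>

lemma emod_homI:
  assumes M: "entwined_module k A C \<psi> M" and f: "linear_map k M N f"
    and "\<And>x a. \<lbrakk>x \<in> carrier M; a \<in> carrier A\<rbrakk> \<Longrightarrow> f (ract M x a) = ract N (f x) a"
    and "\<And>x. x \<in> carrier M \<Longrightarrow> coact N (f x) = tmap k N C f (coact M x)"
  shows "restrict f (carrier M) \<in> emod_hom k A C M N"
proof -
  note M' = right_module_lin[OF entwined_right[OF M]]
  have "tmap k N C (restrict f (carrier M)) (coact M x) = tmap k N C f (coact M x)" if "x \<in> carrier M" for x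
    by (rule tmap_cong[OF M'(1) C.module linear_map_closed[OF coact_linear[OF M] that]]) simp
  then show ?thesis
    using assms M' by (simp add: emod_hom_iff linear_map_restrict)
qed

lemma emod_hom_id:
  assumes "entwined_module k A C \<psi> M"
  shows "(\<lambda>x\<in>carrier M. x) \<in> emod_hom k A C M M"
  using right_module_lin(1)[OF entwined_right[OF assms]]
  by (intro emod_homI assms linear_id)
    (simp_all add: tmap_id C.module linear_map_closed[OF coact_linear[OF assms]])

lemma emod_hom_comp:
  assumes L: "entwined_module k A C \<psi> L" and M: "entwined_module k A C \<psi> M" and N: "entwined_module k A C \<psi> N"
    and f: "f \<in> emod_hom k A C L M" and g: "g \<in> emod_hom k A C M N"
  shows "compose (carrier L) g f \<in> emod_hom k A C L N"
proof -
  note m = right_module_lin(1)[OF entwined_right[OF L]] right_module_lin(1)[OF entwined_right[OF M]]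
    right_module_lin(1)[OF entwined_right[OF N]]
  have fl: "linear_map k L M f" and gl: "linear_map k M N g" using f g by (auto simp: emod_hom_iff)
  have "tmap k N C g (tmap k M C f (coact L x)) = tmap k N C (\<lambda>x. g (f x)) (coact L x)" if "x \<in> carrier L" for x
    by (rule tmap_tmap[OF m C.module linear_map_closed[OF coact_linear[OF L] that] fl gl])
  then show ?thesis
    unfolding compose_def using f g
    by (intro emod_homI L linear_comp[OF gl fl]) (auto simp: emod_hom_iff linear_map_closed)
qed

lemma rmod_hom_fun:
  assumes "f \<in> rmod_hom k A M N"
  shows "f \<in> carrier M \<rightarrow> carrier N" "f \<in> extensional (carrier M)"
  using assms by (auto simp: rmod_hom_iff linear_map_closed)

lemma rmod_cat: "is_category (rmod_cat k A)"
  by (rule is_category.intro)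
    (simp_all add: rmod_cat_def rmod_hom_id rmod_hom_comp Id_compose[OF rmod_hom_fun]
      compose_Id[OF rmod_hom_fun] compose_assoc[OF rmod_hom_fun(1), symmetric])

lemma emod_hom_fun:
  assumes "f \<in> emod_hom k A C M N"
  shows "f \<in> carrier M \<rightarrow> carrier N" "f \<in> extensional (carrier M)"
  using assms by (auto simp: emod_hom_iff linear_map_closed)

lemma emod_cat: "is_category (emod_cat k A C \<psi>)"
  by (rule is_category.intro)
    (simp_all add: emod_cat_def emod_hom_id emod_hom_comp Id_compose[OF emod_hom_fun]
      compose_Id[OF emod_hom_fun] compose_assoc[OF emod_hom_fun(1), symmetric])

lemma truncate_simps [simp]:
  "carrier (rmod.truncate M) = carrier M" "add (rmod.truncate M) = add M" "zero (rmod.truncate M) = zero M"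
  "smult (rmod.truncate M) = smult M" "ract (rmod.truncate M) = ract M"
  by (simp_all add: rmod.truncate_def rmod.defs)

lemma same_truncate: "same_module (rmod.truncate M) M"
  by (simp add: same_module_def)

lemma right_module_truncate: "right_module k A (rmod.truncate M) = right_module k A M"
  by (rule right_module_cong[OF same_truncate]) simp

lemma rmod_hom_truncate:
  "rmod_hom k A (rmod.truncate M) N = rmod_hom k A M N" "rmod_hom k A L (rmod.truncate M) = rmod_hom k A L M"
  by (auto simp: rmod_hom_iff same_moduleD[OF same_truncate])

lemma forget_functor: "is_functor (emod_cat k A C \<psi>) (rmod_cat k A) forget_functor"
  by (intro is_functor.intro emod_cat rmod_cat is_functor_axioms.intro)
    (auto simp: emod_cat_def rmod_cat_def forget_functor_def right_module_truncate rmod_hom_truncate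
      entwined_right emod_hom_rmod)

text \<open>Every element of \<open>Y\<close> has the form \<open>h x\<close>, so each axiom is the
  image under \<open>h\<close>, or under \<open>h \<otimes> C\<close>, of the axiom for
  \<open>X\<close>. The linear section \<open>h'\<close> supplies the linearity of the structure
  maps of \<open>Y\<close>.\<close>

lemma entwined_module_iso:
  assumes X: "entwined_module k A C \<psi> X" and Y: "module k Y"
    and h: "linear_map k X Y h" and h': "linear_map k Y X h'"
    and hh': "\<And>y. y \<in> carrier Y \<Longrightarrow> h (h' y) = y"
    and r: "\<And>x a. \<lbrakk>x \<in> carrier X; a \<in> carrier A\<rbrakk> \<Longrightarrow> ract Y (h x) a = h (ract X x a)"
    and c: "\<And>x. x \<in> carrier X \<Longrightarrow> coact Y (h x) = tmap k Y C h (coact X x)"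
  shows "entwined_module k A C \<psi> Y"
proof -
  note Xr = entwined_right[OF X]
  note [lin] = right_module_lin[OF Xr] Y h linear_map_closed[OF h] linear_comp[OF h] linear_map_closed[OF h'] linear_comp[OF h']
    linear_map_closed[OF coact_linear[OF X]] linear_comp[OF coact_linear[OF X]]
  interpret X: right_module k A X by (rule Xr)
  have Y_cases: "\<exists>x\<in>carrier X. y = h x" if "y \<in> carrier Y" for y
    using hh'[OF that] linear_map_closed[OF h' that] by metis
  have r': "ract Y y a = h (ract X (h' y) a)" if "y \<in> carrier Y" "a \<in> carrier A" for y a
    using r[OF linear_map_closed[OF h' that(1)] that(2)] hh'[OF that(1)] by simp
  have c': "coact Y y = tmap k Y C h (coact X (h' y))" if "y \<in> carrier Y" for y
    using c[OF linear_map_closed[OF h' that(1)]] hh'[OF that(1)] by simp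
  have Yr: "right_module k A Y"
  proof (rule right_moduleI[OF Y])
    fix a assume a [lin]: "a \<in> carrier A"
    have "linear_map k Y Y (\<lambda>y. h (ract X (h' y) a))" by (assumption | rule lin)+
    then show "linear_map k Y Y (\<lambda>y. ract Y y a)"
      unfolding linear_map_def using a by (auto simp: r' Pi_iff moduleD[OF Y])
  next
    fix y assume y [lin]: "y \<in> carrier Y"
    have "linear_map k A Y (\<lambda>a. h (ract X (h' y) a))" by (assumption | rule lin)+
    then show "linear_map k A Y (\<lambda>a. ract Y y a)"
      unfolding linear_map_def using y by (auto simp: r' Pi_iff moduleD[OF module])
  next
    fix y a b assume "y \<in> carrier Y" "a \<in> carrier A" "b \<in> carrier A"
    then show "ract Y y (a \<otimes>\<^bsub>A\<^esub> b) = ract Y (ract Y y a) b"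
      using Y_cases[of y] by (auto simp: r X.ract_mult X.ract_closed)
  next
    fix y assume "y \<in> carrier Y"
    then show "ract Y y \<one>\<^bsub>A\<^esub> = y"
      using Y_cases[of y] by (auto simp: r X.ract_one)
  qed
  have cl: "linear_map k Y (tensor k Y C) (coact Y)"
  proof -
    have "linear_map k Y (tensor k Y C) (\<lambda>y. tmap k Y C h (coact X (h' y)))" by (assumption | rule lin)+
    then show ?thesis
      unfolding linear_map_def by (auto simp: c' Pi_iff moduleD[OF Y])
  qed
  note [lin] = cl
  show ?thesis
    unfolding entwined_module_iff
  proof (intro conjI Yr cl ballI)
    fix y assume "y \<in> carrier Y"
    then obtain x where x [lin]: "x \<in> carrier X" and y: "y = h x" using Y_cases by blast
    have "tmap k (tensor k Y C) C (coact Y) (tmap k Y C h (coact X x))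
      = tmap k (tensor k Y C) C (\<lambda>x. coact Y (h x)) (coact X x)"
      by (rule tmap_tmap) (assumption | rule lin)+
    also have "\<dots> = tmap k (tensor k Y C) C (\<lambda>x. tmap k Y C h (coact X x)) (coact X x)"
      by (rule tmap_cong[OF X.module C.module], (assumption | rule lin)+) (rule c)
    also have "\<dots> = tmap k (tensor k Y C) C (tmap k Y C h) (tmap k (tensor k X C) C (coact X) (coact X x))"
      by (rule tmap_tmap[symmetric]) (assumption | rule lin coact_linear[OF X])+
    also have "\<dots> = tmap k (tensor k Y C) C (tmap k Y C h) (cdelta X (coact X x))"
      by (simp add: coact_coassoc[OF X x])
    also have "\<dots> = cdelta Y (tmap k Y C h (coact X x))"
      by (rule cdelta_natural[symmetric]) (assumption | rule lin)+
    finally show "tmap k (tensor k Y C) C (coact Y) (coact Y y) = cdelta Y (coact Y y)"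
      by (simp add: y c x)
    have "tens_sum Y (tmap k Y C h (coact X x)) (\<lambda>m0 m1. counit C m1 \<odot>\<^bsub>Y\<^esub> m0)
      = tens_sum Y (coact X x) (\<lambda>m0 m1. counit C m1 \<odot>\<^bsub>Y\<^esub> h m0)"
      by (rule tens_sum_tmap) (assumption | rule lin)+
    also have "\<dots> = tens_sum Y (coact X x) (\<lambda>m0 m1. h (counit C m1 \<odot>\<^bsub>X\<^esub> m0))"
      by (rule tens_sum_cong[OF X.module C.module], (assumption | rule lin)+,
          rule linear_map_smult[OF h, symmetric], (assumption | rule lin)+)
    also have "\<dots> = h (tens_sum X (coact X x) (\<lambda>m0 m1. counit C m1 \<odot>\<^bsub>X\<^esub> m0))"
      by (rule tens_sum_linear[where h = h, symmetric]) (assumption | rule lin)+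
    finally show "tens_sum Y (coact Y y) (\<lambda>m0 m1. counit C m1 \<odot>\<^bsub>Y\<^esub> m0) = y"
      by (simp add: y c x coact_counit[OF X x])
    fix a assume a [lin]: "a \<in> carrier A"
    have "tmap k Y C h (cact X (coact X x) a) = cact Y (tmap k Y C h (coact X x)) a"
      by (rule cact_natural[OF Xr Yr h r[symmetric]]) (assumption | rule lin)+
    then show "coact Y (ract Y y a) = cact Y (coact Y y) a"
      by (simp add: y c r x a X.ract_closed coact_ract[OF X])
  qed
qed

section \<open>Transport of structure along an injective coding\<close>

lemma transport_simps:
  fixes X :: "('k, 'm, 'a, 'c) emod"
  shows "carrier (transport k C e X) = e ` carrier X"
    "ract (transport k C e X) u a = e (ract X (inv_into (carrier X) e u) a)"
    "coact (transport k C e X) u = tmap k (transport k C e X) C e (coact X (inv_into (carrier X) e u))"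
    "u \<oplus>\<^bsub>transport k C e X\<^esub> v = e (inv_into (carrier X) e u \<oplus>\<^bsub>X\<^esub> inv_into (carrier X) e v)"
    "\<zero>\<^bsub>transport k C e X\<^esub> = e \<zero>\<^bsub>X\<^esub>"
    "r \<odot>\<^bsub>transport k C e X\<^esub> u = e (r \<odot>\<^bsub>X\<^esub> inv_into (carrier X) e u)"
proof -
  let ?N = "\<lparr>carrier = e ` carrier X, mult = undefined, one = undefined, zero = e \<zero>\<^bsub>X\<^esub>,
    add = (\<lambda>u v. e (inv_into (carrier X) e u \<oplus>\<^bsub>X\<^esub> inv_into (carrier X) e v)),
    smult = (\<lambda>r u. e (r \<odot>\<^bsub>X\<^esub> inv_into (carrier X) e u))\<rparr>"
  have "same_module (transport k C e X) ?N" by (simp add: same_module_def transport_def Let_def)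
  note s = same_moduleD[OF this]
  show "coact (transport k C e X) u = tmap k (transport k C e X) C e (coact X (inv_into (carrier X) e u))"
    unfolding tmap_def s by (simp add: transport_def Let_def)
qed (simp_all add: transport_def Let_def)

context
  fixes X :: "('k, 'm, 'a, 'c) emod" and e :: "'m \<Rightarrow> 'u"
  assumes e: "inj_on e (carrier X)"
begin

abbreviation "TX \<equiv> transport k C e X"

lemma transport_inv [simp]: "x \<in> carrier X \<Longrightarrow> inv_into (carrier X) e (e x) = x"
  by (rule inv_into_f_f[OF e])

lemma transport_module:
  assumes X: "module k X"
  shows "module k TX"
proof -
  have "abelian_group TX"
  proof (rule abelian_groupI)
    show "u \<oplus>\<^bsub>TX\<^esub> v = v \<oplus>\<^bsub>TX\<^esub> u" if "u \<in> carrier TX" "v \<in> carrier TX" for u v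
      using that unfolding transport_simps by (subst module_comm[OF X]) auto
    show "\<exists>v\<in>carrier TX. v \<oplus>\<^bsub>TX\<^esub> u = \<zero>\<^bsub>TX\<^esub>" if u: "u \<in> carrier TX" for u
    proof -
      obtain x where x: "x \<in> carrier X" "u = e x" using u by (auto simp: transport_simps)
      obtain y where "y \<in> carrier X" "y \<oplus>\<^bsub>X\<^esub> x = \<zero>\<^bsub>X\<^esub>"
        using abelian_groupE(6)[OF module_group[OF X] x(1)] by blast
      then show ?thesis using x by (intro bexI[of _ "e y"]) (auto simp: transport_simps)
    qed
  qed (auto simp: transport_simps module_zero[OF X] module_add[OF X] module_assoc[OF X]
      module_zero_left[OF X])
  then show ?thesis
    by (intro moduleI module_cring[OF X])
      (auto simp: transport_simps module_smult[OF X] module_add_smult[OF X] module_smult_add[OF X]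
        module_smult_smult[OF X] module_one_smult[OF X] module_add[OF X])
qed

lemma transport_linear:
  assumes X: "module k X"
  shows "linear_map k X TX e" "linear_map k TX X (inv_into (carrier X) e)"
  by (intro linear_mapI; auto simp: transport_simps moduleD(3,4,5)[OF X])+

lemma transport_right_module:
  assumes X: "right_module k A X"
  shows "right_module k A TX"
proof (rule right_moduleI)
  interpret X: right_module k A X by fact
  note [simp] = moduleD(4,5)[OF X.module] X.ract_closed
  show "module k TX" by (rule transport_module[OF X.module])
qed (auto intro!: linear_mapI simp: transport_simps right_module.ract_mult[OF X] right_module.ract_one[OF X]
    right_module.ract_closed[OF X] right_module.ract_add_left[OF X] right_module.ract_add_right[OF X]
    right_module.ract_smult_left[OF X] right_module.ract_smult_right[OF X]
    moduleD(4,5)[OF right_module_lin(1)[OF X]])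

lemma transport_entwined:
  assumes X: "entwined_module k A C \<psi> X"
  shows "entwined_module k A C \<psi> TX"
proof -
  have m: "module k X" using right_module_lin(1)[OF entwined_right[OF X]] .
  show ?thesis
    by (rule entwined_module_iso[OF X transport_module[OF m] transport_linear[OF m]])
      (auto simp: transport_simps)
qed

end

end

section \<open>The functor \<open>\<bullet> \<otimes> C\<close> inside the universe\<close>

locale entwining_universe = entwining_structure k A C \<psi>
  for k :: "('k, 'r) ring_scheme"
    and A :: "('k, 'a, 'x) module_scheme"
    and C :: "('k, 'c, 'y) coalgebra_scheme"
    and \<psi> :: "('a, 'c) entwining" +
  fixes \<iota> :: "('u \<times> 'c) list \<Rightarrow> 'u"
  assumes universe_closed: "inj_on \<iota> (lists (UNIV \<times> carrier C))"
begin

abbreviation "enc \<equiv> tens_code \<iota>"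
abbreviation "dec M \<equiv> inv_into (carrier (tensor k M C)) enc"
abbreviation "G M \<equiv> transport k C enc (cofree k A C \<psi> M)"
abbreviation "GF \<equiv> tensor_C_functor k A C \<psi> \<iota>"

text \<open>The chosen representative has its right entries in \<open>carrier C\<close>, so it lies
  where \<open>\<iota>\<close> is injective, and a tensor is the class of any of its
  representatives.\<close>

lemma enc_inj:
  assumes M: "module k M"
  shows "inj_on enc (carrier (tensor k M C))"
proof (rule inj_onI)
  fix s t assume st: "s \<in> carrier (tensor k M C)" "t \<in> carrier (tensor k M C)" "enc s = enc t"
  have rep: "(SOME xs. xs \<in> s) \<in> s \<and> (SOME xs. xs \<in> s) \<in> lists (UNIV \<times> carrier C) \<and>
      s = tens_class k M C (SOME xs. xs \<in> s)"
    if s: "s \<in> carrier (tensor k M C)" for s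
  proof -
    obtain ys where ys: "ys \<in> lists (carrier M \<times> carrier C)" "s = tens_class k M C ys"
      using s by (rule tensor_cases)
    then have "ys \<in> s" by (simp add: tens_class_self)
    then have m: "(SOME xs. xs \<in> s) \<in> s" by (rule someI)
    then have eq: "tens_eq k M C ys (SOME xs. xs \<in> s)" by (simp add: ys tens_class_def)
    have "(SOME xs. xs \<in> s) \<in> lists (carrier M \<times> carrier C)" using tens_eq_lists[OF M C.module eq] by simp
    then have "(SOME xs. xs \<in> s) \<in> lists (UNIV \<times> carrier C)" by auto
    moreover have "s = tens_class k M C (SOME xs. xs \<in> s)"
      using ys(2) tens_class_eq[OF eq] by (rule HOL.trans)
    ultimately show ?thesis using m by blast
  qed
  have "(SOME xs. xs \<in> s) = (SOME xs. xs \<in> t)"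
    by (rule inj_onD[OF universe_closed])
      (use st(3) rep[OF st(1), THEN conjunct2, THEN conjunct1] rep[OF st(2), THEN conjunct2, THEN conjunct1]
        in \<open>simp_all only: tens_code_def\<close>)
  then show "s = t"
    using rep[OF st(1), THEN conjunct2, THEN conjunct2] rep[OF st(2), THEN conjunct2, THEN conjunct2] by metis
qed

context
  fixes M :: "('k, 'u, 'a) rmod"
  assumes M: "right_module k A M"
begin

lemma enc_inj_cofree: "inj_on enc (carrier (cofree k A C \<psi> M))"
  unfolding cofree_simps by (rule enc_inj[OF right_module_lin(1)[OF M]])

lemma dec_enc: "t \<in> carrier (tensor k M C) \<Longrightarrow> dec M (enc t) = t"
  by (rule inv_into_f_f[OF enc_inj[OF right_module_lin(1)[OF M]]])

lemma G_carrier: "carrier (G M) = enc ` carrier (tensor k M C)"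
  by (simp add: transport_simps cofree_simps)

lemma G_cases:
  assumes "u \<in> carrier (G M)"
  obtains t where "t \<in> carrier (tensor k M C)" "u = enc t"
  using assms by (auto simp: G_carrier)

lemma G_entwined: "entwined_module k A C \<psi> (G M)"
  by (rule transport_entwined[OF enc_inj_cofree cofree_entwined[OF M]])

lemma enc_linear: "linear_map k (tensor k M C) (G M) enc"
  and dec_linear: "linear_map k (G M) (tensor k M C) (dec M)"
proof -
  have m: "module k (cofree k A C \<psi> M)"
    using right_module_lin(1)[OF entwined_right[OF cofree_entwined[OF M]]] .
  show "linear_map k (tensor k M C) (G M) enc" "linear_map k (G M) (tensor k M C) (dec M)"
    using transport_linear[OF enc_inj_cofree m] unfolding same_moduleD[OF cofree_simps(1)] cofree_simps by simp_all
qed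

lemma G_ract: "t \<in> carrier (tensor k M C) \<Longrightarrow> ract (G M) (enc t) a = enc (cact M t a)"
  by (simp add: transport_simps cofree_simps dec_enc)

lemma G_coact: "t \<in> carrier (tensor k M C) \<Longrightarrow> coact (G M) (enc t) = tmap k (G M) C enc (cdelta M t)"
  by (simp add: transport_simps(3) cofree_simps dec_enc)

lemma far_enc: "t \<in> carrier (tensor k M C) \<Longrightarrow> far GF M M' f (enc t) = enc (tmap k M' C f t)"
  by (simp add: tensor_C_functor_def dec_enc tmap_def)

lemma far_extensional: "far GF M M' f \<in> extensional (carrier (G M))"
  by (simp add: tensor_C_functor_def G_carrier)

end

text \<open>Naturality of \<open>cact\<close> and \<open>cdelta\<close> in the module, carried
  through the coding.\<close>

lemma far_hom:
  fixes M N :: "('k, 'u, 'a) rmod"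
  assumes M: "right_module k A M" and N: "right_module k A N" and f: "f \<in> rmod_hom k A M N"
  shows "far GF M N f \<in> emod_hom k A C (G M) (G N)"
proof -
  have fl: "linear_map k M N f" and fr: "\<And>x a. \<lbrakk>x \<in> carrier M; a \<in> carrier A\<rbrakk> \<Longrightarrow> f (ract M x a) = ract N (f x) a"
    using f by (auto simp: rmod_hom_iff)
  note [lin] = M N right_module_lin(1)[OF M] right_module_lin(1)[OF N] fl linear_map_closed[OF fl] linear_comp[OF fl]
    enc_linear[OF N] linear_map_closed[OF enc_linear[OF N]] linear_comp[OF enc_linear[OF N]]
    enc_linear[OF M] linear_map_closed[OF enc_linear[OF M]] linear_comp[OF enc_linear[OF M]]
    dec_linear[OF M] linear_map_closed[OF dec_linear[OF M]] linear_comp[OF dec_linear[OF M]]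
    right_module_lin(1)[OF entwined_right[OF G_entwined[OF M]]] right_module_lin(1)[OF entwined_right[OF G_entwined[OF N]]]
  let ?f = "\<lambda>u. enc (tmap k N C f (dec M u))"
  have eq: "far GF M N f = restrict ?f (carrier (G M))"
    by (rule extensionalityI[OF far_extensional[OF M]])
      (auto elim!: G_cases[OF M] simp: far_enc[OF M] dec_enc[OF M] G_carrier[OF M])
  show ?thesis unfolding eq
  proof (rule emod_homI[OF G_entwined[OF M]])
    show "linear_map k (G M) (G N) ?f" by (assumption | rule lin)+
    fix u assume u: "u \<in> carrier (G M)"
    then obtain t where t [lin]: "t \<in> carrier (tensor k M C)" and ut: "u = enc t" by (rule G_cases[OF M])
    have ft [lin]: "tmap k N C f t \<in> carrier (tensor k N C)" by (assumption | rule lin)+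
    show "?f (ract (G M) u a) = ract (G N) (?f u) a" if a: "a \<in> carrier A" for a
      using cact_natural[OF M N fl fr t a] cact_closed[OF M t a] a
      by (simp add: ut G_ract[OF M t] G_ract[OF N ft] dec_enc[OF M] t)
    have "coact (G N) (?f u) = tmap k (G N) C enc (cdelta N (tmap k N C f t))"
      by (simp add: ut dec_enc[OF M t] G_coact[OF N ft])
    also have "\<dots> = tmap k (G N) C enc (tmap k (tensor k N C) C (tmap k N C f) (cdelta M t))"
      by (subst cdelta_natural) (assumption | rule lin HOL.refl)+
    also have "\<dots> = tmap k (G N) C (\<lambda>s. enc (tmap k N C f s)) (cdelta M t)"
      by (rule tmap_tmap) (assumption | rule lin)+
    also have "\<dots> = tmap k (G N) C (\<lambda>s. ?f (enc s)) (cdelta M t)"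
      by (rule tmap_cong[of k "tensor k M C"], (assumption | rule lin)+) (simp add: dec_enc[OF M])
    also have "\<dots> = tmap k (G N) C ?f (tmap k (G M) C enc (cdelta M t))"
      by (rule tmap_tmap[symmetric]) (assumption | rule lin)+
    also have "\<dots> = tmap k (G N) C ?f (coact (G M) u)"
      by (simp add: ut G_coact[OF M t])
    finally show "coact (G N) (?f u) = tmap k (G N) C ?f (coact (G M) u)" .
  qed
qed

lemma G_functor: "is_functor (rmod_cat k A) (emod_cat k A C \<psi>) GF"
proof (intro is_functor.intro emod_cat rmod_cat is_functor_axioms.intro)
  fix L M N :: "('k, 'u, 'a) rmod" and f g
  have fob: "fob GF = (\<lambda>M. G M)" by (simp add: tensor_C_functor_def)
  note [simp] = fob rmod_cat_def emod_cat_def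
  assume "L \<in> Ob (rmod_cat k A)"
  then have L: "right_module k A L" by simp
  show "fob GF L \<in> Ob (emod_cat k A C \<psi>)" using G_entwined[OF L] by simp
  show "far GF L L (Idt (rmod_cat k A) L) = Idt (emod_cat k A C \<psi>) (fob GF L)"
  proof (rule extensionalityI[of _ "carrier (G L)"])
    fix u assume "u \<in> carrier (G L)"
    then obtain t where t: "t \<in> carrier (tensor k L C)" "u = enc t" by (rule G_cases[OF L])
    have "tmap k L C (\<lambda>x\<in>carrier L. x) t = tmap k L C (\<lambda>x. x) t"
      by (rule tmap_cong[OF right_module_lin(1)[OF L] C.module t(1)]) simp
    then show "far GF L L (Idt (rmod_cat k A) L) u = Idt (emod_cat k A C \<psi>) (fob GF L) u"
      using t by (simp add: far_enc[OF L] tmap_id[OF right_module_lin(1)[OF L] C.module] G_carrier[OF L])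
  qed (use far_extensional[OF L] in simp_all)
  assume "M \<in> Ob (rmod_cat k A)"
  then have M: "right_module k A M" by simp
  assume f: "f \<in> Ar (rmod_cat k A) L M"
  then show "far GF L M f \<in> Ar (emod_cat k A C \<psi>) (fob GF L) (fob GF M)"
    using far_hom[OF L M] by simp
  assume "N \<in> Ob (rmod_cat k A)"
  then have N: "right_module k A N" by simp
  assume g: "g \<in> Ar (rmod_cat k A) M N"
  have fl: "linear_map k L M f" and gl: "linear_map k M N g" using f g by (auto simp: rmod_hom_iff)
  note m = right_module_lin(1)[OF L] right_module_lin(1)[OF M] right_module_lin(1)[OF N]
  show "far GF L N (Cmp (rmod_cat k A) L M N g f)
    = Cmp (emod_cat k A C \<psi>) (fob GF L) (fob GF M) (fob GF N) (far GF M N g) (far GF L M f)"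
  proof (rule extensionalityI[of _ "carrier (G L)"])
    fix u assume "u \<in> carrier (G L)"
    then obtain t where t: "t \<in> carrier (tensor k L C)" "u = enc t" by (rule G_cases[OF L])
    have "tmap k N C (compose (carrier L) g f) t = tmap k N C (\<lambda>x. g (f x)) t"
      by (rule tmap_cong[OF m(1) C.module t(1)]) (simp add: compose_def)
    also have "\<dots> = tmap k N C g (tmap k M C f t)"
      by (rule tmap_tmap[symmetric, OF m C.module t(1) fl gl])
    finally show "far GF L N (Cmp (rmod_cat k A) L M N g f) u
      = Cmp (emod_cat k A C \<psi>) (fob GF L) (fob GF M) (fob GF N) (far GF M N g) (far GF L M f) u"
      using t tmap_closed[OF m(1,2) C.module t(1) fl]
      by (simp add: far_enc[OF L] far_enc[OF M] compose_def G_carrier[OF L])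
  qed (use far_extensional[OF L] in \<open>simp_all add: compose_def\<close>)
qed

text \<open>\<open>Y \<otimes> \<epsilon>\<close>, the counit of the adjunction in which the
  coaction is the unit.\<close>

definition ccounit where "ccounit Y s = tens_sum Y s (\<lambda>y c. counit C c \<odot>\<^bsub>Y\<^esub> y)"

lemma ccounit_linear [lin]:
  "\<lbrakk>module k Y; linear_map k X (tensor k Y C) f\<rbrakk> \<Longrightarrow> linear_map k X Y (\<lambda>x. ccounit Y (f x))"
  unfolding ccounit_def by (assumption | rule lin)+

lemma ccounit_tens: "\<lbrakk>module k Y; y \<in> carrier Y; c \<in> carrier C\<rbrakk> \<Longrightarrow> ccounit Y (tens k Y C y c) = counit C c \<odot>\<^bsub>Y\<^esub> y"
  unfolding ccounit_def by (rule tens_sum_tens) (assumption | rule lin)+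

lemma ccounit_tmap:
  assumes "module k X" "module k Y" "linear_map k X Y h" "s \<in> carrier (tensor k X C)"
  shows "ccounit Y (tmap k Y C h s) = h (ccounit X s)"
proof (rule linear_ext_tensor[OF _ _ _ _ _ _ assms(4)])
  note [lin] = assms linear_comp[OF assms(3)] linear_map_closed[OF assms(3)]
  fix x c assume [lin]: "x \<in> carrier X" "c \<in> carrier C"
  have "ccounit Y (tmap k Y C h (tens k X C x c)) = ccounit Y (tens k Y C (h x) c)"
    by (subst tmap_tens) (assumption | rule lin HOL.refl)+
  also have "\<dots> = counit C c \<odot>\<^bsub>Y\<^esub> h x" by (rule ccounit_tens) (assumption | rule lin)+
  also have "\<dots> = h (counit C c \<odot>\<^bsub>X\<^esub> x)" by (rule linear_map_smult[OF assms(3), symmetric]) (assumption | rule lin)+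
  also have "\<dots> = h (ccounit X (tens k X C x c))" by (subst ccounit_tens) (assumption | rule lin HOL.refl)+
  finally show "ccounit Y (tmap k Y C h (tens k X C x c)) = h (ccounit X (tens k X C x c))" .
qed (assumption | rule lin assms linear_comp[OF assms(3)])+

text \<open>Right linearity of the counit of the adjunction rests on
  \<open>psi_counit\<close>.\<close>

lemma ccounit_cact:
  assumes Y: "right_module k A Y" and s: "s \<in> carrier (tensor k Y C)" and a: "a \<in> carrier A"
  shows "ccounit Y (cact Y s a) = ract Y (ccounit Y s) a"
proof (rule linear_ext_tensor[OF _ _ _ _ _ _ s])
  note [lin] = Y a right_module_lin[OF Y]
  fix y c assume [lin]: "y \<in> carrier Y" "c \<in> carrier C"
  have "ccounit Y (cact Y (tens k Y C y c) a) = ccounit Y (tens_sum (tensor k Y C) (Psi c a) (\<lambda>a' c'. tens k Y C (ract Y y a') c'))"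
    by (subst cact_tens) (assumption | rule lin HOL.refl)+
  also have "\<dots> = tens_sum Y (Psi c a) (\<lambda>a' c'. ccounit Y (tens k Y C (ract Y y a') c'))"
    by (rule tens_sum_linear[where h = "ccounit Y"]) (assumption | rule lin)+
  also have "\<dots> = tens_sum Y (Psi c a) (\<lambda>a' c'. counit C c' \<odot>\<^bsub>Y\<^esub> ract Y y a')"
    by (rule tens_sum_cong[OF module C.module], (assumption | rule lin)+, rule ccounit_tens, (assumption | rule lin)+)
  also have "\<dots> = counit C c \<odot>\<^bsub>Y\<^esub> ract Y y a"
    by (rule psi_counit_sum) (assumption | rule lin)+
  also have "\<dots> = ract Y (counit C c \<odot>\<^bsub>Y\<^esub> y) a"
    by (rule right_module.ract_smult_left[OF Y, symmetric]) (assumption | rule lin)+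
  also have "\<dots> = ract Y (ccounit Y (tens k Y C y c)) a"
    by (subst ccounit_tens) (assumption | rule lin HOL.refl)+
  finally show "ccounit Y (cact Y (tens k Y C y c) a) = ract Y (ccounit Y (tens k Y C y c)) a" .
qed (assumption | rule lin Y a right_module_lin[OF Y])+

text \<open>One triangle identity, from the left counit law of \<open>C\<close>; the other is the
  counit axiom of the coaction.\<close>

lemma ccounit_cdelta:
  assumes Y: "module k Y" and s: "s \<in> carrier (tensor k Y C)"
  shows "tmap k Y C (ccounit Y) (cdelta Y s) = s"
proof (rule linear_ext_tensor[OF _ _ _ _ linear_id _ s])
  note [lin] = Y
  fix y c assume y [lin]: "y \<in> carrier Y" and c [lin]: "c \<in> carrier C"
  have "tmap k Y C (ccounit Y) (cdelta Y (tens k Y C y c))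
    = tens_sum (tensor k Y C) (comult C c) (\<lambda>c1 c2. tmap k Y C (ccounit Y) (tens k (tensor k Y C) C (tens k Y C y c1) c2))"
    unfolding cdelta_tens[OF Y y c] by (rule tmap_tens_sum) (assumption | rule lin)+
  also have "\<dots> = tens_sum (tensor k Y C) (comult C c) (\<lambda>c1 c2. counit C c1 \<odot>\<^bsub>tensor k Y C\<^esub> tens k Y C y c2)"
    apply (rule tens_sum_cong[OF C.module C.module], (assumption | rule lin)+)
    apply (subst tmap_tens[of k "tensor k Y C"], (assumption | rule lin)+)
    apply (subst ccounit_tens, (assumption | rule lin)+)
    apply (rule linear_map_smult[OF bilin_left[OF bilin_tens]], (assumption | rule lin)+)
    done
  also have "\<dots> = tens k Y C y c" by (rule counit_left_sum) (assumption | rule lin)+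
  finally show "tmap k Y C (ccounit Y) (cdelta Y (tens k Y C y c)) = tens k Y C y c" .
qed (assumption | rule lin Y)+

lemma forget_left_adjoint: "left_adjoint (emod_cat k A C \<psi>) (rmod_cat k A) forget_functor GF"
proof -
  \<comment> \<open>\<open>\<Phi>\<close> is the coaction followed by \<open>h \<otimes> C\<close>,
    and its inverse \<open>\<Theta>\<close> composes with \<open>Y \<otimes> \<epsilon>\<close>;
    \<open>enc\<close> and \<open>dec\<close> pass between tensors and their codes.\<close>
  define \<Phi> :: "('k, 'u, 'a, 'c) emod \<Rightarrow> ('k, 'u, 'a) rmod \<Rightarrow> ('u \<Rightarrow> 'u) \<Rightarrow> 'u \<Rightarrow> 'u"
    where "\<Phi> X Y h = (\<lambda>x\<in>carrier X. enc (tmap k Y C h (coact X x)))" for X Y h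
  define \<Theta> :: "('k, 'u, 'a, 'c) emod \<Rightarrow> ('k, 'u, 'a) rmod \<Rightarrow> ('u \<Rightarrow> 'u) \<Rightarrow> 'u \<Rightarrow> 'u"
    where "\<Theta> X Y g = (\<lambda>x\<in>carrier X. ccounit Y (dec Y (g x)))" for X Y g
  have fob: "fob GF = (\<lambda>M. G M)" "fob forget_functor = rmod.truncate" "far forget_functor = (\<lambda>M N f. f)"
    by (simp_all add: tensor_C_functor_def forget_functor_def)
  note [simp] = fob rmod_cat_def emod_cat_def rmod_hom_truncate
  have \<Phi>_hom: "\<Phi> X Y h \<in> emod_hom k A C X (G Y)" and \<Theta>\<Phi>: "\<Theta> X Y (\<Phi> X Y h) = h"
    if X: "entwined_module k A C \<psi> X" and Y: "right_module k A Y" and h: "h \<in> rmod_hom k A X Y"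
    for X :: "('k, 'u, 'a, 'c) emod" and Y :: "('k, 'u, 'a) rmod" and h :: "'u \<Rightarrow> 'u"
  proof -
    have hl: "linear_map k X Y h" and hr: "\<And>x a. \<lbrakk>x \<in> carrier X; a \<in> carrier A\<rbrakk> \<Longrightarrow> h (ract X x a) = ract Y (h x) a"
      using h by (auto simp: rmod_hom_iff)
    note Xr = entwined_right[OF X]
    note [lin] = right_module_lin(1)[OF Xr] right_module_lin(1)[OF Y] hl linear_comp[OF hl] linear_map_closed[OF hl]
      coact_linear[OF X] linear_comp[OF coact_linear[OF X]] linear_map_closed[OF coact_linear[OF X]]
      enc_linear[OF Y] linear_map_closed[OF enc_linear[OF Y]] linear_comp[OF enc_linear[OF Y]]
      right_module_lin(1)[OF entwined_right[OF G_entwined[OF Y]]]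
    show "\<Phi> X Y h \<in> emod_hom k A C X (G Y)"
      unfolding \<Phi>_def
    proof (rule emod_homI[OF X])
      show "linear_map k X (G Y) (\<lambda>x. enc (tmap k Y C h (coact X x)))" by (assumption | rule lin)+
      fix x assume x [lin]: "x \<in> carrier X"
      have t [lin]: "tmap k Y C h (coact X x) \<in> carrier (tensor k Y C)" by (assumption | rule lin)+
      show "enc (tmap k Y C h (coact X (ract X x a))) = ract (G Y) (enc (tmap k Y C h (coact X x))) a"
        if a: "a \<in> carrier A" for a
        using cact_natural[OF Xr Y hl hr linear_map_closed[OF coact_linear[OF X] x] a]
        by (simp add: G_ract[OF Y t] coact_ract[OF X x a])
      have "coact (G Y) (enc (tmap k Y C h (coact X x))) = tmap k (G Y) C enc (cdelta Y (tmap k Y C h (coact X x)))"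
        by (rule G_coact[OF Y t])
      also have "\<dots> = tmap k (G Y) C enc (tmap k (tensor k Y C) C (tmap k Y C h) (cdelta X (coact X x)))"
        by (subst cdelta_natural) (assumption | rule lin HOL.refl)+
      also have "\<dots> = tmap k (G Y) C (\<lambda>s. enc (tmap k Y C h s)) (cdelta X (coact X x))"
        by (rule tmap_tmap) (assumption | rule lin)+
      also have "\<dots> = tmap k (G Y) C (\<lambda>s. enc (tmap k Y C h s)) (tmap k (tensor k X C) C (coact X) (coact X x))"
        by (simp add: coact_coassoc[OF X x])
      also have "\<dots> = tmap k (G Y) C (\<lambda>x. enc (tmap k Y C h (coact X x))) (coact X x)"
        by (rule tmap_tmap) (assumption | rule lin)+
      finally show "coact (G Y) (enc (tmap k Y C h (coact X x))) = \<dots>" .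
    qed
    show "\<Theta> X Y (\<Phi> X Y h) = h"
    proof (rule extensionalityI)
      fix x assume x [lin]: "x \<in> carrier X"
      have t [lin]: "tmap k Y C h (coact X x) \<in> carrier (tensor k Y C)" by (assumption | rule lin)+
      have "ccounit Y (tmap k Y C h (coact X x)) = h (ccounit X (coact X x))"
        by (rule ccounit_tmap) (assumption | rule lin)+
      then show "\<Theta> X Y (\<Phi> X Y h) x = h x"
        using coact_counit[OF X x] x by (simp add: \<Theta>_def \<Phi>_def dec_enc[OF Y t] ccounit_def[of X])
    qed (use h in \<open>auto simp: \<Theta>_def rmod_hom_iff\<close>)
  qed
  have \<Theta>_hom: "\<Theta> X Y g \<in> rmod_hom k A X Y" and \<Phi>\<Theta>: "\<Phi> X Y (\<Theta> X Y g) = g"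
    if X: "entwined_module k A C \<psi> X" and Y: "right_module k A Y" and g: "g \<in> emod_hom k A C X (G Y)"
    for X :: "('k, 'u, 'a, 'c) emod" and Y :: "('k, 'u, 'a) rmod" and g :: "'u \<Rightarrow> 'u"
  proof -
    have gl: "linear_map k X (G Y) g" and gr: "\<And>x a. \<lbrakk>x \<in> carrier X; a \<in> carrier A\<rbrakk> \<Longrightarrow> g (ract X x a) = ract (G Y) (g x) a"
      and gc: "\<And>x. x \<in> carrier X \<Longrightarrow> coact (G Y) (g x) = tmap k (G Y) C g (coact X x)"
      using g by (auto simp: emod_hom_iff)
    note Xr = entwined_right[OF X]
    note [lin] = right_module_lin[OF Xr] right_module_lin[OF Y] gl linear_comp[OF gl] linear_map_closed[OF gl]
      coact_linear[OF X] linear_comp[OF coact_linear[OF X]] linear_map_closed[OF coact_linear[OF X]]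
      enc_linear[OF Y] linear_map_closed[OF enc_linear[OF Y]] linear_comp[OF enc_linear[OF Y]]
      dec_linear[OF Y] linear_map_closed[OF dec_linear[OF Y]] linear_comp[OF dec_linear[OF Y]]
      right_module_lin(1)[OF entwined_right[OF G_entwined[OF Y]]]
    have l: "linear_map k X Y (\<lambda>x. ccounit Y (dec Y (g x)))" by (assumption | rule lin)+
    have enc_dec: "enc (dec Y u) = u" if "u \<in> carrier (G Y)" for u
      using that by (elim G_cases[OF Y]) (simp add: dec_enc[OF Y])
    show "\<Theta> X Y g \<in> rmod_hom k A X Y"
    proof -
      have "ccounit Y (dec Y (g (ract X x a))) = ract Y (ccounit Y (dec Y (g x))) a"
        if x [lin]: "x \<in> carrier X" and a [lin]: "a \<in> carrier A" for x a
      proof -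
        obtain t where t: "t \<in> carrier (tensor k Y C)" "g x = enc t"
          using linear_map_closed[OF gl x] by (rule G_cases[OF Y])
        show ?thesis
          using t ccounit_cact[OF Y t(1) a] cact_closed[OF Y t(1) a]
          by (simp add: gr x a G_ract[OF Y] dec_enc[OF Y])
      qed
      then show ?thesis
        using l right_module_lin[OF Xr] by (auto simp: \<Theta>_def rmod_hom_iff linear_map_restrict)
    qed
    show "\<Phi> X Y (\<Theta> X Y g) = g"
    proof (rule extensionalityI)
      fix x assume x [lin]: "x \<in> carrier X"
      have d: "dec Y (g x) \<in> carrier (tensor k Y C)" by (assumption | rule lin)+
      note [lin] = d
      have "tmap k Y C (\<Theta> X Y g) (coact X x) = tmap k Y C (\<lambda>x. ccounit Y (dec Y (g x))) (coact X x)"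
        by (rule tmap_cong[of k X], (assumption | rule lin)+) (simp add: \<Theta>_def)
      also have "\<dots> = tmap k Y C (\<lambda>u. ccounit Y (dec Y u)) (tmap k (G Y) C g (coact X x))"
        by (rule tmap_tmap[symmetric]) (assumption | rule lin)+
      also have "\<dots> = tmap k Y C (\<lambda>u. ccounit Y (dec Y u)) (coact (G Y) (enc (dec Y (g x))))"
        by (simp add: gc x enc_dec linear_map_closed[OF gl])
      also have "\<dots> = tmap k Y C (\<lambda>u. ccounit Y (dec Y u)) (tmap k (G Y) C enc (cdelta Y (dec Y (g x))))"
        by (simp add: G_coact[OF Y d])
      also have "\<dots> = tmap k Y C (\<lambda>s. ccounit Y (dec Y (enc s))) (cdelta Y (dec Y (g x)))"
        by (rule tmap_tmap) (assumption | rule lin)+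
      also have "\<dots> = tmap k Y C (ccounit Y) (cdelta Y (dec Y (g x)))"
        by (rule tmap_cong[of k "tensor k Y C"], (assumption | rule lin)+) (simp add: dec_enc[OF Y])
      also have "\<dots> = dec Y (g x)" by (rule ccounit_cdelta) (assumption | rule lin)+
      finally show "\<Phi> X Y (\<Theta> X Y g) x = g x"
        using x by (simp add: \<Phi>_def enc_dec linear_map_closed[OF gl])
    qed (use g in \<open>auto simp: \<Phi>_def emod_hom_iff\<close>)
  qed
  show ?thesis
    unfolding left_adjoint_def
  proof (intro conjI forget_functor G_functor exI[of _ \<Phi>] ballI)
    fix X :: "('k, 'u, 'a, 'c) emod" and Y :: "('k, 'u, 'a) rmod"
    assume "X \<in> Ob (emod_cat k A C \<psi>)" "Y \<in> Ob (rmod_cat k A)"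
    then have X: "entwined_module k A C \<psi> X" and Y: "right_module k A Y" by simp_all
    note m = right_module_lin(1)[OF entwined_right[OF X]] right_module_lin(1)[OF Y]
    show "bij_betw (\<Phi> X Y) (Ar (rmod_cat k A) (fob forget_functor X) Y) (Ar (emod_cat k A C \<psi>) X (fob GF Y))"
      by (rule bij_betw_byWitness[where f' = "\<Theta> X Y"]) (auto simp: \<Phi>_hom \<Theta>_hom \<Phi>\<Theta> \<Theta>\<Phi> X Y)
    fix h :: "'u \<Rightarrow> 'u" assume "h \<in> Ar (rmod_cat k A) (fob forget_functor X) Y"
    then have h: "h \<in> rmod_hom k A X Y" by simp
    then have hl: "linear_map k X Y h" by (simp add: rmod_hom_iff)
    {
      fix X' :: "('k, 'u, 'a, 'c) emod" and f :: "'u \<Rightarrow> 'u" assume "X' \<in> Ob (emod_cat k A C \<psi>)" and f: "f \<in> Ar (emod_cat k A C \<psi>) X' X"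
      then have X': "entwined_module k A C \<psi> X'" by simp
      have fl: "linear_map k X' X f" and fc: "\<And>x. x \<in> carrier X' \<Longrightarrow> coact X (f x) = tmap k X C f (coact X' x)"
        using f by (auto simp: emod_hom_iff)
      note m' = right_module_lin(1)[OF entwined_right[OF X']]
      have "tmap k Y C (compose (carrier X') h f) (coact X' x) = tmap k Y C h (coact X (f x))" if x: "x \<in> carrier X'" for x
      proof -
        note c = linear_map_closed[OF coact_linear[OF X'] x]
        have "tmap k Y C (compose (carrier X') h f) (coact X' x) = tmap k Y C (\<lambda>x. h (f x)) (coact X' x)"
          by (rule tmap_cong[OF m' C.module c]) (simp add: compose_def)
        also have "\<dots> = tmap k Y C h (tmap k X C f (coact X' x))"
          by (rule tmap_tmap[symmetric, OF m' m C.module c fl hl])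
        finally show ?thesis by (simp add: fc x)
      qed
      then show "\<Phi> X' Y (Cmp (rmod_cat k A) (fob forget_functor X') (fob forget_functor X) Y h (far forget_functor X' X f))
        = Cmp (emod_cat k A C \<psi>) X' X (fob GF Y) (\<Phi> X Y h) f"
        using linear_map_closed[OF fl] by (auto simp: \<Phi>_def compose_def[of _ "restrict _ _"] fun_eq_iff)
    next
      fix Y' :: "('k, 'u, 'a) rmod" and g :: "'u \<Rightarrow> 'u" assume "Y' \<in> Ob (rmod_cat k A)" and g: "g \<in> Ar (rmod_cat k A) Y Y'"
      then have Y': "right_module k A Y'" by simp
      have gl: "linear_map k Y Y' g" using g by (auto simp: rmod_hom_iff)
      note m' = right_module_lin(1)[OF Y']
      have "tmap k Y' C (compose (carrier X) g h) (coact X x) = tmap k Y' C g (tmap k Y C h (coact X x))"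
        and "tmap k Y C h (coact X x) \<in> carrier (tensor k Y C)" if x: "x \<in> carrier X" for x
      proof -
        note c = linear_map_closed[OF coact_linear[OF X] x]
        have "tmap k Y' C (compose (carrier X) g h) (coact X x) = tmap k Y' C (\<lambda>x. g (h x)) (coact X x)"
          by (rule tmap_cong[OF m(1) C.module c]) (simp add: compose_def)
        also have "\<dots> = tmap k Y' C g (tmap k Y C h (coact X x))"
          by (rule tmap_tmap[symmetric, OF m m' C.module c hl gl])
        finally show "tmap k Y' C (compose (carrier X) g h) (coact X x) = tmap k Y' C g (tmap k Y C h (coact X x))" .
        show "tmap k Y C h (coact X x) \<in> carrier (tensor k Y C)" by (rule tmap_closed[OF m C.module c hl])
      qed
      then show "\<Phi> X Y' (Cmp (rmod_cat k A) (fob forget_functor X) Y Y' g h)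
        = Cmp (emod_cat k A C \<psi>) X (fob GF Y) (fob GF Y') (far GF Y Y' g) (\<Phi> X Y h)"
        by (auto simp: \<Phi>_def compose_def[of _ "far _ _ _ _"] fun_eq_iff far_enc[OF Y])
    }
  qed
qed

end

section \<open>The adjunction in the other direction\<close>

context entwining_dual_basis
begin

definition zeta where
  "zeta \<theta> Y s = tens_sum Y s (\<lambda>y c. tens_sum Y (coact Y y) (\<lambda>y0 y1. ract Y y0 (\<theta> (tens k C C y1 c))))"

lemma pair_phib_general:
  assumes \<theta>: "linear_map k (tensor k C C) A \<theta>" and t: "t \<in> carrier AC" and y: "y \<in> carrier C"
  shows "pair y (phib \<theta> t) = tens_sum A t (\<lambda>a c. tens_sum A (Psi y a) (\<lambda>a' y'. a' \<otimes>\<^bsub>A\<^esub> \<theta> (tens k C C y' c)))"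
proof (rule linear_ext_tensor[OF _ _ _ _ _ _ t])
  note [lin] = \<theta> linear_map_closed[OF \<theta>] linear_comp[OF \<theta>] y
  fix a c assume [lin]: "a \<in> carrier A" "c \<in> carrier C"
  have "pair y (phib \<theta> (tens k A C a c)) = tens_sum A (Psi y a) (\<lambda>a' y'. a' \<otimes>\<^bsub>A\<^esub> \<theta> (tens k C C y' c))"
    by (rule pair_phib) (assumption | rule lin)+
  also have "\<dots> = tens_sum A (tens k A C a c) (\<lambda>a c. tens_sum A (Psi y a) (\<lambda>a' y'. a' \<otimes>\<^bsub>A\<^esub> \<theta> (tens k C C y' c)))"
    by (rule tens_sum_tens[symmetric]) (assumption | rule lin)+
  finally show "pair y (phib \<theta> (tens k A C a c)) = \<dots>" .
qed (assumption | rule lin \<theta> linear_map_closed[OF \<theta>] linear_comp[OF \<theta>] y)+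

context
  fixes \<theta> and Y :: "('k, 'q, 'a, 'c, 'z) emod_scheme"
  assumes th: "\<theta> \<in> V1 k A C \<psi>" and Y: "entwined_module k A C \<psi> Y"
begin

lemmas zeta_lin = Y_lin[OF Y] entwined_right[OF Y] coact_linear[OF Y] V1_linear[OF th] theta_lin[OF V1_linear[OF th]]

lemma zeta_linear [lin]:
  "linear_map k X (tensor k Y C) f \<Longrightarrow> linear_map k X Y (\<lambda>x. zeta \<theta> Y (f x))"
  unfolding zeta_def by (assumption | rule lin zeta_lin)+

lemma zeta_tens:
  "\<lbrakk>y \<in> carrier Y; c \<in> carrier C\<rbrakk> \<Longrightarrow> zeta \<theta> Y (tens k Y C y c)
    = tens_sum Y (coact Y y) (\<lambda>y0 y1. ract Y y0 (\<theta> (tens k C C y1 c)))"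
  unfolding zeta_def by (rule tens_sum_tens) (assumption | rule lin zeta_lin)+

text \<open>The coaction of \<open>y a\<close> twists \<open>a\<close> past \<open>y1\<close>. The
  inner sum is then the pairing of \<open>y1\<close> with the image of \<open>a \<otimes> c\<close>
  under \<open>phib \<theta>\<close>, which is the link between \<open>zeta\<close> and
  \<open>phi_bar\<close>.\<close>

lemma zeta_ract_tens:
  assumes y: "y \<in> carrier Y" and a: "a \<in> carrier A" and c: "c \<in> carrier C"
  shows "zeta \<theta> Y (tens k Y C (ract Y y a) c) = tens_sum Y (coact Y y) (\<lambda>y0 y1. ract Y y0
      (tens_sum A (Psi y1 a) (\<lambda>a' y1'. a' \<otimes>\<^bsub>A\<^esub> \<theta> (tens k C C y1' c))))"
proof -
  note [lin] = zeta_lin y a c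
  let ?F = "\<lambda>y0 y1. ract Y y0 (\<theta> (tens k C C y1 c))"
  have "zeta \<theta> Y (tens k Y C (ract Y y a) c) = tens_sum Y (coact Y (ract Y y a)) ?F"
    by (rule zeta_tens) (assumption | rule lin)+
  also have "\<dots> = tens_sum Y (cact Y (coact Y y) a) ?F"
    by (simp add: coact_ract[OF Y y a])
  also have "\<dots> = tens_sum Y (coact Y y) (\<lambda>y0 y1. tens_sum Y (tens_sum (tensor k Y C) (Psi y1 a)
        (\<lambda>a' c'. tens k Y C (ract Y y0 a') c')) ?F)"
    unfolding cact_def by (rule tens_sum_tens_sum) (assumption | rule lin)+
  also have "\<dots> = tens_sum Y (coact Y y) (\<lambda>y0 y1. ract Y y0
      (tens_sum A (Psi y1 a) (\<lambda>a' y1'. a' \<otimes>\<^bsub>A\<^esub> \<theta> (tens k C C y1' c))))"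
  proof (rule tens_sum_cong[OF _ C.module], (assumption | rule lin)+)
    fix y0 y1 assume y0 [lin]: "y0 \<in> carrier Y" and [lin]: "y1 \<in> carrier C"
    have "tens_sum Y (tens_sum (tensor k Y C) (Psi y1 a) (\<lambda>a' c'. tens k Y C (ract Y y0 a') c')) ?F
      = tens_sum Y (Psi y1 a) (\<lambda>a' c'. tens_sum Y (tens k Y C (ract Y y0 a') c') ?F)"
      by (rule tens_sum_tens_sum) (assumption | rule lin)+
    also have "\<dots> = tens_sum Y (Psi y1 a) (\<lambda>a' c'. ract Y (ract Y y0 a') (\<theta> (tens k C C c' c)))"
      by (rule tens_sum_cong[OF module C.module], (assumption | rule lin)+, rule tens_sum_tens, (assumption | rule lin)+)
    also have "\<dots> = tens_sum Y (Psi y1 a) (\<lambda>a' c'. ract Y y0 (a' \<otimes>\<^bsub>A\<^esub> \<theta> (tens k C C c' c)))"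
      by (rule tens_sum_cong[OF module C.module], (assumption | rule lin)+,
          rule right_module.ract_mult[OF entwined_right[OF Y], symmetric], (assumption | rule lin)+)
    also have "\<dots> = ract Y y0 (tens_sum A (Psi y1 a) (\<lambda>a' y1'. a' \<otimes>\<^bsub>A\<^esub> \<theta> (tens k C C y1' c)))"
      by (rule tens_sum_linear[where h = "ract Y y0", symmetric]) (assumption | rule lin)+
    finally show "tens_sum Y (tens_sum (tensor k Y C) (Psi y1 a) (\<lambda>a' c'. tens k Y C (ract Y y0 a') c')) ?F = \<dots>" .
  qed
  finally show ?thesis .
qed

text \<open>The first condition of \<open>V1\<close> is made for this: it absorbs the two twists of
  \<open>b\<close>, past \<open>c\<close> and past \<open>y1\<close>.\<close>

lemma zeta_cact:
  assumes s: "s \<in> carrier (tensor k Y C)" and b: "b \<in> carrier A"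
  shows "zeta \<theta> Y (cact Y s b) = ract Y (zeta \<theta> Y s) b"
proof (rule linear_ext_tensor[OF _ _ _ _ _ _ s])
  note [lin] = zeta_lin b
  fix y c assume [lin]: "y \<in> carrier Y" "c \<in> carrier C"
  have "zeta \<theta> Y (cact Y (tens k Y C y c) b) = zeta \<theta> Y (tens_sum (tensor k Y C) (Psi c b) (\<lambda>b' c'. tens k Y C (ract Y y b') c'))"
    by (subst cact_tens) (assumption | rule lin HOL.refl)+
  also have "\<dots> = tens_sum Y (Psi c b) (\<lambda>b' c'. zeta \<theta> Y (tens k Y C (ract Y y b') c'))"
    by (rule tens_sum_linear[where h = "zeta \<theta> Y"]) (assumption | rule lin)+
  also have "\<dots> = tens_sum Y (Psi c b) (\<lambda>b' c'. tens_sum Y (coact Y y) (\<lambda>y0 y1. ract Y y0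
      (tens_sum A (Psi y1 b') (\<lambda>b'' y1'. b'' \<otimes>\<^bsub>A\<^esub> \<theta> (tens k C C y1' c')))))"
    by (rule tens_sum_cong[OF module C.module], (assumption | rule lin)+, rule zeta_ract_tens, (assumption | rule lin)+)
  also have "\<dots> = tens_sum Y (coact Y y) (\<lambda>y0 y1. tens_sum Y (Psi c b) (\<lambda>b' c'. ract Y y0
      (tens_sum A (Psi y1 b') (\<lambda>b'' y1'. b'' \<otimes>\<^bsub>A\<^esub> \<theta> (tens k C C y1' c')))))"
    by (rule tens_sum_swap) (assumption | rule lin)+
  also have "\<dots> = tens_sum Y (coact Y y) (\<lambda>y0 y1. ract Y (ract Y y0 (\<theta> (tens k C C y1 c))) b)"
  proof (rule tens_sum_cong[OF _ C.module], (assumption | rule lin)+)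
    fix y0 y1 assume y0 [lin]: "y0 \<in> carrier Y" and y1 [lin]: "y1 \<in> carrier C"
    have "tens_sum Y (Psi c b) (\<lambda>b' c'. ract Y y0
      (tens_sum A (Psi y1 b') (\<lambda>b'' y1'. b'' \<otimes>\<^bsub>A\<^esub> \<theta> (tens k C C y1' c'))))
      = ract Y y0 (tens_sum A (Psi c b) (\<lambda>b' c'. tens_sum A (Psi y1 b') (\<lambda>b'' y1'. b'' \<otimes>\<^bsub>A\<^esub> \<theta> (tens k C C y1' c'))))"
      by (rule tens_sum_linear[where h = "ract Y y0", symmetric]) (assumption | rule lin)+
    also have "\<dots> = ract Y y0 (\<theta> (tens k C C y1 c) \<otimes>\<^bsub>A\<^esub> b)"
      by (subst V1_mult[OF th]) (assumption | rule lin HOL.refl)+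
    also have "\<dots> = ract Y (ract Y y0 (\<theta> (tens k C C y1 c))) b"
      by (rule right_module.ract_mult[OF entwined_right[OF Y]]) (assumption | rule lin)+
    finally show "tens_sum Y (Psi c b) (\<lambda>b' c'. ract Y y0
      (tens_sum A (Psi y1 b') (\<lambda>b'' y1'. b'' \<otimes>\<^bsub>A\<^esub> \<theta> (tens k C C y1' c')))) = \<dots>" .
  qed
  also have "\<dots> = ract Y (tens_sum Y (coact Y y) (\<lambda>y0 y1. ract Y y0 (\<theta> (tens k C C y1 c)))) b"
    by (rule tens_sum_linear[where h = "\<lambda>u. ract Y u b", symmetric]) (assumption | rule lin)+
  also have "\<dots> = ract Y (zeta \<theta> Y (tens k Y C y c)) b"
    by (subst zeta_tens) (assumption | rule lin HOL.refl)+
  finally show "zeta \<theta> Y (cact Y (tens k Y C y c) b) = ract Y (zeta \<theta> Y (tens k Y C y c)) b" .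
qed (assumption | rule lin zeta_lin b)+

text \<open>Coassociativity of \<open>Y\<close> splits \<open>y1\<close>, and the second condition
  of \<open>V1\<close> turns this twisted splitting of \<open>y1\<close> into a splitting of
  \<open>c\<close>.\<close>

lemma zeta_coact:
  assumes s: "s \<in> carrier (tensor k Y C)"
  shows "coact Y (zeta \<theta> Y s) = tmap k Y C (zeta \<theta> Y) (cdelta Y s)"
proof (rule linear_ext_tensor[OF _ _ _ _ _ _ s])
  note [lin] = zeta_lin
  let ?YC = "tensor k Y C"
  fix y c assume y [lin]: "y \<in> carrier Y" and c [lin]: "c \<in> carrier C"
  let ?F = "\<lambda>u e. cact Y u (\<theta> (tens k C C e c))"
  have "coact Y (zeta \<theta> Y (tens k Y C y c)) = coact Y (tens_sum Y (coact Y y) (\<lambda>y0 y1. ract Y y0 (\<theta> (tens k C C y1 c))))"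
    by (subst zeta_tens) (assumption | rule lin HOL.refl)+
  also have "\<dots> = tens_sum ?YC (coact Y y) (\<lambda>y0 y1. coact Y (ract Y y0 (\<theta> (tens k C C y1 c))))"
    by (rule tens_sum_linear[where h = "coact Y"]) (assumption | rule lin)+
  also have "\<dots> = tens_sum ?YC (coact Y y) (\<lambda>y0 y1. ?F (coact Y y0) y1)"
    by (rule tens_sum_cong[OF _ C.module], (assumption | rule lin)+, rule coact_ract[OF Y], (assumption | rule lin)+)
  also have "\<dots> = tens_sum ?YC (tmap k ?YC C (coact Y) (coact Y y)) ?F"
    by (rule tens_sum_tmap[symmetric]) (assumption | rule lin)+
  also have "\<dots> = tens_sum ?YC (cdelta Y (coact Y y)) ?F" by (simp add: coact_coassoc[OF Y y])
  also have "\<dots> = tens_sum ?YC (coact Y y) (\<lambda>y0 y1. tens_sum ?YC (tens_sum (tensor k ?YC C) (comult C y1)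
        (\<lambda>c1 c2. tens k ?YC C (tens k Y C y0 c1) c2)) ?F)"
    unfolding cdelta_def by (rule tens_sum_tens_sum) (assumption | rule lin)+
  also have "\<dots> = tens_sum ?YC (coact Y y) (\<lambda>y0 y1. tens_sum ?YC (comult C c)
        (\<lambda>e1 e2. tens k Y C (ract Y y0 (\<theta> (tens k C C y1 e1))) e2))"
  proof (rule tens_sum_cong[OF _ C.module], (assumption | rule lin)+)
    fix y0 y1 assume y0 [lin]: "y0 \<in> carrier Y" and y1 [lin]: "y1 \<in> carrier C"
    have "tens_sum ?YC (tens_sum (tensor k ?YC C) (comult C y1) (\<lambda>c1 c2. tens k ?YC C (tens k Y C y0 c1) c2)) ?F
      = tens_sum ?YC (comult C y1) (\<lambda>c1 c2. tens_sum ?YC (tens k ?YC C (tens k Y C y0 c1) c2) ?F)"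
      by (rule tens_sum_tens_sum) (assumption | rule lin)+
    also have "\<dots> = tens_sum ?YC (comult C y1) (\<lambda>c1 c2. cact Y (tens k Y C y0 c1) (\<theta> (tens k C C c2 c)))"
      by (rule tens_sum_cong[OF C.module C.module], (assumption | rule lin)+, rule tens_sum_tens, (assumption | rule lin)+)
    also have "\<dots> = tens_sum ?YC (comult C y1) (\<lambda>c1 c2. tmap k Y C (ract Y y0) (Psi c1 (\<theta> (tens k C C c2 c))))"
      unfolding tmap_def
      by (rule tens_sum_cong[OF C.module C.module], (assumption | rule lin)+, rule cact_tens, (assumption | rule lin)+)
    also have "\<dots> = tmap k Y C (ract Y y0) (tens_sum AC (comult C y1) (\<lambda>c1 c2. Psi c1 (\<theta> (tens k C C c2 c))))"
      by (rule tmap_tens_sum[symmetric]) (assumption | rule lin)+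
    also have "\<dots> = tmap k Y C (ract Y y0) (tens_sum AC (comult C c) (\<lambda>e1 e2. tens k A C (\<theta> (tens k C C y1 e1)) e2))"
      by (subst V1_comult[OF th]) (assumption | rule lin HOL.refl)+
    also have "\<dots> = tens_sum ?YC (comult C c) (\<lambda>e1 e2. tmap k Y C (ract Y y0) (tens k A C (\<theta> (tens k C C y1 e1)) e2))"
      by (rule tmap_tens_sum) (assumption | rule lin)+
    also have "\<dots> = tens_sum ?YC (comult C c) (\<lambda>e1 e2. tens k Y C (ract Y y0 (\<theta> (tens k C C y1 e1))) e2)"
      by (rule tens_sum_cong[OF C.module C.module], (assumption | rule lin)+, rule tmap_tens, (assumption | rule lin)+)
    finally show "tens_sum ?YC (tens_sum (tensor k ?YC C) (comult C y1) (\<lambda>c1 c2. tens k ?YC C (tens k Y C y0 c1) c2)) ?F = \<dots>" .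
  qed
  also have "\<dots> = tens_sum ?YC (comult C c) (\<lambda>e1 e2. tens_sum ?YC (coact Y y)
        (\<lambda>y0 y1. tens k Y C (ract Y y0 (\<theta> (tens k C C y1 e1))) e2))"
    by (rule tens_sum_swap) (assumption | rule lin)+
  also have "\<dots> = tens_sum ?YC (comult C c) (\<lambda>e1 e2. tmap k Y C (zeta \<theta> Y) (tens k ?YC C (tens k Y C y e1) e2))"
  proof (rule tens_sum_cong[OF C.module C.module], (assumption | rule lin)+)
    fix e1 e2 assume [lin]: "e1 \<in> carrier C" "e2 \<in> carrier C"
    have "tmap k Y C (zeta \<theta> Y) (tens k ?YC C (tens k Y C y e1) e2) = tens k Y C (zeta \<theta> Y (tens k Y C y e1)) e2"
      by (rule tmap_tens) (assumption | rule lin)+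
    also have "\<dots> = tens k Y C (tens_sum Y (coact Y y) (\<lambda>y0 y1. ract Y y0 (\<theta> (tens k C C y1 e1)))) e2"
      by (subst zeta_tens) (assumption | rule lin HOL.refl)+
    also have "\<dots> = tens_sum ?YC (coact Y y) (\<lambda>y0 y1. tens k Y C (ract Y y0 (\<theta> (tens k C C y1 e1))) e2)"
      by (rule tens_sum_linear[where h = "\<lambda>u. tens k Y C u e2"]) (assumption | rule lin)+
    finally show "\<dots> = tmap k Y C (zeta \<theta> Y) (tens k ?YC C (tens k Y C y e1) e2)" ..
  qed
  also have "\<dots> = tmap k Y C (zeta \<theta> Y) (cdelta Y (tens k Y C y c))"
    unfolding cdelta_tens[OF Y_lin(1)[OF Y] y c] by (rule tmap_tens_sum[symmetric]) (assumption | rule lin)+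
  finally show "coact Y (zeta \<theta> Y (tens k Y C y c)) = tmap k Y C (zeta \<theta> Y) (cdelta Y (tens k Y C y c))" .
qed (assumption | rule lin zeta_lin)+

text \<open>The triangle identity at \<open>Y\<close>: by \<open>zeta_ract_tens\<close> the sum over
  \<open>z\<close> is the pairing of \<open>y1\<close> with \<open>phib \<theta> z\<close>, that is
  with the generator, and this returns the counit of \<open>y1\<close>.\<close>

lemma zeta_unit:
  assumes z: "z \<in> carrier AC" and pz: "phib \<theta> z = unit_DA" and y: "y \<in> carrier Y"
  shows "zeta \<theta> Y (tmap k Y C (ract Y y) z) = y"
proof -
  note [lin] = zeta_lin z y
  have "zeta \<theta> Y (tmap k Y C (ract Y y) z) = tens_sum Y z (\<lambda>a c. zeta \<theta> Y (tens k Y C (ract Y y a) c))"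
    unfolding tmap_def by (rule tens_sum_linear[where h = "zeta \<theta> Y"]) (assumption | rule lin)+
  also have "\<dots> = tens_sum Y z (\<lambda>a c. tens_sum Y (coact Y y) (\<lambda>y0 y1. ract Y y0
      (tens_sum A (Psi y1 a) (\<lambda>a' y1'. a' \<otimes>\<^bsub>A\<^esub> \<theta> (tens k C C y1' c)))))"
    by (rule tens_sum_cong[OF module C.module], (assumption | rule lin)+, rule zeta_ract_tens, (assumption | rule lin)+)
  also have "\<dots> = tens_sum Y (coact Y y) (\<lambda>y0 y1. tens_sum Y z (\<lambda>a c. ract Y y0
      (tens_sum A (Psi y1 a) (\<lambda>a' y1'. a' \<otimes>\<^bsub>A\<^esub> \<theta> (tens k C C y1' c)))))"
    by (rule tens_sum_swap) (assumption | rule lin)+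
  also have "\<dots> = tens_sum Y (coact Y y) (\<lambda>y0 y1. counit C y1 \<odot>\<^bsub>Y\<^esub> y0)"
  proof (rule tens_sum_cong[OF _ C.module], (assumption | rule lin)+)
    fix y0 y1 assume y0 [lin]: "y0 \<in> carrier Y" and y1 [lin]: "y1 \<in> carrier C"
    have "tens_sum Y z (\<lambda>a c. ract Y y0 (tens_sum A (Psi y1 a) (\<lambda>a' y1'. a' \<otimes>\<^bsub>A\<^esub> \<theta> (tens k C C y1' c))))
      = ract Y y0 (tens_sum A z (\<lambda>a c. tens_sum A (Psi y1 a) (\<lambda>a' y1'. a' \<otimes>\<^bsub>A\<^esub> \<theta> (tens k C C y1' c))))"
      by (rule tens_sum_linear[where h = "ract Y y0", symmetric]) (assumption | rule lin)+
    also have "\<dots> = ract Y y0 (pair y1 (phib \<theta> z))"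
      by (subst pair_phib_general) (assumption | rule lin HOL.refl)+
    also have "\<dots> = ract Y y0 (counit C y1 \<odot>\<^bsub>A\<^esub> \<one>\<^bsub>A\<^esub>)"
      by (simp add: pz pair_unit y1)
    also have "\<dots> = counit C y1 \<odot>\<^bsub>Y\<^esub> ract Y y0 \<one>\<^bsub>A\<^esub>"
      by (rule right_module.ract_smult_right[OF entwined_right[OF Y]]) (assumption | rule lin)+
    finally show "tens_sum Y z (\<lambda>a c. ract Y y0 (tens_sum A (Psi y1 a) (\<lambda>a' y1'. a' \<otimes>\<^bsub>A\<^esub> \<theta> (tens k C C y1' c))))
      = counit C y1 \<odot>\<^bsub>Y\<^esub> y0"
      by (simp add: right_module.ract_one[OF entwined_right[OF Y]] y0)
  qed
  also have "\<dots> = y" by (rule coact_counit[OF Y y])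
  finally show ?thesis .
qed

end

text \<open>The image of \<open>1 \<otimes> c\<close> under \<open>phib\<close> is
  \<open>\<Sum>\<^sub>i d\<^sub>i\<^sup>* \<otimes> \<theta>(d\<^sub>i \<otimes> c)\<close>. The
  universal map of \<open>z\<close> contracts the dual basis with the last factor of the coaction of
  \<open>z\<close>, which leaves the expression met in \<open>zeta_cofree\<close>.\<close>

lemma univ_phib_one:
  assumes th: "\<theta> \<in> V1 k A C \<psi>" and z: "z \<in> carrier AC" and c: "c \<in> carrier C"
  shows "univ NA z (phib \<theta> (tens k A C \<one>\<^bsub>A\<^esub> c))
    = tens_sum AC (cdelta A z) (\<lambda>s e. cact regular s (\<theta> (tens k C C e c)))"
proof -
  note V = V1_linear[OF th]
  note NAs = same_moduleD[OF AC_simps(1)] AC_simps(2,3,4)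
  have sm: "smult NA = smult AC" using AC_simps(1) by (simp add: same_module_def)
  have crl: "linear_map k X AC (\<lambda>x. cact regular t (f x))"
    if "module k X" "linear_map k X A f" "t \<in> carrier AC" for t f and X :: "('k, 'q, 'z) module_scheme"
    using cact_linear_right[OF regular_right_module that(1,2), unfolded same_moduleD[OF regular_simps(1)], OF that(3)] .
  note [lin] = V theta_lin[OF V] z c univ_NA_linear[OF z] linear_comp[OF univ_NA_linear[OF z]] crl
    cact_closed[OF regular_right_module, unfolded same_moduleD[OF regular_simps(1)]]
  have d: "dact NA g z = tens_sum AC (cdelta A z) (\<lambda>s e. g e \<odot>\<^bsub>AC\<^esub> s)" for g
    unfolding dact_def NAs sm ..
  have "phib \<theta> (tens k A C \<one>\<^bsub>A\<^esub> c) = tens_sum DA coev (\<lambda>g x. tens k D A g (\<theta> (tens k C C x c)))"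
  proof (rule pair_ext)
    fix y assume y [lin]: "y \<in> carrier C"
    have "pair y (phib \<theta> (tens k A C \<one>\<^bsub>A\<^esub> c)) = tens_sum A (Psi y \<one>\<^bsub>A\<^esub>) (\<lambda>a' y'. a' \<otimes>\<^bsub>A\<^esub> \<theta> (tens k C C y' c))"
      by (rule pair_phib) (assumption | rule lin)+
    also have "\<dots> = \<one>\<^bsub>A\<^esub> \<otimes>\<^bsub>A\<^esub> \<theta> (tens k C C y c)" by (rule psi_one_sum) (assumption | rule lin)+
    also have "\<dots> = \<theta> (tens k C C y c)" by (rule R.l_one) (assumption | rule lin)+
    also have "\<dots> = tens_sum A coev (\<lambda>g x. g y \<odot>\<^bsub>A\<^esub> \<theta> (tens k C C x c))"
      by (rule coev_sum[symmetric]) (assumption | rule lin)+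
    also have "\<dots> = tens_sum A coev (\<lambda>g x. pair y (tens k D A g (\<theta> (tens k C C x c))))"
      by (rule tens_sum_cong[OF D_module C.module], (assumption | rule lin)+, rule pair_tens[symmetric], (assumption | rule lin)+)
    also have "\<dots> = pair y (tens_sum DA coev (\<lambda>g x. tens k D A g (\<theta> (tens k C C x c))))"
      by (rule tens_sum_linear[where h = "pair y", symmetric]) (assumption | rule lin)+
    finally show "pair y (phib \<theta> (tens k A C \<one>\<^bsub>A\<^esub> c)) = \<dots>" .
  qed (assumption | rule lin)+
  then have "univ NA z (phib \<theta> (tens k A C \<one>\<^bsub>A\<^esub> c)) = univ NA z (tens_sum DA coev (\<lambda>g x. tens k D A g (\<theta> (tens k C C x c))))"
    by simp
  also have "\<dots> = tens_sum AC coev (\<lambda>g x. univ NA z (tens k D A g (\<theta> (tens k C C x c))))"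
    by (rule tens_sum_linear[where h = "univ NA z"]) (assumption | rule lin)+
  also have "\<dots> = tens_sum AC coev (\<lambda>g x. tens_sum AC (cdelta A z) (\<lambda>s e. g e \<odot>\<^bsub>AC\<^esub> cact regular s (\<theta> (tens k C C x c))))"
  proof (rule tens_sum_cong[OF D_module C.module], (assumption | rule lin)+)
    fix g x assume [lin]: "g \<in> carrier D" "x \<in> carrier C"
    have "univ NA z (tens k D A g (\<theta> (tens k C C x c))) = cact regular (dact NA g z) (\<theta> (tens k C C x c))"
      by (rule univ_tens[OF A_tensor_C_entwined, unfolded NAs]) (assumption | rule lin)+
    also have "\<dots> = tens_sum AC (cdelta A z) (\<lambda>s e. cact regular (g e \<odot>\<^bsub>AC\<^esub> s) (\<theta> (tens k C C x c)))"
      unfolding d by (rule tens_sum_linear[where h = "\<lambda>u. cact regular u (\<theta> (tens k C C x c))"]) (assumption | rule lin)+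
    also have "\<dots> = tens_sum AC (cdelta A z) (\<lambda>s e. g e \<odot>\<^bsub>AC\<^esub> cact regular s (\<theta> (tens k C C x c)))"
      by (rule tens_sum_cong[OF _ C.module], (assumption | rule lin)+,
          rule linear_map_smult[of k AC AC "\<lambda>u. cact regular u b" for b], (assumption | rule lin)+)
    finally show "univ NA z (tens k D A g (\<theta> (tens k C C x c))) = \<dots>" .
  qed
  also have "\<dots> = tens_sum AC (cdelta A z) (\<lambda>s e. tens_sum AC coev (\<lambda>g x. g e \<odot>\<^bsub>AC\<^esub> cact regular s (\<theta> (tens k C C x c))))"
    by (rule tens_sum_swap) (assumption | rule lin)+
  also have "\<dots> = tens_sum AC (cdelta A z) (\<lambda>s e. cact regular s (\<theta> (tens k C C e c)))"
    by (rule tens_sum_cong[OF _ C.module], (assumption | rule lin)+, rule coev_sum, (assumption | rule lin)+)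
  finally show ?thesis .
qed

text \<open>The other triangle identity, composed with a morphism \<open>h\<close> out of
  \<open>X \<otimes> C\<close>. The map \<open>tmap k X C (ract X x)\<close> from
  \<open>A \<otimes> C\<close> to \<open>X \<otimes> C\<close> sends \<open>1 \<otimes> c\<close> to
  \<open>x \<otimes> c\<close>, so the claim reduces to \<open>A \<otimes> C\<close>, where it is
  the assumption \<open>one\<close>.\<close>

lemma zeta_cofree:
  fixes X :: "('k, 'q, 'a, 'z) rmod_scheme"
  assumes th: "\<theta> \<in> V1 k A C \<psi>" and z: "z \<in> carrier AC"
    and one: "\<And>c. c \<in> carrier C \<Longrightarrow> univ NA z (phib \<theta> (tens k A C \<one>\<^bsub>A\<^esub> c)) = tens k A C \<one>\<^bsub>A\<^esub> c"
    and X: "right_module k A X" and Y: "entwined_module k A C \<psi> Y"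
    and h: "linear_map k (tensor k X C) Y h"
    and hr: "\<And>t a. \<lbrakk>t \<in> carrier (tensor k X C); a \<in> carrier A\<rbrakk> \<Longrightarrow> h (cact X t a) = ract Y (h t) a"
    and hc: "\<And>t. t \<in> carrier (tensor k X C) \<Longrightarrow> coact Y (h t) = tmap k Y C h (cdelta X t)"
    and t: "t \<in> carrier (tensor k X C)"
  shows "zeta \<theta> Y (tmap k Y C (\<lambda>x. h (tmap k X C (ract X x) z)) t) = h t"
proof (rule linear_ext_tensor[OF _ _ _ _ _ _ t])
  note V = V1_linear[OF th]
  have crl: "linear_map k X' AC (\<lambda>x. cact regular t (f x))"
    if "module k X'" "linear_map k X' A f" "t \<in> carrier AC" for t f and X' :: "('k, 'q2, 'z2) module_scheme"
    using cact_linear_right[OF regular_right_module that(1,2), unfolded same_moduleD[OF regular_simps(1)], OF that(3)] .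
  note [lin] = V theta_lin[OF V] z right_module_lin[OF X] X Y zeta_lin[OF th Y] h linear_map_closed[OF h] linear_comp[OF h]
    crl cact_closed[OF regular_right_module, unfolded same_moduleD[OF regular_simps(1)]] zeta_linear[OF th Y]
  show "linear_map k (tensor k X C) Y (\<lambda>t. zeta \<theta> Y (tmap k Y C (\<lambda>x. h (tmap k X C (ract X x) z)) t))"
    by (assumption | rule lin)+
  fix x c assume x [lin]: "x \<in> carrier X" and c [lin]: "c \<in> carrier C"
  let ?XC = "tensor k X C"
  let ?e = "tmap k X C (ract X x)"
  have "zeta \<theta> Y (tmap k Y C (\<lambda>x. h (tmap k X C (ract X x) z)) (tens k X C x c)) = zeta \<theta> Y (tens k Y C (h (?e z)) c)"
    by (subst tmap_tens[of k X]) (assumption | rule lin HOL.refl)+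
  also have "\<dots> = tens_sum Y (coact Y (h (?e z))) (\<lambda>y0 y1. ract Y y0 (\<theta> (tens k C C y1 c)))"
    by (rule zeta_tens[OF th Y]) (assumption | rule lin)+
  also have "\<dots> = tens_sum Y (tmap k Y C h (cdelta X (?e z))) (\<lambda>y0 y1. ract Y y0 (\<theta> (tens k C C y1 c)))"
    by (subst hc) (assumption | rule lin HOL.refl)+
  also have "\<dots> = tens_sum Y (cdelta X (?e z)) (\<lambda>s e. ract Y (h s) (\<theta> (tens k C C e c)))"
    by (rule tens_sum_tmap) (assumption | rule lin)+
  also have "\<dots> = tens_sum Y (cdelta X (?e z)) (\<lambda>s e. h (cact X s (\<theta> (tens k C C e c))))"
    by (rule tens_sum_cong[OF _ C.module], (assumption | rule lin)+, rule hr[symmetric], (assumption | rule lin)+)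
  also have "\<dots> = h (tens_sum ?XC (cdelta X (?e z)) (\<lambda>s e. cact X s (\<theta> (tens k C C e c))))"
    by (rule tens_sum_linear[where h = h, symmetric]) (assumption | rule lin)+
  \<comment> \<open>By naturality the coaction is computed at \<open>z\<close> in
    \<open>A \<otimes> C\<close>, before \<open>A\<close> is mapped to \<open>X\<close>.\<close>
  also have "cdelta X (?e z) = tmap k ?XC C ?e (cdelta A z)"
    by (rule cdelta_natural) (assumption | rule lin)+
  also have "tens_sum ?XC (tmap k ?XC C ?e (cdelta A z)) (\<lambda>s e. cact X s (\<theta> (tens k C C e c)))
    = tens_sum ?XC (cdelta A z) (\<lambda>s e. cact X (?e s) (\<theta> (tens k C C e c)))"
    by (rule tens_sum_tmap) (assumption | rule lin)+
  also have "\<dots> = tens_sum ?XC (cdelta A z) (\<lambda>s e. ?e (cact regular s (\<theta> (tens k C C e c))))"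
  proof (rule tens_sum_cong[OF _ C.module], (assumption | rule lin)+)
    fix s e assume s [lin]: "s \<in> carrier AC" and [lin]: "e \<in> carrier C"
    have "linear_map k A X (ract X x)" "\<theta> (tens k C C e c) \<in> carrier A" by (assumption | rule lin)+
    from cact_natural[OF regular_right_module X, unfolded same_moduleD[OF regular_simps(1)] regular_simps, OF this(1) _ s this(2)]
    show "cact X (?e s) (\<theta> (tens k C C e c)) = ?e (cact regular s (\<theta> (tens k C C e c)))"
      by (simp add: right_module.ract_mult[OF X x])
  qed
  also have "\<dots> = ?e (tens_sum AC (cdelta A z) (\<lambda>s e. cact regular s (\<theta> (tens k C C e c))))"
    by (rule tmap_tens_sum[symmetric]) (assumption | rule lin)+
  also have "\<dots> = ?e (tens k A C \<one>\<^bsub>A\<^esub> c)"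
    by (simp add: univ_phib_one[OF th z c, symmetric] one c)
  also have "\<dots> = tens k X C (ract X x \<one>\<^bsub>A\<^esub>) c"
    by (rule tmap_tens) (assumption | rule lin)+
  also have "\<dots> = tens k X C x c" by (simp add: right_module.ract_one[OF X x])
  finally show "zeta \<theta> Y (tmap k Y C (\<lambda>x. h (tmap k X C (ract X x) z)) (tens k X C x c)) = h (tens k X C x c)" .
qed (assumption | rule lin h right_module_lin[OF X] Y_lin[OF Y])+

end

section \<open>The adjunction defined by \<open>z\<close> and \<open>\<theta>\<close>\<close>

locale entwining_frobenius =
  entwining_dual_basis k A C \<psi> m d d' + entwining_universe k A C \<psi> \<iota>
  for k :: "('k, 'r) ring_scheme"
    and A :: "('k, 'a, 'x) module_scheme"
    and C :: "('k, 'c, 'y) coalgebra_scheme"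
    and \<psi> :: "('a, 'c) entwining"
    and m d d'
    and \<iota> :: "('u \<times> 'c) list \<Rightarrow> 'u"
begin

lemma G_left_adjoint:
  assumes zW: "z \<in> W1 k A C \<psi>" and th: "\<theta> \<in> V1 k A C \<psi>"
    and inv: "\<And>x. x \<in> carrier DA \<Longrightarrow> phi_bar k A C \<psi> m d d' \<theta> (phi k A C \<psi> z x) = x"
      "\<And>y. y \<in> carrier AC \<Longrightarrow> phi k A C \<psi> z (phi_bar k A C \<psi> m d d' \<theta> y) = y"
  shows "left_adjoint (rmod_cat k A) (emod_cat k A C \<psi>) GF forget_functor"
proof -
  note V = V1_linear[OF th]
  have z: "z \<in> carrier AC" and zw: "\<And>a. a \<in> carrier A \<Longrightarrow> tmap k A C (\<lambda>x. a \<otimes>\<^bsub>A\<^esub> x) z = cact regular z a"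
    using zW by (auto simp: W1_iff)
  \<comment> \<open>At the generator and at the elements \<open>1 \<otimes> c\<close>, the two
    inverse laws become the inputs \<open>pz\<close> and \<open>one\<close> of the triangle
    identities.\<close>
  have uz: "univ NA z unit_DA = z"
    by (rule univ_unit[OF A_tensor_C_entwined]) (simp add: AC_simps z)
  have pz: "phib \<theta> z = unit_DA"
    using inv(1)[OF unit_DA_closed] by (simp add: phi_univ z unit_DA_closed uz phi_bar_phib[OF V])
  have one: "univ NA z (phib \<theta> (tens k A C \<one>\<^bsub>A\<^esub> c)) = tens k A C \<one>\<^bsub>A\<^esub> c" if "c \<in> carrier C" for c
    using inv(2)[of "tens k A C \<one>\<^bsub>A\<^esub> c"] that
    by (simp add: phi_univ z phi_bar_phib[OF V] phib_closed[OF V] tens_closed)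
  \<comment> \<open>The unit of the adjunction, \<open>x \<mapsto> x z\<close>, before
    coding.\<close>
  let ?e = "\<lambda>X x. tmap k X C (ract X x) z"
  define \<Phi> :: "('k, 'u, 'a) rmod \<Rightarrow> ('k, 'u, 'a, 'c) emod \<Rightarrow> ('u \<Rightarrow> 'u) \<Rightarrow> 'u \<Rightarrow> 'u"
    where "\<Phi> X Y h = (\<lambda>x\<in>carrier X. h (enc (?e X x)))" for X Y h
  define \<Theta> :: "('k, 'u, 'a) rmod \<Rightarrow> ('k, 'u, 'a, 'c) emod \<Rightarrow> ('u \<Rightarrow> 'u) \<Rightarrow> 'u \<Rightarrow> 'u"
    where "\<Theta> X Y g = (\<lambda>u\<in>carrier (G X). zeta \<theta> Y (tmap k Y C g (dec X u)))" for X Y g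
  have fob: "fob GF = (\<lambda>M. G M)" "fob forget_functor = rmod.truncate" "far forget_functor = (\<lambda>M N f. f)"
    by (simp_all add: tensor_C_functor_def forget_functor_def)
  note [simp] = fob rmod_cat_def emod_cat_def rmod_hom_truncate
  have e_closed: "?e X x \<in> carrier (tensor k X C)" if X: "right_module k A X" and x: "x \<in> carrier X"
    for X :: "('k, 'u, 'a) rmod" and x
    by (assumption | rule lin z x right_module_lin[OF X])+
  \<comment> \<open>The unit is right linear because \<open>z\<close> commutes with
    \<open>A\<close>.\<close>
  have e_ract: "?e X (ract X x a) = cact X (?e X x) a"
    if X: "right_module k A X" and x: "x \<in> carrier X" and a: "a \<in> carrier A"
    for X :: "('k, 'u, 'a) rmod" and x a
  proof -
    note [lin] = z x a right_module_lin[OF X]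
    have "?e X (ract X x a) = tmap k X C (\<lambda>b. ract X x (a \<otimes>\<^bsub>A\<^esub> b)) z"
      by (rule tmap_cong[OF module C.module z]) (simp add: right_module.ract_mult[OF X] x a)
    also have "\<dots> = tmap k X C (ract X x) (tmap k A C (\<lambda>b. a \<otimes>\<^bsub>A\<^esub> b) z)"
      by (rule tmap_tmap[symmetric]) (assumption | rule lin)+
    also have "\<dots> = tmap k X C (ract X x) (cact regular z a)" by (simp add: zw a)
    also have "\<dots> = cact X (?e X x) a"
    proof -
      have "linear_map k A X (ract X x)" by (assumption | rule lin)+
      from cact_natural[OF regular_right_module X, unfolded same_moduleD[OF regular_simps(1)] regular_simps, OF this _ z a]
      show ?thesis by (simp add: right_module.ract_mult[OF X x])
    qed
    finally show ?thesis .
  qed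
  have \<Phi>_hom: "\<Phi> X Y h \<in> rmod_hom k A X Y" and \<Theta>\<Phi>: "\<Theta> X Y (\<Phi> X Y h) = h"
    if X: "right_module k A X" and Y: "entwined_module k A C \<psi> Y" and h: "h \<in> emod_hom k A C (G X) Y"
    for X :: "('k, 'u, 'a) rmod" and Y :: "('k, 'u, 'a, 'c) emod" and h :: "'u \<Rightarrow> 'u"
  proof -
    have hl: "linear_map k (G X) Y h"
      and hr: "\<And>x a. \<lbrakk>x \<in> carrier (G X); a \<in> carrier A\<rbrakk> \<Longrightarrow> h (ract (G X) x a) = ract Y (h x) a"
      and hc: "\<And>x. x \<in> carrier (G X) \<Longrightarrow> coact Y (h x) = tmap k Y C h (coact (G X) x)"
      using h by (auto simp: emod_hom_iff)
    note ec = linear_map_closed[OF enc_linear[OF X]]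
    note [lin] = z right_module_lin[OF X] right_module_lin(1)[OF entwined_right[OF Y]]
      right_module_lin(1)[OF entwined_right[OF G_entwined[OF X]]]
      hl linear_comp[OF hl] linear_map_closed[OF hl] enc_linear[OF X] ec linear_comp[OF enc_linear[OF X]]
    have l: "linear_map k X Y (\<lambda>x. h (enc (?e X x)))" by (assumption | rule lin)+
    then show "\<Phi> X Y h \<in> rmod_hom k A X Y"
      using e_closed[OF X] right_module_lin[OF X]
      by (auto simp: \<Phi>_def rmod_hom_iff linear_map_restrict e_ract[OF X] G_ract[OF X, symmetric] hr ec)
    \<comment> \<open>\<open>h\<close> is read on tensors instead of codes, as
      \<open>zeta_cofree\<close> requires.\<close>
    let ?k = "\<lambda>t. h (enc t)"
    have kl: "linear_map k (tensor k X C) Y ?k" by (assumption | rule lin)+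
    have kr: "?k (cact X t a) = ract Y (?k t) a" if "t \<in> carrier (tensor k X C)" "a \<in> carrier A" for t a
      using that by (simp add: G_ract[OF X, symmetric] hr ec)
    have kc: "coact Y (?k t) = tmap k Y C ?k (cdelta X t)" if t [lin]: "t \<in> carrier (tensor k X C)" for t
    proof -
      have "coact Y (?k t) = tmap k Y C h (tmap k (G X) C enc (cdelta X t))"
        by (simp add: hc ec t G_coact[OF X])
      also have "\<dots> = tmap k Y C ?k (cdelta X t)" by (rule tmap_tmap) (assumption | rule lin)+
      finally show ?thesis .
    qed
    show "\<Theta> X Y (\<Phi> X Y h) = h"
    proof (rule extensionalityI)
      fix u assume u: "u \<in> carrier (G X)"
      then obtain t where t: "t \<in> carrier (tensor k X C)" "u = enc t" by (rule G_cases[OF X])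
      have "tmap k Y C (\<Phi> X Y h) t = tmap k Y C (\<lambda>x. ?k (?e X x)) t"
        by (rule tmap_cong[OF right_module_lin(1)[OF X] C.module t(1)]) (simp add: \<Phi>_def)
      then show "\<Theta> X Y (\<Phi> X Y h) u = h u"
        using u t zeta_cofree[OF th z one X Y kl kr kc t(1)] by (simp add: \<Theta>_def dec_enc[OF X])
    qed (use h in \<open>auto simp: \<Theta>_def emod_hom_iff\<close>)
  qed
  have \<Theta>_hom: "\<Theta> X Y g \<in> emod_hom k A C (G X) Y" and \<Phi>\<Theta>: "\<Phi> X Y (\<Theta> X Y g) = g"
    if X: "right_module k A X" and Y: "entwined_module k A C \<psi> Y" and g: "g \<in> rmod_hom k A X Y"
    for X :: "('k, 'u, 'a) rmod" and Y :: "('k, 'u, 'a, 'c) emod" and g :: "'u \<Rightarrow> 'u"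
  proof -
    have gl: "linear_map k X Y g" and gr: "\<And>x a. \<lbrakk>x \<in> carrier X; a \<in> carrier A\<rbrakk> \<Longrightarrow> g (ract X x a) = ract Y (g x) a"
      using g by (auto simp: rmod_hom_iff)
    note Yr = entwined_right[OF Y]
    note ec = linear_map_closed[OF enc_linear[OF X]]
    note [lin] = right_module_lin[OF X] right_module_lin[OF Yr] gl linear_comp[OF gl] linear_map_closed[OF gl]
      dec_linear[OF X] linear_comp[OF dec_linear[OF X]] linear_map_closed[OF dec_linear[OF X]]
      enc_linear[OF X] ec linear_comp[OF enc_linear[OF X]] zeta_linear[OF th Y] z
      right_module_lin(1)[OF entwined_right[OF G_entwined[OF X]]]
    let ?h = "\<lambda>u. zeta \<theta> Y (tmap k Y C g (dec X u))"
    show "\<Theta> X Y g \<in> emod_hom k A C (G X) Y"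
      unfolding \<Theta>_def
    proof (rule emod_homI[OF G_entwined[OF X]])
      show "linear_map k (G X) Y ?h" by (assumption | rule lin)+
      fix u assume "u \<in> carrier (G X)"
      then obtain t where t [lin]: "t \<in> carrier (tensor k X C)" and ut: "u = enc t" by (rule G_cases[OF X])
      have gt [lin]: "tmap k Y C g t \<in> carrier (tensor k Y C)" by (assumption | rule lin)+
      show "?h (ract (G X) u a) = ract Y (?h u) a" if a: "a \<in> carrier A" for a
        using cact_natural[OF X Yr gl gr t a] cact_closed[OF X t a]
        by (simp add: ut G_ract[OF X t] dec_enc[OF X] t zeta_cact[OF th Y gt a])
      have "coact Y (?h u) = tmap k Y C (zeta \<theta> Y) (cdelta Y (tmap k Y C g t))"
        by (simp add: ut dec_enc[OF X t] zeta_coact[OF th Y gt])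
      also have "\<dots> = tmap k Y C (zeta \<theta> Y) (tmap k (tensor k Y C) C (tmap k Y C g) (cdelta X t))"
        by (subst cdelta_natural) (assumption | rule lin HOL.refl)+
      also have "\<dots> = tmap k Y C (\<lambda>s. zeta \<theta> Y (tmap k Y C g s)) (cdelta X t)"
        by (rule tmap_tmap) (assumption | rule lin)+
      also have "\<dots> = tmap k Y C (\<lambda>s. ?h (enc s)) (cdelta X t)"
        by (rule tmap_cong[of k "tensor k X C"], (assumption | rule lin)+) (simp add: dec_enc[OF X])
      also have "\<dots> = tmap k Y C ?h (tmap k (G X) C enc (cdelta X t))"
        by (rule tmap_tmap[symmetric]) (assumption | rule lin)+
      also have "\<dots> = tmap k Y C ?h (coact (G X) u)"
        by (simp add: ut G_coact[OF X t])
      finally show "coact Y (?h u) = tmap k Y C ?h (coact (G X) u)" .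
    qed
    show "\<Phi> X Y (\<Theta> X Y g) = g"
    proof (rule extensionalityI)
      fix x assume x [lin]: "x \<in> carrier X"
      have "tmap k Y C g (?e X x) = tmap k Y C (\<lambda>a. g (ract X x a)) z"
        by (rule tmap_tmap) (assumption | rule lin)+
      also have "\<dots> = ?e Y (g x)"
        by (rule tmap_cong[OF module C.module z]) (simp add: gr x)
      finally show "\<Phi> X Y (\<Theta> X Y g) x = g x"
        using x e_closed[OF X x] zeta_unit[OF th Y z pz linear_map_closed[OF gl x]]
        by (simp add: \<Phi>_def \<Theta>_def ec dec_enc[OF X])
    qed (use g in \<open>auto simp: \<Phi>_def rmod_hom_iff\<close>)
  qed
  show ?thesis
    unfolding left_adjoint_def
  proof (intro conjI forget_functor G_functor exI[of _ \<Phi>] ballI)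
    fix X :: "('k, 'u, 'a) rmod" and Y :: "('k, 'u, 'a, 'c) emod"
    assume "X \<in> Ob (rmod_cat k A)" "Y \<in> Ob (emod_cat k A C \<psi>)"
    then have X: "right_module k A X" and Y: "entwined_module k A C \<psi> Y" by simp_all
    note ec = linear_map_closed[OF enc_linear[OF X] e_closed[OF X]]
    show "bij_betw (\<Phi> X Y) (Ar (emod_cat k A C \<psi>) (fob GF X) Y) (Ar (rmod_cat k A) X (fob forget_functor Y))"
      by (rule bij_betw_byWitness[where f' = "\<Theta> X Y"]) (auto simp: \<Phi>_hom \<Theta>_hom \<Phi>\<Theta> \<Theta>\<Phi> X Y)
    fix h :: "'u \<Rightarrow> 'u" assume "h \<in> Ar (emod_cat k A C \<psi>) (fob GF X) Y"
    {
      fix X' :: "('k, 'u, 'a) rmod" and f :: "'u \<Rightarrow> 'u"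
      assume "X' \<in> Ob (rmod_cat k A)" and f: "f \<in> Ar (rmod_cat k A) X' X"
      then have X': "right_module k A X'" by simp
      have fl: "linear_map k X' X f" and fr: "\<And>x a. \<lbrakk>x \<in> carrier X'; a \<in> carrier A\<rbrakk> \<Longrightarrow> f (ract X' x a) = ract X (f x) a"
        using f by (auto simp: rmod_hom_iff)
      have "tmap k X C f (?e X' x) = ?e X (f x)" if x [lin]: "x \<in> carrier X'" for x
      proof -
        note [lin] = fl z right_module_lin[OF X'] right_module_lin[OF X]
        have "tmap k X C f (?e X' x) = tmap k X C (\<lambda>a. f (ract X' x a)) z"
          by (rule tmap_tmap) (assumption | rule lin)+
        also have "\<dots> = ?e X (f x)"
          by (rule tmap_cong[OF module C.module z]) (simp add: fr x)
        finally show ?thesis .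
      qed
      then show "\<Phi> X' Y (Cmp (emod_cat k A C \<psi>) (fob GF X') (fob GF X) Y h (far GF X' X f))
        = Cmp (rmod_cat k A) X' X (fob forget_functor Y) (\<Phi> X Y h) f"
        using linear_map_closed[OF fl] linear_map_closed[OF enc_linear[OF X'] e_closed[OF X']] e_closed[OF X']
        by (auto simp: \<Phi>_def compose_def fun_eq_iff far_enc[OF X'])
    next
      fix Y' :: "('k, 'u, 'a, 'c) emod" and g :: "'u \<Rightarrow> 'u"
      assume "Y' \<in> Ob (emod_cat k A C \<psi>)" and g: "g \<in> Ar (emod_cat k A C \<psi>) Y Y'"
      show "\<Phi> X Y' (Cmp (emod_cat k A C \<psi>) (fob GF X) Y Y' g h)
        = Cmp (rmod_cat k A) X (fob forget_functor Y) (fob forget_functor Y') (far forget_functor Y Y' g) (\<Phi> X Y h)"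
        using ec by (auto simp: \<Phi>_def compose_def fun_eq_iff)
    }
  qed
qed

end

section \<open>The two representing objects\<close>

lemma left_adjointE:
  assumes "left_adjoint \<C> \<D> F G"
  obtains \<Phi> where "\<And>X Y. \<lbrakk>X \<in> Ob \<C>; Y \<in> Ob \<D>\<rbrakk> \<Longrightarrow> bij_betw (\<Phi> X Y) (Ar \<D> (fob F X) Y) (Ar \<C> X (fob G Y))"
    and "\<And>X X' Y f h. \<lbrakk>X \<in> Ob \<C>; X' \<in> Ob \<C>; Y \<in> Ob \<D>; f \<in> Ar \<C> X' X; h \<in> Ar \<D> (fob F X) Y\<rbrakk> \<Longrightarrow>
      \<Phi> X' Y (Cmp \<D> (fob F X') (fob F X) Y h (far F X' X f)) = Cmp \<C> X' X (fob G Y) (\<Phi> X Y h) f"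
    and "\<And>X Y Y' g h. \<lbrakk>X \<in> Ob \<C>; Y \<in> Ob \<D>; Y' \<in> Ob \<D>; g \<in> Ar \<D> Y Y'; h \<in> Ar \<D> (fob F X) Y\<rbrakk> \<Longrightarrow>
      \<Phi> X Y' (Cmp \<D> (fob F X) Y Y' g h) = Cmp \<C> X (fob G Y) (fob G Y') (far G Y Y' g) (\<Phi> X Y h)"
  using assms unfolding left_adjoint_def
  apply (elim conjE exE)
  subgoal for \<Phi> by (rule that[of \<Phi>]) blast+
  done

context entwining_dual_basis
begin

text \<open>The identity is a morphism that fixes the generator, so \<open>univ_unique\<close>
  applies to it.\<close>

lemma univ_id:
  assumes t: "t \<in> carrier DA"
  shows "univ N unit_DA t = t"
proof -
  have "linear_map k DA N (\<lambda>x. x)" unfolding same_moduleD[OF DA_simps(1)] by (rule linear_id)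
  then show ?thesis
    by (rule univ_unique[OF N_entwined, symmetric])
      (auto simp: DA_simps same_moduleD[OF DA_simps(1)] same_tmap[OF DA_simps(1)] tmap_id lin t)
qed

lemma univ_NA_hom:
  assumes z: "z \<in> carrier AC"
  shows "restrict (univ NA z) (carrier N) \<in> emod_hom k A C N NA"
proof (rule emod_homI[OF N_entwined])
  show "linear_map k N NA (univ NA z)"
    unfolding same_moduleD[OF DA_simps(1)] same_moduleD[OF AC_simps(1)] by (rule univ_NA_linear[OF z])
  have z': "z \<in> carrier NA" using z by (simp add: AC_simps)
  fix t assume t: "t \<in> carrier N"
  show "univ NA z (ract N t a) = ract NA (univ NA z t) a" if "a \<in> carrier A" for a
    using univ_ract[OF A_tensor_C_entwined z'] t that by (simp add: DA_simps)
  show "coact NA (univ NA z t) = tmap k NA C (univ NA z) (coact N t)"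
    using univ_coact[OF A_tensor_C_entwined z'] t by (simp add: DA_simps)
qed

text \<open>As functions of \<open>t\<close>, both sides are right linear and colinear, so they may
  be compared at the generator, where \<open>dlact_unit\<close> and the condition of
  \<open>W1\<close> apply.\<close>

lemma univ_NA_lact:
  assumes zW: "z \<in> W1 k A C \<psi>" and b: "b \<in> carrier A" and t: "t \<in> carrier DA"
  shows "univ NA z (dlact b t) = tmap k A C (\<lambda>x. b \<otimes>\<^bsub>A\<^esub> x) (univ NA z t)"
proof -
  have z: "z \<in> carrier AC" and zw: "tmap k A C (\<lambda>x. b \<otimes>\<^bsub>A\<^esub> x) z = cact regular z b"
    using zW b by (auto simp: W1_iff)
  have z': "z \<in> carrier NA" using z by (simp add: AC_simps)
  let ?f = "univ NA z" and ?l = "tmap k A C (\<lambda>x. b \<otimes>\<^bsub>A\<^esub> x)"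
  note fl = univ_NA_linear[OF z]
  note [lin] = fl linear_comp[OF fl] linear_map_closed[OF fl] b
  have fr: "?f (dract t a) = cact regular (?f t) a" if "t \<in> carrier DA" "a \<in> carrier A" for t a
    using univ_ract[OF A_tensor_C_entwined z' that] by (simp add: AC_simps)
  have fc: "cdelta A (?f t) = tmap k AC C ?f (dcoact t)" if "t \<in> carrier DA" for t
    using univ_coact[OF A_tensor_C_entwined z' that] by (simp add: AC_simps same_tmap[OF AC_simps(1)])
  have fu: "?f unit_DA = z" by (rule univ_unit[OF A_tensor_C_entwined z'])
  interpret NA: bi_entwined_module k A C \<psi> NA by (rule A_tensor_C_bi_entwined)
  note NAs = same_moduleD[OF AC_simps(1)] AC_simps
  have lr: "?l (cact regular s a) = cact regular (?l s) a" if "s \<in> carrier AC" "a \<in> carrier A" for s a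
    using NA.lact_ract[OF b, of s a] that by (simp add: AC_simps)
  have lc: "cdelta A (?l s) = tmap k AC C ?l (cdelta A s)" if [lin]: "s \<in> carrier AC" for s
    by (rule cdelta_natural) (assumption | rule lin)+
  have unique: "h t = univ NA (h unit_DA) t"
    if "linear_map k DA AC h" "\<And>t a. \<lbrakk>t \<in> carrier DA; a \<in> carrier A\<rbrakk> \<Longrightarrow> h (dract t a) = cact regular (h t) a"
      "\<And>t. t \<in> carrier DA \<Longrightarrow> cdelta A (h t) = tmap k AC C h (dcoact t)" for h
    by (rule univ_unique[OF A_tensor_C_entwined]) (auto simp: NAs same_tmap[OF AC_simps(1)] that t)
  have "?f (dlact b t) = univ NA (?f (dlact b unit_DA)) t"
  proof (rule unique)
    show "linear_map k DA AC (\<lambda>t. ?f (dlact b t))" by (assumption | rule lin)+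
    show "?f (dlact b (dract t a)) = cact regular (?f (dlact b t)) a" if "t \<in> carrier DA" "a \<in> carrier A" for t a
      using that by (simp add: dlact_dract b fr dlact_closed)
    show "cdelta A (?f (dlact b t)) = tmap k AC C (\<lambda>t. ?f (dlact b t)) (dcoact t)" if [lin]: "t \<in> carrier DA" for t
    proof -
      have "cdelta A (?f (dlact b t)) = tmap k AC C ?f (tmap k DA C (dlact b) (dcoact t))"
        using that by (simp add: fc dlact_closed b dlact_dcoact)
      also have "\<dots> = tmap k AC C (\<lambda>t. ?f (dlact b t)) (dcoact t)" by (rule tmap_tmap) (assumption | rule lin)+
      finally show ?thesis .
    qed
  qed
  also have "?f (dlact b unit_DA) = ?l (?f unit_DA)"
    by (simp add: dlact_unit b fr unit_DA_closed fu zw)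
  also have "univ NA (?l (?f unit_DA)) t = ?l (?f t)"
  proof (rule unique[symmetric])
    show "linear_map k DA AC (\<lambda>t. ?l (?f t))" by (assumption | rule lin)+
    show "?l (?f (dract t a)) = cact regular (?l (?f t)) a" if "t \<in> carrier DA" "a \<in> carrier A" for t a
      using that by (simp add: fr lr linear_map_closed[OF fl])
    show "cdelta A (?l (?f t)) = tmap k AC C (\<lambda>t. ?l (?f t)) (dcoact t)" if [lin]: "t \<in> carrier DA" for t
    proof -
      have "cdelta A (?l (?f t)) = tmap k AC C ?l (tmap k AC C ?f (dcoact t))"
        using that by (simp add: lc linear_map_closed[OF fl] fc)
      also have "\<dots> = tmap k AC C (\<lambda>t. ?l (?f t)) (dcoact t)" by (rule tmap_tmap) (assumption | rule lin)+
      finally show ?thesis .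
    qed
  qed
  finally show ?thesis .
qed

end

context entwining_structure
begin

lemma transport_hom:
  fixes X :: "('k, 'm, 'a, 'c) emod"
  assumes e: "inj_on e (carrier X)" and X: "entwined_module k A C \<psi> X"
  shows "restrict e (carrier X) \<in> emod_hom k A C X (transport k C e X)"
    and "restrict (inv_into (carrier X) e) (carrier (transport k C e X)) \<in> emod_hom k A C (transport k C e X) X"
proof -
  have m: "module k X" using right_module_lin(1)[OF entwined_right[OF X]] .
  show 1: "restrict e (carrier X) \<in> emod_hom k A C X (transport k C e X)"
    by (rule emod_homI[OF X transport_linear(1)[OF e m]]) (simp_all add: transport_simps inv_into_f_f[OF e])
  show "restrict (inv_into (carrier X) e) (carrier (transport k C e X)) \<in> emod_hom k A C (transport k C e X) X"
    by (rule emod_hom_inverse[OF X transport_entwined[OF e X] 1])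
      (auto simp: transport_simps inv_into_f_f[OF e])
qed

text \<open>\<open>transport\<close> acts on records with a coaction, so \<open>A\<close> is given a
  junk one, which \<open>Au\<close> truncates away again.\<close>

definition regular_emod :: "('k, 'a, 'a, 'c) emod" where
  "regular_emod = \<lparr>carrier = carrier A, mult = undefined, one = undefined, zero = \<zero>\<^bsub>A\<^esub>, add = add A,
     smult = smult A, ract = mult A, coact = undefined\<rparr>"

end

section \<open>Copies of \<open>A\<close> and of \<open>C\<^sup>* \<otimes> A\<close> in the
  universe\<close>

context entwining_frobenius
begin

context
  fixes j :: "'a \<Rightarrow> 'u"
  assumes j: "inj_on j (carrier A)"
begin

definition Au :: "('k, 'u, 'a) rmod" where
  "Au = rmod.truncate (transport k C j regular_emod)"

lemma regular_emod_simps: "same_module regular_emod A" "carrier regular_emod = carrier A" "ract regular_emod = mult A"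
  by (simp_all add: regular_emod_def same_module_def)

lemma regular_emod_right: "right_module k A regular_emod"
proof -
  have "same_module regular_emod regular" by (simp add: regular_emod_def regular_def same_module_def)
  from right_module_cong[OF this, of k A] show ?thesis
    using regular_right_module by (simp add: regular_emod_simps regular_simps)
qed

lemma j': "inj_on j (carrier regular_emod)"
  by (simp add: regular_emod_simps j)

abbreviation "jinv \<equiv> inv_into (carrier A) j"

lemma Au_right: "right_module k A Au"
  unfolding Au_def right_module_truncate by (rule transport_right_module[OF j' regular_emod_right])

lemma Au_carrier: "carrier Au = j ` carrier A"
  by (simp add: Au_def transport_simps regular_emod_simps)

lemma jinv_j: "a \<in> carrier A \<Longrightarrow> jinv (j a) = a"
  by (rule inv_into_f_f[OF j])

lemma Au_ract: "a \<in> carrier A \<Longrightarrow> ract Au (j a) b = j (a \<otimes>\<^bsub>A\<^esub> b)"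
  by (simp add: Au_def transport_simps regular_emod_simps jinv_j)

lemma j_linear: "linear_map k A Au j"
  and jinv_linear: "linear_map k Au A jinv"
proof -
  have m: "module k regular_emod" using right_module_lin(1)[OF regular_emod_right] .
  show "linear_map k A Au j" "linear_map k Au A jinv"
    using transport_linear[OF j' m]
    unfolding same_moduleD[OF regular_emod_simps(1)] Au_def same_moduleD[OF same_truncate] by simp_all
qed

lemmas j_lin = j_linear linear_comp[OF j_linear] linear_map_closed[OF j_linear]
  jinv_linear linear_comp[OF jinv_linear] linear_map_closed[OF jinv_linear]
  Au_right right_module_lin[OF Au_right]
  enc_linear[OF Au_right] linear_comp[OF enc_linear[OF Au_right]] linear_map_closed[OF enc_linear[OF Au_right]]
  dec_linear[OF Au_right] linear_comp[OF dec_linear[OF Au_right]] linear_map_closed[OF dec_linear[OF Au_right]]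
  right_module_lin(1)[OF entwined_right[OF G_entwined[OF Au_right]]]

text \<open>The isomorphism from \<open>A \<otimes> C\<close> to the value of the functor at the
  copy of \<open>A\<close>; \<open>kappa'\<close> is its inverse.\<close>

definition kappa where "kappa t = enc (tmap k Au C j t)"
definition kappa' where "kappa' u = tmap k A C jinv (dec Au u)"

lemma tmap_j_jinv:
  "t \<in> carrier AC \<Longrightarrow> tmap k A C jinv (tmap k Au C j t) = t"
  "s \<in> carrier (tensor k Au C) \<Longrightarrow> tmap k Au C j (tmap k A C jinv s) = s"
proof -
  note [lin] = j_lin
  assume t [lin]: "t \<in> carrier AC"
  have "tmap k A C jinv (tmap k Au C j t) = tmap k A C (\<lambda>a. jinv (j a)) t"
    by (rule tmap_tmap) (assumption | rule lin)+
  also have "\<dots> = tmap k A C (\<lambda>x. x) t" by (rule tmap_cong[OF module C.module t]) (simp add: jinv_j)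
  finally show "tmap k A C jinv (tmap k Au C j t) = t" by (simp add: tmap_id module C.module t)
next
  note [lin] = j_lin
  assume s [lin]: "s \<in> carrier (tensor k Au C)"
  have "tmap k Au C j (tmap k A C jinv s) = tmap k Au C (\<lambda>a. j (jinv a)) s"
    by (rule tmap_tmap) (assumption | rule lin)+
  also have "\<dots> = tmap k Au C (\<lambda>x. x) s"
    by (rule tmap_cong[OF _ C.module s], rule lin) (auto simp: jinv_j Au_carrier)
  finally show "tmap k Au C j (tmap k A C jinv s) = s"
    using tmap_id[OF right_module_lin(1)[OF Au_right] C.module s] by simp
qed

lemma kappa_closed: "t \<in> carrier AC \<Longrightarrow> kappa t \<in> carrier (G Au)"
  unfolding kappa_def by (assumption | rule lin j_lin)+

lemma kappa'_closed: "u \<in> carrier (G Au) \<Longrightarrow> kappa' u \<in> carrier AC"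
  unfolding kappa'_def by (assumption | rule lin j_lin)+

lemma kappa'_kappa: "t \<in> carrier AC \<Longrightarrow> kappa' (kappa t) = t"
proof -
  assume [lin]: "t \<in> carrier AC"
  have "tmap k Au C j t \<in> carrier (tensor k Au C)" by (assumption | rule lin j_lin)+
  then show ?thesis by (simp add: kappa_def kappa'_def dec_enc[OF Au_right] tmap_j_jinv \<open>t \<in> _\<close>)
qed

lemma kappa_kappa': "u \<in> carrier (G Au) \<Longrightarrow> kappa (kappa' u) = u"
  by (elim G_cases[OF Au_right]) (simp add: kappa_def kappa'_def dec_enc[OF Au_right] tmap_j_jinv)

lemma kappa_ract:
  assumes t: "t \<in> carrier AC" and a: "a \<in> carrier A"
  shows "kappa (cact regular t a) = ract (G Au) (kappa t) a"
proof -
  have "tmap k Au C j (cact regular t a) = cact Au (tmap k Au C j t) a"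
    by (rule cact_natural[OF regular_right_module Au_right, unfolded same_moduleD[OF regular_simps(1)] regular_simps])
      (simp_all add: j_linear Au_ract t a)
  moreover have "tmap k Au C j t \<in> carrier (tensor k Au C)" by (assumption | rule lin j_lin t)+
  ultimately show ?thesis by (simp add: kappa_def G_ract[OF Au_right])
qed

lemma kappa_hom: "restrict kappa (carrier NA) \<in> emod_hom k A C NA (G Au)"
proof (rule emod_homI[OF A_tensor_C_entwined], unfold same_moduleD[OF AC_simps(1)] AC_simps)
  note [lin] = j_lin
  show "linear_map k AC (G Au) kappa" unfolding kappa_def by (assumption | rule lin)+
  fix t assume t [lin]: "t \<in> carrier AC"
  have jt [lin]: "tmap k Au C j t \<in> carrier (tensor k Au C)" by (assumption | rule lin)+
  show "kappa (cact regular t a) = ract (G Au) (kappa t) a" if "a \<in> carrier A" for a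
    by (rule kappa_ract[OF t that])
  have "coact (G Au) (kappa t) = tmap k (G Au) C enc (cdelta Au (tmap k Au C j t))"
    by (simp add: kappa_def G_coact[OF Au_right jt])
  also have "\<dots> = tmap k (G Au) C enc (tmap k (tensor k Au C) C (tmap k Au C j) (cdelta A t))"
    by (subst cdelta_natural) (assumption | rule lin HOL.refl)+
  also have "\<dots> = tmap k (G Au) C kappa (cdelta A t)"
    unfolding kappa_def[abs_def] by (rule tmap_tmap) (assumption | rule lin)+
  finally show "coact (G Au) (kappa t) = tmap k (G Au) C kappa (cdelta A t)" .
qed

lemma kappa'_hom: "restrict kappa' (carrier (G Au)) \<in> emod_hom k A C (G Au) NA"
  by (rule emod_hom_inverse[OF A_tensor_C_entwined G_entwined[OF Au_right] kappa_hom])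
    (simp_all add: AC_simps kappa'_closed kappa_kappa' kappa'_kappa)

text \<open>Left multiplications are endomorphisms of the regular right module. The functor turns
  them into the left action on \<open>A \<otimes> C\<close>, and this is how the left action becomes
  accessible to naturality.\<close>

definition mult_u where "mult_u b = (\<lambda>v\<in>carrier Au. j (b \<otimes>\<^bsub>A\<^esub> jinv v))"

lemma mult_u_hom:
  assumes b: "b \<in> carrier A"
  shows "mult_u b \<in> rmod_hom k A Au Au"
proof -
  have l: "linear_map k Au Au (\<lambda>v. j (b \<otimes>\<^bsub>A\<^esub> jinv v))" by (assumption | rule lin j_lin b)+
  show ?thesis
    unfolding mult_u_def rmod_hom_iff
    using linear_map_restrict[OF right_module_lin(1)[OF Au_right] l]
    by (auto simp: Au_carrier Au_ract jinv_j b R.m_assoc)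
qed

lemma mult_u_kappa:
  assumes b: "b \<in> carrier A" and t: "t \<in> carrier AC"
  shows "far GF Au Au (mult_u b) (kappa t) = kappa (tmap k A C (\<lambda>x. b \<otimes>\<^bsub>A\<^esub> x) t)"
proof -
  note [lin] = j_lin b t
  have jt [lin]: "tmap k Au C j t \<in> carrier (tensor k Au C)" by (assumption | rule lin)+
  have ml: "linear_map k Au Au (mult_u b)" using mult_u_hom[OF b] by (simp add: rmod_hom_iff)
  have "tmap k Au C (mult_u b) (tmap k Au C j t) = tmap k Au C (\<lambda>x. mult_u b (j x)) t"
    by (rule tmap_tmap) (assumption | rule lin ml)+
  also have "\<dots> = tmap k Au C (\<lambda>x. j (b \<otimes>\<^bsub>A\<^esub> x)) t"
    by (rule tmap_cong[OF module C.module t]) (simp add: mult_u_def Au_carrier jinv_j)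
  also have "\<dots> = tmap k Au C j (tmap k A C (\<lambda>x. b \<otimes>\<^bsub>A\<^esub> x) t)"
    by (rule tmap_tmap[symmetric]) (assumption | rule lin)+
  finally show ?thesis by (simp add: kappa_def far_enc[OF Au_right jt])
qed

text \<open>A tensor in \<open>C\<^sup>* \<otimes> A\<close> is determined by its pairings with \<open>d\<^sub>1, \<dots>, d\<^sub>m\<close>; this places \<open>C\<^sup>* \<otimes> A\<close> in the universe.\<close>

definition dual_code :: "(('c \<Rightarrow> 'k) \<times> 'a) list set \<Rightarrow> 'u" where
  "dual_code t = \<iota> (map (\<lambda>i. (j (pair (d i) t), d i)) [1..<Suc m])"

text \<open>The code yields the values of the pairing on the basis, and \<open>pair_coev\<close>
  rebuilds the tensor from them. The second entries \<open>d i\<close> are the same for all tensors;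
  they serve to form a list in the domain of \<open>\<iota>\<close>.\<close>

lemma dual_code_inj: "inj_on dual_code (carrier DA)"
proof (rule inj_onI)
  fix s t assume st: "s \<in> carrier DA" "t \<in> carrier DA" and eq: "dual_code s = dual_code t"
  have "map (\<lambda>i. (j (pair (d i) s), d i)) [1..<Suc m] = map (\<lambda>i. (j (pair (d i) t), d i)) [1..<Suc m]"
    using eq unfolding dual_code_def
    by (rule inj_onD[OF universe_closed]) (use basis_closed in \<open>auto simp del: upt_Suc\<close>)
  then have "j (pair (d i) s) = j (pair (d i) t)" if "i \<in> {1..m}" for i
    using that by (auto simp: map_eq_conv simp del: upt_Suc)
  then have p: "pair (d i) s = pair (d i) t" if "i \<in> {1..m}" for i
    using inj_onD[OF j] pair_closed[OF basis_closed(1)[OF that]] st that by blast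
  interpret DA: abelian_group DA by (rule module_group) (rule lin)+
  have sum: "(\<Oplus>\<^bsub>DA\<^esub>i\<in>{1..m}. tens k D A (d' i) (pair (d i) u)) = u" if "u \<in> carrier DA" for u
    using finsum_coev[of DA "\<lambda>g x. tens k D A g (pair x u)"] pair_coev[OF that] that
    by (simp add: lin)
  have "(\<Oplus>\<^bsub>DA\<^esub>i\<in>{1..m}. tens k D A (d' i) (pair (d i) s)) = (\<Oplus>\<^bsub>DA\<^esub>i\<in>{1..m}. tens k D A (d' i) (pair (d i) t))"
    using basis_closed pair_closed[OF basis_closed(1)] st
    by (intro DA.finsum_cong') (auto simp: p intro!: tens_closed)
  then show "s = t" unfolding sum[OF st(1)] sum[OF st(2)] .
qed

text \<open>Yoneda in terms of elements: the adjunction makes evaluation at one element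
  \<open>z'\<close> a bijection from the morphisms \<open>G Au \<rightarrow> Y\<close> to the
  elements of \<open>Y\<close>. The generator of \<open>C\<^sup>* \<otimes> A\<close> has the same
  property, and sending each distinguished element to the other gives mutually inverse
  morphisms.\<close>

lemma iso_if_left_adjoint:
  assumes adj: "left_adjoint (rmod_cat k A) (emod_cat k A C \<psi>) GF forget_functor"
  shows "bemod_isomorphic k A C \<psi> N NA"
proof -
  let ?K = "G Au"
  have fob: "fob GF = (\<lambda>M. G M)" "fob forget_functor = rmod.truncate" "far forget_functor = (\<lambda>M N f. f)"
    by (simp_all add: tensor_C_functor_def forget_functor_def)
  note [simp] = fob rmod_cat_def emod_cat_def rmod_hom_truncate
  obtain \<Phi> :: "('k, 'u, 'a) rmod \<Rightarrow> ('k, 'u, 'a, 'c) emod \<Rightarrow> ('u \<Rightarrow> 'u) \<Rightarrow> 'u \<Rightarrow> 'u" where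
    bij: "\<And>X Y. \<lbrakk>right_module k A X; entwined_module k A C \<psi> Y\<rbrakk> \<Longrightarrow>
      bij_betw (\<Phi> X Y) (emod_hom k A C (G X) Y) (rmod_hom k A X Y)"
    and nat1: "\<And>X X' Y f h. \<lbrakk>right_module k A X; right_module k A X'; entwined_module k A C \<psi> Y;
        f \<in> rmod_hom k A X' X; h \<in> emod_hom k A C (G X) Y\<rbrakk> \<Longrightarrow>
      \<Phi> X' Y (compose (carrier (G X')) h (far GF X' X f)) = compose (carrier X') (\<Phi> X Y h) f"
    and nat2: "\<And>X Y Y' g h. \<lbrakk>right_module k A X; entwined_module k A C \<psi> Y; entwined_module k A C \<psi> Y';
        g \<in> emod_hom k A C Y Y'; h \<in> emod_hom k A C (G X) Y\<rbrakk> \<Longrightarrow>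
      \<Phi> X Y' (compose (carrier (G X)) g h) = compose (carrier X) g (\<Phi> X Y h)"
    by (rule left_adjointE[OF adj, simplified]) blast
  have K: "entwined_module k A C \<psi> ?K" by (rule G_entwined[OF Au_right])
  define idK where "idK = (\<lambda>x\<in>carrier ?K. x)"
  have idK: "idK \<in> emod_hom k A C ?K ?K" unfolding idK_def by (rule emod_hom_id[OF K])
  \<comment> \<open>The unit of the adjunction at the copy of \<open>A\<close>; by naturality in the
    second argument it determines all of \<open>\<Phi> Au\<close>.\<close>
  define u where "u = \<Phi> Au ?K idK"
  have u: "u \<in> rmod_hom k A Au ?K" unfolding u_def using bij[OF Au_right K] idK by (auto simp: bij_betw_def)
  have \<Phi>_eq: "\<Phi> Au Y h = compose (carrier Au) h u"
    if Y: "entwined_module k A C \<psi> Y" and h: "h \<in> emod_hom k A C ?K Y"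
    for Y :: "('k, 'u, 'a, 'c) emod" and h :: "'u \<Rightarrow> 'u"
    using nat2[OF Au_right K Y h idK] compose_Id[OF emod_hom_fun[OF h]] by (simp add: u_def idK_def)
  have oneu: "j \<one>\<^bsub>A\<^esub> \<in> carrier Au" by (simp add: Au_carrier)
  \<comment> \<open>The copy of \<open>A\<close> is cyclic, generated by the code of
    \<open>1\<close>, so the linear map \<open>u\<close> is determined by this value.\<close>
  define z' where "z' = u (j \<one>\<^bsub>A\<^esub>)"
  have z'K: "z' \<in> carrier ?K" using rmod_hom_fun(1)[OF u] oneu by (auto simp: z'_def)
  have uj: "u (j a) = ract ?K z' a" if "a \<in> carrier A" for a
  proof -
    have "u (ract Au (j \<one>\<^bsub>A\<^esub>) a) = ract ?K (u (j \<one>\<^bsub>A\<^esub>)) a"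
      using u that oneu by (auto simp: rmod_hom_iff)
    then show ?thesis using that by (simp add: Au_ract z'_def)
  qed
  \<comment> \<open>Evaluation at \<open>z'\<close> is onto: \<open>y\<close> defines the right
    linear map \<open>a \<mapsto> y a\<close>, which comes from a morphism under the
    bijection.\<close>
  have ex: "\<exists>h\<in>emod_hom k A C ?K Y. h z' = y" if Y: "entwined_module k A C \<psi> Y" and y: "y \<in> carrier Y"
    for Y :: "('k, 'u, 'a, 'c) emod" and y
  proof -
    note [lin] = right_module_lin[OF entwined_right[OF Y]] y j_lin
    have "linear_map k Au Y (\<lambda>v. ract Y y (jinv v))" by (assumption | rule lin)+
    from linear_map_restrict[OF right_module_lin(1)[OF Au_right] this]
    have "(\<lambda>v\<in>carrier Au. ract Y y (jinv v)) \<in> rmod_hom k A Au Y"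
      by (auto simp: rmod_hom_iff Au_carrier Au_ract jinv_j
          right_module.ract_mult[OF entwined_right[OF Y]] y)
    then have "(\<lambda>v\<in>carrier Au. ract Y y (jinv v)) \<in> \<Phi> Au Y ` emod_hom k A C ?K Y"
      unfolding bij_betw_imp_surj_on[OF bij[OF Au_right Y]] .
    then obtain h where h: "h \<in> emod_hom k A C ?K Y" "\<Phi> Au Y h = (\<lambda>v\<in>carrier Au. ract Y y (jinv v))"
      by (elim imageE) simp
    have "compose (carrier Au) h u (j \<one>\<^bsub>A\<^esub>) = (\<lambda>v\<in>carrier Au. ract Y y (jinv v)) (j \<one>\<^bsub>A\<^esub>)"
      unfolding h(2)[symmetric] \<Phi>_eq[OF Y h(1)] ..
    then have "h z' = y"
      using oneu by (simp add: compose_def z'_def jinv_j right_module.ract_one[OF entwined_right[OF Y] y])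
    then show ?thesis using h(1) by blast
  qed
  \<comment> \<open>Evaluation at \<open>z'\<close> is injective, as equal values at
    \<open>z'\<close> force equal images under \<open>\<Phi> Au Y\<close>.\<close>
  have un: "h = h'" if Y: "entwined_module k A C \<psi> Y" and h: "h \<in> emod_hom k A C ?K Y" and h': "h' \<in> emod_hom k A C ?K Y"
    and eq: "h z' = h' z'" for Y :: "('k, 'u, 'a, 'c) emod" and h h' :: "'u \<Rightarrow> 'u"
  proof -
    have "h (u (j a)) = h' (u (j a))" if "a \<in> carrier A" for a
    proof -
      have "h (ract ?K z' a) = ract Y (h z') a" "h' (ract ?K z' a) = ract Y (h' z') a"
        using h h' that z'K by (simp_all only: emod_hom_iff)
      then show ?thesis by (simp only: uj[OF that] eq)
    qed
    then have "\<Phi> Au Y h = \<Phi> Au Y h'"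
      unfolding \<Phi>_eq[OF Y h] \<Phi>_eq[OF Y h'] compose_def by (intro restrict_ext) (auto simp: Au_carrier)
    then show ?thesis by (rule inj_onD[OF bij_betw_imp_inj_on[OF bij[OF Au_right Y]] _ h h'])
  qed
  define z where "z = kappa' z'"
  have z: "z \<in> carrier AC" unfolding z_def by (rule kappa'_closed[OF z'K])
  have kz: "kappa z = z'" unfolding z_def by (rule kappa_kappa'[OF z'K])
  have zW: "z \<in> W1 k A C \<psi>"
    unfolding W1_iff
  proof (intro conjI z ballI)
    fix b assume b: "b \<in> carrier A"
    \<comment> \<open>Naturality at the endomorphism \<open>mult_u b\<close> says that
      \<open>?g\<close> after \<open>u\<close> equals \<open>u\<close> after
      \<open>mult_u b\<close>; at the code of \<open>1\<close> this becomes
      \<open>b z = z b\<close>.\<close>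
    let ?g = "far GF Au Au (mult_u b)"
    have g: "?g \<in> emod_hom k A C ?K ?K" by (rule far_hom[OF Au_right Au_right mult_u_hom[OF b]])
    have "compose (carrier ?K) idK ?g = ?g"
      unfolding idK_def by (rule Id_compose[OF emod_hom_fun[OF g]])
    then have "compose (carrier Au) ?g u = compose (carrier Au) u (mult_u b)"
      using nat1[OF Au_right Au_right K mult_u_hom[OF b] idK] by (simp add: \<Phi>_eq[OF K g] u_def)
    from fun_cong[OF this, of "j \<one>\<^bsub>A\<^esub>"] have "?g z' = u (j b)"
      using oneu b by (simp add: compose_def z'_def mult_u_def jinv_j)
    then have "kappa (tmap k A C (\<lambda>x. b \<otimes>\<^bsub>A\<^esub> x) z) = ract ?K (kappa z) b"
      using mult_u_kappa[OF b z] by (simp add: kz uj b)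
    also have "\<dots> = kappa (cact regular z b)"
      by (rule kappa_ract[OF z b, symmetric])
    finally have "kappa' (kappa (tmap k A C (\<lambda>x. b \<otimes>\<^bsub>A\<^esub> x) z)) = kappa' (kappa (cact regular z b))" by simp
    moreover have "tmap k A C (\<lambda>x. b \<otimes>\<^bsub>A\<^esub> x) z \<in> carrier AC" "cact regular z b \<in> carrier AC"
      using z b by - (assumption | rule lin linear_map_closed[OF cact_regular_linear[OF linear_id]])+
    ultimately show "tmap k A C (\<lambda>x. b \<otimes>\<^bsub>A\<^esub> x) z = cact regular z b" by (simp add: kappa'_kappa)
  qed
  \<comment> \<open>To become an object of the category, \<open>C\<^sup>* \<otimes> A\<close> is
    stripped of its left action and moved into the universe by \<open>dual_code\<close>; the
    morphism found there is then pulled back.\<close>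
  let ?N = "emod.truncate N"
  have sN: "same_module ?N N" "carrier ?N = carrier N" "ract ?N = ract N" "coact ?N = coact N"
    by (simp_all add: emod.truncate_def emod.defs same_module_def)
  have N': "entwined_module k A C \<psi> ?N"
    using entwined_module_cong[OF sN(1,3,4)] N_entwined by simp
  have e: "inj_on dual_code (carrier ?N)" using dual_code_inj by (simp add: sN DA_simps)
  let ?Nu = "transport k C dual_code ?N"
  have Nu: "entwined_module k A C \<psi> ?Nu" by (rule transport_entwined[OF e N'])
  have "dual_code unit_DA \<in> carrier ?Nu" by (simp add: transport_simps sN DA_simps unit_DA_closed)
  then obtain g0 where g0: "g0 \<in> emod_hom k A C ?K ?Nu" "g0 z' = dual_code unit_DA"
    using ex[OF Nu] by blast
  have homN: "emod_hom k A C X ?N = emod_hom k A C X N" for X :: "('k, 'u, 'a, 'c) emod"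
    by (auto simp: emod_hom_iff same_moduleD[OF sN(1)] sN same_tmap[OF sN(1)])
  define g1 where "g1 = compose (carrier ?K) (restrict (inv_into (carrier ?N) dual_code) (carrier ?Nu)) g0"
  have g1: "g1 \<in> emod_hom k A C ?K N"
    using emod_hom_comp[OF K Nu N' g0(1) transport_hom(2)[OF e N']] by (simp add: g1_def homN)
  have g1z: "g1 z' = unit_DA"
    using z'K \<open>dual_code unit_DA \<in> carrier ?Nu\<close> inv_into_f_f[OF e, of unit_DA]
    by (simp add: g1_def compose_def g0 sN DA_simps unit_DA_closed)
  define g where "g = compose (carrier NA) g1 (restrict kappa (carrier NA))"
  have g: "g \<in> emod_hom k A C NA N"
    unfolding g_def by (rule emod_hom_comp[OF A_tensor_C_entwined K N_entwined kappa_hom g1])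
  have gz: "g z = unit_DA" using z by (simp add: g_def compose_def AC_simps kz g1z)
  define f where "f = restrict (univ NA z) (carrier N)"
  have f: "f \<in> emod_hom k A C N NA" unfolding f_def by (rule univ_NA_hom[OF z])
  have fu: "f unit_DA = z"
    using univ_unit[OF A_tensor_C_entwined, of z] z by (simp add: f_def AC_simps DA_simps unit_DA_closed)
  note G' = hom_NA_N[OF g] and F = hom_N_NA[OF f]
  \<comment> \<open>An endomorphism of \<open>C\<^sup>* \<otimes> A\<close> that fixes the generator
    is the identity, by \<open>univ_unique\<close>.\<close>
  have gf: "g (f t) = t" if t: "t \<in> carrier DA" for t
  proof -
    have gfh: "compose (carrier N) g f \<in> emod_hom k A C N N"
      by (rule emod_hom_comp[OF N_entwined A_tensor_C_entwined N_entwined f g])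
    have "compose (carrier N) g f t = univ N (compose (carrier N) g f unit_DA) t"
    proof (rule univ_unique[OF N_entwined _ _ _ t])
      show "linear_map k DA N (compose (carrier N) g f)"
        using gfh by (simp add: emod_hom_iff same_moduleD[OF DA_simps(1)])
      show "compose (carrier N) g f (dract t a) = ract N (compose (carrier N) g f t) a" if "t \<in> carrier DA" "a \<in> carrier A" for t a
        using gfh that by (simp add: emod_hom_iff DA_simps)
      show "coact N (compose (carrier N) g f t) = tmap k N C (compose (carrier N) g f) (dcoact t)" if "t \<in> carrier DA" for t
        using gfh that by (simp add: emod_hom_iff DA_simps)
    qed
    then show ?thesis using t by (simp add: compose_def DA_simps unit_DA_closed fu gz univ_id)
  qed
  have fg: "f (g t) = t" if t: "t \<in> carrier AC" for t
  proof -
    \<comment> \<open>The uniqueness \<open>un\<close> concerns morphisms out of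
      \<open>G Au\<close>, so \<open>f\<close> after \<open>g\<close> is conjugated with
      \<open>kappa\<close>; the result fixes \<open>z'\<close>.\<close>
    let ?k' = "restrict kappa' (carrier ?K)" and ?k = "restrict kappa (carrier NA)"
    let ?h = "compose (carrier ?K) ?k (compose (carrier ?K) f (compose (carrier ?K) g ?k'))"
    have h: "?h \<in> emod_hom k A C ?K ?K"
      by (intro emod_hom_comp[OF K A_tensor_C_entwined K _ kappa_hom] emod_hom_comp[OF K N_entwined A_tensor_C_entwined _ f]
          emod_hom_comp[OF K A_tensor_C_entwined N_entwined kappa'_hom g])
    have "?h z' = z'"
      using z'K z by (simp add: compose_def z_def[symmetric] gz fu AC_simps kz)
    then have "?h = idK" using un[OF K h idK] z'K by (simp add: idK_def)
    from fun_cong[OF this, of "kappa t"] have "kappa (f (g t)) = kappa t"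
      using t kappa_closed[OF t] linear_map_closed[OF F(1) linear_map_closed[OF G'(1) t]]
      by (simp add: compose_def idK_def kappa'_kappa AC_simps)
    then have "kappa' (kappa (f (g t))) = kappa' (kappa t)" by simp
    then show ?thesis using t linear_map_closed[OF F(1) linear_map_closed[OF G'(1) t]] by (simp add: kappa'_kappa)
  qed
  have fb: "f \<in> bemod_hom k A C N NA"
    using f univ_NA_lact[OF zW] by (simp add: bemod_hom_iff AC_simps DA_simps f_def dlact_closed)
  \<comment> \<open>So far \<open>g\<close> is a morphism of entwined modules; its left linearity
    comes from being inverse to \<open>f\<close>, which is left linear because
    \<open>z \<in> W1\<close>.\<close>
  have "restrict g (carrier NA) \<in> bemod_hom k A C NA N"
    by (rule bemod_hom_inverse[OF N_bi_entwined A_tensor_C_bi_entwined fb])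
      (simp_all add: AC_simps DA_simps linear_map_closed[OF G'(1)] fg gf)
  then show ?thesis
    unfolding bemod_isomorphic_def using fb
    by (intro conjI N_bi_entwined A_tensor_C_bi_entwined bexI[of _ f] bexI[of _ "restrict g (carrier NA)"])
      (auto simp: compose_def AC_simps DA_simps fg gf linear_map_closed[OF G'(1)] linear_map_closed[OF F(1)] intro!: restrict_ext)
qed

end

end

theorem theorem4p9:
  fixes k :: "('k, 'r) ring_scheme"
    and A :: "('k, 'a, 'x) module_scheme"
    and C :: "('k, 'c, 'y) coalgebra_scheme"
    and \<psi> :: "('a, 'c) entwining"
    and m :: nat and d :: "nat \<Rightarrow> 'c" and d' :: "nat \<Rightarrow> 'c \<Rightarrow> 'k"
    and \<iota> :: "('u \<times> 'c) list \<Rightarrow> 'u" and j :: "'a \<Rightarrow> 'u"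
  assumes "entwining_structure k A C \<psi>"
    and "finite_dual_basis k C m d d'"
    and universe_closed: "inj_on \<iota> (lists (UNIV \<times> carrier C))"
    and universe_contains_A: "inj_on j (carrier A)"
  shows
    "(Frobenius_pair (emod_cat k A C \<psi>) (rmod_cat k A) forget_functor (tensor_C_functor k A C \<psi> \<iota>)
      \<longleftrightarrow>
      (\<exists>z\<in>W1 k A C \<psi>. \<exists>\<theta>\<in>V1 k A C \<psi>.
        (\<forall>x\<in>carrier (tensor k (dual k C) A). phi_bar k A C \<psi> m d d' \<theta> (phi k A C \<psi> z x) = x) \<and>
        (\<forall>y\<in>carrier (tensor k A C). phi k A C \<psi> z (phi_bar k A C \<psi> m d d' \<theta> y) = y)))
     \<and>
     ((\<exists>z\<in>W1 k A C \<psi>. \<exists>\<theta>\<in>V1 k A C \<psi>.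
        (\<forall>x\<in>carrier (tensor k (dual k C) A). phi_bar k A C \<psi> m d d' \<theta> (phi k A C \<psi> z x) = x) \<and>
        (\<forall>y\<in>carrier (tensor k A C). phi k A C \<psi> z (phi_bar k A C \<psi> m d d' \<theta> y) = y))
      \<longleftrightarrow>
      bemod_isomorphic k A C \<psi> (dual_tensor_A k A C \<psi> m d d') (A_tensor_C k A C \<psi>))"
    (is "(?F \<longleftrightarrow> ?E) \<and> (?E \<longleftrightarrow> ?I)")
proof -
  interpret entwining_structure k A C \<psi> by fact
  interpret entwining_frobenius k A C \<psi> m d d' \<iota>
    by unfold_locales fact+
  \<comment> \<open>The implications run from 1 to 3, from 3 to 2 and from 2 to 1. Since
    \<open>forget_left_adjoint\<close> holds in any case, statement 1 amounts to the second
    adjunction.\<close>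
  have "?I" if "?F"
    using that iso_if_left_adjoint[OF universe_contains_A] by (simp add: Frobenius_pair_def)
  moreover have "?E" if "?I" by (rule inverse_if_iso[OF that])
  moreover have "?F" if "?E"
    using that unfolding Frobenius_pair_def
    by (elim bexE conjE) (intro conjI forget_left_adjoint, rule G_left_adjoint; blast)
  ultimately show ?thesis by blast
qed

end
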